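(* Let $Z$ be a complex affine Poisson algebra such that $\operatorname{Spec}(Z)$ is a smooth complex affine Poisson variety whose symplectic leaves are Zariski locally closed, and let $A$ be a Poisson order over $Z$. For every simple Poisson $A$-module $M$ there is a unique symplectic core of $\operatorname{Prim}(A)$ which is dense in $\mathcal{V}(M)$ in the Jacobson topology. The assignment sending $\operatorname{Ann}_A(M)$ to this symplectic core is a homeomorphism from the space of annihilators of simple Poisson $A$-modules (with its Jacobson topology) to the space $\operatorname{Prim}_{\mathcal{C}}(A)$ of symplectic cores of $\operatorname{Prim}(A)$ (with its quotient topology).
   Context: Algebras are unital. "Affine" means semiprime and finitely generated. A Poisson algebra is a commutative algebra $Z$ over the ground field $k$ (here $k=\mathbb{C}$) with a skew-symmetric $k$-bilinear biderivation $\{\cdot,\cdot\}$ making $Z$ a Lie algebra. A Poisson order over $Z$ is a (not necessarily commutative) $Z$-algebra $A$, finitely generated as a $Z$-module, such that the Poisson bracket on $Z$ extends to a $k$-bilinear map $\{\cdot,\cdot\}:Z\times A\to A$ for which the maps $H(x):=\{x,\cdot\}:A\to A$ satisfy, for all $x,y\in Z$, $a\in A$: (i) $H(x)\in\operatorname{Der}_k(A)$; (ii) $H(xy)a=xH(y)a+yH(x)a$. The maps $H(x)$, $x \in Z$, are the Hamiltonian derivations. A Poisson $A$-module is an $A$-module $M$ with a linear map $\nabla:Z\to\operatorname{End}_k(M)$ such that for all $x,y\in Z$, $a\in A$, $m\in M$: (i) $\nabla(xy)m=x\nabla(y)m+y\nabla(x)m$; (ii) $\{x,a\}m=[\nabla(x),a]m$;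 (iii) $\nabla(\{x,y\})m=[\nabla(x),\nabla(y)]m$. Submodules are the $A$-submodules stable under $\nabla(Z)$; a Poisson module is simple if it is non-zero with no proper non-zero Poisson submodules. $\operatorname{Ann}_A(M)=\{a\in A: aM=0\}$. If $\mathcal{S}$ is a set of ideals of $A$, its Jacobson topology has closed sets $\{I\in\mathcal{S}:\bigcap_{J\in S}J\subseteq I\}$ for $S\subseteq\mathcal{S}$. $\operatorname{Prim}(A)$ is the set of primitive ideals (annihilators of simple left $A$-modules) with its Jacobson topology. $\mathcal{V}(M):=\{I\in\operatorname{Prim}(A):\operatorname{Ann}_A(M)\subseteq I\}$. For an ideal $I\subseteq A$, the Poisson core $\mathcal{P}(I)$ is the largest two-sided ideal of $A$ contained in $I$ and stable under all Hamiltonian derivations. Define $I\sim J$ on $\operatorname{Prim}(A)$ if $\mathcal{P}(I)=\mathcal{P}(J)$; the equivalence classes are the symplectic cores of $\operatorname{Prim}(A)$, and $\operatorname{Prim}_{\mathcal{C}}(A)$ is the set of symplectic cores with the quotient topology from $\operatorname{Prim}(A)$. The symplectic leaves of $\operatorname{Spec}(Z)$ (a complex analytic Poisson manifold when smooth) are the equivalence classes of closed points under being connected by piecewise Hamiltonian flows.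
   Formalization: A Poisson order is also required to satisfy the Jacobi identity H({x,y}) = [H(x),H(y)] on A; without it the claim fails, e.g. Z=C[u,v] with zero bracket, A=Mat_2(Z), {f,a}=f_u[E12,a]+f_v[E21,a] has no simple Poisson modules. *)

theory Defs
  imports
    "HOL-Analysis.Analysis"
    "HOL-Algebra.Algebra"
    "HOL-Algebra.Algebraic_Closure_Type"
begin

section \<open>Affine Poisson algebras over the complex numbers\<close>

text \<open>A commutative complex algebra is a record Z of type (complex, 'z) module satisfying the
  library locale \<^locale>\<open>algebra\<close> over the field below; \<open>c \<odot>\<^bsub>Z\<^esub> x\<close> is the scalar action.\<close>

abbreviation complex_field :: "complex ring"
  where "complex_field \<equiv> ring_of_type_algebra"

locale poisson_algebra = algebra complex_field Z
  for Z :: "(complex, 'z) module" +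
  fixes pb :: "'z \<Rightarrow> 'z \<Rightarrow> 'z"
  assumes pb_closed: "\<lbrakk>x \<in> carrier Z; y \<in> carrier Z\<rbrakk> \<Longrightarrow> pb x y \<in> carrier Z"
    and pb_add: "\<lbrakk>x \<in> carrier Z; y \<in> carrier Z; w \<in> carrier Z\<rbrakk> \<Longrightarrow>
      pb (x \<oplus>\<^bsub>Z\<^esub> y) w = pb x w \<oplus>\<^bsub>Z\<^esub> pb y w"
    and pb_scale: "\<lbrakk>x \<in> carrier Z; y \<in> carrier Z\<rbrakk> \<Longrightarrow> pb (c \<odot>\<^bsub>Z\<^esub> x) y = c \<odot>\<^bsub>Z\<^esub> pb x y"
    and pb_skew: "\<lbrakk>x \<in> carrier Z; y \<in> carrier Z\<rbrakk> \<Longrightarrow> pb x y = \<ominus>\<^bsub>Z\<^esub> pb y x"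
    and pb_leibniz: "\<lbrakk>x \<in> carrier Z; y \<in> carrier Z; w \<in> carrier Z\<rbrakk> \<Longrightarrow>
      pb x (y \<otimes>\<^bsub>Z\<^esub> w) = pb x y \<otimes>\<^bsub>Z\<^esub> w \<oplus>\<^bsub>Z\<^esub> y \<otimes>\<^bsub>Z\<^esub> pb x w"
    and pb_jacobi: "\<lbrakk>x \<in> carrier Z; y \<in> carrier Z; w \<in> carrier Z\<rbrakk> \<Longrightarrow>
      pb x (pb y w) \<oplus>\<^bsub>Z\<^esub> pb y (pb w x) \<oplus>\<^bsub>Z\<^esub> pb w (pb x y) = \<zero>\<^bsub>Z\<^esub>"

definition semiprime_ring :: "('a, 'b) ring_scheme \<Rightarrow> bool"
  where "semiprime_ring R \<longleftrightarrow>
    (\<forall>I. ideal I R \<and> I \<cdot>\<^bsub>R\<^esub> I = {\<zero>\<^bsub>R\<^esub>} \<longrightarrow> I = {\<zero>\<^bsub>R\<^esub>})"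

definition finitely_generated_algebra :: "(complex, 'z) module \<Rightarrow> bool"
  where "finitely_generated_algebra Z \<longleftrightarrow>
    (\<exists>S. finite S \<and> S \<subseteq> carrier Z \<and>
      generate_ring Z (S \<union> range (\<lambda>c. c \<odot>\<^bsub>Z\<^esub> \<one>\<^bsub>Z\<^esub>)) = carrier Z)"

locale affine_poisson_algebra = poisson_algebra +
  assumes finitely_generated: "finitely_generated_algebra Z"
    and semiprime: "semiprime_ring Z"


section \<open>Smoothness and symplectic leaves of the spectrum\<close>

definition closed_points :: "('z, 'b) ring_scheme \<Rightarrow> 'z set set"
  where "closed_points Z = {m. maximalideal m Z}"

text \<open>The Krull dimension of the local ring at a prime ideal, i.e. the height of that prime.\<close>

definition local_krull_dim :: "('z, 'b) ring_scheme \<Rightarrow> 'z set \<Rightarrow> enat"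
  where "local_krull_dim Z p = Sup {enat n | n.
    \<exists>P :: nat \<Rightarrow> 'z set. (\<forall>i\<le>n. primeideal (P i) Z) \<and> (\<forall>i<n. P i \<subset> P (Suc i)) \<and> P n = p}"

text \<open>\<open>m/m\<^sup>2\<close> has complex dimension \<open>n\<close>; the dimension is computed inside the complex algebra
  \<open>Z/m\<^sup>2\<close>, with the images of the constants as scalars.\<close>

definition cotangent_dim :: "(complex, 'z) module \<Rightarrow> 'z set \<Rightarrow> nat \<Rightarrow> bool"
  where "cotangent_dim Z m n \<longleftrightarrow>
    ring.dimension (Z Quot (m \<cdot>\<^bsub>Z\<^esub> m)) n
      (range (\<lambda>c. (m \<cdot>\<^bsub>Z\<^esub> m) +>\<^bsub>Z\<^esub> (c \<odot>\<^bsub>Z\<^esub> \<one>\<^bsub>Z\<^esub>)))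
      ((\<lambda>x. (m \<cdot>\<^bsub>Z\<^esub> m) +>\<^bsub>Z\<^esub> x) ` m)"

text \<open>Over the complex numbers a variety is smooth iff its local rings at closed points are
  regular.\<close>

definition smooth_spectrum :: "(complex, 'z) module \<Rightarrow> bool"
  where "smooth_spectrum Z \<longleftrightarrow>
    (\<forall>m \<in> closed_points Z. \<exists>n. cotangent_dim Z m n \<and> local_krull_dim Z m = enat n)"

text \<open>The value of \<open>f\<close> at the closed point \<open>m\<close>: the residue field is the field of complex
  numbers by the Nullstellensatz.\<close>

definition value_at :: "(complex, 'z) module \<Rightarrow> 'z set \<Rightarrow> 'z \<Rightarrow> complex"
  where "value_at Z m f = (THE c. f \<ominus>\<^bsub>Z\<^esub> (c \<odot>\<^bsub>Z\<^esub> \<one>\<^bsub>Z\<^esub>) \<in> m)"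

text \<open>An integral curve, over a compact time interval, of the Hamiltonian vector field of \<open>f\<close>.
  As the regular functions contain the coordinates of a closed embedding into affine space, testing
  against all regular functions says that the curve is differentiable in the analytic manifold with
  velocity given by that vector field.\<close>

definition hamiltonian_curve ::
    "(complex, 'z) module \<Rightarrow> ('z \<Rightarrow> 'z \<Rightarrow> 'z) \<Rightarrow> 'z \<Rightarrow> real \<Rightarrow> (real \<Rightarrow> 'z set) \<Rightarrow> bool"
  where "hamiltonian_curve Z pb f T \<gamma> \<longleftrightarrow>
    (\<forall>t\<in>{0..T}. \<gamma> t \<in> closed_points Z) \<and>
    (\<forall>g\<in>carrier Z. \<forall>t\<in>{0..T}.
      ((\<lambda>s. value_at Z (\<gamma> s) g) has_vector_derivative value_at Z (\<gamma> t) (pb f g))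
        (at t within {0..T}))"

definition hamiltonian_flow ::
    "(complex, 'z) module \<Rightarrow> ('z \<Rightarrow> 'z \<Rightarrow> 'z) \<Rightarrow> 'z set \<Rightarrow> 'z set \<Rightarrow> bool"
  where "hamiltonian_flow Z pb p q \<longleftrightarrow>
    (\<exists>f\<in>carrier Z. \<exists>T>0. \<exists>\<gamma>. hamiltonian_curve Z pb f T \<gamma> \<and> \<gamma> 0 = p \<and> \<gamma> T = q)"

definition symplectic_leaves ::
    "(complex, 'z) module \<Rightarrow> ('z \<Rightarrow> 'z \<Rightarrow> 'z) \<Rightarrow> 'z set set set"
  where "symplectic_leaves Z pb =
    closed_points Z // {(p, q). p \<in> closed_points Z \<and> q \<in> closed_points Z \<and>
      equivclp (hamiltonian_flow Z pb) p q}"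

definition zariski_closed :: "('z, 'b) ring_scheme \<Rightarrow> 'z set set \<Rightarrow> bool"
  where "zariski_closed Z C \<longleftrightarrow> (\<exists>F \<subseteq> carrier Z. C = {m \<in> closed_points Z. F \<subseteq> m})"

definition zariski_locally_closed :: "('z, 'b) ring_scheme \<Rightarrow> 'z set set \<Rightarrow> bool"
  where "zariski_locally_closed Z L \<longleftrightarrow>
    (\<exists>C D. zariski_closed Z C \<and> zariski_closed Z D \<and> L = C - D)"


section \<open>Poisson orders\<close>

text \<open>A \<open>Z\<close>-algebra is a record A of type ('z, 'a) module; the structure map is
  \<open>z \<mapsto> z \<odot>\<^bsub>A\<^esub> \<one>\<^bsub>A\<^esub>\<close>, whose image is central but which need not be injective.
  The library locale \<^locale>\<open>algebra\<close> is not applicable since it makes A commutative.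
  \<open>H x a\<close> is the extended bracket \<open>{x, a}\<close>.\<close>

locale hamiltonian_order =
  PZ: poisson_algebra Z pb + ZA: module Z A + AR: ring A
  for Z :: "(complex, 'z) module" and pb :: "'z \<Rightarrow> 'z \<Rightarrow> 'z" and A :: "('z, 'a) module" +
  fixes H :: "'z \<Rightarrow> 'a \<Rightarrow> 'a"
  assumes smult_mult_left: "\<lbrakk>z \<in> carrier Z; a \<in> carrier A; b \<in> carrier A\<rbrakk> \<Longrightarrow>
      (z \<odot>\<^bsub>A\<^esub> a) \<otimes>\<^bsub>A\<^esub> b = z \<odot>\<^bsub>A\<^esub> (a \<otimes>\<^bsub>A\<^esub> b)"
    and smult_mult_right: "\<lbrakk>z \<in> carrier Z; a \<in> carrier A; b \<in> carrier A\<rbrakk> \<Longrightarrow>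
      a \<otimes>\<^bsub>A\<^esub> (z \<odot>\<^bsub>A\<^esub> b) = z \<odot>\<^bsub>A\<^esub> (a \<otimes>\<^bsub>A\<^esub> b)"
    and finite_module: "\<exists>F. finite F \<and> F \<subseteq> carrier A \<and>
      (\<forall>a\<in>carrier A. \<exists>z\<in>F \<rightarrow> carrier Z. a = (\<Oplus>\<^bsub>A\<^esub>f\<in>F. z f \<odot>\<^bsub>A\<^esub> f))"
    and H_closed: "\<lbrakk>x \<in> carrier Z; a \<in> carrier A\<rbrakk> \<Longrightarrow> H x a \<in> carrier A"
    and H_extends: "\<lbrakk>x \<in> carrier Z; y \<in> carrier Z\<rbrakk> \<Longrightarrow>
      H x (y \<odot>\<^bsub>A\<^esub> \<one>\<^bsub>A\<^esub>) = pb x y \<odot>\<^bsub>A\<^esub> \<one>\<^bsub>A\<^esub>"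
    and H_add_left: "\<lbrakk>x \<in> carrier Z; y \<in> carrier Z; a \<in> carrier A\<rbrakk> \<Longrightarrow>
      H (x \<oplus>\<^bsub>Z\<^esub> y) a = H x a \<oplus>\<^bsub>A\<^esub> H y a"
    and H_scale_left: "\<lbrakk>x \<in> carrier Z; a \<in> carrier A\<rbrakk> \<Longrightarrow>
      H (c \<odot>\<^bsub>Z\<^esub> x) a = (c \<odot>\<^bsub>Z\<^esub> \<one>\<^bsub>Z\<^esub>) \<odot>\<^bsub>A\<^esub> H x a"
    and H_add_right: "\<lbrakk>x \<in> carrier Z; a \<in> carrier A; b \<in> carrier A\<rbrakk> \<Longrightarrow>
      H x (a \<oplus>\<^bsub>A\<^esub> b) = H x a \<oplus>\<^bsub>A\<^esub> H x b"
    and H_scale_right: "\<lbrakk>x \<in> carrier Z; a \<in> carrier A\<rbrakk> \<Longrightarrow>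
      H x ((c \<odot>\<^bsub>Z\<^esub> \<one>\<^bsub>Z\<^esub>) \<odot>\<^bsub>A\<^esub> a) = (c \<odot>\<^bsub>Z\<^esub> \<one>\<^bsub>Z\<^esub>) \<odot>\<^bsub>A\<^esub> H x a"
    and H_derivation: "\<lbrakk>x \<in> carrier Z; a \<in> carrier A; b \<in> carrier A\<rbrakk> \<Longrightarrow>
      H x (a \<otimes>\<^bsub>A\<^esub> b) = H x a \<otimes>\<^bsub>A\<^esub> b \<oplus>\<^bsub>A\<^esub> a \<otimes>\<^bsub>A\<^esub> H x b"
    and H_leibniz: "\<lbrakk>x \<in> carrier Z; y \<in> carrier Z; a \<in> carrier A\<rbrakk> \<Longrightarrow>
      H (x \<otimes>\<^bsub>Z\<^esub> y) a = x \<odot>\<^bsub>A\<^esub> H y a \<oplus>\<^bsub>A\<^esub> y \<odot>\<^bsub>A\<^esub> H x a"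

text \<open>The extended bracket is required to satisfy the Jacobi identity as well. This is implicit in
  the notion of a Poisson module: by the lemma \<open>jacobi_defect_annihilates\<close> below, the Jacobi defect
  of the bracket kills every Poisson module. Without the identity there may be no non-zero Poisson
  module at all, e.g. for the 2 by 2 matrices over \<open>Z = \<complex>[u,v]\<close> with the zero
  bracket on \<open>Z\<close> and \<open>{f, a} = (\<partial>f/\<partial>u) [E12, a] + (\<partial>f/\<partial>v) [E21, a]\<close>.\<close>

locale poisson_order = hamiltonian_order +
  assumes H_jacobi: "\<lbrakk>x \<in> carrier Z; y \<in> carrier Z; a \<in> carrier A\<rbrakk> \<Longrightarrow>
      H (pb x y) a = H x (H y a) \<ominus>\<^bsub>A\<^esub> H y (H x a)"


section \<open>Modules, simple modules and annihilators\<close>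

text \<open>The library locale \<^locale>\<open>module\<close> requires a commutative ring.\<close>

locale left_module = LR: ring A + LM: abelian_group M
  for A :: "('a, 'b) ring_scheme" and M :: "('a, 'm) module" +
  assumes act_closed: "\<lbrakk>a \<in> carrier A; v \<in> carrier M\<rbrakk> \<Longrightarrow> a \<odot>\<^bsub>M\<^esub> v \<in> carrier M"
    and act_add_left: "\<lbrakk>a \<in> carrier A; b \<in> carrier A; v \<in> carrier M\<rbrakk> \<Longrightarrow>
      (a \<oplus>\<^bsub>A\<^esub> b) \<odot>\<^bsub>M\<^esub> v = a \<odot>\<^bsub>M\<^esub> v \<oplus>\<^bsub>M\<^esub> b \<odot>\<^bsub>M\<^esub> v"
    and act_add_right: "\<lbrakk>a \<in> carrier A; v \<in> carrier M; w \<in> carrier M\<rbrakk> \<Longrightarrow>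
      a \<odot>\<^bsub>M\<^esub> (v \<oplus>\<^bsub>M\<^esub> w) = a \<odot>\<^bsub>M\<^esub> v \<oplus>\<^bsub>M\<^esub> a \<odot>\<^bsub>M\<^esub> w"
    and act_mult: "\<lbrakk>a \<in> carrier A; b \<in> carrier A; v \<in> carrier M\<rbrakk> \<Longrightarrow>
      (a \<otimes>\<^bsub>A\<^esub> b) \<odot>\<^bsub>M\<^esub> v = a \<odot>\<^bsub>M\<^esub> (b \<odot>\<^bsub>M\<^esub> v)"
    and act_one: "v \<in> carrier M \<Longrightarrow> \<one>\<^bsub>A\<^esub> \<odot>\<^bsub>M\<^esub> v = v"

definition simple_module :: "('a, 'b) ring_scheme \<Rightarrow> ('a, 'm) module \<Rightarrow> bool"
  where "simple_module A M \<longleftrightarrow> left_module A M \<and> carrier M \<noteq> {\<zero>\<^bsub>M\<^esub>} \<and>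
    (\<forall>N. submodule N A M \<longrightarrow> N = {\<zero>\<^bsub>M\<^esub>} \<or> N = carrier M)"

definition annihilator :: "('a, 'b) ring_scheme \<Rightarrow> ('a, 'm) module \<Rightarrow> 'a set"
  where "annihilator A M = {a \<in> carrier A. \<forall>v \<in> carrier M. a \<odot>\<^bsub>M\<^esub> v = \<zero>\<^bsub>M\<^esub>}"

text \<open>Every simple left module is cyclic, hence isomorphic to one whose carrier consists of elements
  of the type of the ring; see \<open>annihilator_mem_Prim\<close> below, which shows that modules on arbitrary
  types do not give further primitive ideals.\<close>

definition Prim :: "('a, 'b) ring_scheme \<Rightarrow> 'a set set"
  where "Prim A = {annihilator A M | M :: ('a, 'a) module. simple_module A M}"

text \<open>\<open>nabla x v\<close> is \<open>\<nabla>(x) v\<close>; an element \<open>x\<close> of \<open>Z\<close> acts on a module as \<open>x \<odot>\<^bsub>A\<^esub> \<one>\<^bsub>A\<^esub>\<close>.\<close>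

locale poisson_module =
  PO: hamiltonian_order Z pb A H + PM: left_module A M
  for Z :: "(complex, 'z) module" and pb :: "'z \<Rightarrow> 'z \<Rightarrow> 'z" and A :: "('z, 'a) module"
    and H :: "'z \<Rightarrow> 'a \<Rightarrow> 'a" and M :: "('a, 'm) module" +
  fixes nabla :: "'z \<Rightarrow> 'm \<Rightarrow> 'm"
  assumes nabla_closed: "\<lbrakk>x \<in> carrier Z; v \<in> carrier M\<rbrakk> \<Longrightarrow> nabla x v \<in> carrier M"
    and nabla_add_right: "\<lbrakk>x \<in> carrier Z; v \<in> carrier M; w \<in> carrier M\<rbrakk> \<Longrightarrow>
      nabla x (v \<oplus>\<^bsub>M\<^esub> w) = nabla x v \<oplus>\<^bsub>M\<^esub> nabla x w"
    and nabla_scale_right: "\<lbrakk>x \<in> carrier Z; v \<in> carrier M\<rbrakk> \<Longrightarrow>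
      nabla x (((c \<odot>\<^bsub>Z\<^esub> \<one>\<^bsub>Z\<^esub>) \<odot>\<^bsub>A\<^esub> \<one>\<^bsub>A\<^esub>) \<odot>\<^bsub>M\<^esub> v) =
      ((c \<odot>\<^bsub>Z\<^esub> \<one>\<^bsub>Z\<^esub>) \<odot>\<^bsub>A\<^esub> \<one>\<^bsub>A\<^esub>) \<odot>\<^bsub>M\<^esub> nabla x v"
    and nabla_add_left: "\<lbrakk>x \<in> carrier Z; y \<in> carrier Z; v \<in> carrier M\<rbrakk> \<Longrightarrow>
      nabla (x \<oplus>\<^bsub>Z\<^esub> y) v = nabla x v \<oplus>\<^bsub>M\<^esub> nabla y v"
    and nabla_scale_left: "\<lbrakk>x \<in> carrier Z; v \<in> carrier M\<rbrakk> \<Longrightarrow>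
      nabla (c \<odot>\<^bsub>Z\<^esub> x) v = ((c \<odot>\<^bsub>Z\<^esub> \<one>\<^bsub>Z\<^esub>) \<odot>\<^bsub>A\<^esub> \<one>\<^bsub>A\<^esub>) \<odot>\<^bsub>M\<^esub> nabla x v"
    and nabla_mult: "\<lbrakk>x \<in> carrier Z; y \<in> carrier Z; v \<in> carrier M\<rbrakk> \<Longrightarrow>
      nabla (x \<otimes>\<^bsub>Z\<^esub> y) v =
      (x \<odot>\<^bsub>A\<^esub> \<one>\<^bsub>A\<^esub>) \<odot>\<^bsub>M\<^esub> nabla y v \<oplus>\<^bsub>M\<^esub> (y \<odot>\<^bsub>A\<^esub> \<one>\<^bsub>A\<^esub>) \<odot>\<^bsub>M\<^esub> nabla x v"
    and nabla_H: "\<lbrakk>x \<in> carrier Z; a \<in> carrier A; v \<in> carrier M\<rbrakk> \<Longrightarrow>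
      H x a \<odot>\<^bsub>M\<^esub> v = nabla x (a \<odot>\<^bsub>M\<^esub> v) \<ominus>\<^bsub>M\<^esub> a \<odot>\<^bsub>M\<^esub> nabla x v"
    and nabla_pb: "\<lbrakk>x \<in> carrier Z; y \<in> carrier Z; v \<in> carrier M\<rbrakk> \<Longrightarrow>
      nabla (pb x y) v = nabla x (nabla y v) \<ominus>\<^bsub>M\<^esub> nabla y (nabla x v)"

definition simple_poisson_module ::
    "(complex, 'z) module \<Rightarrow> ('z \<Rightarrow> 'z \<Rightarrow> 'z) \<Rightarrow> ('z, 'a) module \<Rightarrow> ('z \<Rightarrow> 'a \<Rightarrow> 'a) \<Rightarrow>
      ('a, 'm) module \<Rightarrow> ('z \<Rightarrow> 'm \<Rightarrow> 'm) \<Rightarrow> bool"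
  where "simple_poisson_module Z pb A H M nabla \<longleftrightarrow>
    poisson_module Z pb A H M nabla \<and> carrier M \<noteq> {\<zero>\<^bsub>M\<^esub>} \<and>
    (\<forall>N. submodule N A M \<and> (\<forall>x\<in>carrier Z. \<forall>v\<in>N. nabla x v \<in> N) \<longrightarrow>
      N = {\<zero>\<^bsub>M\<^esub>} \<or> N = carrier M)"

text \<open>Every element of a simple Poisson module is a finite sum of words in operators coming from
  \<open>A\<close> and \<open>Z\<close> applied to a fixed vector, so up to isomorphism the carrier may be taken inside the
  type of lists of such words; see \<open>annihilator_mem_poisson_annihilators\<close> below, which shows that
  modules on arbitrary types do not give further annihilators.\<close>

definition poisson_annihilators ::
    "(complex, 'z) module \<Rightarrow> ('z \<Rightarrow> 'z \<Rightarrow> 'z) \<Rightarrow> ('z, 'a) module \<Rightarrow> ('z \<Rightarrow> 'a \<Rightarrow> 'a) \<Rightarrow> 'a set set"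
  where "poisson_annihilators Z pb A H =
    {annihilator A M | (M :: ('a, ('a + 'z) list list) module) nabla.
      simple_poisson_module Z pb A H M nabla}"


section \<open>The Jacobson topology and symplectic cores\<close>

text \<open>The intersection with the carrier makes the empty intersection equal to the whole ring.\<close>

definition jacobson_topology :: "('a, 'b) ring_scheme \<Rightarrow> 'a set set \<Rightarrow> 'a set topology"
  where "jacobson_topology A \<S> = topology (\<lambda>U. U \<subseteq> \<S> \<and>
    (\<exists>S \<subseteq> \<S>. \<S> - U = {I \<in> \<S>. carrier A \<inter> \<Inter>S \<subseteq> I}))"

text \<open>The closed set \<open>\<V>(M)\<close> depends only on the annihilator \<open>P\<close> of \<open>M\<close>.\<close>

definition prim_variety :: "('a, 'b) ring_scheme \<Rightarrow> 'a set \<Rightarrow> 'a set set"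
  where "prim_variety A P = {I \<in> Prim A. P \<subseteq> I}"

definition poisson_ideal ::
    "('z, 'c) ring_scheme \<Rightarrow> ('a, 'b) ring_scheme \<Rightarrow> ('z \<Rightarrow> 'a \<Rightarrow> 'a) \<Rightarrow> 'a set \<Rightarrow> bool"
  where "poisson_ideal Z A H J \<longleftrightarrow> ideal J A \<and> (\<forall>x\<in>carrier Z. \<forall>a\<in>J. H x a \<in> J)"

definition poisson_core ::
    "('z, 'c) ring_scheme \<Rightarrow> ('a, 'b) ring_scheme \<Rightarrow> ('z \<Rightarrow> 'a \<Rightarrow> 'a) \<Rightarrow> 'a set \<Rightarrow> 'a set"
  where "poisson_core Z A H I = (GREATEST J. poisson_ideal Z A H J \<and> J \<subseteq> I)"

definition symplectic_cores ::
    "('z, 'c) ring_scheme \<Rightarrow> ('a, 'b) ring_scheme \<Rightarrow> ('z \<Rightarrow> 'a \<Rightarrow> 'a) \<Rightarrow> 'a set set set"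
  where "symplectic_cores Z A H =
    Prim A // {(I, J). I \<in> Prim A \<and> J \<in> Prim A \<and> poisson_core Z A H I = poisson_core Z A H J}"

definition core_space ::
    "('z, 'c) ring_scheme \<Rightarrow> ('a, 'b) ring_scheme \<Rightarrow> ('z \<Rightarrow> 'a \<Rightarrow> 'a) \<Rightarrow> 'a set set topology"
  where "core_space Z A H = topology (\<lambda>\<U>. \<U> \<subseteq> symplectic_cores Z A H \<and>
    openin (jacobson_topology A (Prim A)) (\<Union>\<U>))"

definition dense_core ::
    "('z, 'c) ring_scheme \<Rightarrow> ('a, 'b) ring_scheme \<Rightarrow> ('z \<Rightarrow> 'a \<Rightarrow> 'a) \<Rightarrow> 'a set \<Rightarrow> 'a set set \<Rightarrow> bool"
  where "dense_core Z A H P C \<longleftrightarrow> C \<in> symplectic_cores Z A H \<and> C \<subseteq> prim_variety A P \<and>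
    Abstract_Topology.closure_of
      (subtopology (jacobson_topology A (Prim A)) (prim_variety A P)) C = prim_variety A P"


section \<open>Adequacy of the definitions\<close>

text \<open>The universes chosen in \<open>Prim\<close> and \<open>poisson_annihilators\<close> lose nothing, the Jacobson and
  quotient topologies are topologies with the stated open sets, Poisson cores exist, and the Jacobi
  defect of the extended bracket annihilates Poisson modules.\<close>

lemma (in left_module) act_minus:
  assumes b: "b \<in> carrier A" and c: "c \<in> carrier A" and v: "v \<in> carrier M"
  shows "(b \<ominus>\<^bsub>A\<^esub> c) \<odot>\<^bsub>M\<^esub> v = b \<odot>\<^bsub>M\<^esub> v \<ominus>\<^bsub>M\<^esub> c \<odot>\<^bsub>M\<^esub> v"
proof -
  have "b = (b \<ominus>\<^bsub>A\<^esub> c) \<oplus>\<^bsub>A\<^esub> c"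
    using b c by (simp add: LR.minus_eq LR.a_assoc LR.l_neg)
  then have "b \<odot>\<^bsub>M\<^esub> v = (b \<ominus>\<^bsub>A\<^esub> c) \<odot>\<^bsub>M\<^esub> v \<oplus>\<^bsub>M\<^esub> c \<odot>\<^bsub>M\<^esub> v"
    using b c v by (metis act_add_left LR.minus_closed)
  then show ?thesis
    using b c v by (simp add: LM.minus_eq LM.a_assoc LM.r_neg act_closed)
qed

lemma (in left_module) act_minus_right:
  assumes b: "b \<in> carrier A" and v: "v \<in> carrier M" and w: "w \<in> carrier M"
  shows "b \<odot>\<^bsub>M\<^esub> (v \<ominus>\<^bsub>M\<^esub> w) = b \<odot>\<^bsub>M\<^esub> v \<ominus>\<^bsub>M\<^esub> b \<odot>\<^bsub>M\<^esub> w"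
proof -
  have "v = (v \<ominus>\<^bsub>M\<^esub> w) \<oplus>\<^bsub>M\<^esub> w"
    using v w by (simp add: LM.minus_eq LM.a_assoc LM.l_neg)
  then have "b \<odot>\<^bsub>M\<^esub> v = b \<odot>\<^bsub>M\<^esub> (v \<ominus>\<^bsub>M\<^esub> w) \<oplus>\<^bsub>M\<^esub> b \<odot>\<^bsub>M\<^esub> w"
    using b v w by (metis act_add_right LM.minus_closed)
  then show ?thesis
    using b v w by (simp add: LM.minus_eq LM.a_assoc LM.r_neg act_closed)
qed

lemma (in left_module) act_zero_right:
  assumes "b \<in> carrier A" shows "b \<odot>\<^bsub>M\<^esub> \<zero>\<^bsub>M\<^esub> = \<zero>\<^bsub>M\<^esub>"
  using act_minus_right[OF assms LM.zero_closed LM.zero_closed] assms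
  by (simp add: LM.minus_eq LM.r_neg act_closed)

lemma (in left_module) act_zero_left:
  assumes "v \<in> carrier M" shows "\<zero>\<^bsub>A\<^esub> \<odot>\<^bsub>M\<^esub> v = \<zero>\<^bsub>M\<^esub>"
  using act_minus[OF LR.zero_closed LR.zero_closed assms] assms
  by (simp add: LM.minus_eq LR.minus_eq LM.r_neg LR.r_neg act_closed)

lemma (in left_module) act_neg_one:
  assumes v: "v \<in> carrier M" shows "(\<ominus>\<^bsub>A\<^esub> \<one>\<^bsub>A\<^esub>) \<odot>\<^bsub>M\<^esub> v = \<ominus>\<^bsub>M\<^esub> v"
  using act_minus[OF LR.zero_closed LR.one_closed v] v
  by (simp add: LM.minus_eq LR.minus_eq act_zero_left act_one)

lemma (in left_module) left_submoduleI:
  assumes sub: "N \<subseteq> carrier M" and zero: "\<zero>\<^bsub>M\<^esub> \<in> N"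
    and add: "\<And>v w. \<lbrakk>v \<in> N; w \<in> N\<rbrakk> \<Longrightarrow> v \<oplus>\<^bsub>M\<^esub> w \<in> N"
    and act: "\<And>a v. \<lbrakk>a \<in> carrier A; v \<in> N\<rbrakk> \<Longrightarrow> a \<odot>\<^bsub>M\<^esub> v \<in> N"
  shows "submodule N A M"
proof (intro submodule.intro submodule_axioms.intro subgroup.intro)
  show "inv\<^bsub>add_monoid M\<^esub> v \<in> N" if "v \<in> N" for v
  proof -
    have "inv\<^bsub>add_monoid M\<^esub> v = (\<ominus>\<^bsub>A\<^esub> \<one>\<^bsub>A\<^esub>) \<odot>\<^bsub>M\<^esub> v"
      using that sub act_neg_one[of v] by (auto simp: a_inv_def[of M])
    then show ?thesis using act[OF _ that] by simp
  qed
qed (use assms in auto)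

lemma (in left_module) annihilator_ideal: "ideal (annihilator A M) A"
proof (intro idealI)
  show "subgroup (annihilator A M) (add_monoid A)"
  proof (intro subgroup.intro)
    show "inv\<^bsub>add_monoid A\<^esub> a \<in> annihilator A M" if "a \<in> annihilator A M" for a
    proof -
      have "(\<zero>\<^bsub>A\<^esub> \<ominus>\<^bsub>A\<^esub> a) \<odot>\<^bsub>M\<^esub> v = \<zero>\<^bsub>M\<^esub>" if "v \<in> carrier M" for v
        using \<open>a \<in> annihilator A M\<close> that
        by (simp add: act_minus annihilator_def act_zero_left LM.minus_eq)
      then show ?thesis
        using that by (simp add: annihilator_def LR.minus_eq flip: a_inv_def)
    qed
  qed (auto simp: annihilator_def act_add_left act_zero_left)
qed (auto simp: annihilator_def act_mult act_zero_right act_closed LR.ring_axioms)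

lemma poisson_moduleD:
  assumes "poisson_module Z pb A H M nabla"
  shows "hamiltonian_order Z pb A H" "left_module A M" "ring A" "abelian_group M"
    "cring Z" "poisson_algebra Z pb"
proof -
  show 1: "hamiltonian_order Z pb A H" "left_module A M"
    using assms by (auto simp: poisson_module_def)
  then show 2: "ring A" "abelian_group M"
    by (auto simp: left_module_def)
  show 3: "poisson_algebra Z pb"
    using 1 by (auto simp: hamiltonian_order_def)
  then show "cring Z"
    by (auto simp: poisson_algebra_def Module.algebra_def)
qed

lemma nabla_minus:
  assumes PM: "poisson_module Z pb A H M nabla"
    and z: "z \<in> carrier Z" and v: "v \<in> carrier M" and w: "w \<in> carrier M"
  shows "nabla z (v \<ominus>\<^bsub>M\<^esub> w) = nabla z v \<ominus>\<^bsub>M\<^esub> nabla z w"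
proof -
  interpret G: abelian_group M using poisson_moduleD[OF PM] by simp
  note cl = poisson_module.nabla_closed[OF PM]
  have "v = (v \<ominus>\<^bsub>M\<^esub> w) \<oplus>\<^bsub>M\<^esub> w"
    using v w by (simp add: G.minus_eq G.a_assoc G.l_neg)
  then have "nabla z v = nabla z (v \<ominus>\<^bsub>M\<^esub> w) \<oplus>\<^bsub>M\<^esub> nabla z w"
    using z v w by (metis poisson_module.nabla_add_right[OF PM] G.minus_closed)
  then show ?thesis
    using z v w by (simp add: G.minus_eq G.a_assoc G.r_neg cl)
qed

lemma nabla_zero:
  assumes PM: "poisson_module Z pb A H M nabla" and x: "x \<in> carrier Z"
  shows "nabla x \<zero>\<^bsub>M\<^esub> = \<zero>\<^bsub>M\<^esub>"
proof -
  interpret G: abelian_group M using poisson_moduleD[OF PM] by simp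
  show ?thesis
    using nabla_minus[OF PM x G.zero_closed G.zero_closed] x
    by (simp add: G.minus_eq G.r_neg poisson_module.nabla_closed[OF PM])
qed

lemma jacobi_defect_annihilates:
  assumes PM: "poisson_module Z pb A H M nabla"
    and x: "x \<in> carrier Z" and y: "y \<in> carrier Z" and a: "a \<in> carrier A"
  shows "H (pb x y) a \<ominus>\<^bsub>A\<^esub> (H x (H y a) \<ominus>\<^bsub>A\<^esub> H y (H x a)) \<in> annihilator A M"
proof -
  note ax = poisson_moduleD[OF PM]
  interpret G: abelian_group M by (fact ax)
  interpret R: ring A by (fact ax)
  note cl = left_module.act_closed[OF ax(2)] poisson_module.nabla_closed[OF PM]
    hamiltonian_order.H_closed[OF ax(1)] poisson_algebra.pb_closed[OF ax(6)]
  note rules = left_module.act_minus[OF ax(2)] left_module.act_minus_right[OF ax(2)]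
    nabla_minus[OF PM] poisson_module.nabla_H[OF PM] poisson_module.nabla_pb[OF PM]
  have "(H (pb x y) a \<ominus>\<^bsub>A\<^esub> (H x (H y a) \<ominus>\<^bsub>A\<^esub> H y (H x a))) \<odot>\<^bsub>M\<^esub> v = \<zero>\<^bsub>M\<^esub>"
    if v: "v \<in> carrier M" for v
  proof -
    define p q r s where "p = nabla x (nabla y (a \<odot>\<^bsub>M\<^esub> v))" and "q = nabla y (nabla x (a \<odot>\<^bsub>M\<^esub> v))"
      and "r = a \<odot>\<^bsub>M\<^esub> nabla x (nabla y v)" and "s = a \<odot>\<^bsub>M\<^esub> nabla y (nabla x v)"
    define t u where "t = nabla x (a \<odot>\<^bsub>M\<^esub> nabla y v)" and "u = nabla y (a \<odot>\<^bsub>M\<^esub> nabla x v)"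
    have car: "p \<in> carrier M" "q \<in> carrier M" "r \<in> carrier M" "s \<in> carrier M"
      "t \<in> carrier M" "u \<in> carrier M"
      using x y a v by (auto simp: p_def q_def r_def s_def t_def u_def cl)
    have "H (pb x y) a \<odot>\<^bsub>M\<^esub> v = (p \<ominus>\<^bsub>M\<^esub> q) \<ominus>\<^bsub>M\<^esub> (r \<ominus>\<^bsub>M\<^esub> s)"
      using x y a v by (simp add: rules cl p_def q_def r_def s_def)
    moreover have "H x (H y a) \<odot>\<^bsub>M\<^esub> v = (p \<ominus>\<^bsub>M\<^esub> t) \<ominus>\<^bsub>M\<^esub> (u \<ominus>\<^bsub>M\<^esub> s)"
      using x y a v by (simp add: rules cl p_def s_def t_def u_def)
    moreover have "H y (H x a) \<odot>\<^bsub>M\<^esub> v = (q \<ominus>\<^bsub>M\<^esub> u) \<ominus>\<^bsub>M\<^esub> (t \<ominus>\<^bsub>M\<^esub> r)"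
      using x y a v by (simp add: rules cl q_def r_def t_def u_def)
    ultimately have "(H (pb x y) a \<ominus>\<^bsub>A\<^esub> (H x (H y a) \<ominus>\<^bsub>A\<^esub> H y (H x a))) \<odot>\<^bsub>M\<^esub> v =
      ((p \<ominus>\<^bsub>M\<^esub> q) \<ominus>\<^bsub>M\<^esub> (r \<ominus>\<^bsub>M\<^esub> s)) \<ominus>\<^bsub>M\<^esub>
      (((p \<ominus>\<^bsub>M\<^esub> t) \<ominus>\<^bsub>M\<^esub> (u \<ominus>\<^bsub>M\<^esub> s)) \<ominus>\<^bsub>M\<^esub> ((q \<ominus>\<^bsub>M\<^esub> u) \<ominus>\<^bsub>M\<^esub> (t \<ominus>\<^bsub>M\<^esub> r)))"
      using x y a v by (simp add: left_module.act_minus[OF ax(2)] cl)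
    also have "\<dots> = \<zero>\<^bsub>M\<^esub>"
      using car G.r_neg[of "p \<oplus>\<^bsub>M\<^esub> (q \<oplus>\<^bsub>M\<^esub> (r \<oplus>\<^bsub>M\<^esub> (s \<oplus>\<^bsub>M\<^esub> (t \<oplus>\<^bsub>M\<^esub> u))))"]
      by (simp add: G.minus_eq G.minus_add G.minus_minus G.a_ac G.r_neg1 G.r_neg2)
    finally show ?thesis .
  qed
  then show ?thesis
    using x y a by (simp add: annihilator_def cl)
qed

definition transport_module :: "('m \<Rightarrow> 'n) \<Rightarrow> ('a, 'm) module \<Rightarrow> ('a, 'n) module"
  where "transport_module g M = (let h = the_inv_into (carrier M) g in
    \<lparr>carrier = g ` carrier M, mult = \<lambda>u w. g (h u \<otimes>\<^bsub>M\<^esub> h w), one = g \<one>\<^bsub>M\<^esub>, ring.zero = g \<zero>\<^bsub>M\<^esub>,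
     ring.add = \<lambda>u w. g (h u \<oplus>\<^bsub>M\<^esub> h w), smult = \<lambda>a u. g (a \<odot>\<^bsub>M\<^esub> h u)\<rparr>)"

context left_module
begin

context
  fixes g :: "'m \<Rightarrow> 'n"
  assumes inj: "inj_on g (carrier M)"
begin

private abbreviation (input) "T \<equiv> transport_module g M"
private abbreviation (input) "h \<equiv> the_inv_into (carrier M) g"

lemma transport_simps:
  "carrier T = g ` carrier M" "\<zero>\<^bsub>T\<^esub> = g \<zero>\<^bsub>M\<^esub>"
  "\<lbrakk>v \<in> carrier M; w \<in> carrier M\<rbrakk> \<Longrightarrow> g v \<oplus>\<^bsub>T\<^esub> g w = g (v \<oplus>\<^bsub>M\<^esub> w)"
  "v \<in> carrier M \<Longrightarrow> a \<odot>\<^bsub>T\<^esub> g v = g (a \<odot>\<^bsub>M\<^esub> v)"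
  "v \<in> carrier M \<Longrightarrow> h (g v) = v"
  by (auto simp: transport_module_def Let_def the_inv_into_f_f[OF inj])

lemma transport_left_module: "left_module A T"
proof (intro left_module.intro left_module_axioms.intro LR.ring_axioms)
  show "abelian_group T"
  proof (rule abelian_groupI)
    fix x assume "x \<in> carrier T"
    then obtain v where v: "x = g v" "v \<in> carrier M" by (auto simp: transport_simps)
    then have "g (\<ominus>\<^bsub>M\<^esub> v) \<oplus>\<^bsub>T\<^esub> x = \<zero>\<^bsub>T\<^esub>" by (simp add: transport_simps LM.l_neg)
    then show "\<exists>y\<in>carrier T. y \<oplus>\<^bsub>T\<^esub> x = \<zero>\<^bsub>T\<^esub>" using v by (auto simp: transport_simps)
  qed (auto simp: transport_simps LM.a_ac)
qed (auto simp: transport_simps act_closed act_add_left act_add_right act_mult act_one)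

lemma transport_minus:
  assumes v: "v \<in> carrier M" and w: "w \<in> carrier M"
  shows "g v \<ominus>\<^bsub>T\<^esub> g w = g (v \<ominus>\<^bsub>M\<^esub> w)"
proof -
  interpret T: left_module A T by (rule transport_left_module)
  have car: "g w \<in> carrier T" "g (\<ominus>\<^bsub>M\<^esub> w) \<in> carrier T"
    using w by (auto simp: transport_simps)
  have "\<ominus>\<^bsub>T\<^esub> g w = g (\<ominus>\<^bsub>M\<^esub> w)"
  proof (rule T.LM.minus_equality)
    show "g (\<ominus>\<^bsub>M\<^esub> w) \<oplus>\<^bsub>T\<^esub> g w = \<zero>\<^bsub>T\<^esub>"
      using w by (simp add: transport_simps LM.l_neg)
  qed (use car in auto)
  then show ?thesis
    using v w by (simp add: T.LM.minus_eq LM.minus_eq transport_simps)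
qed

lemma transport_annihilator: "annihilator A T = annihilator A M"
proof -
  have "g (a \<odot>\<^bsub>M\<^esub> v) = g \<zero>\<^bsub>M\<^esub> \<longleftrightarrow> a \<odot>\<^bsub>M\<^esub> v = \<zero>\<^bsub>M\<^esub>" if "a \<in> carrier A" "v \<in> carrier M" for a v
    using that act_closed by (simp add: inj_on_eq_iff[OF inj])
  then show ?thesis
    by (auto simp: annihilator_def transport_simps)
qed

lemma transport_submodule:
  assumes "submodule N A T"
  shows "submodule (h ` N) A M" and "N = g ` (h ` N)"
proof -
  interpret N: submodule N A T by (rule assms)
  have NT: "N \<subseteq> g ` carrier M" using N.subset by (simp add: transport_simps)
  have mem: "v \<in> h ` N \<longleftrightarrow> v \<in> carrier M \<and> g v \<in> N" for v
  proof
    assume "v \<in> h ` N"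
    then obtain w where "w \<in> carrier M" "g w \<in> N" "v = h (g w)" using NT by blast
    then show "v \<in> carrier M \<and> g v \<in> N" by (simp add: transport_simps(5))
  next
    assume "v \<in> carrier M \<and> g v \<in> N"
    then show "v \<in> h ` N" by (intro image_eqI[of _ _ "g v"]) (simp_all add: transport_simps(5))
  qed
  have "g (h u) = u" if "u \<in> N" for u
    using that NT by (intro f_the_inv_into_f[OF inj]) blast
  then show "N = g ` (h ` N)" by (simp add: image_image)
  have zero: "g \<zero>\<^bsub>M\<^esub> \<in> N" using N.one_closed by (simp add: transport_simps)
  have add: "g (v \<oplus>\<^bsub>M\<^esub> w) \<in> N" if "v \<in> carrier M" "w \<in> carrier M" "g v \<in> N" "g w \<in> N" for v w
    using N.m_closed[OF that(3,4)] that by (simp add: transport_simps)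
  have act: "g (a \<odot>\<^bsub>M\<^esub> v) \<in> N" if "a \<in> carrier A" "v \<in> carrier M" "g v \<in> N" for a v
    using N.smult_closed[OF that(1,3)] that by (simp add: transport_simps)
  show "submodule (h ` N) A M"
    by (rule left_submoduleI) (simp_all add: subset_iff mem zero add act act_closed)
qed

end

end

lemma annihilator_mem_Prim:
  fixes M :: "('a, 'm) module"
  assumes "simple_module A M"
  shows "annihilator A M \<in> Prim A"
proof -
  interpret left_module A M using assms by (simp add: simple_module_def)
  obtain v where v: "v \<in> carrier M" "v \<noteq> \<zero>\<^bsub>M\<^esub>"
    using assms LM.zero_closed by (auto simp: simple_module_def)
  let ?f = "\<lambda>a. a \<odot>\<^bsub>M\<^esub> v"
  have "submodule (?f ` carrier A) A M"
  proof (rule left_submoduleI)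
    show "?f ` carrier A \<subseteq> carrier M" using v act_closed by blast
    show "\<zero>\<^bsub>M\<^esub> \<in> ?f ` carrier A"
      using act_zero_left[OF v(1)] by (intro image_eqI[of _ _ "\<zero>\<^bsub>A\<^esub>"]) simp_all
    show "x \<oplus>\<^bsub>M\<^esub> y \<in> ?f ` carrier A" if xy: "x \<in> ?f ` carrier A" "y \<in> ?f ` carrier A" for x y
    proof -
      obtain a b where "a \<in> carrier A" "b \<in> carrier A" "x = ?f a" "y = ?f b" using xy by blast
      then show ?thesis
        using act_add_left[of a b v] v by (intro image_eqI[of _ _ "a \<oplus>\<^bsub>A\<^esub> b"]) simp_all
    qed
    show "a \<odot>\<^bsub>M\<^esub> y \<in> ?f ` carrier A" if a: "a \<in> carrier A" and y: "y \<in> ?f ` carrier A" for a y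
    proof -
      obtain b where "b \<in> carrier A" "y = ?f b" using y by blast
      then show ?thesis
        using a act_mult[of a b v] v by (intro image_eqI[of _ _ "a \<otimes>\<^bsub>A\<^esub> b"]) simp_all
    qed
  qed
  then have "?f ` carrier A = {\<zero>\<^bsub>M\<^esub>} \<or> ?f ` carrier A = carrier M"
    using assms by (simp add: simple_module_def)
  moreover have "v \<in> ?f ` carrier A"
    using v by (intro image_eqI[of _ _ "\<one>\<^bsub>A\<^esub>"]) (simp_all add: act_one)
  ultimately have surj: "?f ` carrier A = carrier M"
    using v by (metis singletonD)
  define g where "g = inv_into (carrier A) (\<lambda>a. a \<odot>\<^bsub>M\<^esub> v)"
  have inj: "inj_on g (carrier M)"
    unfolding g_def surj[symmetric] by (rule inj_on_inv_into) simp
  note T = transport_simps[OF inj]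
  have "simple_module A (transport_module g M)"
    unfolding simple_module_def
  proof (intro conjI allI impI)
    show "left_module A (transport_module g M)" by (rule transport_left_module[OF inj])
    have "g v \<noteq> g \<zero>\<^bsub>M\<^esub>" using inj v by (simp add: inj_on_eq_iff)
    then show "carrier (transport_module g M) \<noteq> {\<zero>\<^bsub>transport_module g M\<^esub>}"
      using v by (auto simp: T)
  next
    fix N assume N: "submodule N A (transport_module g M)"
    note tr = transport_submodule[OF inj N]
    have "the_inv_into (carrier M) g ` N = {\<zero>\<^bsub>M\<^esub>} \<or> the_inv_into (carrier M) g ` N = carrier M"
      using assms tr(1) by (simp add: simple_module_def)
    then show "N = {\<zero>\<^bsub>transport_module g M\<^esub>} \<or> N = carrier (transport_module g M)"
      using tr(2) by (auto simp: T)
  qed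
  then show ?thesis
    unfolding Prim_def using transport_annihilator[OF inj] by blast
qed


fun letter :: "('a, 'm) module \<Rightarrow> ('z \<Rightarrow> 'm \<Rightarrow> 'm) \<Rightarrow> 'a + 'z \<Rightarrow> 'm \<Rightarrow> 'm"
  where "letter M nabla (Inl a) v = a \<odot>\<^bsub>M\<^esub> v"
  | "letter M nabla (Inr x) v = nabla x v"

definition word_sum ::
    "('a, 'm) module \<Rightarrow> ('z \<Rightarrow> 'm \<Rightarrow> 'm) \<Rightarrow> 'm \<Rightarrow> ('a + 'z) list list \<Rightarrow> 'm"
  where "word_sum M nabla v ws =
    foldr (\<lambda>w s. foldr (letter M nabla) w v \<oplus>\<^bsub>M\<^esub> s) ws \<zero>\<^bsub>M\<^esub>"

lemma transport_poisson_module: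
  assumes PM: "poisson_module Z pb A H M nabla" and inj: "inj_on g (carrier M)"
  shows "poisson_module Z pb A H (transport_module g M)
    (\<lambda>x u. g (nabla x (the_inv_into (carrier M) g u)))"
proof -
  note ax = poisson_moduleD[OF PM]
  interpret L: left_module A M by (fact ax)
  interpret O: hamiltonian_order Z pb A H by (fact ax)
  interpret RA: ring A by (fact ax)
  have Zmod: "Module.module complex_field Z"
    using ax(6) by (auto simp: poisson_algebra_def Module.algebra_def)
  interpret RZ: cring Z by (fact ax)
  have sc: "(c \<odot>\<^bsub>Z\<^esub> \<one>\<^bsub>Z\<^esub>) \<in> carrier Z" for c
    by (intro Module.module.smult_closed[OF Zmod]) (auto simp: ring_of_type_algebra_def)
  have zA: "x \<odot>\<^bsub>A\<^esub> \<one>\<^bsub>A\<^esub> \<in> carrier A" if "x \<in> carrier Z" for x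
    using that O.ZA.smult_closed by blast
  have Zcl: "x \<oplus>\<^bsub>Z\<^esub> y \<in> carrier Z" "x \<otimes>\<^bsub>Z\<^esub> y \<in> carrier Z"
    if "x \<in> carrier Z" "y \<in> carrier Z" for x y
    using that by auto
  note T = L.transport_simps[OF inj] L.transport_minus[OF inj]
  note cl = L.act_closed poisson_module.nabla_closed[OF PM] sc zA Zcl O.H_closed
    poisson_algebra.pb_closed[OF ax(6)]
  show ?thesis
  proof (intro poisson_module.intro poisson_module_axioms.intro ax L.transport_left_module[OF inj])
  qed (auto simp: T cl poisson_module.nabla_add_right[OF PM] poisson_module.nabla_add_left[OF PM]
      poisson_module.nabla_scale_right[OF PM] poisson_module.nabla_scale_left[OF PM]
      poisson_module.nabla_mult[OF PM] poisson_module.nabla_H[OF PM]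
      poisson_module.nabla_pb[OF PM])
qed

lemma annihilator_mem_poisson_annihilators:
  fixes M :: "('a, 'm) module"
  assumes S: "simple_poisson_module Z pb A H M nabla"
  shows "annihilator A M \<in> poisson_annihilators Z pb A H"
proof -
  have PM: "poisson_module Z pb A H M nabla"
    using S by (simp add: simple_poisson_module_def)
  interpret left_module A M using poisson_moduleD[OF PM] by simp
  note ncl = poisson_module.nabla_closed[OF PM]
  obtain v where v: "v \<in> carrier M" "v \<noteq> \<zero>\<^bsub>M\<^esub>"
    using S LM.zero_closed by (auto simp: simple_poisson_module_def)
  define L where "L = Inl ` carrier A \<union> Inr ` carrier Z"
  define W where "W = lists (lists L)"
  let ?l = "letter M nabla" and ?s = "word_sum M nabla v"
  have l_cl: "?l l u \<in> carrier M" if "l \<in> L" "u \<in> carrier M" for l u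
    using that by (auto simp: L_def act_closed ncl)
  have l_add: "?l l (u \<oplus>\<^bsub>M\<^esub> w) = ?l l u \<oplus>\<^bsub>M\<^esub> ?l l w"
    if "l \<in> L" "u \<in> carrier M" "w \<in> carrier M" for l u w
    using that by (auto simp: L_def act_add_right poisson_module.nabla_add_right[OF PM])
  have l_zero: "?l l \<zero>\<^bsub>M\<^esub> = \<zero>\<^bsub>M\<^esub>" if "l \<in> L" for l
    using that by (auto simp: L_def act_zero_right nabla_zero[OF PM])
  have w_cl: "foldr ?l w v \<in> carrier M" if "w \<in> lists L" for w
    using that by (induction w) (auto simp: v l_cl)
  have s_simps: "?s [] = \<zero>\<^bsub>M\<^esub>" "?s (w # ws) = foldr ?l w v \<oplus>\<^bsub>M\<^esub> ?s ws" for w ws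
    by (auto simp: word_sum_def)
  have s_cl: "?s ws \<in> carrier M" if "ws \<in> W" for ws
    using that unfolding W_def by (induction ws) (simp_all add: s_simps w_cl)
  have s_app: "?s (ws @ ws') = ?s ws \<oplus>\<^bsub>M\<^esub> ?s ws'" if "ws \<in> W" "ws' \<in> W" for ws ws'
    using that s_cl unfolding W_def
    by (induction ws) (simp_all add: s_simps w_cl LM.a_assoc)
  have s_map: "?l l (?s ws) = ?s (map ((#) l) ws)" if "l \<in> L" "ws \<in> W" for l ws
    using that s_cl unfolding W_def
    by (induction ws) (simp_all add: s_simps w_cl l_zero l_add)
  have map_W: "map ((#) l) ws \<in> W" if "l \<in> L" "ws \<in> W" for l ws
    using that by (auto simp: W_def in_lists_conv_set)
  have "submodule (?s ` W) A M"
  proof (rule left_submoduleI)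
    show "?s ` W \<subseteq> carrier M" using s_cl by blast
    show "\<zero>\<^bsub>M\<^esub> \<in> ?s ` W" by (rule image_eqI[of _ _ "[]"]) (simp_all add: s_simps W_def)
    show "a \<oplus>\<^bsub>M\<^esub> b \<in> ?s ` W" if ab: "a \<in> ?s ` W" "b \<in> ?s ` W" for a b
    proof -
      obtain x y where xy: "x \<in> W" "y \<in> W" "a = ?s x" "b = ?s y" using ab by blast
      then have "x @ y \<in> W" by (simp add: W_def)
      then show ?thesis using s_app[OF xy(1,2)] xy by (metis image_eqI)
    qed
    show "a \<odot>\<^bsub>M\<^esub> b \<in> ?s ` W" if a: "a \<in> carrier A" and b: "b \<in> ?s ` W" for a b
    proof -
      obtain x where x: "x \<in> W" "b = ?s x" using b by blast
      have l: "Inl a \<in> L" using a by (simp add: L_def)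
      show ?thesis using s_map[OF l x(1)] map_W[OF l x(1)] x by simp
    qed
  qed
  moreover have "\<forall>x\<in>carrier Z. \<forall>b\<in>?s ` W. nabla x b \<in> ?s ` W"
  proof (intro ballI)
    fix x b assume x: "x \<in> carrier Z" and b: "b \<in> ?s ` W"
    obtain ws where ws: "ws \<in> W" "b = ?s ws" using b by blast
    have l: "Inr x \<in> L" using x by (simp add: L_def)
    show "nabla x b \<in> ?s ` W" using s_map[OF l ws(1)] map_W[OF l ws(1)] ws by simp
  qed
  moreover have "v \<in> ?s ` W"
    using v by (intro image_eqI[of _ _ "[[]]"]) (simp_all add: s_simps W_def)
  ultimately have surj: "?s ` W = carrier M"
    using S v unfolding simple_poisson_module_def by (metis singletonD)
  define g where "g = inv_into W ?s"
  have inj: "inj_on g (carrier M)"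
    unfolding g_def surj[symmetric] by (rule inj_on_inv_into) simp
  note T = transport_simps[OF inj]
  let ?T = "transport_module g M" and ?h = "the_inv_into (carrier M) g"
  let ?n = "\<lambda>x u. g (nabla x (?h u))"
  have "simple_poisson_module Z pb A H ?T ?n"
    unfolding simple_poisson_module_def
  proof (intro conjI allI impI)
    show "poisson_module Z pb A H ?T ?n" by (rule transport_poisson_module[OF PM inj])
    have "g v \<noteq> g \<zero>\<^bsub>M\<^esub>" using inj v by (simp add: inj_on_eq_iff)
    then show "carrier ?T \<noteq> {\<zero>\<^bsub>?T\<^esub>}"
      using v by (auto simp: T)
  next
    fix N assume N: "submodule N A ?T \<and> (\<forall>x\<in>carrier Z. \<forall>u\<in>N. ?n x u \<in> N)"
    note tr = transport_submodule[OF inj conjunct1[OF N]]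
    have sub: "?h ` N \<subseteq> carrier M"
      using subgroup.subset[OF submodule.axioms(1)[OF tr(1)]] by simp
    have stable: "nabla x w \<in> ?h ` N" if x: "x \<in> carrier Z" and w: "w \<in> ?h ` N" for x w
    proof -
      obtain u where u: "u \<in> N" "w = ?h u" using w by blast
      have "g (nabla x w) \<in> N" using N x u by blast
      moreover have "?h (g (nabla x w)) = nabla x w"
        using x w sub by (intro T(5)) (auto intro: ncl)
      ultimately show ?thesis by (metis image_eqI)
    qed
    then have "?h ` N = {\<zero>\<^bsub>M\<^esub>} \<or> ?h ` N = carrier M"
      using S tr(1) unfolding simple_poisson_module_def by blast
    then show "N = {\<zero>\<^bsub>?T\<^esub>} \<or> N = carrier ?T"
      using tr(2) by (auto simp: T)
  qed
  then show ?thesis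
    unfolding poisson_annihilators_def using transport_annihilator[OF inj] by blast
qed


lemma istopology_jacobson:
  assumes prime: "\<And>S T I. \<lbrakk>S \<subseteq> \<S>; T \<subseteq> \<S>; I \<in> \<S>; carrier A \<inter> \<Inter>S \<inter> \<Inter>T \<subseteq> I\<rbrakk> \<Longrightarrow>
    carrier A \<inter> \<Inter>S \<subseteq> I \<or> carrier A \<inter> \<Inter>T \<subseteq> I"
  shows "istopology (\<lambda>U. U \<subseteq> \<S> \<and> (\<exists>S \<subseteq> \<S>. \<S> - U = {I \<in> \<S>. carrier A \<inter> \<Inter>S \<subseteq> I}))"
proof -
  define V where "V S = {I \<in> \<S>. carrier A \<inter> \<Inter>S \<subseteq> I}" for S
  have mem: "I \<in> V S \<longleftrightarrow> I \<in> \<S> \<and> carrier A \<inter> \<Inter>S \<subseteq> I" for I S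
    by (simp add: V_def)
  have un: "V S \<union> V T = V (S \<union> T)" if "S \<subseteq> \<S>" "T \<subseteq> \<S>" for S T
  proof (rule Set.set_eqI)
    fix I
    have "carrier A \<inter> \<Inter>(S \<union> T) = carrier A \<inter> \<Inter>S \<inter> \<Inter>T" by blast
    moreover have "carrier A \<inter> \<Inter>S \<inter> \<Inter>T \<subseteq> I"
      if "carrier A \<inter> \<Inter>S \<subseteq> I \<or> carrier A \<inter> \<Inter>T \<subseteq> I" using that by blast
    ultimately show "I \<in> V S \<union> V T \<longleftrightarrow> I \<in> V (S \<union> T)"
      using prime[OF that, of I] unfolding Un_iff mem by metis
  qed
  have fixed: "V F = F" if F: "F \<subseteq> \<S>" "\<And>I. I \<in> V F \<Longrightarrow> I \<in> F" for F
  proof (rule Set.set_eqI)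
    fix I
    have "carrier A \<inter> \<Inter>F \<subseteq> I" if "I \<in> F" using that by blast
    then show "I \<in> V F \<longleftrightarrow> I \<in> F" using F mem by (meson subsetD)
  qed
  have antimono: "V T \<subseteq> V S" if "T \<subseteq> V S" for S T
  proof
    fix I assume I: "I \<in> V T"
    have "carrier A \<inter> \<Inter>S \<subseteq> J" if "J \<in> T" for J
      using \<open>T \<subseteq> V S\<close> that mem by (meson subsetD)
    then have "carrier A \<inter> \<Inter>S \<subseteq> carrier A \<inter> \<Inter>T"
      by (intro Int_greatest Inter_greatest) simp_all
    then show "I \<in> V S" using I mem by (meson order_trans)
  qed
  show ?thesis
    unfolding istopology_def V_def[symmetric]
  proof (intro conjI allI impI)
    fix U W
    assume U: "U \<subseteq> \<S> \<and> (\<exists>S\<subseteq>\<S>. \<S> - U = V S)" and W: "W \<subseteq> \<S> \<and> (\<exists>S\<subseteq>\<S>. \<S> - W = V S)"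
    show "U \<inter> W \<subseteq> \<S>" using U by (meson le_infI1)
    obtain S where S: "S \<subseteq> \<S>" "\<S> - U = V S" using U by metis
    obtain T where T: "T \<subseteq> \<S>" "\<S> - W = V T" using W by metis
    have "\<S> - U \<inter> W = V (S \<union> T)"
      unfolding Diff_Int S(2) T(2) by (rule un[OF S(1) T(1)])
    then show "\<exists>S\<subseteq>\<S>. \<S> - U \<inter> W = V S"
      using S(1) T(1) by (meson Un_least)
  next
    fix \<K> assume K: "\<forall>K\<in>\<K>. K \<subseteq> \<S> \<and> (\<exists>S\<subseteq>\<S>. \<S> - K = V S)"
    show "\<Union>\<K> \<subseteq> \<S>" using K by (meson Union_least)
    have "V (\<S> - \<Union>\<K>) = \<S> - \<Union>\<K>"
    proof (rule fixed)
      fix I assume I: "I \<in> V (\<S> - \<Union>\<K>)"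
      have "I \<notin> K" if KK: "K \<in> \<K>" for K
      proof -
        obtain S where S: "\<S> - K = V S" using K KK by metis
        have "\<S> - \<Union>\<K> \<subseteq> V S" unfolding S[symmetric] using KK by (simp add: Diff_mono Union_upper)
        then have "I \<in> \<S> - K" using antimono I unfolding S by (meson subsetD)
        then show ?thesis by simp
      qed
      then show "I \<in> \<S> - \<Union>\<K>" using I mem by simp
    qed simp
    then show "\<exists>S\<subseteq>\<S>. \<S> - \<Union>\<K> = V S"
      by (metis Diff_subset)
  qed
qed

lemma ideal_Inter:
  assumes "ring A" and "\<And>J. J \<in> S \<Longrightarrow> ideal J A"
  shows "ideal (carrier A \<inter> \<Inter>S) A"
proof -
  interpret ring A by fact
  have "ideal (\<Inter>(insert (carrier A) S)) A"
    by (rule i_Intersect) (use assms oneideal in auto)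
  then show ?thesis by simp
qed

context left_module
begin

lemma annihilated_submodule:
  assumes J: "ideal J A"
  shows "submodule {v \<in> carrier M. \<forall>b\<in>J. b \<odot>\<^bsub>M\<^esub> v = \<zero>\<^bsub>M\<^esub>} A M"
proof -
  interpret J: ideal J A by fact
  have J_cl: "b \<in> carrier A" if "b \<in> J" for b using that by (rule J.Icarr)
  show ?thesis
  proof (rule left_submoduleI)
    fix a v assume a: "a \<in> carrier A" and v: "v \<in> {v \<in> carrier M. \<forall>b\<in>J. b \<odot>\<^bsub>M\<^esub> v = \<zero>\<^bsub>M\<^esub>}"
    have "b \<odot>\<^bsub>M\<^esub> (a \<odot>\<^bsub>M\<^esub> v) = \<zero>\<^bsub>M\<^esub>" if b: "b \<in> J" for b
      using v a J_cl[OF b] J.I_r_closed[OF b a] act_mult[of b a v] by simp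
    then show "a \<odot>\<^bsub>M\<^esub> v \<in> {v \<in> carrier M. \<forall>b\<in>J. b \<odot>\<^bsub>M\<^esub> v = \<zero>\<^bsub>M\<^esub>}"
      using a v by (simp add: act_closed)
  qed (auto simp: act_zero_right act_add_right J_cl)
qed

lemma annihilator_prime:
  assumes I: "ideal I A" and J: "ideal J A" and IJ: "I \<inter> J \<subseteq> annihilator A M"
    and simple: "{v \<in> carrier M. \<forall>b\<in>I. b \<odot>\<^bsub>M\<^esub> v = \<zero>\<^bsub>M\<^esub>} = {\<zero>\<^bsub>M\<^esub>} \<or>
      {v \<in> carrier M. \<forall>b\<in>I. b \<odot>\<^bsub>M\<^esub> v = \<zero>\<^bsub>M\<^esub>} = carrier M"
  shows "I \<subseteq> annihilator A M \<or> J \<subseteq> annihilator A M"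
  using simple
proof
  interpret I: ideal I A by fact
  interpret J: ideal J A by fact
  assume *: "{v \<in> carrier M. \<forall>b\<in>I. b \<odot>\<^bsub>M\<^esub> v = \<zero>\<^bsub>M\<^esub>} = {\<zero>\<^bsub>M\<^esub>}"
  have "c \<odot>\<^bsub>M\<^esub> v = \<zero>\<^bsub>M\<^esub>" if c: "c \<in> J" and v: "v \<in> carrier M" for c v
  proof -
    have "b \<odot>\<^bsub>M\<^esub> (c \<odot>\<^bsub>M\<^esub> v) = \<zero>\<^bsub>M\<^esub>" if b: "b \<in> I" for b
    proof -
      have "b \<otimes>\<^bsub>A\<^esub> c \<in> I \<inter> J"
        using I.I_r_closed[OF b J.Icarr[OF c]] J.I_l_closed[OF c I.Icarr[OF b]] by simp
      then have "b \<otimes>\<^bsub>A\<^esub> c \<in> annihilator A M" using IJ by blast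
      then show ?thesis
        using act_mult[OF I.Icarr[OF b] J.Icarr[OF c] v] v by (simp add: annihilator_def)
    qed
    then have "c \<odot>\<^bsub>M\<^esub> v \<in> {v \<in> carrier M. \<forall>b\<in>I. b \<odot>\<^bsub>M\<^esub> v = \<zero>\<^bsub>M\<^esub>}"
      using act_closed[OF J.Icarr[OF c] v] by simp
    then show ?thesis unfolding * by simp
  qed
  then show ?thesis using J.Icarr by (auto simp: annihilator_def)
next
  interpret I: ideal I A by fact
  assume "{v \<in> carrier M. \<forall>b\<in>I. b \<odot>\<^bsub>M\<^esub> v = \<zero>\<^bsub>M\<^esub>} = carrier M"
  then show ?thesis using I.Icarr by (auto simp: annihilator_def)
qed

end

lemma openin_jacobson_Prim:
  assumes "ring A"
  shows "openin (jacobson_topology A (Prim A)) U \<longleftrightarrow>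
    U \<subseteq> Prim A \<and> (\<exists>S \<subseteq> Prim A. Prim A - U = {I \<in> Prim A. carrier A \<inter> \<Inter>S \<subseteq> I})"
proof -
  have ideals: "ideal J A" if "J \<in> Prim A" for J
    using that left_module.annihilator_ideal by (auto simp: Prim_def simple_module_def)
  have "istopology (\<lambda>U. U \<subseteq> Prim A \<and>
    (\<exists>S \<subseteq> Prim A. Prim A - U = {I \<in> Prim A. carrier A \<inter> \<Inter>S \<subseteq> I}))"
  proof (rule istopology_jacobson)
    fix S T I assume *: "S \<subseteq> Prim A" "T \<subseteq> Prim A" "I \<in> Prim A"
      "carrier A \<inter> \<Inter>S \<inter> \<Inter>T \<subseteq> I"
    obtain M :: "('a, 'a) module" where M: "simple_module A M" "I = annihilator A M"
      using *(3) by (auto simp: Prim_def)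
    interpret left_module A M using M by (simp add: simple_module_def)
    have S: "ideal (carrier A \<inter> \<Inter>S) A" and T: "ideal (carrier A \<inter> \<Inter>T) A"
      using *(1,2) ideals by (auto intro!: ideal_Inter assms)
    show "carrier A \<inter> \<Inter>S \<subseteq> I \<or> carrier A \<inter> \<Inter>T \<subseteq> I"
      unfolding M(2)
    proof (rule annihilator_prime[OF S T])
      show "carrier A \<inter> \<Inter>S \<inter> (carrier A \<inter> \<Inter>T) \<subseteq> annihilator A M"
        using *(4) M(2) by blast
    qed (use M(1) annihilated_submodule[OF S] in \<open>simp add: simple_module_def\<close>)
  qed
  then show ?thesis by (simp add: jacobson_topology_def)
qed

lemma poisson_annihilator_stable:
  assumes PM: "poisson_module Z pb A H M nabla"
    and x: "x \<in> carrier Z" and a: "a \<in> annihilator A M"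
  shows "H x a \<in> annihilator A M"
proof -
  note ax = poisson_moduleD[OF PM]
  interpret left_module A M by (fact ax)
  have a': "a \<in> carrier A" "\<And>v. v \<in> carrier M \<Longrightarrow> a \<odot>\<^bsub>M\<^esub> v = \<zero>\<^bsub>M\<^esub>"
    using a by (auto simp: annihilator_def)
  show ?thesis
    using x a' nabla_zero[OF PM]
    by (simp add: annihilator_def hamiltonian_order.H_closed[OF ax(1)]
        poisson_module.nabla_H[OF PM] poisson_module.nabla_closed[OF PM] LM.minus_eq)
qed

lemma openin_jacobson_poisson_annihilators:
  fixes Z :: "(complex, 'z) module" and A :: "('z, 'a) module"
    and pb :: "'z \<Rightarrow> 'z \<Rightarrow> 'z" and H :: "'z \<Rightarrow> 'a \<Rightarrow> 'a"
  assumes "ring A"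
  defines "\<S> \<equiv> poisson_annihilators Z pb A H"
  shows "openin (jacobson_topology A \<S>) U \<longleftrightarrow>
    U \<subseteq> \<S> \<and> (\<exists>S \<subseteq> \<S>. \<S> - U = {I \<in> \<S>. carrier A \<inter> \<Inter>S \<subseteq> I})"
proof -
  have ideals: "ideal J A" "\<And>x a. \<lbrakk>x \<in> carrier Z; a \<in> J\<rbrakk> \<Longrightarrow> H x a \<in> J" if J: "J \<in> \<S>" for J
  proof -
    obtain M :: "('a, ('a + 'z) list list) module" and nabla
      where PM: "poisson_module Z pb A H M nabla" and JM: "J = annihilator A M"
      using J by (auto simp: \<S>_def poisson_annihilators_def simple_poisson_module_def)
    show "ideal J A"
      unfolding JM by (rule left_module.annihilator_ideal[OF poisson_moduleD(2)[OF PM]])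
    show "H x a \<in> J" if "x \<in> carrier Z" "a \<in> J" for x a
      using that unfolding JM by (rule poisson_annihilator_stable[OF PM])
  qed
  have "istopology (\<lambda>U. U \<subseteq> \<S> \<and> (\<exists>S \<subseteq> \<S>. \<S> - U = {I \<in> \<S>. carrier A \<inter> \<Inter>S \<subseteq> I}))"
  proof (rule istopology_jacobson)
    fix S T I assume *: "S \<subseteq> \<S>" "T \<subseteq> \<S>" "I \<in> \<S>" "carrier A \<inter> \<Inter>S \<inter> \<Inter>T \<subseteq> I"
    obtain M :: "('a, ('a + 'z) list list) module" and nabla
      where M: "simple_poisson_module Z pb A H M nabla" "I = annihilator A M"
      using *(3) unfolding \<S>_def poisson_annihilators_def by blast
    then have PM: "poisson_module Z pb A H M nabla"
      by (simp add: simple_poisson_module_def)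
    note ax = poisson_moduleD[OF PM]
    interpret left_module A M by (fact ax)
    have S: "ideal (carrier A \<inter> \<Inter>S) A" and T: "ideal (carrier A \<inter> \<Inter>T) A"
      using *(1,2) ideals(1) by (auto intro!: ideal_Inter assms(1))
    let ?J = "carrier A \<inter> \<Inter>S"
    define N where "N = {v \<in> carrier M. \<forall>b\<in>?J. b \<odot>\<^bsub>M\<^esub> v = \<zero>\<^bsub>M\<^esub>}"
    have stable: "nabla x v \<in> N" if x: "x \<in> carrier Z" and v': "v \<in> N" for x v
    proof -
      have vM: "v \<in> carrier M" and v: "\<And>b. b \<in> ?J \<Longrightarrow> b \<odot>\<^bsub>M\<^esub> v = \<zero>\<^bsub>M\<^esub>"
        using v' by (simp_all add: N_def)
      have "b \<odot>\<^bsub>M\<^esub> nabla x v = \<zero>\<^bsub>M\<^esub>" if b: "b \<in> ?J" for b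
      proof -
        have bA: "b \<in> carrier A" using b by simp
        have nv: "b \<odot>\<^bsub>M\<^esub> nabla x v \<in> carrier M"
          using act_closed[OF bA poisson_module.nabla_closed[OF PM x vM]] .
        have "H x b \<in> J" if "J \<in> S" for J
          using ideals(2)[of J x b] that *(1) b x by auto
        then have "H x b \<in> ?J"
          using hamiltonian_order.H_closed[OF ax(1) x bA] by simp
        then have "\<zero>\<^bsub>M\<^esub> = nabla x (b \<odot>\<^bsub>M\<^esub> v) \<ominus>\<^bsub>M\<^esub> b \<odot>\<^bsub>M\<^esub> nabla x v"
          using poisson_module.nabla_H[OF PM x bA vM] v[of "H x b"] by simp
        also have "b \<odot>\<^bsub>M\<^esub> v = \<zero>\<^bsub>M\<^esub>" using b by (rule v)
        finally have "\<ominus>\<^bsub>M\<^esub> (b \<odot>\<^bsub>M\<^esub> nabla x v) = \<zero>\<^bsub>M\<^esub>"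
          using nv nabla_zero[OF PM x] by (simp add: LM.minus_eq)
        then have "\<ominus>\<^bsub>M\<^esub> (\<ominus>\<^bsub>M\<^esub> (b \<odot>\<^bsub>M\<^esub> nabla x v)) = \<zero>\<^bsub>M\<^esub>" by simp
        then show ?thesis using LM.minus_minus[OF nv] by simp
      qed
      then show ?thesis
        using x vM by (simp add: N_def poisson_module.nabla_closed[OF PM])
    qed
    have "submodule N A M" unfolding N_def by (rule annihilated_submodule[OF S])
    then have "N = {\<zero>\<^bsub>M\<^esub>} \<or> N = carrier M"
      using M(1) stable by (simp add: simple_poisson_module_def)
    moreover have "?J \<inter> (carrier A \<inter> \<Inter>T) \<subseteq> annihilator A M"
      using *(4) M(2) by blast
    ultimately show "carrier A \<inter> \<Inter>S \<subseteq> I \<or> carrier A \<inter> \<Inter>T \<subseteq> I"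
      unfolding M(2) N_def by (intro annihilator_prime[OF S T])
  qed
  then show ?thesis by (simp add: jacobson_topology_def)
qed

lemma equiv_symplectic_cores:
  "equiv (Prim A) {(I, J). I \<in> Prim A \<and> J \<in> Prim A \<and> poisson_core Z A H I = poisson_core Z A H J}"
  by (rule equivI) (auto simp: refl_on_def sym_def trans_def)

lemma openin_core_space:
  "openin (core_space Z A H) \<U> \<longleftrightarrow> \<U> \<subseteq> symplectic_cores Z A H \<and>
    openin (jacobson_topology A (Prim A)) (\<Union>\<U>)"
proof -
  have "istopology (\<lambda>\<U>. \<U> \<subseteq> symplectic_cores Z A H \<and>
    openin (jacobson_topology A (Prim A)) (\<Union>\<U>))"
    unfolding istopology_def
  proof (intro conjI allI impI)
    fix S T
    assume S: "S \<subseteq> symplectic_cores Z A H \<and> openin (jacobson_topology A (Prim A)) (\<Union>S)"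
      and T: "T \<subseteq> symplectic_cores Z A H \<and> openin (jacobson_topology A (Prim A)) (\<Union>T)"
    show "S \<inter> T \<subseteq> symplectic_cores Z A H" using S by blast
    have disj: "C = D" if CS: "C \<in> S" and DT: "D \<in> T" and p: "p \<in> C" "p \<in> D" for C D p
    proof -
      have "C \<in> symplectic_cores Z A H" "D \<in> symplectic_cores Z A H"
        using CS DT S T by auto
      then have "C = D \<or> C \<inter> D = {}"
        unfolding symplectic_cores_def by (rule quotient_disj[OF equiv_symplectic_cores])
      then show ?thesis using p by auto
    qed
    have "\<Union>(S \<inter> T) = \<Union>S \<inter> \<Union>T"
    proof (intro subset_antisym subsetI)
      fix p assume "p \<in> \<Union>S \<inter> \<Union>T"
      then obtain C D where CD: "C \<in> S" "D \<in> T" "p \<in> C" "p \<in> D" by auto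
      then have "C \<in> S \<inter> T" using disj[OF CD] by simp
      then show "p \<in> \<Union>(S \<inter> T)" using CD(3) by auto
    qed auto
    then show "openin (jacobson_topology A (Prim A)) (\<Union>(S \<inter> T))"
      using S T by (simp add: openin_Int)
  next
    fix \<K> assume K: "\<forall>K\<in>\<K>. K \<subseteq> symplectic_cores Z A H \<and>
      openin (jacobson_topology A (Prim A)) (\<Union>K)"
    then show "\<Union>\<K> \<subseteq> symplectic_cores Z A H" by blast
    have "\<Union>(\<Union>\<K>) = (\<Union>K\<in>\<K>. \<Union>K)" by blast
    moreover have "openin (jacobson_topology A (Prim A)) (\<Union>K\<in>\<K>. \<Union>K)"
      by (rule openin_Union) (use K in auto)
    ultimately show "openin (jacobson_topology A (Prim A)) (\<Union>(\<Union>\<K>))" by simp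
  qed
  then show ?thesis by (simp add: core_space_def)
qed

lemma poisson_ideal_sum:
  assumes HO: "hamiltonian_order Z pb A H"
    and J: "poisson_ideal Z A H J" and K: "poisson_ideal Z A H K"
  shows "poisson_ideal Z A H (J <+>\<^bsub>A\<^esub> K)"
proof -
  interpret RA: ring A using HO by (simp add: hamiltonian_order_def)
  have id: "ideal J A" "ideal K A" using J K by (simp_all add: poisson_ideal_def)
  have "H x u \<in> J <+>\<^bsub>A\<^esub> K" if x: "x \<in> carrier Z" and u: "u \<in> J <+>\<^bsub>A\<^esub> K" for x u
  proof -
    obtain a b where ab: "a \<in> J" "b \<in> K" "u = a \<oplus>\<^bsub>A\<^esub> b"
      using u by (auto simp: set_add_def set_mult_def)
    have car: "a \<in> carrier A" "b \<in> carrier A"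
      using ideal.Icarr[OF id(1) ab(1)] ideal.Icarr[OF id(2) ab(2)] by auto
    have "H x a \<in> J" "H x b \<in> K" using J K x ab by (simp_all add: poisson_ideal_def)
    moreover have "H x u = H x a \<oplus>\<^bsub>A\<^esub> H x b"
      using hamiltonian_order.H_add_right[OF HO x car] ab(3) by simp
    ultimately show ?thesis by (auto simp: set_add_def set_mult_def)
  qed
  then show ?thesis using RA.add_ideals[OF id] by (simp add: poisson_ideal_def)
qed

lemma poisson_ideal_zero:
  assumes HO: "hamiltonian_order Z pb A H"
  shows "poisson_ideal Z A H {\<zero>\<^bsub>A\<^esub>}"
proof -
  interpret RA: ring A using HO by (simp add: hamiltonian_order_def)
  have "H x \<zero>\<^bsub>A\<^esub> = \<zero>\<^bsub>A\<^esub>" if x: "x \<in> carrier Z" for x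
  proof -
    have cl: "H x \<zero>\<^bsub>A\<^esub> \<in> carrier A"
      using hamiltonian_order.H_closed[OF HO x] by simp
    have "H x \<zero>\<^bsub>A\<^esub> = H x \<zero>\<^bsub>A\<^esub> \<oplus>\<^bsub>A\<^esub> H x \<zero>\<^bsub>A\<^esub>"
      using hamiltonian_order.H_add_right[OF HO x, of "\<zero>\<^bsub>A\<^esub>" "\<zero>\<^bsub>A\<^esub>"] by simp
    then show ?thesis using RA.add.r_cancel_one'[OF cl cl] by simp
  qed
  then show ?thesis using RA.zeroideal by (simp add: poisson_ideal_def)
qed

lemma poisson_core_greatest:
  assumes HO: "hamiltonian_order Z pb A H" and I: "ideal I A"
  shows "poisson_ideal Z A H (poisson_core Z A H I)" and "poisson_core Z A H I \<subseteq> I"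
    and "\<And>J. \<lbrakk>poisson_ideal Z A H J; J \<subseteq> I\<rbrakk> \<Longrightarrow> J \<subseteq> poisson_core Z A H I"
proof -
  interpret RA: ring A using HO by (simp add: hamiltonian_order_def)
  define P where "P = poisson_ideal Z A H"
  have P: "ideal J A" "\<And>x a. \<lbrakk>x \<in> carrier Z; a \<in> J\<rbrakk> \<Longrightarrow> H x a \<in> J" if "P J" for J
    using that by (simp_all add: P_def poisson_ideal_def)
  define U where "U = {a. \<exists>J. P J \<and> J \<subseteq> I \<and> a \<in> J}"
  have U_I: "U \<subseteq> I" by (auto simp: U_def)
  have U_ub: "J \<subseteq> U" if "P J" "J \<subseteq> I" for J using that by (auto simp: U_def)
  have UE: "\<exists>J. P J \<and> J \<subseteq> I \<and> a \<in> J" if "a \<in> U" for a using that by (simp add: U_def)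
  have "ideal U A"
  proof (rule idealI)
    show "ring A" by (rule RA.ring_axioms)
    show "subgroup U (add_monoid A)"
    proof (rule RA.add.subgroupI)
      show "U \<subseteq> carrier A" using U_I ideal.Icarr[OF I] by auto
      have "\<zero>\<^bsub>A\<^esub> \<in> I"
        by (rule additive_subgroup.zero_closed[OF ideal.axioms(1)[OF I]])
      then have "{\<zero>\<^bsub>A\<^esub>} \<subseteq> U"
        using U_ub[of "{\<zero>\<^bsub>A\<^esub>}"] poisson_ideal_zero[OF HO] by (simp add: P_def)
      then show "U \<noteq> {}" by auto
      show "\<ominus>\<^bsub>A\<^esub> a \<in> U" if a: "a \<in> U" for a
      proof -
        obtain J where J: "P J" "J \<subseteq> I" "a \<in> J" using UE[OF a] by auto
        have "\<ominus>\<^bsub>A\<^esub> a \<in> J"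
          by (rule additive_subgroup.a_inv_closed[OF ideal.axioms(1)[OF P(1)[OF J(1)]] J(3)])
        then show ?thesis using U_ub[OF J(1,2)] by auto
      qed
      show "a \<oplus>\<^bsub>A\<^esub> b \<in> U" if a: "a \<in> U" and b: "b \<in> U" for a b
      proof -
        obtain J where J: "P J" "J \<subseteq> I" "a \<in> J" using UE[OF a] by auto
        obtain K where K: "P K" "K \<subseteq> I" "b \<in> K" using UE[OF b] by auto
        have "P (J <+>\<^bsub>A\<^esub> K)"
          using poisson_ideal_sum[OF HO] J(1) K(1) by (simp add: P_def)
        moreover have "J <+>\<^bsub>A\<^esub> K \<subseteq> I"
        proof
          fix u assume "u \<in> J <+>\<^bsub>A\<^esub> K"
          then obtain c d where cd: "c \<in> J" "d \<in> K" "u = c \<oplus>\<^bsub>A\<^esub> d"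
            by (auto simp: set_add_def set_mult_def)
          then have "c \<in> I" "d \<in> I" using J(2) K(2) by auto
          then show "u \<in> I"
            unfolding cd(3) by (rule additive_subgroup.a_closed[OF ideal.axioms(1)[OF I]])
        qed
        moreover have "a \<oplus>\<^bsub>A\<^esub> b \<in> J <+>\<^bsub>A\<^esub> K"
          using J(3) K(3) by (auto simp: set_add_def set_mult_def)
        ultimately show ?thesis using U_ub by (meson subsetD)
      qed
    qed
    fix a x assume a: "a \<in> U" and x: "x \<in> carrier A"
    obtain J where J: "P J" "J \<subseteq> I" "a \<in> J" using UE[OF a] by auto
    show "x \<otimes>\<^bsub>A\<^esub> a \<in> U" "a \<otimes>\<^bsub>A\<^esub> x \<in> U"
      using ideal.I_l_closed[OF P(1)[OF J(1)] J(3) x] ideal.I_r_closed[OF P(1)[OF J(1)] J(3) x]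
        U_ub[OF J(1,2)] by auto
  qed
  moreover have "H x a \<in> U" if x: "x \<in> carrier Z" and a: "a \<in> U" for x a
  proof -
    obtain J where J: "P J" "J \<subseteq> I" "a \<in> J" using UE[OF a] by auto
    show ?thesis using P(2)[OF J(1) x J(3)] U_ub[OF J(1,2)] by auto
  qed
  ultimately have PU: "P U" by (simp add: P_def poisson_ideal_def)
  have "poisson_core Z A H I = U"
    unfolding poisson_core_def P_def[symmetric] using PU U_I U_ub by (intro Greatest_equality) auto
  then show "poisson_ideal Z A H (poisson_core Z A H I)" "poisson_core Z A H I \<subseteq> I"
    "\<And>J. \<lbrakk>poisson_ideal Z A H J; J \<subseteq> I\<rbrakk> \<Longrightarrow> J \<subseteq> poisson_core Z A H I"
    using PU U_I U_ub by (simp_all add: P_def)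
qed

end

theory Submission
  imports Defs
begin

text \<open>It suffices to show that the Poisson core of every primitive ideal is the annihilator of a
  simple Poisson module, and that the annihilator \<open>P\<close> of a simple Poisson module is the intersection
  of the primitive ideals with Poisson core \<open>P\<close>: these ideals then form the symplectic core that is
  dense in the variety of \<open>P\<close>, and the topologies correspond because an intersection of Poisson ideals
  is a Poisson ideal.

  For the first claim, let \<open>I\<close> be the annihilator of a simple module \<open>V\<close>. The additive maps from \<open>A\<close>
  to \<open>V\<close> form a Poisson module that contains a copy of \<open>V\<close>, and a simple Poisson subquotient that
  detects a vector of \<open>V\<close> has annihilator the Poisson core of \<open>I\<close>.

  For the second claim, \<open>P\<close> is prime, because a maximal annihilator ideal is prime, and minimal primes
  over a stable ideal are stable under derivations. Let \<open>K\<close> be the image of \<open>Z\<close> in \<open>A\<close>. As \<open>M\<close> has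
  countable dimension, an element of the fraction field of \<open>K/(K \<inter> P)\<close> that is killed by all
  Hamiltonian derivations acts on \<open>M\<close> as a scalar (Dixmier's argument with resolvents). Hence elements
  of \<open>K\<close> that are linearly independent modulo \<open>P\<close> have a generalised Wronskian outside \<open>P\<close>. Countably
  many such Wronskians exhaust \<open>K\<close>; a prime \<open>I\<close> containing \<open>P\<close> that avoids all of them contains no
  stable ideal larger than \<open>P\<close>, since every ideal larger than \<open>P\<close> meets \<open>K\<close> outside \<open>P\<close>. An ideal
  maximal among those that avoid a countable multiplicative set is primitive, again by the resolvent
  argument.\<close>

section \<open>Complex vector spaces of countable dimension\<close>

text \<open>Neither the quotient by \<open>P\<close> nor any localisation is formed. The quotient is
  replaced by congruence modulo \<open>P\<close>, and a fraction by a numerator together with a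
  denominator in \<open>K\<close> outside \<open>P\<close>; such denominators cancel modulo
  \<open>P\<close> because they are central and \<open>P\<close> is prime. The obstacle is to bound
  from above the Poisson core of a primitive ideal \<open>I\<close> that contains \<open>P\<close>.
  If a stable ideal between \<open>P\<close> and \<open>I\<close> contained a central
  \<open>z\<close> outside \<open>P\<close>, all iterated derivatives of \<open>z\<close> would lie
  in \<open>I\<close>. Writing \<open>z\<close> modulo \<open>P\<close> as a complex combination of
  independent elements turns this into a linear system modulo \<open>I\<close> with constant
  unknowns, and a Wronskian outside \<open>I\<close> forces these constants to vanish. Countably
  many Wronskians suffice because \<open>K\<close> has countable dimension, and countability also
  makes an ideal avoiding them primitive: resolvents at all complex numbers are too many for a space
  of countable dimension. A subquotient of the module of additive maps is taken because that module
  need not have a simple submodule. The Jacobi identity of the extended bracket enters as the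
  flatness of the connection on those maps.\<close>

locale complex_scalars = ring A for A (structure) +
  fixes sc :: "complex \<Rightarrow> 'a"
  assumes sc_closed [simp, intro]: "sc c \<in> carrier A"
    and sc_add: "sc (c + d) = sc c \<oplus> sc d"
    and sc_mult: "sc (c * d) = sc c \<otimes> sc d"
    and sc_one: "sc 1 = \<one>"
    and sc_central: "a \<in> carrier A \<Longrightarrow> a \<otimes> sc c = sc c \<otimes> a"
begin

lemma sc_zero: "sc 0 = \<zero>"
  using sc_add[of 0 0] by (metis add.l_cancel_one' add_0 sc_closed)

lemma sc_uminus: "sc (- c) = \<ominus> sc c"
  using sc_add[of "- c" c] sc_zero minus_equality by auto

end

locale complex_module = complex_scalars A sc + left_module A M
  for A :: "('a, 'b) ring_scheme" and M :: "('a, 'm) module" and sc :: "complex \<Rightarrow> 'a"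
begin

abbreviation csc :: "complex \<Rightarrow> 'm \<Rightarrow> 'm"
  where "csc c v \<equiv> sc c \<odot>\<^bsub>M\<^esub> v"

lemma csc_closed [simp, intro]: "v \<in> carrier M \<Longrightarrow> csc c v \<in> carrier M"
  by (simp add: act_closed)

lemma csc_scalar:
  assumes v: "v \<in> carrier M"
  shows "csc (c + d) v = csc c v \<oplus>\<^bsub>M\<^esub> csc d v" "csc (c * d) v = csc c (csc d v)"
    "csc 1 v = v" "csc 0 v = \<zero>\<^bsub>M\<^esub>" "csc (- c) v = \<ominus>\<^bsub>M\<^esub> csc c v"
proof -
  show 1: "csc (c + d) v = csc c v \<oplus>\<^bsub>M\<^esub> csc d v" for c d
    using v by (simp add: sc_add act_add_left)
  show "csc (c * d) v = csc c (csc d v)" "csc 1 v = v" and 2: "csc 0 v = \<zero>\<^bsub>M\<^esub>"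
    using v by (simp_all add: sc_mult act_mult sc_one act_one sc_zero act_zero_left)
  have "csc (- c) v \<oplus>\<^bsub>M\<^esub> csc c v = \<zero>\<^bsub>M\<^esub>" using 1[of "-c" c] 2 by simp
  then show "csc (- c) v = \<ominus>\<^bsub>M\<^esub> csc c v" using v LM.minus_equality by auto
qed

lemma csc_zero: "csc c \<zero>\<^bsub>M\<^esub> = \<zero>\<^bsub>M\<^esub>"
  by (simp add: act_zero_right)

lemma csc_add:
  "\<lbrakk>v \<in> carrier M; w \<in> carrier M\<rbrakk> \<Longrightarrow> csc c (v \<oplus>\<^bsub>M\<^esub> w) = csc c v \<oplus>\<^bsub>M\<^esub> csc c w"
  by (simp add: act_add_right)

lemma csc_uminus: "v \<in> carrier M \<Longrightarrow> csc c (\<ominus>\<^bsub>M\<^esub> v) = \<ominus>\<^bsub>M\<^esub> csc c v"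
  using act_minus_right[of "sc c" "\<zero>\<^bsub>M\<^esub>" v] by (simp add: LM.minus_eq csc_zero)

lemmas csc_simps = csc_scalar csc_zero csc_add csc_uminus

text \<open>Countable dimension is encoded by a sequence that may repeat or be dependent, so no
  basis is chosen. The spans of its initial segments form a countable cover, which pigeonholes an
  uncountable family into one finite-dimensional space.\<close>

primrec initial_span :: "(nat \<Rightarrow> 'm) \<Rightarrow> nat \<Rightarrow> 'm set"
  where "initial_span e 0 = {\<zero>\<^bsub>M\<^esub>}"
  | "initial_span e (Suc n) = {v \<oplus>\<^bsub>M\<^esub> csc c (e n) | v c. v \<in> initial_span e n}"

definition countable_dim :: bool
  where "countable_dim \<longleftrightarrow>
    (\<exists>e. range e \<subseteq> carrier M \<and> carrier M \<subseteq> (\<Union>n. initial_span e n))"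

lemma initial_span_closed:
  assumes "range e \<subseteq> carrier M"
  shows "initial_span e n \<subseteq> carrier M"
proof (induction n)
  case (Suc n)
  have "e n \<in> carrier M" using assms by auto
  then show ?case using Suc by auto
qed simp

lemma initial_span_lin:
  assumes e: "range e \<subseteq> carrier M" and "v \<in> initial_span e n" "w \<in> initial_span e n"
  shows "v \<oplus>\<^bsub>M\<^esub> csc c w \<in> initial_span e n"
  using assms(2,3)
proof (induction n arbitrary: v w)
  case 0
  then show ?case by (simp add: csc_simps)
next
  case (Suc n)
  obtain v' s w' t where *: "v' \<in> initial_span e n" "v = v' \<oplus>\<^bsub>M\<^esub> csc s (e n)"
    "w' \<in> initial_span e n" "w = w' \<oplus>\<^bsub>M\<^esub> csc t (e n)"
    using Suc.prems by auto
  have car: "v' \<in> carrier M" "w' \<in> carrier M" "e n \<in> carrier M"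
    using * initial_span_closed[OF e] e by auto
  have "v \<oplus>\<^bsub>M\<^esub> csc c w = (v' \<oplus>\<^bsub>M\<^esub> csc c w') \<oplus>\<^bsub>M\<^esub> csc (s + c * t) (e n)"
    using car by (simp add: * csc_simps LM.a_ac)
  then show ?case using Suc.IH[OF *(1,3)] by auto
qed

text \<open>Induction on \<open>n\<close>, eliminating the last generator with a pivot
  \<open>k\<close>. The family is indexed rather than a set of vectors, so equal vectors at two
  indices also give a relation.\<close>

lemma finite_dependent:
  assumes e: "range e \<subseteq> carrier M" and "infinite \<Lambda>" "\<And>l. l \<in> \<Lambda> \<Longrightarrow> y l \<in> initial_span e n"
  shows "\<exists>F c. finite F \<and> F \<subseteq> \<Lambda> \<and> (\<exists>l\<in>F. c l \<noteq> 0) \<and> (\<Oplus>\<^bsub>M\<^esub>l\<in>F. csc (c l) (y l)) = \<zero>\<^bsub>M\<^esub>"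
  using assms(2,3)
proof (induction n arbitrary: y \<Lambda>)
  case 0
  then obtain l where l: "l \<in> \<Lambda>" by (metis ex_in_conv finite.emptyI)
  then have "y l = \<zero>\<^bsub>M\<^esub>" using 0(2) by auto
  then have "(\<Oplus>\<^bsub>M\<^esub>k\<in>{l}. csc ((\<lambda>_. 1) k) (y k)) = \<zero>\<^bsub>M\<^esub>"
    by (simp add: csc_simps LM.finsum_insert)
  then show ?case using l by (intro exI[of _ "{l}"] exI[of _ "\<lambda>_. 1"]) auto
next
  case (Suc n)
  have y_car: "y l \<in> carrier M" if "l \<in> \<Lambda>" for l
    using Suc.prems(2)[OF that] initial_span_closed[OF e] by blast
  have "\<forall>l\<in>\<Lambda>. \<exists>t v. v \<in> initial_span e n \<and> y l = v \<oplus>\<^bsub>M\<^esub> csc t (e n)"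
    using Suc.prems(2) by auto
  then obtain t v where tv: "\<And>l. l \<in> \<Lambda> \<Longrightarrow> v l \<in> initial_span e n"
    "\<And>l. l \<in> \<Lambda> \<Longrightarrow> y l = v l \<oplus>\<^bsub>M\<^esub> csc (t l) (e n)" by metis
  have en: "e n \<in> carrier M" using e by auto
  have v_car: "v l \<in> carrier M" if "l \<in> \<Lambda>" for l
    using tv(1)[OF that] initial_span_closed[OF e] by blast
  show ?case
  proof (cases "\<forall>l\<in>\<Lambda>. t l = 0")
    case True
    then have "y l = v l" if "l \<in> \<Lambda>" for l using tv(2) v_car en that by (simp add: csc_simps)
    then show ?thesis using Suc.IH[of \<Lambda> y] Suc.prems(1) tv(1) by auto
  next
    case False
    then obtain k where k: "k \<in> \<Lambda>" "t k \<noteq> 0" by auto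
    \<comment> \<open>Subtracting \<open>r l\<close> times \<open>y k\<close> removes the component
      along \<open>e n\<close>, so the \<open>u l\<close> with \<open>l\<close> different from
      \<open>k\<close> fall under the induction hypothesis.\<close>
    define r where "r l = t l / t k" for l
    define u where "u l = y l \<oplus>\<^bsub>M\<^esub> csc (- r l) (y k)" for l
    have u_span: "u l \<in> initial_span e n" if l: "l \<in> \<Lambda>" for l
    proof -
      have "u l = (v l \<oplus>\<^bsub>M\<^esub> csc (- r l) (v k)) \<oplus>\<^bsub>M\<^esub> csc (t l + - r l * t k) (e n)"
        unfolding u_def tv(2)[OF l] tv(2)[OF k(1)] csc_scalar(1,2)[OF en]
          csc_add[OF v_car[OF k(1)] csc_closed[OF en]]
        using v_car[OF l] v_car[OF k(1)] en by (simp add: LM.a_ac)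
      also have "csc (t l + - r l * t k) (e n) = \<zero>\<^bsub>M\<^esub>"
        using k en by (simp add: r_def csc_scalar(4))
      finally have "u l = v l \<oplus>\<^bsub>M\<^esub> csc (- r l) (v k)"
        using v_car[OF l] v_car[OF k(1)] by simp
      then show ?thesis
        using initial_span_lin[OF e tv(1)[OF l] tv(1)[OF k(1)], of "- r l"] by simp
    qed
    obtain F c where F: "finite F" "F \<subseteq> \<Lambda> - {k}" "\<exists>l\<in>F. c l \<noteq> 0"
      "(\<Oplus>\<^bsub>M\<^esub>l\<in>F. csc (c l) (u l)) = \<zero>\<^bsub>M\<^esub>"
      using Suc.IH[of "\<Lambda> - {k}" u] Suc.prems(1) u_span by auto
    have ycF: "y l \<in> carrier M" if "l \<in> F" for l using that F y_car by auto
    note yk = y_car[OF k(1)]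
    \<comment> \<open>The coefficient at \<open>k\<close> absorbs the multiples of
      \<open>y k\<close> that are hidden in the \<open>u l\<close>.\<close>
    define d where "d = (\<lambda>l. if l = k then - (\<Sum>l\<in>F. c l * r l) else c l)"
    have sum: "(\<Oplus>\<^bsub>M\<^esub>l\<in>G. csc (c l) (u l)) =
      (\<Oplus>\<^bsub>M\<^esub>l\<in>G. csc (c l) (y l)) \<oplus>\<^bsub>M\<^esub> csc (- (\<Sum>l\<in>G. c l * r l)) (y k)" if "finite G" "G \<subseteq> F" for G
      using that
    proof (induction G rule: finite_induct)
      case empty
      then show ?case using yk by (simp add: csc_simps)
    next
      case (insert g G)
      have cy: "(\<lambda>l. csc (c l) (y l)) \<in> G \<rightarrow> carrier M" "(\<lambda>l. csc (c l) (u l)) \<in> G \<rightarrow> carrier M"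
        "y g \<in> carrier M"
        using insert.prems ycF yk by (auto simp: u_def)
      have ug: "csc (c g) (u g) = csc (c g) (y g) \<oplus>\<^bsub>M\<^esub> csc (- (c g * r g)) (y k)"
        using cy yk by (simp add: u_def csc_simps)
      have "csc (- (\<Sum>l\<in>insert g G. c l * r l)) (y k) =
        csc (- (c g * r g)) (y k) \<oplus>\<^bsub>M\<^esub> csc (- (\<Sum>l\<in>G. c l * r l)) (y k)"
        using insert.hyps yk by (subst csc_scalar(1)[symmetric]) auto
      then show ?case
        using insert cy yk ug by (simp add: LM.finsum_insert u_def LM.a_ac)
    qed
    have "(\<Oplus>\<^bsub>M\<^esub>l\<in>insert k F. csc (d l) (y l)) =
      csc (d k) (y k) \<oplus>\<^bsub>M\<^esub> (\<Oplus>\<^bsub>M\<^esub>l\<in>F. csc (d l) (y l))"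
      using F ycF yk by (intro LM.finsum_insert) auto
    also have "(\<Oplus>\<^bsub>M\<^esub>l\<in>F. csc (d l) (y l)) = (\<Oplus>\<^bsub>M\<^esub>l\<in>F. csc (c l) (y l))"
      using F(2) ycF by (intro LM.finsum_cong') (auto simp: d_def)
    also have "csc (d k) (y k) \<oplus>\<^bsub>M\<^esub> (\<Oplus>\<^bsub>M\<^esub>l\<in>F. csc (c l) (y l)) = \<zero>\<^bsub>M\<^esub>"
      using sum[OF F(1)] F(4) ycF yk by (simp add: d_def LM.a_comm LM.finsum_closed)
    finally have z: "(\<Oplus>\<^bsub>M\<^esub>l\<in>insert k F. csc (d l) (y l)) = \<zero>\<^bsub>M\<^esub>" .
    have "\<exists>l\<in>insert k F. d l \<noteq> 0" using F(2,3) by (auto simp: d_def)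
    then show ?thesis using F(1,2) k(1) z by (intro exI[of _ "insert k F"] exI[of _ d]) auto
  qed
qed

section \<open>Polynomials and resolvents of a linear operator on a space of countable
  dimension\<close>

primrec horner_eval :: "('m \<Rightarrow> 'm) \<Rightarrow> 'm \<Rightarrow> complex list \<Rightarrow> 'm"
  where "horner_eval f w [] = \<zero>\<^bsub>M\<^esub>"
  | "horner_eval f w (a # as) = csc a w \<oplus>\<^bsub>M\<^esub> f (horner_eval f w as)"

text \<open>\<open>f\<close> is only a map on the carrier and not a ring element, so
  \<open>p(f) w\<close> is computed by Horner's scheme on the coefficient list; this makes
  \<open>pCons\<close> the recursion step.\<close>

definition poly_act :: "('m \<Rightarrow> 'm) \<Rightarrow> 'm \<Rightarrow> complex poly \<Rightarrow> 'm"
  where "poly_act f w p = horner_eval f w (coeffs p)"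

text \<open>A polynomial relation \<open>p(f) w = 0\<close> modulo \<open>U\<close> is impossible because \<open>p\<close> splits, and applying
  \<open>f - \<lambda>\<close> to a relation between the resolvents \<open>(f - \<lambda>)\<^sup>-\<^sup>1 w\<close> shortens it.\<close>

context
  fixes f :: "'m \<Rightarrow> 'm" and w :: 'm and U :: "'m set"
  assumes f_closed: "\<And>v. v \<in> carrier M \<Longrightarrow> f v \<in> carrier M"
    and f_add: "\<And>u v. \<lbrakk>u \<in> carrier M; v \<in> carrier M\<rbrakk> \<Longrightarrow> f (u \<oplus>\<^bsub>M\<^esub> v) = f u \<oplus>\<^bsub>M\<^esub> f v"
    and f_csc: "\<And>c v. v \<in> carrier M \<Longrightarrow> f (csc c v) = csc c (f v)"
    and U_sub: "U \<subseteq> carrier M" "\<zero>\<^bsub>M\<^esub> \<in> U"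
    and U_add: "\<And>u v. \<lbrakk>u \<in> U; v \<in> U\<rbrakk> \<Longrightarrow> u \<oplus>\<^bsub>M\<^esub> v \<in> U"
    and U_csc: "\<And>c u. u \<in> U \<Longrightarrow> csc c u \<in> U"
    and U_f: "\<And>u. u \<in> U \<Longrightarrow> f u \<in> U"
    and f_inj: "\<And>c v. \<lbrakk>v \<in> carrier M; f v \<oplus>\<^bsub>M\<^esub> csc (- c) v \<in> U\<rbrakk> \<Longrightarrow> v \<in> U"
    and w: "w \<in> carrier M" "w \<notin> U"
begin

private definition shift :: "complex \<Rightarrow> 'm \<Rightarrow> 'm"
  where "shift c v = f v \<oplus>\<^bsub>M\<^esub> csc (- c) v"

private lemma f_zero: "f \<zero>\<^bsub>M\<^esub> = \<zero>\<^bsub>M\<^esub>"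
  using f_csc[of "\<zero>\<^bsub>M\<^esub>" 0] f_closed[of "\<zero>\<^bsub>M\<^esub>"] by (simp add: csc_simps)

private lemma shift_closed: "v \<in> carrier M \<Longrightarrow> shift c v \<in> carrier M"
  by (simp add: shift_def f_closed)

private lemma shift_add:
  "\<lbrakk>u \<in> carrier M; v \<in> carrier M\<rbrakk> \<Longrightarrow> shift c (u \<oplus>\<^bsub>M\<^esub> v) = shift c u \<oplus>\<^bsub>M\<^esub> shift c v"
  by (simp add: shift_def f_closed f_add csc_simps LM.a_ac)

private lemma shift_csc: "v \<in> carrier M \<Longrightarrow> shift c (csc d v) = csc d (shift c v)"
  using csc_scalar(2)[of v d "-c"] csc_scalar(2)[of v "-c" d]
  by (simp add: shift_def f_closed f_csc csc_add mult.commute)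

private lemma shift_shift: "v \<in> carrier M \<Longrightarrow> shift c v = shift d v \<oplus>\<^bsub>M\<^esub> csc (d - c) v"
  using csc_scalar(1)[of v "-d" "d - c"]
  by (simp add: shift_def f_closed LM.a_assoc)

private lemma U_diff: "\<lbrakk>u \<in> U; v \<in> U\<rbrakk> \<Longrightarrow> u \<ominus>\<^bsub>M\<^esub> v \<in> U"
  using U_add[OF _ U_csc[of v "-1"]] U_sub
  by (auto simp: csc_simps LM.minus_eq subset_iff)

private lemma U_shift: "u \<in> U \<Longrightarrow> shift c u \<in> U"
  by (simp add: shift_def U_add U_f U_csc)

private lemma poly_act_pCons: "poly_act f w (pCons a p) = csc a w \<oplus>\<^bsub>M\<^esub> f (poly_act f w p)"
  using w by (auto simp: poly_act_def cCons_def csc_simps f_zero)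

private lemma poly_act_zero: "poly_act f w 0 = \<zero>\<^bsub>M\<^esub>"
  by (simp add: poly_act_def)

private lemma poly_act_closed: "poly_act f w p \<in> carrier M"
  using w by (induction p rule: pCons_induct) (simp_all add: poly_act_zero poly_act_pCons f_closed)

private lemma poly_act_add: "poly_act f w (p + q) = poly_act f w p \<oplus>\<^bsub>M\<^esub> poly_act f w q"
proof (induction p arbitrary: q rule: pCons_induct)
  case 0
  then show ?case by (simp add: poly_act_zero poly_act_closed)
next
  case (pCons a p)
  obtain b r where q: "q = pCons b r" by (cases q)
  show ?case
    using w by (simp add: q poly_act_pCons pCons.IH poly_act_closed f_add f_closed csc_simps LM.a_ac)
qed

private lemma poly_act_smult: "poly_act f w (Polynomial.smult c p) = csc c (poly_act f w p)"
  using w by (induction p rule: pCons_induct)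
    (simp_all add: poly_act_zero poly_act_pCons poly_act_closed f_csc f_closed csc_simps)

private lemma poly_act_root: "poly_act f w ([:- c, 1:] * p) = shift c (poly_act f w p)"
  using w by (simp add: mult_pCons_left poly_act_add poly_act_smult poly_act_pCons shift_def
      poly_act_closed f_closed csc_simps LM.a_comm del: smult_minus_left)

text \<open>A nonconstant complex polynomial has a factor \<open>X - c\<close>, and
  \<open>f - c\<close> carries no vector outside \<open>U\<close> into \<open>U\<close>; so the
  factors can be removed one at a time down to a nonzero constant.\<close>

private lemma poly_act_notin: "p \<noteq> 0 \<Longrightarrow> poly_act f w p \<notin> U"
proof (induction "Polynomial.degree p" arbitrary: p rule: less_induct)
  case less
  show ?case
  proof (cases "Polynomial.degree p = 0")
    case True
    then obtain a where a: "p = [:a:]" "a \<noteq> 0" using less.prems by (metis degree_eq_zeroE pCons_0_0)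
    have "w = csc (1 / a) (csc a w)" using w a csc_scalar(2)[of w "1 / a" a] by (simp add: csc_simps)
    then show ?thesis
      using U_csc[of "csc a w" "1 / a"] w a by (auto simp: poly_act_pCons poly_act_zero f_zero)
  next
    case False
    then obtain c where "poly p c = 0"
      using fundamental_theorem_of_algebra[of p] by (metis constant_degree)
    then obtain q where q: "p = [:- c, 1:] * q" by (meson poly_eq_0_iff_dvd dvdE)
    then have "q \<noteq> 0" using less.prems by auto
    then have "Polynomial.degree q < Polynomial.degree p" unfolding q by (subst degree_mult_eq) auto
    then have "poly_act f w q \<notin> U" using less.hyps \<open>q \<noteq> 0\<close> by simp
    then show ?thesis
      using f_inj[of "poly_act f w q" c] poly_act_closed
      unfolding q poly_act_root shift_def by blast
  qed
qed

text \<open>The polynomial term is there for the induction: \<open>f - k\<close> maps a resolvent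
  \<open>y l\<close> to \<open>w\<close> plus a multiple of \<open>y l\<close> modulo
  \<open>U\<close>, and these copies of \<open>w\<close> have to be collected.\<close>

private lemma resolvents_independent:
  assumes "finite F" "\<And>l. l \<in> F \<Longrightarrow> y l \<in> carrier M \<and> shift l (y l) \<ominus>\<^bsub>M\<^esub> w \<in> U"
    and "poly_act f w p \<oplus>\<^bsub>M\<^esub> (\<Oplus>\<^bsub>M\<^esub>l\<in>F. csc (c l) (y l)) \<in> U"
  shows "\<forall>l\<in>F. c l = 0"
  using assms
proof (induction F arbitrary: p c rule: finite_induct)
  case (insert k F)
  have y: "y l \<in> carrier M" "shift l (y l) \<ominus>\<^bsub>M\<^esub> w \<in> U" if "l \<in> insert k F" for l
    using insert.prems(1) that by auto
  have fs: "(\<Oplus>\<^bsub>M\<^esub>l\<in>G. csc (d l) (y l)) \<in> carrier M" if "G \<subseteq> insert k F" for G d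
    using y(1) that by (intro LM.finsum_closed) auto
  note car = fs poly_act_closed y(1) w(1) shift_closed csc_closed
  have step: "shift k (\<Oplus>\<^bsub>M\<^esub>l\<in>G. csc (c l) (y l)) \<ominus>\<^bsub>M\<^esub>
      (csc (\<Sum>l\<in>G. c l) w \<oplus>\<^bsub>M\<^esub> (\<Oplus>\<^bsub>M\<^esub>l\<in>G. csc (c l * (l - k)) (y l))) \<in> U"
    if "finite G" "G \<subseteq> insert k F" for G
    using that
  proof (induction G rule: finite_induct)
    case empty
    have "shift k \<zero>\<^bsub>M\<^esub> = \<zero>\<^bsub>M\<^esub>" by (simp add: shift_def f_zero csc_simps)
    then have "shift k \<zero>\<^bsub>M\<^esub> \<ominus>\<^bsub>M\<^esub> (csc 0 w \<oplus>\<^bsub>M\<^esub> \<zero>\<^bsub>M\<^esub>) = \<zero>\<^bsub>M\<^esub>"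
      using w by (simp add: csc_simps LM.minus_eq)
    then show ?case using U_sub by simp
  next
    case (insert g G)
    then have g: "g \<in> insert k F" and G: "G \<subseteq> insert k F" by auto
    define S T R where "S = (\<Oplus>\<^bsub>M\<^esub>l\<in>G. csc (c l) (y l))"
      and "T = (\<Oplus>\<^bsub>M\<^esub>l\<in>G. csc (c l * (l - k)) (y l))" and "R = shift g (y g)"
    have STR: "S \<in> carrier M" "T \<in> carrier M" "R \<in> carrier M" "shift k S \<in> carrier M"
      using car G g by (auto simp: S_def T_def R_def)
    note yg = y(1)[OF g]
    have ins: "(\<Oplus>\<^bsub>M\<^esub>l\<in>insert g G. csc (c l) (y l)) = csc (c g) (y g) \<oplus>\<^bsub>M\<^esub> S"
      "(\<Oplus>\<^bsub>M\<^esub>l\<in>insert g G. csc (c l * (l - k)) (y l)) = csc (c g * (g - k)) (y g) \<oplus>\<^bsub>M\<^esub> T"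
      using insert.hyps G y(1) yg unfolding S_def T_def by (subst LM.finsum_insert; auto)+
    have "shift k (csc (c g) (y g)) = csc (c g) R \<oplus>\<^bsub>M\<^esub> csc (c g * (g - k)) (y g)"
      using yg STR by (simp add: shift_csc shift_shift[of "y g" k g] csc_simps R_def)
    then have "shift k (csc (c g) (y g) \<oplus>\<^bsub>M\<^esub> S) \<ominus>\<^bsub>M\<^esub>
        (csc (\<Sum>l\<in>insert g G. c l) w \<oplus>\<^bsub>M\<^esub> (csc (c g * (g - k)) (y g) \<oplus>\<^bsub>M\<^esub> T)) =
        csc (c g) (R \<ominus>\<^bsub>M\<^esub> w) \<oplus>\<^bsub>M\<^esub> (shift k S \<ominus>\<^bsub>M\<^esub> (csc (\<Sum>l\<in>G. c l) w \<oplus>\<^bsub>M\<^esub> T))"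
      using insert.hyps yg STR w
      by (simp add: shift_add csc_simps LM.minus_eq LM.minus_add LM.a_ac LM.r_neg LM.r_neg1 LM.r_neg2)
    moreover have "R \<ominus>\<^bsub>M\<^esub> w \<in> U" using y(2)[OF g] by (simp add: R_def)
    ultimately show ?case
      using insert.IH[OF G] unfolding ins S_def[symmetric] T_def[symmetric] by (simp add: U_add U_csc)
  qed
  have reduce: "poly_act f w ([:- k, 1:] * p + [:\<Sum>l\<in>G. c l:]) \<oplus>\<^bsub>M\<^esub>
      (\<Oplus>\<^bsub>M\<^esub>l\<in>G. csc (c l * (l - k)) (y l)) \<in> U"
    if G: "finite G" "G \<subseteq> insert k F" and U: "poly_act f w p \<oplus>\<^bsub>M\<^esub> (\<Oplus>\<^bsub>M\<^esub>l\<in>G. csc (c l) (y l)) \<in> U" for G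
  proof -
    define S T Q where "S = shift k (\<Oplus>\<^bsub>M\<^esub>l\<in>G. csc (c l) (y l))"
      and "T = (\<Oplus>\<^bsub>M\<^esub>l\<in>G. csc (c l * (l - k)) (y l))"
      and "Q = shift k (poly_act f w p)"
    define W where "W = csc (\<Sum>l\<in>G. c l) w"
    have STQ: "S \<in> carrier M" "T \<in> carrier M" "Q \<in> carrier M" "W \<in> carrier M"
      using car G by (auto simp: S_def T_def Q_def W_def)
    have "shift k (poly_act f w p \<oplus>\<^bsub>M\<^esub> (\<Oplus>\<^bsub>M\<^esub>l\<in>G. csc (c l) (y l))) = Q \<oplus>\<^bsub>M\<^esub> S"
      using fs[OF G(2)] poly_act_closed by (simp add: shift_add Q_def S_def)
    then have "(Q \<oplus>\<^bsub>M\<^esub> S) \<ominus>\<^bsub>M\<^esub> (S \<ominus>\<^bsub>M\<^esub> (W \<oplus>\<^bsub>M\<^esub> T)) \<in> U"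
      using U_diff[OF U_shift[OF U, of k] step[OF G]] by (simp add: S_def T_def W_def)
    moreover have "(Q \<oplus>\<^bsub>M\<^esub> S) \<ominus>\<^bsub>M\<^esub> (S \<ominus>\<^bsub>M\<^esub> (W \<oplus>\<^bsub>M\<^esub> T)) = (Q \<oplus>\<^bsub>M\<^esub> W) \<oplus>\<^bsub>M\<^esub> T"
      using STQ by (simp add: LM.minus_eq LM.minus_add LM.a_ac LM.r_neg LM.r_neg1 LM.r_neg2)
    moreover have "poly_act f w ([:- k, 1:] * p + [:\<Sum>l\<in>G. c l:]) = Q \<oplus>\<^bsub>M\<^esub> W"
      using w by (simp only: poly_act_add poly_act_root poly_act_pCons poly_act_zero f_zero Q_def W_def)
        simp
    ultimately show ?thesis by (simp add: T_def)
  qed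
  \<comment> \<open>The factor \<open>k - k\<close> deletes the index \<open>k\<close>, so the
    induction hypothesis applies to the remaining indices; as these differ from \<open>k\<close>, it
    gives back \<open>c l = 0\<close>.\<close>
  have "(\<Oplus>\<^bsub>M\<^esub>l\<in>insert k F. csc (c l * (l - k)) (y l)) =
      csc (c k * (k - k)) (y k) \<oplus>\<^bsub>M\<^esub> (\<Oplus>\<^bsub>M\<^esub>l\<in>F. csc (c l * (l - k)) (y l))"
    using insert.hyps y(1) by (intro LM.finsum_insert) auto
  also have "\<dots> = (\<Oplus>\<^bsub>M\<^esub>l\<in>F. csc (c l * (l - k)) (y l))"
    using fs[of F] y(1)[of k] by (simp add: csc_simps subset_insertI)
  finally have "\<forall>l\<in>F. c l * (l - k) = 0"
    using insert.IH[of _ "\<lambda>l. c l * (l - k)"] insert.prems(1)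
      reduce[OF finite.insertI[OF insert.hyps(1)] order_refl insert.prems(2)] by auto
  then have F0: "\<forall>l\<in>F. c l = 0" using insert.hyps(2) by auto
  have "(\<Oplus>\<^bsub>M\<^esub>l\<in>F. csc (c l) (y l)) = (\<Oplus>\<^bsub>M\<^esub>l\<in>F. \<zero>\<^bsub>M\<^esub>)"
    using F0 y(1) by (intro LM.finsum_cong') (auto simp: csc_simps)
  moreover have "(\<Oplus>\<^bsub>M\<^esub>l\<in>insert k F. csc (c l) (y l)) = csc (c k) (y k) \<oplus>\<^bsub>M\<^esub> (\<Oplus>\<^bsub>M\<^esub>l\<in>F. csc (c l) (y l))"
    using insert.hyps y(1) by (intro LM.finsum_insert) auto
  moreover have "(\<Oplus>\<^bsub>M\<^esub>l\<in>{k}. csc (c l) (y l)) = csc (c k) (y k)"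
    using y(1) by (subst LM.finsum_insert) auto
  ultimately have "(\<Oplus>\<^bsub>M\<^esub>l\<in>insert k F. csc (c l) (y l)) = (\<Oplus>\<^bsub>M\<^esub>l\<in>{k}. csc (c l) (y l))"
    using y(1)[of k] by simp
  \<comment> \<open>What remains is a polynomial in \<open>f\<close> that sends \<open>w\<close>
    into \<open>U\<close>, hence the zero polynomial; its value at \<open>k\<close> is
    \<open>c k\<close>.\<close>
  then have "poly_act f w ([:- k, 1:] * p + [:c k:]) \<oplus>\<^bsub>M\<^esub>
      (\<Oplus>\<^bsub>M\<^esub>l\<in>{k}. csc (c l * (l - k)) (y l)) \<in> U"
    using reduce[of "{k}"] insert.prems(2) by simp
  moreover have "(\<Oplus>\<^bsub>M\<^esub>l\<in>{k}. csc (c l * (l - k)) (y l)) = \<zero>\<^bsub>M\<^esub>"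
    using y(1)[of k] by (subst LM.finsum_insert) (auto simp: csc_simps)
  ultimately have "poly_act f w ([:- k, 1:] * p + [:c k:]) \<in> U"
    using poly_act_closed by simp
  then have "[:- k, 1:] * p + [:c k:] = 0" using poly_act_notin by blast
  then have "poly ([:- k, 1:] * p + [:c k:]) k = 0" by (simp only: poly_0)
  then have "c k = 0" by simp
  then show ?case using F0 by simp
qed simp

text \<open>Uncountably many resolvents would leave infinitely many of them in one initial span,
  where finitely many satisfy a nontrivial linear relation.\<close>

lemma countable_resolvents:
  assumes "countable_dim"
  shows "countable {l. \<exists>y\<in>carrier M. (f y \<oplus>\<^bsub>M\<^esub> csc (- l) y) \<ominus>\<^bsub>M\<^esub> w \<in> U}"
proof (rule ccontr)
  define R where "R l z \<longleftrightarrow> z \<in> carrier M \<and> shift l z \<ominus>\<^bsub>M\<^esub> w \<in> U" for l z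
  assume "\<not> ?thesis"
  then have unc: "uncountable {l. \<exists>z. R l z}" unfolding R_def shift_def Bex_def by simp
  obtain e where e: "range e \<subseteq> carrier M" "carrier M \<subseteq> (\<Union>n. initial_span e n)"
    using assms by (auto simp: countable_dim_def)
  define y where "y l = (SOME z. R l z)" for l
  have y: "R l (y l)" if "\<exists>z. R l z" for l
    using that unfolding y_def by (rule someI_ex)
  define G where "G n = {l. R l (y l) \<and> y l \<in> initial_span e n}" for n
  have "{l. \<exists>z. R l z} \<subseteq> (\<Union>n. G n)"
  proof
    fix l assume "l \<in> {l. \<exists>z. R l z}"
    then have yl: "R l (y l)" using y by simp
    then have "y l \<in> (\<Union>n. initial_span e n)" using e(2) unfolding R_def by (meson subsetD)
    then show "l \<in> (\<Union>n. G n)" using yl by (auto simp: G_def)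
  qed
  then have "\<not> (\<forall>n. countable (G n))"
    using unc countable_subset[of _ "\<Union>n. G n"] by (meson countable_UN countableI_type)
  then obtain n where "infinite (G n)" using countable_finite by auto
  moreover have "y l \<in> initial_span e n" if "l \<in> G n" for l using that by (simp add: G_def)
  ultimately obtain F c where F: "finite F" "F \<subseteq> G n" "\<exists>l\<in>F. c l \<noteq> 0"
    "(\<Oplus>\<^bsub>M\<^esub>l\<in>F. csc (c l) (y l)) = \<zero>\<^bsub>M\<^esub>"
    using finite_dependent[OF e(1), of "G n" y n] by metis
  have "poly_act f w 0 \<oplus>\<^bsub>M\<^esub> (\<Oplus>\<^bsub>M\<^esub>l\<in>F. csc (c l) (y l)) \<in> U"
    using F(4) U_sub by (simp add: poly_act_zero)
  moreover have "\<And>l. l \<in> F \<Longrightarrow> y l \<in> carrier M \<and> shift l (y l) \<ominus>\<^bsub>M\<^esub> w \<in> U"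
    using F(2) unfolding G_def R_def by (metis (mono_tags, lifting) mem_Collect_eq subsetD)
  ultimately show False using resolvents_independent[OF F(1), of y 0 c] F(3) by metis
qed

end

end

section \<open>Ascending chains of subgroups with operators\<close>

text \<open>Operators replace a ring of scalars: the same notion covers complex subspaces and
  \<open>K\<close>-submodules, and the Noetherian argument enlarges the operator set by one
  generator at a time.\<close>

definition op_subgroup :: "('a, 'b) ring_scheme \<Rightarrow> ('a \<Rightarrow> 'a) set \<Rightarrow> 'a set \<Rightarrow> bool"
  where "op_subgroup G \<Omega> N \<longleftrightarrow> N \<subseteq> carrier G \<and> \<zero>\<^bsub>G\<^esub> \<in> N \<and>
    (\<forall>u\<in>N. \<forall>v\<in>N. u \<ominus>\<^bsub>G\<^esub> v \<in> N) \<and> (\<forall>\<phi>\<in>\<Omega>. \<forall>u\<in>N. \<phi> u \<in> N)"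

definition acc_on :: "('a, 'b) ring_scheme \<Rightarrow> ('a \<Rightarrow> 'a) set \<Rightarrow> 'a set \<Rightarrow> bool"
  where "acc_on G \<Omega> N \<longleftrightarrow> (\<forall>K :: nat \<Rightarrow> 'a set.
    (\<forall>i. op_subgroup G \<Omega> (K i) \<and> K i \<subseteq> N \<and> K i \<subseteq> K (Suc i)) \<longrightarrow> (\<exists>n. \<forall>i\<ge>n. K i = K n))"

lemma op_subgroup_mono: "\<lbrakk>op_subgroup G \<Omega>' N; \<Omega> \<subseteq> \<Omega>'\<rbrakk> \<Longrightarrow> op_subgroup G \<Omega> N"
  unfolding op_subgroup_def by blast

lemma acc_onD:
  assumes "acc_on G \<Omega> N" "\<And>i. op_subgroup G \<Omega> (K i)" "\<And>i. K i \<subseteq> N" "\<And>i. K i \<subseteq> K (Suc i)"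
  shows "\<exists>n. \<forall>i\<ge>n. K i = K n"
  using assms unfolding acc_on_def by blast

lemma acc_on_maximal:
  assumes acc: "acc_on G \<Omega> N" and "K0 \<in> \<F>"
    and F: "\<And>K. K \<in> \<F> \<Longrightarrow> op_subgroup G \<Omega> K \<and> K \<subseteq> N"
  shows "\<exists>K\<in>\<F>. \<forall>K'\<in>\<F>. K \<subseteq> K' \<longrightarrow> K' = K"
proof (rule ccontr)
  assume "\<not> ?thesis"
  then have step: "\<exists>K'. K' \<in> \<F> \<and> K \<subset> K'" if "K \<in> \<F>" for K using that by blast
  have "\<exists>f :: nat \<Rightarrow> 'a set. \<forall>n. f n \<in> \<F> \<and> f n \<subset> f (Suc n)"
    using \<open>K0 \<in> \<F>\<close> step by (intro dependent_nat_choice) auto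
  then obtain f :: "nat \<Rightarrow> 'a set" where f: "\<And>n. f n \<in> \<F>" "\<And>n. f n \<subset> f (Suc n)" by meson
  then have "\<exists>n. \<forall>i\<ge>n. f i = f n"
    using F by (intro acc_onD[OF acc]) auto
  then show False using f(2) by (metis le_refl nat_le_linear not_less_eq_eq order_less_irrefl)
qed

context abelian_group
begin

lemma op_subgroupD:
  assumes "op_subgroup G \<Omega> N"
  shows "u \<in> N \<Longrightarrow> u \<in> carrier G" "\<zero> \<in> N" "\<lbrakk>u \<in> N; v \<in> N\<rbrakk> \<Longrightarrow> u \<ominus> v \<in> N"
    "u \<in> N \<Longrightarrow> \<ominus> u \<in> N" "\<lbrakk>u \<in> N; v \<in> N\<rbrakk> \<Longrightarrow> u \<oplus> v \<in> N" "\<lbrakk>\<phi> \<in> \<Omega>; u \<in> N\<rbrakk> \<Longrightarrow> \<phi> u \<in> N"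
proof -
  show 1: "u \<in> carrier G" if "u \<in> N" for u using assms that by (auto simp: op_subgroup_def)
  show 2: "\<zero> \<in> N" using assms by (simp add: op_subgroup_def)
  show 3: "u \<ominus> v \<in> N" if "u \<in> N" "v \<in> N" for u v
    using assms that by (auto simp: op_subgroup_def)
  show 4: "\<ominus> u \<in> N" if "u \<in> N" for u
    using 3[of \<zero> u] 1[OF that] 2 that by (simp add: minus_eq)
  show "u \<oplus> v \<in> N" if "u \<in> N" "v \<in> N" for u v
    using 3[OF that(1) 4[OF that(2)]] 1 that by (simp add: minus_eq)
  show "\<lbrakk>\<phi> \<in> \<Omega>; u \<in> N\<rbrakk> \<Longrightarrow> \<phi> u \<in> N" using assms by (auto simp: op_subgroup_def)
qed

lemma op_subgroupI:
  assumes "N \<subseteq> carrier G" "\<zero> \<in> N" "\<And>u v. \<lbrakk>u \<in> N; v \<in> N\<rbrakk> \<Longrightarrow> u \<oplus> v \<in> N"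
    "\<And>u. u \<in> N \<Longrightarrow> \<ominus> u \<in> N" "\<And>\<phi> u. \<lbrakk>\<phi> \<in> \<Omega>; u \<in> N\<rbrakk> \<Longrightarrow> \<phi> u \<in> N"
  shows "op_subgroup G \<Omega> N"
  using assms by (simp add: op_subgroup_def minus_eq)

lemma op_subgroup_Int:
  "\<lbrakk>op_subgroup G \<Omega> N; op_subgroup G \<Omega> N'\<rbrakk> \<Longrightarrow> op_subgroup G \<Omega> (N \<inter> N')"
  unfolding op_subgroup_def by blast

end

definition additive_op :: "('a, 'b) ring_scheme \<Rightarrow> ('a \<Rightarrow> 'a) \<Rightarrow> bool"
  where "additive_op G \<phi> \<longleftrightarrow> (\<forall>u\<in>carrier G. \<phi> u \<in> carrier G) \<and>
    (\<forall>u\<in>carrier G. \<forall>v\<in>carrier G. \<phi> (u \<oplus>\<^bsub>G\<^esub> v) = \<phi> u \<oplus>\<^bsub>G\<^esub> \<phi> v)"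

context abelian_group
begin

lemma additive_opD:
  assumes "additive_op G \<phi>"
  shows "u \<in> carrier G \<Longrightarrow> \<phi> u \<in> carrier G"
    "\<lbrakk>u \<in> carrier G; v \<in> carrier G\<rbrakk> \<Longrightarrow> \<phi> (u \<oplus> v) = \<phi> u \<oplus> \<phi> v"
    "\<phi> \<zero> = \<zero>" "u \<in> carrier G \<Longrightarrow> \<phi> (\<ominus> u) = \<ominus> \<phi> u"
    "\<lbrakk>u \<in> carrier G; v \<in> carrier G\<rbrakk> \<Longrightarrow> \<phi> (u \<ominus> v) = \<phi> u \<ominus> \<phi> v"
proof -
  show cl: "\<phi> u \<in> carrier G" if "u \<in> carrier G" for u using assms that by (simp add: additive_op_def)
  show add: "\<phi> (u \<oplus> v) = \<phi> u \<oplus> \<phi> v" if "u \<in> carrier G" "v \<in> carrier G" for u v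
    using assms that by (simp add: additive_op_def)
  show z: "\<phi> \<zero> = \<zero>" using add[of \<zero> \<zero>] cl[of \<zero>] by (metis add.l_cancel_one' l_zero zero_closed)
  show m: "\<phi> (\<ominus> u) = \<ominus> \<phi> u" if "u \<in> carrier G" for u
    using add[of "\<ominus> u" u] cl that z by (metis a_inv_closed l_neg minus_equality)
  show "\<phi> (u \<ominus> v) = \<phi> u \<ominus> \<phi> v" if "u \<in> carrier G" "v \<in> carrier G" for u v
    using that by (simp add: minus_eq add m)
qed

lemma additive_op_pow: "additive_op G \<phi> \<Longrightarrow> additive_op G (\<phi> ^^ n)"
  for \<phi> :: "'a \<Rightarrow> 'a"
  by (induction n) (simp_all add: additive_op_def)

text \<open>The argument of Hilbert's basis theorem: \<open>layer n\<close> consists of the \<open>N\<close>-polynomials in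
  \<open>T\<close> of degree less than \<open>n\<close>, and \<open>lead K n\<close> of the coefficients of \<open>T\<^sup>n\<close> of the elements
  of \<open>K\<close> of degree at most \<open>n\<close>.\<close>

context
  fixes \<Omega> :: "('a \<Rightarrow> 'a) set" and N :: "'a set" and T :: "'a \<Rightarrow> 'a"
  assumes \<Omega>: "\<And>\<phi>. \<phi> \<in> \<Omega> \<Longrightarrow> additive_op G \<phi>" and T: "additive_op G T"
    and comm: "\<And>\<phi> u. \<lbrakk>\<phi> \<in> \<Omega>; u \<in> carrier G\<rbrakk> \<Longrightarrow> T (\<phi> u) = \<phi> (T u)"
    and N: "op_subgroup G \<Omega> N"
begin

private primrec layer :: "nat \<Rightarrow> 'a set"
  where "layer 0 = {\<zero>}"
  | "layer (Suc n) = {(T ^^ n) a \<oplus> b | a b. a \<in> N \<and> b \<in> layer n}"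

private lemma layer_SucI: "\<lbrakk>a \<in> N; b \<in> layer n\<rbrakk> \<Longrightarrow> (T ^^ n) a \<oplus> b \<in> layer (Suc n)"
  by auto

private lemma layer_SucE:
  assumes "u \<in> layer (Suc n)"
  obtains a b where "a \<in> N" "b \<in> layer n" "u = (T ^^ n) a \<oplus> b"
  using assms by auto

declare layer.simps(2) [simp del]

private definition lead :: "'a set \<Rightarrow> nat \<Rightarrow> 'a set"
  where "lead K n = {a \<in> N. \<exists>b\<in>layer n. (T ^^ n) a \<oplus> b \<in> K}"

private lemmas Tn = additive_opD[OF additive_op_pow[OF T]]

private lemma comm_pow: "\<lbrakk>\<phi> \<in> \<Omega>; u \<in> carrier G\<rbrakk> \<Longrightarrow> (T ^^ n) (\<phi> u) = \<phi> ((T ^^ n) u)"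
  by (induction n) (simp_all add: comm Tn)

private lemma layer_op_subgroup: "op_subgroup G \<Omega> (layer n)"
proof (induction n)
  case 0
  then show ?case by (auto simp: op_subgroup_def minus_eq additive_opD[OF \<Omega>])
next
  case (Suc n)
  note L = op_subgroupD[OF Suc] and ND = op_subgroupD[OF N]
  show ?case
  proof (rule op_subgroupI)
    show "layer (Suc n) \<subseteq> carrier G" by (auto simp: L ND Tn elim!: layer_SucE)
    have "(T ^^ n) \<zero> \<oplus> \<zero> \<in> layer (Suc n)" using L(2) ND(2) by (intro layer_SucI)
    then show "\<zero> \<in> layer (Suc n)" by (simp add: Tn)
  next
    fix u v assume "u \<in> layer (Suc n)" "v \<in> layer (Suc n)"
    then obtain a b c d where *: "a \<in> N" "b \<in> layer n" "u = (T ^^ n) a \<oplus> b"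
      "c \<in> N" "d \<in> layer n" "v = (T ^^ n) c \<oplus> d" by (meson layer_SucE)
    then have "u \<oplus> v = (T ^^ n) (a \<oplus> c) \<oplus> (b \<oplus> d)" by (simp add: Tn L ND a_ac)
    then show "u \<oplus> v \<in> layer (Suc n)" using layer_SucI[OF ND(5)[OF *(1,4)] L(5)[OF *(2,5)]] by simp
  next
    fix u assume "u \<in> layer (Suc n)"
    then obtain a b where *: "a \<in> N" "b \<in> layer n" "u = (T ^^ n) a \<oplus> b" by (meson layer_SucE)
    then have "\<ominus> u = (T ^^ n) (\<ominus> a) \<oplus> (\<ominus> b)" by (simp add: Tn L ND minus_add)
    then show "\<ominus> u \<in> layer (Suc n)" using layer_SucI[OF ND(4)[OF *(1)] L(4)[OF *(2)]] by simp
  next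
    fix \<phi> u assume \<phi>: "\<phi> \<in> \<Omega>" and "u \<in> layer (Suc n)"
    then obtain a b where *: "a \<in> N" "b \<in> layer n" "u = (T ^^ n) a \<oplus> b" by (meson layer_SucE)
    then have "\<phi> u = (T ^^ n) (\<phi> a) \<oplus> \<phi> b"
      by (simp add: Tn L ND additive_opD[OF \<Omega>[OF \<phi>]] comm_pow[OF \<phi>])
    then show "\<phi> u \<in> layer (Suc n)" using layer_SucI[OF ND(6)[OF \<phi> *(1)] L(6)[OF \<phi> *(2)]] by simp
  qed
qed

private lemmas LD = op_subgroupD[OF layer_op_subgroup]
private lemmas ND = op_subgroupD[OF N]

private lemma layer_Suc: "layer n \<subseteq> layer (Suc n)"
proof
  fix b assume "b \<in> layer n"
  then have "(T ^^ n) \<zero> \<oplus> b \<in> layer (Suc n)" using ND(2) by (intro layer_SucI)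
  then show "b \<in> layer (Suc n)" using LD(1)[OF \<open>b \<in> layer n\<close>] by (simp add: Tn)
qed

private lemma layer_mono: "m \<le> n \<Longrightarrow> layer m \<subseteq> layer n"
  using layer_Suc by (rule lift_Suc_mono_le)

private lemma layer_shift: "b \<in> layer n \<Longrightarrow> T b \<in> layer (Suc n)"
proof (induction n arbitrary: b)
  case 0
  have "(T ^^ 0) \<zero> \<oplus> \<zero> \<in> layer (Suc 0)" using ND(2) by (intro layer_SucI) auto
  then show ?case using 0 additive_opD(3)[OF T] by simp
next
  case (Suc n)
  then obtain a c where *: "a \<in> N" "c \<in> layer n" "b = (T ^^ n) a \<oplus> c" by (meson layer_SucE)
  then have "T b = (T ^^ Suc n) a \<oplus> T c" by (simp add: Tn LD ND additive_opD[OF T])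
  then show ?case using layer_SucI[OF *(1) Suc.IH[OF *(2)]] by simp
qed

private lemma layers_op_subgroup: "op_subgroup G (insert T \<Omega>) (\<Union>n. layer n)"
proof (rule op_subgroupI)
  show "(\<Union>n. layer n) \<subseteq> carrier G" using LD(1) by (meson UN_least subsetI)
  show "\<zero> \<in> (\<Union>n. layer n)" using LD(2) by (meson UN_I UNIV_I)
  show "\<ominus> u \<in> (\<Union>n. layer n)" if "u \<in> (\<Union>n. layer n)" for u
    using LD(4) that by (meson UN_E UN_I UNIV_I)
next
  fix u v assume "u \<in> (\<Union>n. layer n)" "v \<in> (\<Union>n. layer n)"
  then obtain m n where "u \<in> layer m" "v \<in> layer n" by auto
  then have "u \<in> layer (max m n)" "v \<in> layer (max m n)"
    using layer_mono[of m "max m n"] layer_mono[of n "max m n"] by auto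
  then show "u \<oplus> v \<in> (\<Union>n. layer n)" using LD(5) by (meson UN_I UNIV_I)
next
  fix \<phi> u assume "\<phi> \<in> insert T \<Omega>" "u \<in> (\<Union>n. layer n)"
  then show "\<phi> u \<in> (\<Union>n. layer n)" using LD(6) layer_shift by (metis UN_E UN_I UNIV_I insertE)
qed

private lemma lead_op_subgroup:
  assumes K: "op_subgroup G (insert T \<Omega>) K"
  shows "op_subgroup G \<Omega> (lead K n)"
proof (rule op_subgroupI)
  note KD = op_subgroupD[OF K]
  show "lead K n \<subseteq> carrier G" using ND(1) by (auto simp: lead_def)
  have "(T ^^ n) \<zero> \<oplus> \<zero> \<in> K" using KD(2) by (simp add: Tn)
  then show "\<zero> \<in> lead K n" using LD(2) ND(2) by (auto simp: lead_def)
next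
  note KD = op_subgroupD[OF K]
  fix u v assume "u \<in> lead K n" "v \<in> lead K n"
  then obtain b d where *: "u \<in> N" "v \<in> N" "b \<in> layer n" "(T ^^ n) u \<oplus> b \<in> K"
     "d \<in> layer n" "(T ^^ n) v \<oplus> d \<in> K" by (auto simp: lead_def)
  have "((T ^^ n) u \<oplus> b) \<oplus> ((T ^^ n) v \<oplus> d) = (T ^^ n) (u \<oplus> v) \<oplus> (b \<oplus> d)"
    using * by (simp add: Tn LD ND a_ac)
  then have "(T ^^ n) (u \<oplus> v) \<oplus> (b \<oplus> d) \<in> K" using KD(5)[OF *(4,6)] by simp
  then show "u \<oplus> v \<in> lead K n" using * LD(5) ND(5) by (auto simp: lead_def)
next
  note KD = op_subgroupD[OF K]
  fix u assume "u \<in> lead K n"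
  then obtain b where *: "u \<in> N" "b \<in> layer n" "(T ^^ n) u \<oplus> b \<in> K" by (auto simp: lead_def)
  have "\<ominus> ((T ^^ n) u \<oplus> b) = (T ^^ n) (\<ominus> u) \<oplus> (\<ominus> b)"
    using * by (simp add: Tn LD ND minus_add)
  then have "(T ^^ n) (\<ominus> u) \<oplus> (\<ominus> b) \<in> K" using KD(4)[OF *(3)] by simp
  then show "\<ominus> u \<in> lead K n" using * LD(4) ND(4) by (auto simp: lead_def)
next
  note KD = op_subgroupD[OF K]
  fix \<phi> u assume \<phi>: "\<phi> \<in> \<Omega>" and "u \<in> lead K n"
  then obtain b where *: "u \<in> N" "b \<in> layer n" "(T ^^ n) u \<oplus> b \<in> K" by (auto simp: lead_def)
  have "\<phi> ((T ^^ n) u \<oplus> b) = (T ^^ n) (\<phi> u) \<oplus> \<phi> b"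
    using * by (simp add: Tn LD ND additive_opD[OF \<Omega>[OF \<phi>]] comm_pow[OF \<phi>])
  then have "(T ^^ n) (\<phi> u) \<oplus> \<phi> b \<in> K" using KD(6)[OF _ *(3), of \<phi>] \<phi> by simp
  then show "\<phi> u \<in> lead K n" using * \<phi> LD(6) ND(6) by (auto simp: lead_def)
qed

text \<open>Applying \<open>T\<close> raises the degree by one and keeps the leading
  coefficient.\<close>

private lemma lead_Suc:
  assumes K: "op_subgroup G (insert T \<Omega>) K"
  shows "lead K n \<subseteq> lead K (Suc n)"
proof
  fix a assume "a \<in> lead K n"
  then obtain b where *: "a \<in> N" "b \<in> layer n" "(T ^^ n) a \<oplus> b \<in> K" by (auto simp: lead_def)
  have "T ((T ^^ n) a \<oplus> b) = (T ^^ Suc n) a \<oplus> T b"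
    using * by (simp add: Tn LD ND additive_opD[OF T])
  then have "(T ^^ Suc n) a \<oplus> T b \<in> K" using op_subgroupD(6)[OF K _ *(3), of T] by simp
  then show "a \<in> lead K (Suc n)" unfolding lead_def using * layer_shift by blast
qed

private lemma lead_mono: "K \<subseteq> K' \<Longrightarrow> lead K n \<subseteq> lead K' n"
  by (auto simp: lead_def)

text \<open>Induction on the degree: from an element of \<open>K'\<close> one subtracts an element
  of \<open>K\<close> with the same leading coefficient. Expressions as polynomials in
  \<open>T\<close> need not be unique, so \<open>lead\<close> collects all leading coefficients that
  occur.\<close>

private lemma lead_determines:
  assumes K: "op_subgroup G (insert T \<Omega>) K" and K': "op_subgroup G (insert T \<Omega>) K'"
    and sub: "K \<subseteq> K'" "K' \<subseteq> (\<Union>n. layer n)" and lead: "\<And>n. lead K n = lead K' n"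
  shows "K = K'"
proof -
  have "u \<in> K" if "u \<in> K'" "u \<in> layer n" for u n
    using that
  proof (induction n arbitrary: u)
    case 0
    then show ?case using op_subgroupD(2)[OF K] by simp
  next
    case (Suc n)
    then obtain a b where ab: "a \<in> N" "b \<in> layer n" "u = (T ^^ n) a \<oplus> b" by (meson layer_SucE)
    then have "a \<in> lead K n" using Suc.prems lead by (auto simp: lead_def)
    then obtain c where c: "c \<in> layer n" "(T ^^ n) a \<oplus> c \<in> K" by (auto simp: lead_def)
    have "u \<ominus> ((T ^^ n) a \<oplus> c) = b \<ominus> c"
      using ab c by (simp add: Tn LD ND minus_eq minus_add a_ac r_neg r_neg1 r_neg2)
    moreover have "u \<ominus> ((T ^^ n) a \<oplus> c) \<in> K'"
      using op_subgroupD(3)[OF K'] Suc.prems c(2) sub(1) by blast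
    ultimately have bc: "b \<ominus> c \<in> K" using Suc.IH LD(3) ab c by simp
    have "u = ((T ^^ n) a \<oplus> c) \<oplus> (b \<ominus> c)"
      using ab c by (simp add: Tn LD ND minus_eq a_ac r_neg r_neg1 r_neg2)
    then show ?case using op_subgroupD(5)[OF K c(2) bc] by simp
  qed
  then show ?thesis using sub by blast
qed

text \<open>The coefficient groups form a double sequence in the chain index and the degree. Its
  diagonal stabilises at some \<open>m\<close>, which settles all degrees from \<open>m\<close> on;
  the finitely many degrees below \<open>m\<close> are settled one by one.\<close>

lemma acc_on_adjoin:
  assumes acc: "acc_on G \<Omega> N"
  shows "\<exists>N'. N \<subseteq> N' \<and> op_subgroup G (insert T \<Omega>) N' \<and> acc_on G (insert T \<Omega>) N'"
proof (intro exI conjI)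
  have "a \<in> layer (Suc 0)" if "a \<in> N" for a
    using layer_SucI[OF that, of \<zero> 0] ND(1)[OF that] by simp
  then show "N \<subseteq> (\<Union>n. layer n)" by (meson UN_I UNIV_I subsetI)
  show "op_subgroup G (insert T \<Omega>) (\<Union>n. layer n)" by (rule layers_op_subgroup)
  show "acc_on G (insert T \<Omega>) (\<Union>n. layer n)"
    unfolding acc_on_def
  proof (intro allI impI)
    fix K :: "nat \<Rightarrow> 'a set"
    assume "\<forall>i. op_subgroup G (insert T \<Omega>) (K i) \<and> K i \<subseteq> (\<Union>n. layer n) \<and> K i \<subseteq> K (Suc i)"
    then have K: "\<And>i. op_subgroup G (insert T \<Omega>) (K i)" "\<And>i. K i \<subseteq> (\<Union>n. layer n)"
      "\<And>i. K i \<subseteq> K (Suc i)" by auto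
    have K_mono: "i \<le> j \<Longrightarrow> K i \<subseteq> K j" for i j using K(3) by (rule lift_Suc_mono_le)
    have N_lead: "lead (K i) n \<subseteq> N" for i n unfolding lead_def by (rule Collect_restrict)
    have mono1: "i \<le> j \<Longrightarrow> lead (K i) n \<subseteq> lead (K j) n" for i j n by (rule lead_mono[OF K_mono])
    have mono2: "m \<le> n \<Longrightarrow> lead (K i) m \<subseteq> lead (K i) n" for i m n
      using lead_Suc[OF K(1)] by (rule lift_Suc_mono_le)
    have "\<exists>m. \<forall>i\<ge>m. lead (K i) i = lead (K m) m"
      by (rule acc_onD[OF acc lead_op_subgroup[OF K(1)] N_lead])
        (meson mono1 mono2 le_SucI order_refl order_trans)
    then obtain m where m: "\<And>i. i \<ge> m \<Longrightarrow> lead (K i) i = lead (K m) m" by blast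
    have "\<exists>s. \<forall>i\<ge>s. lead (K i) n = lead (K s) n" for n
      by (rule acc_onD[OF acc lead_op_subgroup[OF K(1)] N_lead]) (rule mono1, simp)
    then obtain s where s: "\<And>n i. i \<ge> s n \<Longrightarrow> lead (K i) n = lead (K (s n)) n" by metis
    define t where "t = m + (\<Sum>n<m. s n)"
    have t: "m \<le> t" "\<And>n. n < m \<Longrightarrow> s n \<le> t"
      using member_le_sum[of _ "{..<m}" s] by (auto simp: t_def intro: trans_le_add2)
    \<comment> \<open>Both indices are at least \<open>m\<close>, so the group lies between two
      diagonal groups, the one at \<open>m\<close> and the one at the maximum of the two
      indices.\<close>
    have diag: "lead (K i) n = lead (K m) m" if "m \<le> i" "m \<le> n" for i n
    proof (rule subset_antisym)
      show "lead (K i) n \<subseteq> lead (K m) m"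
        using m[of "max i n"] mono1[of i "max i n" n] mono2[of n "max i n" "max i n"] that by auto
      show "lead (K m) m \<subseteq> lead (K i) n" using mono1 mono2 that by blast
    qed
    have "K t = K i" if "i \<ge> t" for i
    proof (rule lead_determines[OF K(1) K(1) K_mono[OF that] K(2)])
      show "lead (K t) n = lead (K i) n" for n
      proof (cases "n < m")
        case True
        then show ?thesis using s[of n t] s[of n i] t(2)[OF True] that by simp
      next
        case False
        then show ?thesis using diag[of t n] diag[of i n] t(1) that by simp
      qed
    qed
    then show "\<exists>n. \<forall>i\<ge>n. K i = K n" by metis
  qed
qed

end

end

section \<open>Noetherian modules over a finitely generated central subalgebra\<close>

context complex_scalars
begin

lemma additive_op_mult: "a \<in> carrier A \<Longrightarrow> additive_op A (\<lambda>u. a \<otimes> u)"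
  by (simp add: additive_op_def r_distr)

text \<open>The new vector adds at most one dimension to \<open>N\<close>. Once a member of the
  chain contains some \<open>u\<close> outside \<open>N\<close>, every later member is determined by
  \<open>u\<close> and its intersection with \<open>N\<close>.\<close>

lemma acc_on_adjoin_vector:
  defines "\<Omega> \<equiv> range (\<lambda>c u. sc c \<otimes> u)"
  assumes N: "op_subgroup A \<Omega> N" and acc: "acc_on A \<Omega> N" and e: "e \<in> carrier A"
  shows "\<exists>N'. insert e N \<subseteq> N' \<and> op_subgroup A \<Omega> N' \<and> acc_on A \<Omega> N'"
proof (intro exI conjI)
  note ND = op_subgroupD[OF N]
  have sc_op: "sc c \<otimes> u \<in> K" if "op_subgroup A \<Omega> K" "u \<in> K" for c u K
    using that(1,2) unfolding op_subgroup_def \<Omega>_def by blast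
  let ?N = "{sc c \<otimes> e \<oplus> v | c v. v \<in> N}"
  show "insert e N \<subseteq> ?N"
  proof
    fix u assume "u \<in> insert e N"
    then have "u = sc 1 \<otimes> e \<oplus> \<zero> \<or> u = sc 0 \<otimes> e \<oplus> u \<and> u \<in> N"
      using e ND(1) by (auto simp: sc_one sc_zero)
    then show "u \<in> ?N" using ND(2) by blast
  qed
  show "op_subgroup A \<Omega> ?N"
  proof (rule op_subgroupI)
    show "?N \<subseteq> carrier A" using e ND(1) by auto
    have "\<zero> = sc 0 \<otimes> e \<oplus> \<zero>" using e by (simp add: sc_zero)
    then show "\<zero> \<in> ?N" using ND(2) by blast
  next
    fix u v assume "u \<in> ?N" "v \<in> ?N"
    then obtain c d u' v' where *: "u = sc c \<otimes> e \<oplus> u'" "v = sc d \<otimes> e \<oplus> v'" "u' \<in> N" "v' \<in> N" by auto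
    then have "u \<oplus> v = sc (c + d) \<otimes> e \<oplus> (u' \<oplus> v')"
      using e ND(1) by (simp add: sc_add l_distr a_ac)
    then show "u \<oplus> v \<in> ?N" using * ND(5) by blast
  next
    fix u assume "u \<in> ?N"
    then obtain c u' where *: "u = sc c \<otimes> e \<oplus> u'" "u' \<in> N" by auto
    then have "\<ominus> u = sc (- c) \<otimes> e \<oplus> (\<ominus> u')"
      using e ND(1) by (simp add: sc_uminus l_minus minus_add)
    then show "\<ominus> u \<in> ?N" using * ND(4) by blast
  next
    fix \<phi> u assume "\<phi> \<in> \<Omega>" "u \<in> ?N"
    then obtain c d u' where *: "\<phi> = (\<lambda>u. sc d \<otimes> u)" "u = sc c \<otimes> e \<oplus> u'" "u' \<in> N"
      by (auto simp: \<Omega>_def)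
    then have "\<phi> u = sc (d * c) \<otimes> e \<oplus> sc d \<otimes> u'"
      using e ND(1) by (simp add: sc_mult r_distr m_assoc)
    then show "\<phi> u \<in> ?N" using * sc_op[OF N] by blast
  qed
  show "acc_on A \<Omega> ?N"
    unfolding acc_on_def
  proof (intro allI impI)
    fix K :: "nat \<Rightarrow> 'a set"
    assume "\<forall>i. op_subgroup A \<Omega> (K i) \<and> K i \<subseteq> ?N \<and> K i \<subseteq> K (Suc i)"
    then have K: "\<And>i. op_subgroup A \<Omega> (K i)" "\<And>i. K i \<subseteq> ?N" "\<And>i. K i \<subseteq> K (Suc i)" by auto
    have K_mono: "i \<le> j \<Longrightarrow> K i \<subseteq> K j" for i j using K(3) by (rule lift_Suc_mono_le)
    have "\<exists>n. \<forall>i\<ge>n. K i \<inter> N = K n \<inter> N"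
    proof (rule acc_onD[OF acc])
      show "K i \<inter> N \<subseteq> K (Suc i) \<inter> N" for i using K(3)[of i] by (rule Int_mono) simp
    qed (use K(1) N in \<open>simp_all add: op_subgroup_Int\<close>)
    then obtain n where n: "\<And>i. i \<ge> n \<Longrightarrow> K i \<inter> N = K n \<inter> N" by blast
    show "\<exists>n. \<forall>i\<ge>n. K i = K n"
    proof (cases "\<forall>i. K i \<subseteq> N")
      case True
      then show ?thesis using n by (metis inf.absorb1)
    next
      case False
      then obtain m u where u: "u \<in> K m" "u \<notin> N" by blast
      then obtain c v where cv: "u = sc c \<otimes> e \<oplus> v" "v \<in> N" using K(2) by blast
      have c: "c \<noteq> 0" using u cv e ND(1) by (auto simp: sc_zero)
      have "w \<in> K (max m n)" if i: "i \<ge> max m n" and w: "w \<in> K i" for i w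
      proof -
        obtain d v' where dv: "w = sc d \<otimes> e \<oplus> v'" "v' \<in> N" using K(2) w by blast
        note car = e ND(1)[OF cv(2)] ND(1)[OF dv(2)]
        have uK: "u \<in> K (max m n)" "u \<in> K i"
          using u(1) K_mono[of m "max m n"] K_mono[of m i] i by auto
        \<comment> \<open>The multiple of \<open>u\<close> with the same component along
          \<open>e\<close> as \<open>w\<close>.\<close>
        define r where "r = sc (d / c) \<otimes> u"
        have r: "r \<in> K (max m n)" "r \<in> K i" unfolding r_def using sc_op[OF K(1)] uK by auto
        have "r = sc d \<otimes> e \<oplus> sc (d / c) \<otimes> v"
          using car c by (simp add: r_def cv(1) r_distr m_assoc[symmetric] sc_mult[symmetric])
        then have "w \<ominus> r = v' \<ominus> sc (d / c) \<otimes> v"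
          using car by (simp add: dv(1) minus_eq minus_add a_ac r_neg r_neg1 r_neg2)
        then have "w \<ominus> r \<in> K i \<inter> N"
          using op_subgroupD(3)[OF K(1) w r(2)] op_subgroupD(3)[OF N dv(2) sc_op[OF N cv(2)]] by simp
        also have "\<dots> = K (max m n) \<inter> N" using n[of i] n[of "max m n"] i by simp
        finally have "w \<ominus> r \<in> K (max m n)" by simp
        moreover have "w = (w \<ominus> r) \<oplus> r"
          using op_subgroupD(1)[OF K(1) w] op_subgroupD(1)[OF K(1) r(1)]
          by (simp add: minus_eq a_assoc l_neg)
        ultimately show ?thesis using op_subgroupD(5)[OF K(1) _ r(1)] by metis
      qed
      then have "K i = K (max m n)" if "i \<ge> max m n" for i using K_mono[OF that] that by blast
      then show ?thesis by blast
    qed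
  qed
qed

text \<open>The complex span of \<open>F\<close> satisfies the chain condition over the scalars, and
  each \<open>s\<close> in \<open>S\<close> is then adjoined as an operator. Centrality makes
  multiplication by \<open>s\<close> commute with the operators already present.\<close>

lemma noetherian_of_generators:
  assumes "finite S" "finite F" "S \<subseteq> carrier A" "F \<subseteq> carrier A"
    and central: "\<And>s a. \<lbrakk>s \<in> S; a \<in> carrier A\<rbrakk> \<Longrightarrow> a \<otimes> s = s \<otimes> a"
  defines "\<Omega> \<equiv> range (\<lambda>c u. sc c \<otimes> u) \<union> (\<lambda>s u. s \<otimes> u) ` S"
  shows "\<exists>N. F \<subseteq> N \<and> op_subgroup A \<Omega> N \<and> acc_on A \<Omega> N"
  unfolding \<Omega>_def using assms(1,3) central
proof (induction S rule: finite_induct)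
  case empty
  show ?case using \<open>finite F\<close> \<open>F \<subseteq> carrier A\<close>
  proof (induction F rule: finite_induct)
    case empty
    have "op_subgroup A (range (\<lambda>c u. sc c \<otimes> u)) {\<zero>}" by (auto simp: op_subgroup_def minus_eq)
    moreover have "acc_on A (range (\<lambda>c u. sc c \<otimes> u)) {\<zero>}"
      unfolding acc_on_def
    proof (intro allI impI)
      fix K :: "nat \<Rightarrow> 'a set"
      assume "\<forall>i. op_subgroup A (range (\<lambda>c u. sc c \<otimes> u)) (K i) \<and> K i \<subseteq> {\<zero>} \<and> K i \<subseteq> K (Suc i)"
      then have "K i \<subseteq> {\<zero>}" "\<zero> \<in> K i" for i by (simp_all add: op_subgroup_def)
      then have "K i = {\<zero>}" for i by (simp add: subset_antisym)
      then show "\<exists>n. \<forall>i\<ge>n. K i = K n" by simp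
    qed
    ultimately show ?case by (intro exI[of _ "{\<zero>}"]) simp
  next
    case (insert f F)
    obtain N where N: "F \<subseteq> N" "op_subgroup A (range (\<lambda>c u. sc c \<otimes> u)) N"
      "acc_on A (range (\<lambda>c u. sc c \<otimes> u)) N"
      using insert.IH insert.prems by (simp del: ex_simps) blast
    obtain N' where "insert f N \<subseteq> N'" "op_subgroup A (range (\<lambda>c u. sc c \<otimes> u)) N'"
      "acc_on A (range (\<lambda>c u. sc c \<otimes> u)) N'"
      using acc_on_adjoin_vector[OF N(2,3), of f] insert.prems by blast
    then show ?case using N(1) by (intro exI[of _ N']) auto
  qed
next
  case (insert s S)
  let ?\<Omega> = "range (\<lambda>c u. sc c \<otimes> u) \<union> (\<lambda>s u. s \<otimes> u) ` S"
  have "\<exists>N. F \<subseteq> N \<and> op_subgroup A ?\<Omega> N \<and> acc_on A ?\<Omega> N"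
  proof (rule insert.IH)
    show "a \<otimes> s' = s' \<otimes> a" if "s' \<in> S" "a \<in> carrier A" for s' a
      using insert.prems(2)[of s' a] that by blast
  qed (use insert.prems(1) in simp)
  then obtain N where N: "F \<subseteq> N" "op_subgroup A ?\<Omega> N" "acc_on A ?\<Omega> N" by blast
  have s: "s \<in> carrier A" "\<And>a. a \<in> carrier A \<Longrightarrow> a \<otimes> s = s \<otimes> a"
    using insert.prems(1) by simp (rule insert.prems(2), simp_all)
  have mult_op: "\<exists>a\<in>carrier A. \<phi> = (\<lambda>u. a \<otimes> u)" if "\<phi> \<in> ?\<Omega>" for \<phi>
    using that insert.prems(1) by (elim UnE rangeE imageE) (use sc_closed in auto)
  have ex: "\<exists>N'. N \<subseteq> N' \<and> op_subgroup A (insert (\<lambda>u. s \<otimes> u) ?\<Omega>) N' \<and>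
    acc_on A (insert (\<lambda>u. s \<otimes> u) ?\<Omega>) N'"
  proof (rule acc_on_adjoin[OF _ _ _ N(2,3)])
    show "additive_op A \<phi>" if "\<phi> \<in> ?\<Omega>" for \<phi>
    proof -
      obtain a where "a \<in> carrier A" "\<phi> = (\<lambda>u. a \<otimes> u)" using mult_op \<open>\<phi> \<in> ?\<Omega>\<close> by meson
      then show ?thesis by (simp add: additive_op_mult)
    qed
    show "additive_op A (\<lambda>u. s \<otimes> u)" using s(1) by (rule additive_op_mult)
    show "s \<otimes> \<phi> u = \<phi> (s \<otimes> u)" if "\<phi> \<in> ?\<Omega>" "u \<in> carrier A" for \<phi> u
    proof -
      obtain a where "a \<in> carrier A" "\<phi> = (\<lambda>u. a \<otimes> u)" using mult_op \<open>\<phi> \<in> ?\<Omega>\<close> by meson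
      then show ?thesis using s(1) s(2)[of a] that(2) by (metis m_assoc)
    qed
  qed
  have eq: "insert (\<lambda>u. s \<otimes> u) ?\<Omega> = range (\<lambda>c u. sc c \<otimes> u) \<union> (\<lambda>s u. s \<otimes> u) ` insert s S"
    by simp
  show ?case using ex N(1) unfolding eq by (elim exE conjE) (intro exI conjI, rule order_trans)
qed

end

section \<open>Prime ideals stable under derivations\<close>

context ring
begin

lemma idealD:
  assumes "ideal I R"
  shows "a \<in> I \<Longrightarrow> a \<in> carrier R" "\<zero> \<in> I" "\<lbrakk>a \<in> I; b \<in> I\<rbrakk> \<Longrightarrow> a \<oplus> b \<in> I"
    "\<lbrakk>a \<in> I; b \<in> I\<rbrakk> \<Longrightarrow> a \<ominus> b \<in> I" "a \<in> I \<Longrightarrow> \<ominus> a \<in> I"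
    "\<lbrakk>a \<in> I; c \<in> carrier R\<rbrakk> \<Longrightarrow> c \<otimes> a \<in> I" "\<lbrakk>a \<in> I; c \<in> carrier R\<rbrakk> \<Longrightarrow> a \<otimes> c \<in> I"
proof -
  interpret I: ideal I R by fact
  show "a \<in> I \<Longrightarrow> a \<in> carrier R" "\<zero> \<in> I" "\<lbrakk>a \<in> I; b \<in> I\<rbrakk> \<Longrightarrow> a \<oplus> b \<in> I"
    "\<lbrakk>a \<in> I; b \<in> I\<rbrakk> \<Longrightarrow> a \<ominus> b \<in> I" "a \<in> I \<Longrightarrow> \<ominus> a \<in> I"
    "\<lbrakk>a \<in> I; c \<in> carrier R\<rbrakk> \<Longrightarrow> c \<otimes> a \<in> I" "\<lbrakk>a \<in> I; c \<in> carrier R\<rbrakk> \<Longrightarrow> a \<otimes> c \<in> I"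
    by (simp_all add: I.I_l_closed I.I_r_closed I.a_closed I.a_inv_closed minus_eq)
qed

lemma two_sided_idealI:
  assumes "I \<subseteq> carrier R" "\<zero> \<in> I" "\<And>a b. \<lbrakk>a \<in> I; b \<in> I\<rbrakk> \<Longrightarrow> a \<oplus> b \<in> I"
    and l: "\<And>a c. \<lbrakk>a \<in> I; c \<in> carrier R\<rbrakk> \<Longrightarrow> c \<otimes> a \<in> I"
    and "\<And>a c. \<lbrakk>a \<in> I; c \<in> carrier R\<rbrakk> \<Longrightarrow> a \<otimes> c \<in> I"
  shows "ideal I R"
proof (rule idealI)
  show "ring R" by (rule ring_axioms)
  show "subgroup I (add_monoid R)"
  proof (rule add.subgroupI)
    show "I \<noteq> {}" using assms(2) by blast
    show "\<ominus> a \<in> I" if "a \<in> I" for a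
    proof -
      have "(\<ominus> \<one>) \<otimes> a = \<ominus> a" using assms(1) that by (auto simp: l_minus)
      then show ?thesis using l[OF that, of "\<ominus> \<one>"] by simp
    qed
  qed (use assms in auto)
qed (use assms in auto)

text \<open>Arithmetic in the quotient by \<open>I\<close> without the quotient ring; membership in
  the carrier is part of the relation, so chains of congruences carry it along.\<close>

definition cong_mod :: "'a set \<Rightarrow> 'a \<Rightarrow> 'a \<Rightarrow> bool"
  where "cong_mod I a b \<longleftrightarrow> a \<in> carrier R \<and> b \<in> carrier R \<and> a \<ominus> b \<in> I"

lemma cong_mod_carrier: "cong_mod I a b \<Longrightarrow> a \<in> carrier R" "cong_mod I a b \<Longrightarrow> b \<in> carrier R"
  by (auto simp: cong_mod_def)

context
  fixes I assumes I: "ideal I R"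
begin

lemma cong_mod_refl: "a \<in> carrier R \<Longrightarrow> cong_mod I a a"
  by (simp add: cong_mod_def minus_eq r_neg idealD[OF I])

lemma cong_mod_sym: "cong_mod I a b \<Longrightarrow> cong_mod I b a"
proof -
  assume ab: "cong_mod I a b"
  then have "b \<ominus> a = \<ominus> (a \<ominus> b)" by (simp add: cong_mod_def minus_eq minus_add a_comm)
  then show ?thesis using ab idealD(5)[OF I, of "a \<ominus> b"] by (simp add: cong_mod_def)
qed

lemma cong_mod_trans: "\<lbrakk>cong_mod I a b; cong_mod I b c\<rbrakk> \<Longrightarrow> cong_mod I a c"
proof -
  assume ab: "cong_mod I a b" and bc: "cong_mod I b c"
  then have "a \<ominus> c = (a \<ominus> b) \<oplus> (b \<ominus> c)"
    by (simp add: cong_mod_def minus_eq a_assoc r_neg1)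
  then show ?thesis using ab bc idealD(3)[OF I, of "a \<ominus> b" "b \<ominus> c"] by (simp add: cong_mod_def)
qed

lemma cong_mod_add: "\<lbrakk>cong_mod I a b; cong_mod I c d\<rbrakk> \<Longrightarrow> cong_mod I (a \<oplus> c) (b \<oplus> d)"
proof -
  assume ab: "cong_mod I a b" and cd: "cong_mod I c d"
  then have "(a \<oplus> c) \<ominus> (b \<oplus> d) = (a \<ominus> b) \<oplus> (c \<ominus> d)"
    by (simp add: cong_mod_def minus_eq minus_add a_ac)
  then show ?thesis using ab cd idealD(3)[OF I, of "a \<ominus> b" "c \<ominus> d"] by (simp add: cong_mod_def)
qed

lemma cong_mod_mult: "\<lbrakk>cong_mod I a b; cong_mod I c d\<rbrakk> \<Longrightarrow> cong_mod I (a \<otimes> c) (b \<otimes> d)"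
proof -
  assume ab: "cong_mod I a b" and cd: "cong_mod I c d"
  then have "(a \<otimes> c) \<ominus> (b \<otimes> d) = (a \<ominus> b) \<otimes> c \<oplus> b \<otimes> (c \<ominus> d)"
    by (simp add: cong_mod_def minus_eq l_distr r_distr l_minus r_minus a_assoc r_neg1)
  then show ?thesis
    using ab cd idealD(3)[OF I, of "(a \<ominus> b) \<otimes> c" "b \<otimes> (c \<ominus> d)"]
      idealD(6)[OF I, of "c \<ominus> d" b] idealD(7)[OF I, of "a \<ominus> b" c]
    by (simp add: cong_mod_def)
qed

lemma cong_mod_uminus: "cong_mod I a b \<Longrightarrow> cong_mod I (\<ominus> a) (\<ominus> b)"
  using cong_mod_mult[OF cong_mod_refl[of "\<ominus> \<one>"], of a b] cong_mod_carrier[of I a b]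
  by (simp add: l_minus)

lemma cong_mod_minus: "\<lbrakk>cong_mod I a b; cong_mod I c d\<rbrakk> \<Longrightarrow> cong_mod I (a \<ominus> c) (b \<ominus> d)"
  by (simp add: minus_eq cong_mod_add cong_mod_uminus)

lemma cong_mod_zero: "cong_mod I a \<zero> \<longleftrightarrow> a \<in> I"
  using idealD(1)[OF I] by (auto simp: cong_mod_def minus_eq)

lemma cong_mod_mem: "cong_mod I a b \<Longrightarrow> a \<in> I \<longleftrightarrow> b \<in> I"
  using cong_mod_trans cong_mod_sym cong_mod_zero by meson

end

definition nc_prime :: "'a set \<Rightarrow> bool"
  where "nc_prime I \<longleftrightarrow> ideal I R \<and> \<one> \<notin> I \<and>
    (\<forall>a\<in>carrier R. \<forall>b\<in>carrier R. (\<forall>c\<in>carrier R. a \<otimes> c \<otimes> b \<in> I) \<longrightarrow> a \<in> I \<or> b \<in> I)"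

lemma nc_primeD:
  assumes "nc_prime I"
  shows "ideal I R" "\<one> \<notin> I"
    "\<lbrakk>a \<in> carrier R; b \<in> carrier R; \<And>c. c \<in> carrier R \<Longrightarrow> a \<otimes> c \<otimes> b \<in> I\<rbrakk> \<Longrightarrow> a \<in> I \<or> b \<in> I"
  using assms by (auto simp: nc_prime_def)

text \<open>Zorn's lemma downwards. The intersection of a chain of primes is prime: if
  \<open>a\<close> is missing from one member and \<open>b\<close> from another, the smaller of the
  two misses both.\<close>

lemma nc_prime_minimal:
  assumes I: "nc_prime I" "P \<subseteq> I"
  shows "\<exists>p. nc_prime p \<and> P \<subseteq> p \<and> p \<subseteq> I \<and> (\<forall>q. nc_prime q \<and> P \<subseteq> q \<and> q \<subseteq> p \<longrightarrow> q = p)"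
proof -
  define \<F> where "\<F> = {p. nc_prime p \<and> P \<subseteq> p \<and> p \<subseteq> I}"
  have "\<exists>m\<in>\<F>. \<forall>a\<in>\<F>. a \<subseteq> m \<longrightarrow> a = m"
  proof (rule predicate_Zorn)
    show "partial_order_on \<F> (relation_of (\<lambda>a b. b \<subseteq> a) \<F>)"
      by (rule partial_order_on_relation_ofI) auto
    fix C assume C: "C \<in> Chains (relation_of (\<lambda>a b. b \<subseteq> a) \<F>)"
    then have CF: "C \<subseteq> \<F>" and lin: "\<And>p q. \<lbrakk>p \<in> C; q \<in> C\<rbrakk> \<Longrightarrow> p \<subseteq> q \<or> q \<subseteq> p"
      by (auto simp: Chains_def relation_of_def)
    show "\<exists>u\<in>\<F>. \<forall>a\<in>C. u \<subseteq> a"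
    proof (cases "C = {}")
      case True
      then show ?thesis using I by (auto simp: \<F>_def)
    next
      case False
      have pr: "nc_prime p" "P \<subseteq> p" "p \<subseteq> I" if "p \<in> C" for p
        using CF that by (auto simp: \<F>_def)
      have "ideal (\<Inter>C) R" using nc_primeD(1)[OF pr(1)] False by (intro i_Intersect) auto
      moreover have "\<one> \<notin> \<Inter>C" using False nc_primeD(2)[OF pr(1)] by auto
      moreover have "a \<in> \<Inter>C \<or> b \<in> \<Inter>C"
        if ab: "a \<in> carrier R" "b \<in> carrier R" "\<forall>c\<in>carrier R. a \<otimes> c \<otimes> b \<in> \<Inter>C" for a b
      proof (rule ccontr)
        assume "\<not> (a \<in> \<Inter>C \<or> b \<in> \<Inter>C)"
        then obtain p q where pq: "p \<in> C" "q \<in> C" "a \<notin> p" "b \<notin> q" by auto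
        obtain r where r: "r \<in> C" "a \<notin> r" "b \<notin> r"
          using lin[OF pq(1,2)] pq by (meson subsetD)
        then show False using nc_primeD(3)[OF pr(1)[OF r(1)] ab(1,2)] ab(3) by auto
      qed
      ultimately have "nc_prime (\<Inter>C)" unfolding nc_prime_def by (intro conjI ballI impI)
      obtain p where p: "p \<in> C" using False by (meson all_not_in_conv)
      have "\<Inter>C \<subseteq> p" using p by (rule Inter_lower)
      also have "p \<subseteq> I" using p by (rule pr(3))
      finally have "\<Inter>C \<in> \<F>"
        using \<open>nc_prime (\<Inter>C)\<close> Inter_greatest[of C P, OF pr(2)] by (simp add: \<F>_def)
      moreover have "\<forall>a\<in>C. \<Inter>C \<subseteq> a" by (intro ballI Inter_lower)
      ultimately show ?thesis by (rule bexI[rotated])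
    qed
  qed
  then obtain m where m: "m \<in> \<F>" "\<forall>a\<in>\<F>. a \<subseteq> m \<longrightarrow> a = m" by (elim bexE)
  have "q = m" if "nc_prime q \<and> P \<subseteq> q \<and> q \<subseteq> m" for q
  proof -
    have "q \<in> \<F>" using that m(1) unfolding \<F>_def by (simp add: order_trans[of q m I])
    then show ?thesis using m(2) that by simp
  qed
  then show ?thesis using m(1) unfolding \<F>_def by (intro exI[of _ m]) simp
qed

end

section \<open>Derivations and prime ideals in characteristic zero\<close>

locale diff_ring = complex_scalars A sc for A (structure) and sc +
  fixes K :: "'a set" and Ham :: "'x set" and H :: "'x \<Rightarrow> 'a \<Rightarrow> 'a"
  assumes K_carrier: "a \<in> K \<Longrightarrow> a \<in> carrier A"
    and K_sc: "sc c \<in> K"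
    and K_add: "\<lbrakk>a \<in> K; b \<in> K\<rbrakk> \<Longrightarrow> a \<oplus> b \<in> K"
    and K_mult: "\<lbrakk>a \<in> K; b \<in> K\<rbrakk> \<Longrightarrow> a \<otimes> b \<in> K"
    and K_central: "\<lbrakk>k \<in> K; a \<in> carrier A\<rbrakk> \<Longrightarrow> a \<otimes> k = k \<otimes> a"
    and H_closed: "\<lbrakk>x \<in> Ham; a \<in> carrier A\<rbrakk> \<Longrightarrow> H x a \<in> carrier A"
    and H_add: "\<lbrakk>x \<in> Ham; a \<in> carrier A; b \<in> carrier A\<rbrakk> \<Longrightarrow> H x (a \<oplus> b) = H x a \<oplus> H x b"
    and H_mult: "\<lbrakk>x \<in> Ham; a \<in> carrier A; b \<in> carrier A\<rbrakk> \<Longrightarrow>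
      H x (a \<otimes> b) = H x a \<otimes> b \<oplus> a \<otimes> H x b"
    and H_sc: "\<lbrakk>x \<in> Ham; a \<in> carrier A\<rbrakk> \<Longrightarrow> H x (sc c \<otimes> a) = sc c \<otimes> H x a"
    and H_K: "\<lbrakk>x \<in> Ham; a \<in> K\<rbrakk> \<Longrightarrow> H x a \<in> K"
begin

lemma K_zero: "\<zero> \<in> K" and K_one: "\<one> \<in> K"
  using K_sc[of 0] K_sc[of 1] by (simp_all add: sc_zero sc_one)

lemma K_uminus: "a \<in> K \<Longrightarrow> \<ominus> a \<in> K"
  using K_mult[OF K_sc[of "-1"]] K_carrier by (force simp: sc_uminus sc_one l_minus)

lemma K_minus: "\<lbrakk>a \<in> K; b \<in> K\<rbrakk> \<Longrightarrow> a \<ominus> b \<in> K"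
  by (simp add: minus_eq K_add K_uminus)

lemma H_additive: "x \<in> Ham \<Longrightarrow> additive_op A (H x)"
  by (simp add: additive_op_def H_closed H_add)

lemmas H_simps = additive_opD[OF H_additive]
lemmas H_pow = additive_opD[OF additive_op_pow[OF H_additive]]

lemma H_pow_Suc: "(H x ^^ Suc n) a = (H x ^^ n) (H x a)"
  by (simp add: funpow_swap1)

definition ham_stable :: "'a set \<Rightarrow> bool"
  where "ham_stable J \<longleftrightarrow> (\<forall>x\<in>Ham. \<forall>a\<in>J. H x a \<in> J)"

text \<open>Only one term of the Leibniz expansion of the power of a derivation survives modulo \<open>I\<close>.\<close>

lemma leibniz_leading_term:
  assumes x: "x \<in> Ham" and I: "ideal I A"
    and "a \<in> carrier A" "b \<in> carrier A"
    and "\<And>i. i < n \<Longrightarrow> (H x ^^ i) a \<in> I" "\<And>i. i < m \<Longrightarrow> (H x ^^ i) b \<in> I"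
  shows "\<exists>k>0. cong_mod I ((H x ^^ (n + m)) (a \<otimes> b))
    (sc (of_nat k) \<otimes> ((H x ^^ n) a \<otimes> (H x ^^ m) b))"
  using assms(3-)
proof (induction "n + m" arbitrary: n m a b)
  case 0
  then show ?case by (intro exI[of _ 1]) (simp add: sc_one cong_mod_refl[OF I])
next
  case (Suc N)
  note ab = Suc.prems(1,2)
  have Hab: "H x a \<in> carrier A" "H x b \<in> carrier A" using ab x by (simp_all add: H_closed)
  let ?t = "(H x ^^ n) a \<otimes> (H x ^^ m) b"
  have t: "?t \<in> carrier A" using ab x by (simp add: H_pow)
  have split: "(H x ^^ (n + m)) (a \<otimes> b) =
      (H x ^^ N) (H x a \<otimes> b) \<oplus> (H x ^^ N) (a \<otimes> H x b)"
    unfolding Suc.hyps(2)[symmetric] H_pow_Suc using ab Hab x by (simp add: H_mult H_pow)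
  have Ha: "(H x ^^ i) (H x a) \<in> I" if "Suc i < n" for i
    using Suc.prems(3)[OF that] unfolding H_pow_Suc .
  have Hb: "(H x ^^ i) (H x b) \<in> I" if "Suc i < m" for i
    using Suc.prems(4)[OF that] unfolding H_pow_Suc .
  \<comment> \<open>One half of Pascal's rule. For \<open>n = 0\<close> the coefficient may be zero:
    the term then has the factor \<open>(H x ^^ m') b\<close> with \<open>m'\<close> smaller than
    \<open>m\<close>, which lies in \<open>I\<close>.\<close>
  have left: "\<exists>k. (0 < n \<longrightarrow> 0 < k) \<and>
      cong_mod I ((H x ^^ N) (H x a \<otimes> b)) (sc (of_nat k) \<otimes> ?t)"
  proof (cases n)
    case (Suc n')
    have "\<exists>k>0. cong_mod I ((H x ^^ (n' + m)) (H x a \<otimes> b))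
        (sc (of_nat k) \<otimes> ((H x ^^ n') (H x a) \<otimes> (H x ^^ m) b))"
      using Suc.hyps(2) Suc Hab ab Ha Suc.prems(4) by (intro Suc.hyps(1)) auto
    then show ?thesis using Suc.hyps(2) Suc unfolding Suc H_pow_Suc by auto
  next
    case 0
    then obtain m' where m: "m = Suc m'" using Suc.hyps(2) by (cases m) auto
    have "\<exists>k>0. cong_mod I ((H x ^^ (0 + m')) (H x a \<otimes> b))
        (sc (of_nat k) \<otimes> ((H x ^^ 0) (H x a) \<otimes> (H x ^^ m') b))"
      using Suc.hyps(2) 0 m Hab ab Suc.prems(4) by (intro Suc.hyps(1)) auto
    moreover have "(H x ^^ m') b \<in> I" using Suc.prems(4) m by simp
    ultimately have "(H x ^^ N) (H x a \<otimes> b) \<in> I"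
      using Suc.hyps(2) 0 m Hab idealD(6)[OF I] cong_mod_mem[OF I] by auto
    then show ?thesis using t 0 cong_mod_zero[OF I] by (intro exI[of _ 0]) (simp add: sc_zero)
  qed
  have right: "\<exists>k. (0 < m \<longrightarrow> 0 < k) \<and>
      cong_mod I ((H x ^^ N) (a \<otimes> H x b)) (sc (of_nat k) \<otimes> ?t)"
  proof (cases m)
    case (Suc m')
    have "\<exists>k>0. cong_mod I ((H x ^^ (n + m')) (a \<otimes> H x b))
        (sc (of_nat k) \<otimes> ((H x ^^ n) a \<otimes> (H x ^^ m') (H x b)))"
      using Suc.hyps(2) Suc Hab ab Hb Suc.prems(3) by (intro Suc.hyps(1)) auto
    then show ?thesis using Suc.hyps(2) Suc unfolding Suc H_pow_Suc by auto
  next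
    case 0
    then obtain n' where n: "n = Suc n'" using Suc.hyps(2) by (cases n) auto
    have "\<exists>k>0. cong_mod I ((H x ^^ (n' + 0)) (a \<otimes> H x b))
        (sc (of_nat k) \<otimes> ((H x ^^ n') a \<otimes> (H x ^^ 0) (H x b)))"
      using Suc.hyps(2) 0 n Hab ab Suc.prems(3) by (intro Suc.hyps(1)) auto
    moreover have "(H x ^^ n') a \<in> I" using Suc.prems(3) n by simp
    ultimately have "(H x ^^ N) (a \<otimes> H x b) \<in> I"
      using Suc.hyps(2) 0 n Hab idealD(6,7)[OF I] cong_mod_mem[OF I] by auto
    then show ?thesis using t 0 cong_mod_zero[OF I] by (intro exI[of _ 0]) (simp add: sc_zero)
  qed
  obtain k l where k: "0 < n \<longrightarrow> 0 < k" "0 < m \<longrightarrow> 0 < l"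
    "cong_mod I ((H x ^^ N) (H x a \<otimes> b)) (sc (of_nat k) \<otimes> ?t)"
    "cong_mod I ((H x ^^ N) (a \<otimes> H x b)) (sc (of_nat l) \<otimes> ?t)" using left right by blast
  have "sc (of_nat (k + l)) \<otimes> ?t = sc (of_nat k) \<otimes> ?t \<oplus> sc (of_nat l) \<otimes> ?t"
    using t by (simp add: sc_add l_distr)
  then have "cong_mod I ((H x ^^ (n + m)) (a \<otimes> b)) (sc (of_nat (k + l)) \<otimes> ?t)"
    using cong_mod_add[OF I k(3,4)] split by simp
  moreover have "0 < k + l" using k(1,2) Suc.hyps(2) by (cases n) auto
  ultimately show ?case by blast
qed

lemma sc_cancel: "\<lbrakk>ideal I A; sc c \<otimes> a \<in> I; c \<noteq> 0; a \<in> carrier A\<rbrakk> \<Longrightarrow> a \<in> I"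
proof -
  assume *: "ideal I A" "sc c \<otimes> a \<in> I" "c \<noteq> 0" "a \<in> carrier A"
  then have mem: "sc (1 / c) \<otimes> (sc c \<otimes> a) \<in> I" by (intro idealD(6)[OF *(1,2)]) auto
  have "sc (1 / c) \<otimes> sc c = \<one>" using sc_mult[of "1 / c" c] *(3) by (simp add: sc_one)
  then have eq: "sc (1 / c) \<otimes> (sc c \<otimes> a) = a"
    using *(4) m_assoc[of "sc (1 / c)" "sc c" a] by simp
  show ?thesis using mem unfolding eq .
qed

text \<open>Take the first powers \<open>n\<close> and \<open>m\<close> of \<open>H x\<close> that
  move \<open>a\<close> and \<open>b\<close> out of \<open>I\<close>. Modulo \<open>I\<close>, the
  power \<open>n + m\<close> applied to \<open>a c b\<close> is a positive integer multiple of
  \<open>(H^n a) c (H^m b)\<close>, and positive integers are invertible scalars; so the primeness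
  of \<open>I\<close> applies.\<close>

lemma nc_prime_derivation_core:
  assumes x: "x \<in> Ham" and p: "nc_prime I"
  shows "nc_prime {a \<in> carrier A. \<forall>n. (H x ^^ n) a \<in> I}" (is "nc_prime ?J")
proof -
  note I = nc_primeD(1)[OF p]
  have I_left: "(H x ^^ n) (c \<otimes> a) \<in> I"
    if "a \<in> carrier A" "\<And>i. (H x ^^ i) a \<in> I" "c \<in> carrier A" for n a c
    using that
  proof (induction n arbitrary: a c)
    case 0
    then show ?case using idealD(6)[OF I, of a c] 0(2)[of 0] by simp
  next
    case (Suc n)
    have Ha: "(H x ^^ i) (H x a) \<in> I" for i using Suc.prems(2)[of "Suc i"] unfolding H_pow_Suc .
    note car = Suc.prems(1,3) H_closed[OF x Suc.prems(1)] H_closed[OF x Suc.prems(3)]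
    have "(H x ^^ Suc n) (c \<otimes> a) = (H x ^^ n) (H x c \<otimes> a) \<oplus> (H x ^^ n) (c \<otimes> H x a)"
      unfolding H_pow_Suc H_mult[OF x car(2,1)] by (rule H_pow(2)[OF x]) (use car in simp_all)
    then show ?case
      using idealD(3)[OF I Suc.IH[OF car(1) Suc.prems(2) car(4)] Suc.IH[OF car(3) Ha car(2)]] by simp
  qed
  have I_right: "(H x ^^ n) (a \<otimes> c) \<in> I"
    if "a \<in> carrier A" "\<And>i. (H x ^^ i) a \<in> I" "c \<in> carrier A" for n a c
    using that
  proof (induction n arbitrary: a c)
    case 0
    then show ?case using idealD(7)[OF I, of a c] 0(2)[of 0] by simp
  next
    case (Suc n)
    have Ha: "(H x ^^ i) (H x a) \<in> I" for i using Suc.prems(2)[of "Suc i"] unfolding H_pow_Suc .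
    note car = Suc.prems(1,3) H_closed[OF x Suc.prems(1)] H_closed[OF x Suc.prems(3)]
    have "(H x ^^ Suc n) (a \<otimes> c) = (H x ^^ n) (H x a \<otimes> c) \<oplus> (H x ^^ n) (a \<otimes> H x c)"
      unfolding H_pow_Suc H_mult[OF x car(1,2)] by (rule H_pow(2)[OF x]) (use car in simp_all)
    then show ?case
      using idealD(3)[OF I Suc.IH[OF car(3) Ha car(2)] Suc.IH[OF car(1) Suc.prems(2) car(4)]] by simp
  qed
  have "ideal ?J A"
  proof (rule two_sided_idealI)
    show "?J \<subseteq> carrier A" by (rule Collect_restrict)
    show "\<zero> \<in> ?J" using H_pow(3)[OF x] idealD(2)[OF I] by simp
    show "a \<oplus> b \<in> ?J" if "a \<in> ?J" "b \<in> ?J" for a b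
    proof -
      have "(H x ^^ n) (a \<oplus> b) \<in> I" for n
        using that H_pow(2)[OF x, of a b n] idealD(3)[OF I, of "(H x ^^ n) a" "(H x ^^ n) b"] by simp
      then show ?thesis using that by simp
    qed
    show "c \<otimes> a \<in> ?J" if "a \<in> ?J" "c \<in> carrier A" for a c
      using that I_left[of a c] by simp
    show "a \<otimes> c \<in> ?J" if "a \<in> ?J" "c \<in> carrier A" for a c
      using that I_right[of a c] by simp
  qed
  moreover have J_I: "?J \<subseteq> I"
  proof
    fix a assume "a \<in> ?J"
    then have "(H x ^^ 0) a \<in> I" by blast
    then show "a \<in> I" by simp
  qed
  moreover have "a \<in> ?J \<or> b \<in> ?J"
    if ab: "a \<in> carrier A" "b \<in> carrier A" and abJ: "\<forall>c\<in>carrier A. a \<otimes> c \<otimes> b \<in> ?J" for a b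
  proof (rule ccontr)
    assume "\<not> ?thesis"
    then have ex: "\<exists>n. (H x ^^ n) a \<notin> I" "\<exists>n. (H x ^^ n) b \<notin> I" using ab by simp_all
    define n m where "n = (LEAST n. (H x ^^ n) a \<notin> I)" and "m = (LEAST n. (H x ^^ n) b \<notin> I)"
    have n: "(H x ^^ n) a \<notin> I" unfolding n_def by (rule LeastI_ex[OF ex(1)])
    have less_n: "(H x ^^ i) a \<in> I" if "i < n" for i
      using not_less_Least[OF that[unfolded n_def]] by simp
    have m: "(H x ^^ m) b \<notin> I" unfolding m_def by (rule LeastI_ex[OF ex(2)])
    have less_m: "(H x ^^ i) b \<in> I" if "i < m" for i
      using not_less_Least[OF that[unfolded m_def]] by simp
    have "(H x ^^ n) a \<otimes> c \<otimes> (H x ^^ m) b \<in> I" if c: "c \<in> carrier A" for c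
    proof -
      \<comment> \<open>A first application with the power zero on \<open>c\<close>: up to a
        positive factor, \<open>c\<close> can be pulled out of the leading term of
        \<open>c b\<close>.\<close>
      have cb: "\<exists>k>0. cong_mod I ((H x ^^ i) (c \<otimes> b)) (sc (of_nat k) \<otimes> (c \<otimes> (H x ^^ i) b))"
        if "i \<le> m" for i
      proof -
        have "(H x ^^ j) b \<in> I" if "j < i" for j
          by (rule less_m) (use that \<open>i \<le> m\<close> in simp)
        then show ?thesis using leibniz_leading_term[OF x I c ab(2), of 0 i] by simp
      qed
      have small: "(H x ^^ i) (c \<otimes> b) \<in> I" if lt: "i < m" for i
      proof -
        obtain k where k: "cong_mod I ((H x ^^ i) (c \<otimes> b)) (sc (of_nat k) \<otimes> (c \<otimes> (H x ^^ i) b))"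
          using cb[OF less_imp_le[OF lt]] by meson
        have "sc (of_nat k) \<otimes> (c \<otimes> (H x ^^ i) b) \<in> I"
          using idealD(6)[OF I idealD(6)[OF I less_m[OF lt] c] sc_closed] .
        then show ?thesis using cong_mod_mem[OF I k] by simp
      qed
      obtain k where k: "k > 0" "cong_mod I ((H x ^^ m) (c \<otimes> b)) (sc (of_nat k) \<otimes> (c \<otimes> (H x ^^ m) b))"
        using cb[of m] by (meson order_refl)
      obtain l where l: "l > 0" "cong_mod I ((H x ^^ (n + m)) (a \<otimes> (c \<otimes> b)))
          (sc (of_nat l) \<otimes> ((H x ^^ n) a \<otimes> (H x ^^ m) (c \<otimes> b)))"
        using leibniz_leading_term[OF x I ab(1) m_closed[OF c ab(2)] less_n small] by meson
      note car = H_pow(1)[OF x ab(1), of n] H_pow(1)[OF x ab(2), of m]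
        H_pow(1)[OF x m_closed[OF c ab(2)], of m]
      have "a \<otimes> (c \<otimes> b) \<in> ?J" using abJ c ab by (simp add: m_assoc)
      then have "(H x ^^ (n + m)) (a \<otimes> (c \<otimes> b)) \<in> I" by simp
      then have "sc (of_nat l) \<otimes> ((H x ^^ n) a \<otimes> (H x ^^ m) (c \<otimes> b)) \<in> I"
        using cong_mod_mem[OF I l(2)] by simp
      then have "(H x ^^ n) a \<otimes> (H x ^^ m) (c \<otimes> b) \<in> I"
        using l(1) car sc_cancel[OF I, of "of_nat l"] by simp
      then have "(H x ^^ n) a \<otimes> (sc (of_nat k) \<otimes> (c \<otimes> (H x ^^ m) b)) \<in> I"
        using cong_mod_mem[OF I cong_mod_mult[OF I cong_mod_refl[OF I car(1)] k(2)]] by simp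
      also have "(H x ^^ n) a \<otimes> (sc (of_nat k) \<otimes> (c \<otimes> (H x ^^ m) b)) =
          ((H x ^^ n) a \<otimes> sc (of_nat k)) \<otimes> (c \<otimes> (H x ^^ m) b)"
        using car c by (simp add: m_assoc)
      also have "\<dots> = sc (of_nat k) \<otimes> ((H x ^^ n) a \<otimes> c \<otimes> (H x ^^ m) b)"
        unfolding sc_central[OF car(1)] using car c by (simp add: m_assoc)
      finally show ?thesis using k(1) car c sc_cancel[OF I, of "of_nat k"] by simp
    qed
    then show False
      using nc_primeD(3)[OF p H_pow(1)[OF x ab(1), of n] H_pow(1)[OF x ab(2), of m]] n m by meson
  qed
  moreover have "\<one> \<notin> ?J" using nc_primeD(2)[OF p] J_I by (rule contra_subsetD[rotated])
  ultimately show ?thesis unfolding nc_prime_def by simp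
qed

text \<open>A minimal prime \<open>p\<close> over \<open>P\<close> inside \<open>I\<close> is
  stable: the elements that all powers of one derivation keep in \<open>p\<close> form a prime that
  contains \<open>P\<close>, hence all of \<open>p\<close>. As \<open>P\<close> is the largest
  stable ideal inside \<open>I\<close>, this gives \<open>p = P\<close>.\<close>

lemma nc_prime_stable_core:
  assumes I: "nc_prime I" "P \<subseteq> I" and P: "ham_stable P" "P \<subseteq> carrier A"
    and greatest: "\<And>J. \<lbrakk>ideal J A; ham_stable J; J \<subseteq> I\<rbrakk> \<Longrightarrow> J \<subseteq> P"
  shows "nc_prime P"
proof -
  obtain p where p: "nc_prime p" "P \<subseteq> p" "p \<subseteq> I"
    "\<And>q. \<lbrakk>nc_prime q; P \<subseteq> q; q \<subseteq> p\<rbrakk> \<Longrightarrow> q = p"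
    using nc_prime_minimal[OF I] by blast
  have "H x a \<in> p" if x: "x \<in> Ham" and a: "a \<in> p" for x a
  proof -
    let ?J = "{a \<in> carrier A. \<forall>n. (H x ^^ n) a \<in> p}"
    have "(H x ^^ n) u \<in> P" if "u \<in> P" for u n
      using that P(1) x by (induction n) (auto simp: ham_stable_def)
    then have "P \<subseteq> ?J" using P(2) p(2) by blast
    moreover have "?J \<subseteq> p"
    proof
      fix a assume "a \<in> ?J"
      then have "(H x ^^ 0) a \<in> p" by blast
      then show "a \<in> p" by simp
    qed
    ultimately have "?J = p" using p(4)[OF nc_prime_derivation_core[OF x p(1)]] by blast
    then have "(H x ^^ 1) a \<in> p" using a by blast
    then show ?thesis by simp
  qed
  then have "p \<subseteq> P" using greatest nc_primeD(1)[OF p(1)] p(3) by (simp add: ham_stable_def)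
  then show ?thesis using p by (metis subset_antisym)
qed

end

section \<open>Central elements in the ideals of a prime ring finite over a central subring\<close>

definition left_ideal :: "('a, 'b) ring_scheme \<Rightarrow> 'a set \<Rightarrow> bool"
  where "left_ideal R L \<longleftrightarrow> L \<subseteq> carrier R \<and> \<zero>\<^bsub>R\<^esub> \<in> L \<and>
    (\<forall>a\<in>L. \<forall>b\<in>L. a \<oplus>\<^bsub>R\<^esub> b \<in> L) \<and> (\<forall>a\<in>L. \<forall>c\<in>carrier R. c \<otimes>\<^bsub>R\<^esub> a \<in> L)"

context ring
begin

lemma left_idealD:
  assumes "left_ideal R L"
  shows "a \<in> L \<Longrightarrow> a \<in> carrier R" "\<zero> \<in> L" "\<lbrakk>a \<in> L; b \<in> L\<rbrakk> \<Longrightarrow> a \<oplus> b \<in> L"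
    "\<lbrakk>a \<in> L; c \<in> carrier R\<rbrakk> \<Longrightarrow> c \<otimes> a \<in> L" "a \<in> L \<Longrightarrow> \<ominus> a \<in> L"
proof -
  show 1: "a \<in> L \<Longrightarrow> a \<in> carrier R" and "\<zero> \<in> L" "\<lbrakk>a \<in> L; b \<in> L\<rbrakk> \<Longrightarrow> a \<oplus> b \<in> L"
    and 2: "\<lbrakk>a \<in> L; c \<in> carrier R\<rbrakk> \<Longrightarrow> c \<otimes> a \<in> L" for a b c
    using assms by (auto simp: left_ideal_def)
  show "\<ominus> a \<in> L" if "a \<in> L" for a using 2[OF that, of "\<ominus> \<one>"] 1[OF that] by (simp add: l_minus)
qed

primrec horner :: "'a \<Rightarrow> 'a list \<Rightarrow> 'a"
  where "horner u [] = \<zero>"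
  | "horner u (k # ks) = k \<oplus> horner u ks \<otimes> u"

end

locale noetherian_diff_ring = diff_ring +
  assumes noetherian: "acc_on A ((\<lambda>k a. k \<otimes> a) ` K) (carrier A)"
begin

abbreviation K_submodule :: "'a set \<Rightarrow> bool"
  where "K_submodule N \<equiv> op_subgroup A ((\<lambda>k a. k \<otimes> a) ` K) N"

lemma K_submoduleI:
  assumes "N \<subseteq> carrier A" "\<zero> \<in> N" "\<And>u v. \<lbrakk>u \<in> N; v \<in> N\<rbrakk> \<Longrightarrow> u \<oplus> v \<in> N"
    and "\<And>k u. \<lbrakk>k \<in> K; u \<in> N\<rbrakk> \<Longrightarrow> k \<otimes> u \<in> N"
  shows "K_submodule N"
proof (rule op_subgroupI)
  show "\<ominus> u \<in> N" if "u \<in> N" for u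
  proof -
    have "u \<in> carrier A" using assms(1) that by (rule subsetD)
    then show ?thesis using assms(4)[OF K_uminus[OF K_one] that] by (simp add: l_minus)
  qed
  show "\<phi> u \<in> N" if "\<phi> \<in> (\<lambda>k a. k \<otimes> a) ` K" "u \<in> N" for \<phi> u
    using that(1) by (rule imageE) (simp add: assms(4) that(2))
qed (use assms(1-3) in simp_all)

lemma maximal_K_submodule:
  assumes "K0 \<in> \<F>" "\<And>N. N \<in> \<F> \<Longrightarrow> K_submodule N"
  shows "\<exists>N\<in>\<F>. \<forall>N'\<in>\<F>. N \<subseteq> N' \<longrightarrow> N' = N"
proof (rule acc_on_maximal[OF noetherian assms(1)])
  show "K_submodule N \<and> N \<subseteq> carrier A" if "N \<in> \<F>" for N
    using assms(2)[OF that] by (simp add: op_subgroup_def)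
qed

section \<open>Integrality over the central subring\<close>

context
  fixes u assumes u: "u \<in> carrier A"
begin

lemma horner_closed: "set ks \<subseteq> K \<Longrightarrow> horner u ks \<in> carrier A"
  by (induction ks) (use u K_carrier in simp_all)

lemma horner_commute: "set ks \<subseteq> K \<Longrightarrow> u \<otimes> horner u ks = horner u ks \<otimes> u"
proof (induction ks)
  case (Cons k ks)
  then have "k \<in> K" "horner u ks \<in> carrier A" using horner_closed by simp_all
  then show ?case
    using Cons K_carrier[of k] u K_central[of k u] m_assoc[of u "horner u ks" u]
    by (simp add: r_distr l_distr)
qed (use u in simp)

lemma horner_snoc:
  "\<lbrakk>set ks \<subseteq> K; k \<in> K\<rbrakk> \<Longrightarrow> horner u (ks @ [k]) = horner u ks \<oplus> k \<otimes> u [^] length ks"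
proof (induction ks)
  case Nil
  then show ?case using u K_carrier[of k] by simp
next
  case (Cons k' ks)
  then have "k' \<in> carrier A" "k \<in> carrier A" "horner u ks \<in> carrier A"
    using horner_closed K_carrier by simp_all
  then show ?case using Cons u by (simp add: l_distr a_assoc m_assoc)
qed

private primrec power_span :: "nat \<Rightarrow> 'a set"
  where "power_span 0 = {\<zero>}"
  | "power_span (Suc n) = {k \<oplus> v \<otimes> u | k v. k \<in> K \<and> v \<in> power_span n}"

private lemma power_span_SucI: "\<lbrakk>k \<in> K; v \<in> power_span n\<rbrakk> \<Longrightarrow> k \<oplus> v \<otimes> u \<in> power_span (Suc n)"
  by auto

private lemma power_span_submodule: "K_submodule (power_span n)"
proof (induction n)
  case 0
  show ?case by (rule K_submoduleI) (use K_carrier in auto)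
next
  case (Suc n)
  note S = op_subgroupD[OF Suc]
  show ?case
  proof (rule K_submoduleI)
    show "power_span (Suc n) \<subseteq> carrier A" using S(1) K_carrier u by auto
    have "\<zero> \<oplus> \<zero> \<otimes> u \<in> power_span (Suc n)" using S(2) K_zero by (intro power_span_SucI)
    then show "\<zero> \<in> power_span (Suc n)" using u by simp
  next
    fix a b assume "a \<in> power_span (Suc n)" "b \<in> power_span (Suc n)"
    then obtain k v l w where *: "k \<in> K" "v \<in> power_span n" "a = k \<oplus> v \<otimes> u"
      "l \<in> K" "w \<in> power_span n" "b = l \<oplus> w \<otimes> u" by auto
    then have "a \<oplus> b = (k \<oplus> l) \<oplus> (v \<oplus> w) \<otimes> u"
      using K_carrier[of k] K_carrier[of l] S(1)[of v] S(1)[of w] u by (simp add: l_distr a_ac)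
    then show "a \<oplus> b \<in> power_span (Suc n)"
      using power_span_SucI[OF K_add[OF *(1,4)] S(5)[OF *(2,5)]] by simp
  next
    fix c a assume c: "c \<in> K" and "a \<in> power_span (Suc n)"
    then obtain k v where *: "k \<in> K" "v \<in> power_span n" "a = k \<oplus> v \<otimes> u" by auto
    then have "c \<otimes> a = (c \<otimes> k) \<oplus> (c \<otimes> v) \<otimes> u"
      using K_carrier[of k] K_carrier[OF c] S(1)[of v] u by (simp add: r_distr m_assoc)
    moreover have "c \<otimes> v \<in> power_span n" using S(6)[OF imageI[OF c] *(2)] .
    ultimately show "c \<otimes> a \<in> power_span (Suc n)"
      using power_span_SucI[OF K_mult[OF c *(1)]] by simp
  qed
qed

private lemma power_span_Suc: "power_span n \<subseteq> power_span (Suc n)"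
proof (induction n)
  case 0
  have "\<zero> \<oplus> \<zero> \<otimes> u \<in> power_span (Suc 0)" using K_zero by (intro power_span_SucI) simp_all
  then show ?case using u by simp
next
  case (Suc n)
  then show ?case by auto
qed

private lemma power_mem_span: "u [^] n \<in> power_span (Suc n)"
proof (induction n)
  case 0
  have "\<one> \<oplus> \<zero> \<otimes> u \<in> power_span (Suc 0)" using K_one by (intro power_span_SucI) simp_all
  then show ?case using u by simp
next
  case (Suc n)
  then have "\<zero> \<oplus> u [^] n \<otimes> u \<in> power_span (Suc (Suc n))"
    using K_zero by (intro power_span_SucI)
  then show ?case using u by simp
qed

private lemma power_span_horner:
  "v \<in> power_span n \<Longrightarrow> \<exists>ks. set ks \<subseteq> K \<and> length ks = n \<and> v = horner u ks"
proof (induction n arbitrary: v)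
  case 0
  then show ?case by simp
next
  case (Suc n)
  then obtain k w where *: "k \<in> K" "w \<in> power_span n" "v = k \<oplus> w \<otimes> u" by auto
  obtain ks where "set ks \<subseteq> K" "length ks = n" "w = horner u ks" using Suc.IH[OF *(2)] by blast
  then show ?case using * by (intro exI[of _ "k # ks"]) simp
qed

text \<open>The \<open>K\<close>-modules spanned by \<open>1, u, ..., u^(n-1)\<close> stabilise, so
  some \<open>u^n\<close> lies in the span of the lower powers. The appended unit makes the relation
  monic, which later supplies a coefficient outside \<open>P\<close>.\<close>

lemma integral_relation: "\<exists>ks. set ks \<subseteq> K \<and> horner u (ks @ [\<one>]) = \<zero>"
proof -
  have "\<exists>n. \<forall>i\<ge>n. power_span i = power_span n"
    by (rule acc_onD[where K = power_span, OF noetherian power_span_submodule _ power_span_Suc])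
      (use power_span_submodule in \<open>simp add: op_subgroup_def\<close>)
  then obtain n where "power_span (Suc n) = power_span n" by (meson le_SucI order_refl)
  then have "\<ominus> (u [^] n) \<in> power_span n"
    using power_mem_span[of n] op_subgroupD(4)[OF power_span_submodule] by simp
  then obtain ks where "set ks \<subseteq> K" "length ks = n" "\<ominus> (u [^] n) = horner u ks"
    using power_span_horner by blast
  then show ?thesis
    using horner_snoc[of ks \<one>] K_one u by (intro exI[of _ ks]) (metis l_neg l_one nat_pow_closed)
qed

end

section \<open>Idempotents of the localisation at the central elements outside a prime\<close>

context
  fixes P assumes P: "nc_prime P"
begin

text \<open>\<open>z\<close> is central, so \<open>z c a = c (z a)\<close> lies in \<open>P\<close>
  for every \<open>c\<close>, and primeness applies.\<close>

lemma K_cancel: "\<lbrakk>z \<in> K; z \<notin> P; a \<in> carrier A; z \<otimes> a \<in> P\<rbrakk> \<Longrightarrow> a \<in> P"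
proof -
  assume *: "z \<in> K" "z \<notin> P" "a \<in> carrier A" "z \<otimes> a \<in> P"
  have "z \<otimes> c \<otimes> a \<in> P" if c: "c \<in> carrier A" for c
  proof -
    have "z \<otimes> c \<otimes> a = c \<otimes> (z \<otimes> a)"
      using K_central[OF *(1) c] K_carrier[OF *(1)] c *(3) m_assoc[of c z a] by simp
    then show ?thesis using idealD(6)[OF nc_primeD(1)[OF P] *(4) c] by simp
  qed
  then show ?thesis using nc_primeD(3)[OF P K_carrier[OF *(1)] *(3)] *(2) by simp
qed

lemma K_prime: "\<lbrakk>z \<in> K; z \<notin> P; y \<in> K; y \<notin> P\<rbrakk> \<Longrightarrow> z \<otimes> y \<notin> P"
  using K_cancel K_carrier by metis

text \<open>Coefficients in \<open>P\<close> at the low end are dropped: \<open>reg\<close> divides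
  the remaining relation by one power of \<open>u\<close>. The first coefficient \<open>k\<close>
  outside \<open>P\<close> gives \<open>k u = - v u u\<close> modulo \<open>P\<close>, so
  \<open>w\<close> is \<open>- v\<close> and \<open>z\<close> is \<open>k\<close>; after inverting
  \<open>z\<close>, the element \<open>u\<close> becomes strongly regular.\<close>

lemma relation_splits:
  assumes u: "u \<in> carrier A" and reg: "\<And>b. \<lbrakk>b \<in> carrier A; b \<otimes> u \<otimes> u \<in> P\<rbrakk> \<Longrightarrow> b \<otimes> u \<in> P"
    and "set ks \<subseteq> K" "\<exists>k\<in>set ks. k \<notin> P" "horner u ks \<otimes> u \<in> P"
  shows "\<exists>w\<in>carrier A. \<exists>z\<in>K. z \<notin> P \<and> u \<otimes> w = w \<otimes> u \<and> cong_mod P (w \<otimes> u \<otimes> u) (z \<otimes> u)"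
  using assms(3-5)
proof (induction ks)
  case (Cons k ks)
  note I = nc_primeD(1)[OF P]
  have k: "k \<in> K" "k \<in> carrier A" and ks: "set ks \<subseteq> K" using Cons.prems(1) K_carrier by simp_all
  define v where "v = horner u ks"
  have v: "v \<in> carrier A" "u \<otimes> v = v \<otimes> u" unfolding v_def
    using horner_closed[OF u ks] horner_commute[OF u ks] by simp_all
  have rel: "k \<otimes> u \<oplus> v \<otimes> u \<otimes> u \<in> P"
    using Cons.prems(3) u v k by (simp add: v_def[symmetric] l_distr)
  show ?case
  proof (cases "k \<in> P")
    case True
    have "(k \<otimes> u \<oplus> v \<otimes> u \<otimes> u) \<ominus> k \<otimes> u \<in> P"
      using idealD(4)[OF I rel idealD(7)[OF I True u]] .
    moreover have "(k \<otimes> u \<oplus> v \<otimes> u \<otimes> u) \<ominus> k \<otimes> u = v \<otimes> u \<otimes> u"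
      using u v k by (simp add: minus_eq a_ac r_neg1 r_neg2 r_neg)
    ultimately have "v \<otimes> u \<in> P" using reg[OF v(1)] by simp
    then show ?thesis using Cons.IH[OF ks] Cons.prems(2) True by (simp add: v_def)
  next
    case False
    have "(\<ominus> v) \<otimes> u \<otimes> u \<ominus> k \<otimes> u = \<ominus> (k \<otimes> u \<oplus> v \<otimes> u \<otimes> u)"
      using u v k by (simp add: l_minus minus_eq minus_add a_comm)
    then have "cong_mod P ((\<ominus> v) \<otimes> u \<otimes> u) (k \<otimes> u)"
      using idealD(5)[OF I rel] u v k by (simp add: cong_mod_def)
    moreover have "u \<otimes> (\<ominus> v) = (\<ominus> v) \<otimes> u" using u v by (simp add: l_minus r_minus)
    ultimately show ?thesis using False k v by (intro bexI[of _ "\<ominus> v"] bexI[of _ k]) simp_all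
  qed
qed simp

text \<open>An idempotent of the localisation of \<open>A/P\<close> at \<open>K - P\<close>, written as \<open>e/z\<close>.\<close>

definition quasi_idempotent :: "'a \<Rightarrow> 'a \<Rightarrow> bool"
  where "quasi_idempotent e z \<longleftrightarrow>
    e \<in> carrier A \<and> z \<in> K \<and> z \<notin> P \<and> cong_mod P (e \<otimes> e) (z \<otimes> e)"

text \<open>Choose \<open>x\<close> in \<open>L\<close> outside \<open>P\<close> with maximal left
  annihilator modulo \<open>P\<close>, then \<open>c\<close> with \<open>x c x\<close> outside
  \<open>P\<close>, and put \<open>u = c x\<close>. By maximality \<open>x u\<close> has the same
  annihilator as \<open>x\<close>, so \<open>b u u\<close> in \<open>P\<close> implies
  \<open>b u\<close> in \<open>P\<close>. The integral relation of \<open>u\<close> therefore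
  splits, and \<open>e = w u\<close> satisfies \<open>e e = w w u u = z e\<close> modulo
  \<open>P\<close>.\<close>

lemma quasi_idempotent_exists:
  assumes L: "left_ideal A L" and nz: "\<not> L \<subseteq> P"
  shows "\<exists>e\<in>L. \<exists>z. quasi_idempotent e z \<and> e \<notin> P"
proof -
  note I = nc_primeD(1)[OF P] and LD = left_idealD[OF L]
  define Ann where "Ann x = {a \<in> carrier A. a \<otimes> x \<in> P}" for x
  have Ann: "K_submodule (Ann x)" if x: "x \<in> carrier A" for x
  proof (rule K_submoduleI)
    show "k \<otimes> a \<in> Ann x" if "k \<in> K" "a \<in> Ann x" for k a
      using that K_carrier[of k] x idealD(6)[OF I, of "a \<otimes> x" k] by (simp add: Ann_def m_assoc)
  qed (use x idealD(2,3)[OF I] in \<open>simp_all add: Ann_def Collect_restrict l_distr\<close>)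
  obtain x0 where "x0 \<in> L" "x0 \<notin> P" using nz by (meson subsetI)
  then have "Ann x0 \<in> Ann ` (L - P)" by simp
  then have "\<exists>N\<in>Ann ` (L - P). \<forall>N'\<in>Ann ` (L - P). N \<subseteq> N' \<longrightarrow> N' = N"
    by (rule maximal_K_submodule) (use Ann LD(1) in auto)
  then obtain x where x: "x \<in> L" "x \<notin> P" "\<And>y. \<lbrakk>y \<in> L; y \<notin> P; Ann x \<subseteq> Ann y\<rbrakk> \<Longrightarrow> Ann y = Ann x"
    by (elim bexE imageE) (metis DiffD1 DiffD2 DiffI imageI)
  note xA = LD(1)[OF x(1)]
  obtain c where c: "c \<in> carrier A" "x \<otimes> c \<otimes> x \<notin> P"
    using nc_primeD(3)[OF P xA xA] x(2) by meson
  define u where "u = c \<otimes> x"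
  have u: "u \<in> L" "u \<in> carrier A" using LD(4)[OF x(1) c(1)] LD(1) by (simp_all add: u_def)
  have xu: "x \<otimes> u = x \<otimes> c \<otimes> x" using xA c by (simp add: u_def m_assoc)
  have "Ann x \<subseteq> Ann (x \<otimes> u)"
  proof
    fix a assume "a \<in> Ann x"
    then show "a \<in> Ann (x \<otimes> u)"
      using idealD(7)[OF I, of "a \<otimes> x" u] xA u by (simp add: Ann_def m_assoc)
  qed
  then have Ann_xu: "Ann (x \<otimes> u) = Ann x"
    using x(3) LD(4)[OF u(1) xA] c(2) xu by simp
  have reg: "b \<otimes> u \<in> P" if b: "b \<in> carrier A" "b \<otimes> u \<otimes> u \<in> P" for b
  proof -
    have "(b \<otimes> c) \<otimes> (x \<otimes> u) = b \<otimes> u \<otimes> u" using b c xA u by (simp add: u_def m_assoc)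
    then have "b \<otimes> c \<in> Ann (x \<otimes> u)" using b c by (simp add: Ann_def)
    then show ?thesis using b c xA by (simp add: Ann_xu) (simp add: Ann_def u_def m_assoc)
  qed
  have uP: "u \<notin> P" using idealD(6)[OF I, of u x] c xA xu by auto
  obtain ks where ks: "set ks \<subseteq> K" "horner u (ks @ [\<one>]) = \<zero>" using integral_relation[OF u(2)] by blast
  have "\<exists>w\<in>carrier A. \<exists>z\<in>K. z \<notin> P \<and> u \<otimes> w = w \<otimes> u \<and> cong_mod P (w \<otimes> u \<otimes> u) (z \<otimes> u)"
  proof (rule relation_splits[OF u(2) reg])
    show "set (ks @ [\<one>]) \<subseteq> K" using ks K_one by simp
    show "\<exists>k\<in>set (ks @ [\<one>]). k \<notin> P" using nc_primeD(2)[OF P] by simp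
    show "horner u (ks @ [\<one>]) \<otimes> u \<in> P" using ks(2) u idealD(2)[OF I] by simp
  qed
  then obtain w z where wz: "w \<in> carrier A" "z \<in> K" "z \<notin> P" "u \<otimes> w = w \<otimes> u"
    "cong_mod P (w \<otimes> u \<otimes> u) (z \<otimes> u)" by blast
  note zA = K_carrier[OF wz(2)]
  define e where "e = w \<otimes> u"
  have e: "e \<in> L" "e \<in> carrier A" using LD(4)[OF u(1) wz(1)] LD(1) by (simp_all add: e_def)
  have "e \<otimes> e = w \<otimes> (u \<otimes> w) \<otimes> u" using wz(1) u by (simp add: e_def m_assoc)
  also have "\<dots> = w \<otimes> (w \<otimes> u \<otimes> u)" using wz(1) u by (simp add: wz(4) m_assoc)
  finally have ee: "e \<otimes> e = w \<otimes> (w \<otimes> u \<otimes> u)" .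
  have "w \<otimes> (z \<otimes> u) = z \<otimes> e"
    using wz(1) zA u K_central[OF wz(2,1)] m_assoc[of w z u] m_assoc[of z w u] by (simp add: e_def)
  then have "cong_mod P (e \<otimes> e) (z \<otimes> e)"
    unfolding ee using cong_mod_mult[OF I cong_mod_refl[OF I wz(1)] wz(5)] by simp
  moreover have "e \<notin> P"
  proof
    assume "e \<in> P"
    then have "w \<otimes> u \<otimes> u \<in> P" using idealD(7)[OF I _ u(2)] by (simp add: e_def)
    then have "z \<otimes> u \<in> P" using cong_mod_mem[OF I wz(5)] by simp
    then show False using K_cancel[OF wz(2,3) u(2)] uP by simp
  qed
  ultimately show ?thesis using e wz(2,3) unfolding quasi_idempotent_def by blast
qed

text \<open>Write \<open>e\<close> and \<open>g\<close> for the idempotents \<open>e/z\<close> and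
  \<open>g/y\<close> of the localisation, with \<open>g e = 0\<close>. Then
  \<open>f = e + g - e g\<close> is their join: \<open>e f = e\<close> and \<open>g f = g\<close>,
  hence \<open>f f = f\<close>. The formula in the statement is this one with denominators
  cleared.\<close>

lemma quasi_idempotent_combine:
  assumes e: "quasi_idempotent e z" and g: "quasi_idempotent g y" and ge: "cong_mod P (g \<otimes> e) \<zero>"
  defines "f \<equiv> (y \<otimes> e \<oplus> z \<otimes> g) \<ominus> e \<otimes> g"
  shows "cong_mod P (e \<otimes> f) (z \<otimes> y \<otimes> e)" "cong_mod P (g \<otimes> f) (z \<otimes> y \<otimes> g)"
    "quasi_idempotent f (z \<otimes> y)"
proof -
  note I = nc_primeD(1)[OF P]
  have eg: "e \<in> carrier A" "g \<in> carrier A" and zy: "z \<in> K" "y \<in> K" "z \<notin> P" "y \<notin> P"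
    and ee: "cong_mod P (e \<otimes> e) (z \<otimes> e)" and gg: "cong_mod P (g \<otimes> g) (y \<otimes> g)"
    using e g by (simp_all add: quasi_idempotent_def)
  note zyA = K_carrier[OF zy(1)] K_carrier[OF zy(2)]
  note rf = cong_mod_refl[OF I]
  have mv: "a \<otimes> (k \<otimes> b) = k \<otimes> (a \<otimes> b)" if "a \<in> carrier A" "b \<in> carrier A" "k \<in> K" for a b k
    using K_central[OF that(3,1)] m_assoc[of a k b] m_assoc[of k a b] K_carrier[OF that(3)] that by simp
  have fA: "f \<in> carrier A" using eg zyA by (simp add: f_def)
  have expand: "a \<otimes> f = (y \<otimes> (a \<otimes> e) \<oplus> z \<otimes> (a \<otimes> g)) \<ominus> a \<otimes> e \<otimes> g" if "a \<in> carrier A" for a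
    using that eg zyA mv[OF that eg(1) zy(2)] mv[OF that eg(2) zy(1)]
    by (simp add: f_def minus_eq r_distr r_minus m_assoc)
  have "cong_mod P (e \<otimes> f) ((y \<otimes> (z \<otimes> e) \<oplus> z \<otimes> (e \<otimes> g)) \<ominus> z \<otimes> e \<otimes> g)"
    unfolding expand[OF eg(1)]
    by (rule cong_mod_minus[OF I cong_mod_add[OF I cong_mod_mult[OF I rf[OF zyA(2)] ee]
          cong_mod_mult[OF I rf[OF zyA(1)] rf[OF m_closed[OF eg]]]] cong_mod_mult[OF I ee rf[OF eg(2)]]])
  moreover have "(y \<otimes> (z \<otimes> e) \<oplus> z \<otimes> (e \<otimes> g)) \<ominus> z \<otimes> e \<otimes> g = z \<otimes> y \<otimes> e"
    using eg zyA mv[of y e z] zy by (simp add: minus_eq m_assoc a_assoc r_neg)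
  ultimately show ef: "cong_mod P (e \<otimes> f) (z \<otimes> y \<otimes> e)" by simp
  have "cong_mod P (g \<otimes> f) ((y \<otimes> \<zero> \<oplus> z \<otimes> (y \<otimes> g)) \<ominus> \<zero> \<otimes> g)"
    unfolding expand[OF eg(2)]
    by (rule cong_mod_minus[OF I cong_mod_add[OF I cong_mod_mult[OF I rf[OF zyA(2)] ge]
          cong_mod_mult[OF I rf[OF zyA(1)] gg]] cong_mod_mult[OF I ge rf[OF eg(2)]]])
  moreover have "(y \<otimes> \<zero> \<oplus> z \<otimes> (y \<otimes> g)) \<ominus> \<zero> \<otimes> g = z \<otimes> y \<otimes> g"
    using eg zyA by (simp add: minus_eq m_assoc)
  ultimately show gf: "cong_mod P (g \<otimes> f) (z \<otimes> y \<otimes> g)" by simp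
  have ff: "f \<otimes> f = (y \<otimes> (e \<otimes> f) \<oplus> z \<otimes> (g \<otimes> f)) \<ominus> e \<otimes> (g \<otimes> f)"
  proof -
    have "f \<otimes> h = (y \<otimes> (e \<otimes> h) \<oplus> z \<otimes> (g \<otimes> h)) \<ominus> e \<otimes> (g \<otimes> h)" if "h \<in> carrier A" for h
      using eg zyA that by (simp add: f_def minus_eq l_distr l_minus m_assoc)
    then show ?thesis using fA by simp
  qed
  have "cong_mod P (f \<otimes> f) ((y \<otimes> (z \<otimes> y \<otimes> e) \<oplus> z \<otimes> (z \<otimes> y \<otimes> g)) \<ominus> e \<otimes> (z \<otimes> y \<otimes> g))"
    unfolding ff
    by (rule cong_mod_minus[OF I cong_mod_add[OF I cong_mod_mult[OF I rf[OF zyA(2)] ef]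
          cong_mod_mult[OF I rf[OF zyA(1)] gf]] cong_mod_mult[OF I rf[OF eg(1)] gf]])
  moreover have "(y \<otimes> (z \<otimes> y \<otimes> e) \<oplus> z \<otimes> (z \<otimes> y \<otimes> g)) \<ominus> e \<otimes> (z \<otimes> y \<otimes> g) = z \<otimes> y \<otimes> f"
  proof -
    have zyK: "z \<otimes> y \<in> K" using K_mult zy by simp
    have "z \<otimes> y \<otimes> f = (z \<otimes> y \<otimes> (y \<otimes> e) \<oplus> z \<otimes> y \<otimes> (z \<otimes> g)) \<ominus> z \<otimes> y \<otimes> (e \<otimes> g)"
      using eg zyA by (simp add: f_def minus_eq r_distr r_minus)
    then show ?thesis
      using mv[OF eg(1,2) zyK] mv[OF zyA(2) eg(1) zyK] mv[OF zyA(1) eg(2) zyK] by simp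
  qed
  ultimately show "quasi_idempotent f (z \<otimes> y)"
    using fA K_mult[OF zy(1,2)] K_prime zy by (simp add: quasi_idempotent_def)
qed

text \<open>Among the idempotents \<open>e/z\<close> coming from \<open>B\<close>, one that fixes
  the most elements under right multiplication is a right identity for \<open>B\<close> in the
  localisation. Hence \<open>b c (z - e)\<close> lies in \<open>P\<close> for \<open>b\<close> in
  \<open>B\<close> and all \<open>c\<close>; a \<open>b\<close> outside \<open>P\<close> and
  primeness put \<open>z - e\<close> into \<open>P\<close>, and so \<open>z\<close> into
  \<open>B\<close>.\<close>

lemma central_element_in_ideal:
  assumes B: "ideal B A" and PB: "P \<subseteq> B" "B \<noteq> P"
  shows "\<exists>z\<in>K. z \<in> B \<and> z \<notin> P"
proof -
  note I = nc_primeD(1)[OF P] and BD = idealD[OF B]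
  note [trans] = cong_mod_trans[OF I]
  \<comment> \<open>The elements \<open>b\<close> with \<open>b (e/z) = b\<close>. They form a
    \<open>K\<close>-submodule, so the chain condition provides a maximal such set.\<close>
  define W where "W = (\<lambda>(e, z). {b \<in> carrier A. cong_mod P (b \<otimes> e) (z \<otimes> b)})"
  define E where "E = {(e, z). e \<in> B \<and> quasi_idempotent e z}"
  have mv: "a \<otimes> (k \<otimes> b) = k \<otimes> (a \<otimes> b)" if "a \<in> carrier A" "b \<in> carrier A" "k \<in> K" for a b k
    using K_central[OF that(3,1)] m_assoc[of a k b] m_assoc[of k a b] K_carrier[OF that(3)] that by simp
  have W: "K_submodule (W s)" if s: "s \<in> E" for s
  proof -
    obtain e z where ez: "s = (e, z)" "e \<in> carrier A" "z \<in> K"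
      using s by (auto simp: E_def quasi_idempotent_def)
    note zA = K_carrier[OF ez(3)]
    show ?thesis
      unfolding W_def ez prod.case
    proof (rule K_submoduleI)
      show "k \<otimes> b \<in> {b \<in> carrier A. cong_mod P (b \<otimes> e) (z \<otimes> b)}"
        if k: "k \<in> K" and b: "b \<in> {b \<in> carrier A. cong_mod P (b \<otimes> e) (z \<otimes> b)}" for k b
      proof -
        have "cong_mod P (k \<otimes> (b \<otimes> e)) (k \<otimes> (z \<otimes> b))"
          using cong_mod_mult[OF I cong_mod_refl[OF I K_carrier[OF k]], of "b \<otimes> e" "z \<otimes> b"] b
          by simp
        then show ?thesis using b K_carrier[OF k] ez mv[OF zA _ k, of b] by (simp add: m_assoc)
      qed
    qed (use ez zA cong_mod_refl[OF I] cong_mod_add[OF I] in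
        \<open>simp_all add: Collect_restrict l_distr r_distr\<close>)
  qed
  have "(\<zero>, \<one>) \<in> E"
    using BD(2) K_one nc_primeD(2)[OF P] cong_mod_refl[OF I] by (simp add: E_def quasi_idempotent_def)
  then have "\<exists>N\<in>W ` E. \<forall>N'\<in>W ` E. N \<subseteq> N' \<longrightarrow> N' = N"
    by (intro maximal_K_submodule[of "W (\<zero>, \<one>)"]) (use W in auto)
  then obtain e z where ez: "(e, z) \<in> E" and max: "\<And>s. \<lbrakk>s \<in> E; W (e, z) \<subseteq> W s\<rbrakk> \<Longrightarrow> W s = W (e, z)"
    by (elim bexE imageE) (metis imageI surj_pair)
  have e: "e \<in> B" "e \<in> carrier A" "quasi_idempotent e z" and z: "z \<in> K" "z \<notin> P"
    and ee: "cong_mod P (e \<otimes> e) (z \<otimes> e)"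
    using ez by (simp_all add: E_def quasi_idempotent_def)
  note zA = K_carrier[OF z(1)]
  define L where "L = {b \<in> B. b \<otimes> e \<in> P}"
  have L: "left_ideal A L"
    unfolding left_ideal_def
  proof (intro conjI ballI)
    show "L \<subseteq> carrier A" using BD(1) by (auto simp: L_def)
    show "\<zero> \<in> L" using BD(2) idealD(2)[OF I] e by (simp add: L_def)
    show "a \<oplus> b \<in> L" if "a \<in> L" "b \<in> L" for a b
      using that BD(1)[of a] BD(1)[of b] BD(3)[of a b] idealD(3)[OF I, of "a \<otimes> e" "b \<otimes> e"] e(2)
      by (simp add: L_def l_distr)
    show "c \<otimes> a \<in> L" if "a \<in> L" "c \<in> carrier A" for a c
      using that BD(1)[of a] BD(6)[of a c] idealD(6)[OF I, of "a \<otimes> e" c] e(2)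
      by (simp add: L_def m_assoc)
  qed
  \<comment> \<open>An element of \<open>L\<close> outside \<open>P\<close> would supply a second
    idempotent \<open>g\<close>, fixed by the join \<open>f\<close> but not by \<open>e\<close>,
    against maximality.\<close>
  have "L \<subseteq> P"
  proof (rule ccontr)
    assume "\<not> L \<subseteq> P"
    then obtain g y where g: "g \<in> L" "quasi_idempotent g y" "g \<notin> P"
      using quasi_idempotent_exists[OF L] by blast
    have gA: "g \<in> B" "g \<in> carrier A" and y: "y \<in> K" "y \<notin> P"
      using g BD(1) by (simp_all add: L_def quasi_idempotent_def)
    note yA = K_carrier[OF y(1)]
    have ge: "cong_mod P (g \<otimes> e) \<zero>" using g(1) cong_mod_zero[OF I] by (simp add: L_def)
    define f where "f = (y \<otimes> e \<oplus> z \<otimes> g) \<ominus> e \<otimes> g"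
    note comb = quasi_idempotent_combine[OF e(3) g(2) ge, folded f_def]
    have fA: "f \<in> carrier A" using comb(3) by (simp add: quasi_idempotent_def)
    have "f \<in> B"
      unfolding f_def using BD(4)[OF BD(3)[OF BD(6)[OF e(1) yA] BD(6)[OF gA(1) zA]] BD(6)[OF gA(1) e(2)]] .
    then have fE: "(f, z \<otimes> y) \<in> E" using comb(3) by (simp add: E_def)
    have "W (e, z) \<subseteq> W (f, z \<otimes> y)"
    proof
      fix b assume "b \<in> W (e, z)"
      then have b: "b \<in> carrier A" "cong_mod P (b \<otimes> e) (z \<otimes> b)" by (simp_all add: W_def)
      have "cong_mod P (z \<otimes> b \<otimes> f) (b \<otimes> e \<otimes> f)"
        by (rule cong_mod_mult[OF I cong_mod_sym[OF I b(2)] cong_mod_refl[OF I fA]])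
      also have "b \<otimes> e \<otimes> f = b \<otimes> (e \<otimes> f)" using b e fA by (simp add: m_assoc)
      also have "cong_mod P (b \<otimes> (e \<otimes> f)) (b \<otimes> (z \<otimes> y \<otimes> e))"
        by (rule cong_mod_mult[OF I cong_mod_refl[OF I b(1)] comb(1)])
      also have "b \<otimes> (z \<otimes> y \<otimes> e) = z \<otimes> y \<otimes> (b \<otimes> e)"
        using b e K_mult[OF z(1) y(1)] by (intro mv)
      also have "cong_mod P (z \<otimes> y \<otimes> (b \<otimes> e)) (z \<otimes> y \<otimes> (z \<otimes> b))"
        by (rule cong_mod_mult[OF I cong_mod_refl[OF I m_closed[OF zA yA]] b(2)])
      finally have "z \<otimes> b \<otimes> f \<ominus> z \<otimes> y \<otimes> (z \<otimes> b) \<in> P" by (simp add: cong_mod_def)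
      moreover have "z \<otimes> b \<otimes> f \<ominus> z \<otimes> y \<otimes> (z \<otimes> b) = z \<otimes> (b \<otimes> f \<ominus> z \<otimes> y \<otimes> b)"
        using b fA zA yA mv[OF yA b(1) z(1)] by (simp add: minus_eq r_distr r_minus m_assoc)
      ultimately have "z \<otimes> (b \<otimes> f \<ominus> z \<otimes> y \<otimes> b) \<in> P" by simp
      then have "b \<otimes> f \<ominus> z \<otimes> y \<otimes> b \<in> P"
        using K_cancel[OF z, of "b \<otimes> f \<ominus> z \<otimes> y \<otimes> b"] b fA zA yA by simp
      then show "b \<in> W (f, z \<otimes> y)" using b fA zA yA by (simp add: W_def cong_mod_def)
    qed
    then have "W (f, z \<otimes> y) = W (e, z)" using max[OF fE] by simp
    moreover have "g \<in> W (f, z \<otimes> y)" using gA comb(2) by (simp add: W_def)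
    ultimately have "cong_mod P (g \<otimes> e) (z \<otimes> g)" by (simp add: W_def)
    then have "z \<otimes> g \<in> P" using cong_mod_mem[OF I] g(1) by (auto simp: L_def)
    then show False using K_cancel[OF z gA(2)] g(3) by simp
  qed
  obtain b where b: "b \<in> B" "b \<notin> P" using PB by blast
  note bA = BD(1)[OF b(1)]
  \<comment> \<open>The element lies in \<open>B\<close>, and \<open>e\<close> kills it modulo
    \<open>P\<close> because \<open>(z - e) e\<close> is in \<open>P\<close>; so it belongs to
    \<open>L\<close>.\<close>
  have "b \<otimes> c \<otimes> (z \<ominus> e) \<in> P" if c: "c \<in> carrier A" for c
  proof -
    have bc: "b \<otimes> c \<in> B" "b \<otimes> c \<in> carrier A" using BD(7)[OF b(1) c] BD(1) by simp_all
    have "(z \<ominus> e) \<otimes> e = z \<otimes> e \<ominus> e \<otimes> e" using zA e by (simp add: minus_eq l_distr l_minus)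
    moreover have "z \<otimes> e \<ominus> e \<otimes> e \<in> P" using cong_mod_sym[OF I ee] by (simp add: cong_mod_def)
    ultimately have "(b \<otimes> c) \<otimes> ((z \<ominus> e) \<otimes> e) \<in> P" using idealD(6)[OF I _ bc(2)] by simp
    then have "b \<otimes> c \<otimes> (z \<ominus> e) \<otimes> e \<in> P" using bc zA e m_assoc[of "b \<otimes> c" "z \<ominus> e" e] by simp
    moreover have "b \<otimes> c \<otimes> (z \<ominus> e) \<in> B" using BD(7)[OF bc(1)] zA e by simp
    ultimately show ?thesis using \<open>L \<subseteq> P\<close> by (auto simp: L_def)
  qed
  then have "z \<ominus> e \<in> P" using nc_primeD(3)[OF P bA, of "z \<ominus> e"] b(2) zA e by simp
  then have "(z \<ominus> e) \<oplus> e \<in> B" using BD(3) PB(1) e(1) by blast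
  moreover have "(z \<ominus> e) \<oplus> e = z" using zA e by (simp add: minus_eq a_assoc l_neg)
  ultimately show ?thesis using z by auto
qed

end

end

section \<open>Simple modules with compatible connections\<close>

lemma (in noetherian_diff_ring) nc_prime_cancel_cong:
  assumes P: "nc_prime P" and z: "z \<in> K" "z \<notin> P" and ab: "a \<in> carrier A" "b \<in> carrier A"
    and c: "cong_mod P (z \<otimes> a) (z \<otimes> b)"
  shows "cong_mod P a b"
proof -
  have "z \<otimes> a \<ominus> z \<otimes> b = z \<otimes> (a \<ominus> b)" using K_carrier[OF z(1)] ab by (simp add: minus_eq r_distr r_minus)
  then have "z \<otimes> (a \<ominus> b) \<in> P" using c by (simp add: cong_mod_def)
  then show ?thesis using K_cancel[OF P z, of "a \<ominus> b"] ab by (simp add: cong_mod_def)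
qed

lemma (in ring) cong_mod_add_cancel:
  assumes I: "ideal I R" and c: "c \<in> carrier R" and a: "a \<in> carrier R" and b: "b \<in> carrier R"
    and ab: "cong_mod I (a \<oplus> c) (b \<oplus> c)"
  shows "cong_mod I a b"
proof -
  have "cong_mod I ((a \<oplus> c) \<ominus> c) ((b \<oplus> c) \<ominus> c)"
    using cong_mod_minus[OF I ab cong_mod_refl[OF I c]] .
  then show ?thesis using a b c by (simp add: minus_eq a_assoc r_neg)
qed

lemma (in abelian_group) eq_of_minus_zero:
  "\<lbrakk>a \<in> carrier G; b \<in> carrier G; a \<ominus> b = \<zero>\<rbrakk> \<Longrightarrow> a = b"
  using minus_equality[of a "\<ominus> b"] by (simp add: minus_eq)

locale simple_diff_module = noetherian_diff_ring A sc K Ham H + complex_module A M sc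
  for A :: "('a, 'b) ring_scheme" (structure) and sc K and Ham :: "'x set"
    and H :: "'x \<Rightarrow> 'a \<Rightarrow> 'a" and M :: "('a, 'm) module" +
  fixes nabla :: "'x \<Rightarrow> 'm \<Rightarrow> 'm"
  assumes nabla_closed: "\<lbrakk>x \<in> Ham; v \<in> carrier M\<rbrakk> \<Longrightarrow> nabla x v \<in> carrier M"
    and nabla_add: "\<lbrakk>x \<in> Ham; v \<in> carrier M; w \<in> carrier M\<rbrakk> \<Longrightarrow>
      nabla x (v \<oplus>\<^bsub>M\<^esub> w) = nabla x v \<oplus>\<^bsub>M\<^esub> nabla x w"
    and nabla_H: "\<lbrakk>x \<in> Ham; a \<in> carrier A; v \<in> carrier M\<rbrakk> \<Longrightarrow>
      H x a \<odot>\<^bsub>M\<^esub> v = nabla x (a \<odot>\<^bsub>M\<^esub> v) \<ominus>\<^bsub>M\<^esub> a \<odot>\<^bsub>M\<^esub> nabla x v"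
    and nontrivial: "carrier M \<noteq> {\<zero>\<^bsub>M\<^esub>}"
    and simple: "\<lbrakk>submodule N A M; \<And>x v. \<lbrakk>x \<in> Ham; v \<in> N\<rbrakk> \<Longrightarrow> nabla x v \<in> N\<rbrakk> \<Longrightarrow>
      N = {\<zero>\<^bsub>M\<^esub>} \<or> N = carrier M"
    and countable_dim: "countable_dim"
begin

abbreviation P :: "'a set"
  where "P \<equiv> annihilator A M"

lemma nabla_additive: "x \<in> Ham \<Longrightarrow> additive_op M (nabla x)"
  by (simp add: additive_op_def nabla_closed nabla_add)

lemmas nabla_zero = LM.additive_opD(3)[OF nabla_additive]

lemma nabla_act:
  assumes "x \<in> Ham" "a \<in> carrier A" "v \<in> carrier M"
  shows "a \<odot>\<^bsub>M\<^esub> nabla x v = nabla x (a \<odot>\<^bsub>M\<^esub> v) \<ominus>\<^bsub>M\<^esub> H x a \<odot>\<^bsub>M\<^esub> v"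
proof -
  have "nabla x (a \<odot>\<^bsub>M\<^esub> v) \<in> carrier M" "a \<odot>\<^bsub>M\<^esub> nabla x v \<in> carrier M"
    using assms by (simp_all add: nabla_closed act_closed)
  then show ?thesis
    using nabla_H[OF assms] LM.r_neg2[of "nabla x (a \<odot>\<^bsub>M\<^esub> v)" "a \<odot>\<^bsub>M\<^esub> nabla x v"]
    by (simp add: LM.minus_eq LM.minus_add LM.minus_minus)
qed

lemma ideal_P: "ideal P A"
  by (rule annihilator_ideal)

lemma simple_stable_submodule:
  assumes "N \<subseteq> carrier M" "v \<in> N" "v \<noteq> \<zero>\<^bsub>M\<^esub>" "\<zero>\<^bsub>M\<^esub> \<in> N"
    and "\<And>v w. \<lbrakk>v \<in> N; w \<in> N\<rbrakk> \<Longrightarrow> v \<oplus>\<^bsub>M\<^esub> w \<in> N"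
    and "\<And>a v. \<lbrakk>a \<in> carrier A; v \<in> N\<rbrakk> \<Longrightarrow> a \<odot>\<^bsub>M\<^esub> v \<in> N"
    and "\<And>x v. \<lbrakk>x \<in> Ham; v \<in> N\<rbrakk> \<Longrightarrow> nabla x v \<in> N"
  shows "N = carrier M"
proof -
  have "submodule N A M" by (rule left_submoduleI) (fact assms)+
  then have "N = {\<zero>\<^bsub>M\<^esub>} \<or> N = carrier M" using assms(7) by (rule simple)
  then show ?thesis using assms(2,3) by auto
qed

text \<open>The vectors killed by \<open>J\<close> form a submodule because \<open>J\<close> absorbs
  right factors, and \<open>nabla x\<close> preserves it because
  \<open>a (nabla x w) = nabla x (a w) - (H x a) w\<close>. One nonzero such vector therefore
  suffices.\<close>

lemma stable_subset_P:
  assumes J: "J \<subseteq> carrier A" "ham_stable J" "\<And>a c. \<lbrakk>a \<in> J; c \<in> carrier A\<rbrakk> \<Longrightarrow> a \<otimes> c \<in> J"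
    and v: "v \<in> carrier M" "v \<noteq> \<zero>\<^bsub>M\<^esub>" "\<And>a. a \<in> J \<Longrightarrow> a \<odot>\<^bsub>M\<^esub> v = \<zero>\<^bsub>M\<^esub>"
  shows "J \<subseteq> P"
proof -
  have JA: "a \<in> carrier A" if "a \<in> J" for a using J(1) that by (rule subsetD)
  let ?N = "{v \<in> carrier M. \<forall>a\<in>J. a \<odot>\<^bsub>M\<^esub> v = \<zero>\<^bsub>M\<^esub>}"
  have "?N = carrier M"
  proof (rule simple_stable_submodule[of _ v])
    show "c \<odot>\<^bsub>M\<^esub> w \<in> ?N" if c: "c \<in> carrier A" and w: "w \<in> ?N" for c w
    proof -
      have "a \<odot>\<^bsub>M\<^esub> (c \<odot>\<^bsub>M\<^esub> w) = \<zero>\<^bsub>M\<^esub>" if a: "a \<in> J" for a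
        using act_mult[OF JA[OF a] c, of w] J(3)[OF a c] w by simp
      then show ?thesis using w c by (simp add: act_closed)
    qed
    show "nabla x w \<in> ?N" if x: "x \<in> Ham" and w: "w \<in> ?N" for x w
    proof -
      have "a \<odot>\<^bsub>M\<^esub> nabla x w = \<zero>\<^bsub>M\<^esub>" if a: "a \<in> J" for a
      proof -
        have "H x a \<in> J" using J(2) x a by (simp add: ham_stable_def)
        then show ?thesis
          using nabla_act[OF x JA[OF a], of w] w a nabla_zero[OF x] by (simp add: LM.minus_eq)
      qed
      then show ?thesis using w x by (simp add: nabla_closed)
    qed
  qed (use v JA in \<open>simp_all add: Collect_restrict act_zero_right act_add_right\<close>)
  then have "a \<odot>\<^bsub>M\<^esub> w = \<zero>\<^bsub>M\<^esub>" if "a \<in> J" "w \<in> carrier M" for a w using that by blast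
  then show ?thesis using JA by (auto simp: annihilator_def)
qed

lemma ham_stable_P: "ham_stable P"
  using nabla_zero by (simp add: ham_stable_def annihilator_def H_closed nabla_H nabla_closed LM.minus_eq)

lemma obtain_nonzero: obtains v where "v \<in> carrier M" "v \<noteq> \<zero>\<^bsub>M\<^esub>"
  using nontrivial LM.zero_closed by (metis singletonI subsetI subset_antisym singletonD)

text \<open>\<open>J m\<close> is the annihilator of the ordinary submodule generated by
  \<open>m\<close>, which \<open>nabla\<close> need not preserve. A maximal one among nonzero
  \<open>m\<close> is prime, and \<open>P\<close> is the largest stable ideal inside it, so
  \<open>P\<close> inherits primeness.\<close>

lemma prime_P: "nc_prime P"
proof -
  define J where "J m = {a \<in> carrier A. \<forall>b\<in>carrier A. a \<odot>\<^bsub>M\<^esub> (b \<odot>\<^bsub>M\<^esub> m) = \<zero>\<^bsub>M\<^esub>}" for m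
  have ideal_J: "ideal (J m) A" if m: "m \<in> carrier M" for m
  proof (rule two_sided_idealI)
    show "c \<otimes> a \<in> J m" if "a \<in> J m" "c \<in> carrier A" for a c
      using that m act_mult[of c a] by (simp add: J_def act_closed act_zero_right)
    show "a \<otimes> c \<in> J m" if "a \<in> J m" "c \<in> carrier A" for a c
    proof -
      have "(a \<otimes> c) \<odot>\<^bsub>M\<^esub> (b \<odot>\<^bsub>M\<^esub> m) = \<zero>\<^bsub>M\<^esub>" if b: "b \<in> carrier A" for b
      proof -
        have "a \<odot>\<^bsub>M\<^esub> ((c \<otimes> b) \<odot>\<^bsub>M\<^esub> m) = \<zero>\<^bsub>M\<^esub>"
          using \<open>a \<in> J m\<close> \<open>c \<in> carrier A\<close> b unfolding J_def by blast
        then show ?thesis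
          using \<open>a \<in> J m\<close> \<open>c \<in> carrier A\<close> b m act_mult[of a c "b \<odot>\<^bsub>M\<^esub> m"] act_mult[of c b m]
          by (simp add: J_def act_closed)
      qed
      then show ?thesis using that by (simp add: J_def)
    qed
  qed (use m in \<open>simp_all add: J_def Collect_restrict act_zero_left act_add_left act_closed\<close>)
  have K_J: "K_submodule (J m)" if m: "m \<in> carrier M" for m
    using idealD[OF ideal_J[OF m]] K_carrier by (intro K_submoduleI subsetI) simp_all
  obtain v where v: "v \<in> carrier M" "v \<noteq> \<zero>\<^bsub>M\<^esub>" by (rule obtain_nonzero)
  then have "J v \<in> J ` (carrier M - {\<zero>\<^bsub>M\<^esub>})" by simp
  then have "\<exists>N\<in>J ` (carrier M - {\<zero>\<^bsub>M\<^esub>}). \<forall>N'\<in>J ` (carrier M - {\<zero>\<^bsub>M\<^esub>}). N \<subseteq> N' \<longrightarrow> N' = N"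
    by (rule maximal_K_submodule) (use K_J in auto)
  then obtain m where m: "m \<in> carrier M" "m \<noteq> \<zero>\<^bsub>M\<^esub>"
    and max: "\<And>w. \<lbrakk>w \<in> carrier M; w \<noteq> \<zero>\<^bsub>M\<^esub>; J m \<subseteq> J w\<rbrakk> \<Longrightarrow> J w = J m"
    by (elim bexE imageE) (metis DiffD1 DiffD2 DiffI imageI singletonD singletonI)
  have "nc_prime (J m)"
    unfolding nc_prime_def
  proof (intro conjI ballI impI)
    show "ideal (J m) A" by (rule ideal_J[OF m(1)])
    have "\<one> \<odot>\<^bsub>M\<^esub> (\<one> \<odot>\<^bsub>M\<^esub> m) \<noteq> \<zero>\<^bsub>M\<^esub>" using m by (simp add: act_one)
    then show "\<one> \<notin> J m" unfolding J_def by blast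
    fix a b assume ab: "a \<in> carrier A" "b \<in> carrier A" "\<forall>c\<in>carrier A. a \<otimes> c \<otimes> b \<in> J m"
    show "a \<in> J m \<or> b \<in> J m"
    proof (cases "b \<in> J m")
      case False
      then obtain c where c: "c \<in> carrier A" "b \<odot>\<^bsub>M\<^esub> (c \<odot>\<^bsub>M\<^esub> m) \<noteq> \<zero>\<^bsub>M\<^esub>"
        using ab(2) by (auto simp: J_def)
      \<comment> \<open>A nonzero vector of the submodule generated by \<open>m\<close>: maximality
        gives \<open>J w = J m\<close>, and \<open>a\<close> annihilates everything that
        \<open>w\<close> generates.\<close>
      define w where "w = b \<odot>\<^bsub>M\<^esub> (c \<odot>\<^bsub>M\<^esub> m)"
      have w: "w \<in> carrier M" "w \<noteq> \<zero>\<^bsub>M\<^esub>" "w = (b \<otimes> c) \<odot>\<^bsub>M\<^esub> m"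
        using c ab m by (simp_all add: w_def act_closed act_mult)
      have dw: "d \<odot>\<^bsub>M\<^esub> w = (d \<otimes> (b \<otimes> c)) \<odot>\<^bsub>M\<^esub> m" if "d \<in> carrier A" for d
        using that c ab m act_mult[of d "b \<otimes> c" m] by (simp add: w(3))
      have "J m \<subseteq> J w"
      proof
        fix a' assume a': "a' \<in> J m"
        have "a' \<odot>\<^bsub>M\<^esub> (d \<odot>\<^bsub>M\<^esub> w) = \<zero>\<^bsub>M\<^esub>" if d: "d \<in> carrier A" for d
          using a' d ab(2) c(1) by (simp add: dw J_def)
        then show "a' \<in> J w" using a' by (simp add: J_def)
      qed
      then have "J w = J m" using max w by simp
      moreover have "a \<in> J w"
      proof -
        have "a \<odot>\<^bsub>M\<^esub> (d \<odot>\<^bsub>M\<^esub> w) = \<zero>\<^bsub>M\<^esub>" if d: "d \<in> carrier A" for d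
        proof -
          have "a \<otimes> d \<otimes> b \<in> J m" using ab(3) d by simp
          then have "(a \<otimes> d \<otimes> b) \<odot>\<^bsub>M\<^esub> (c \<odot>\<^bsub>M\<^esub> m) = \<zero>\<^bsub>M\<^esub>" using c by (simp add: J_def)
          then show ?thesis
            using ab d c m by (simp add: w_def act_mult[symmetric] act_closed m_assoc)
        qed
        then show ?thesis using ab by (simp add: J_def)
      qed
      ultimately show ?thesis by simp
    qed simp
  qed
  moreover have "P \<subseteq> J m" using m by (auto simp: J_def annihilator_def act_closed)
  ultimately show ?thesis
  proof (rule nc_prime_stable_core)
    show "ham_stable P" by (rule ham_stable_P)
    show "P \<subseteq> carrier A" by (simp add: annihilator_def Collect_restrict)
    fix L assume L: "ideal L A" "ham_stable L" "L \<subseteq> J m"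
    show "L \<subseteq> P"
    proof (rule stable_subset_P[OF _ L(2) _ m])
      show "a \<odot>\<^bsub>M\<^esub> m = \<zero>\<^bsub>M\<^esub>" if "a \<in> L" for a
      proof -
        have "a \<odot>\<^bsub>M\<^esub> (\<one> \<odot>\<^bsub>M\<^esub> m) = \<zero>\<^bsub>M\<^esub>" using L(3) that by (auto simp: J_def)
        then show ?thesis using m by (simp add: act_one)
      qed
    qed (use idealD(1,7)[OF L(1)] in auto)
  qed
qed

lemma cong_act: "\<lbrakk>cong_mod P a b; v \<in> carrier M\<rbrakk> \<Longrightarrow> a \<odot>\<^bsub>M\<^esub> v = b \<odot>\<^bsub>M\<^esub> v"
  using act_minus[of a b v] LM.eq_of_minus_zero[of "a \<odot>\<^bsub>M\<^esub> v" "b \<odot>\<^bsub>M\<^esub> v"]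
  by (simp add: cong_mod_def annihilator_def act_closed)

text \<open>\<open>g/h\<close> is an element of the fraction field of \<open>K/(K \<inter> P)\<close> killed by all derivations. It acts
  on \<open>M\<close> through its denominators, which generate a stable ideal.\<close>

context
  fixes g h :: 'a
  assumes gh: "g \<in> K" "h \<in> K" "h \<notin> P"
    and const: "\<And>x. x \<in> Ham \<Longrightarrow> cong_mod P (h \<otimes> H x g) (g \<otimes> H x h)"
begin

text \<open>\<open>t\<close> is a denominator of \<open>g/h\<close> with numerator \<open>y\<close>.
  Membership of \<open>t\<close> in \<open>P\<close> is allowed, which makes the relation closed
  under the derivations.\<close>

private definition den :: "'a \<Rightarrow> 'a \<Rightarrow> bool"
  where "den t y \<longleftrightarrow> t \<in> K \<and> y \<in> K \<and> cong_mod P (t \<otimes> g) (h \<otimes> y)"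

private lemma denD: "den t y \<Longrightarrow> t \<in> K" "den t y \<Longrightarrow> y \<in> K"
  "den t y \<Longrightarrow> t \<in> carrier A" "den t y \<Longrightarrow> y \<in> carrier A" "den t y \<Longrightarrow> cong_mod P (t \<otimes> g) (h \<otimes> y)"
  using K_carrier by (auto simp: den_def)

private lemma K_comm: "\<lbrakk>k \<in> K; l \<in> K\<rbrakk> \<Longrightarrow> k \<otimes> l = l \<otimes> k"
  using K_central K_carrier by blast

private lemma K_lcomm: "\<lbrakk>k \<in> K; l \<in> K; m \<in> K\<rbrakk> \<Longrightarrow> k \<otimes> (l \<otimes> m) = l \<otimes> (k \<otimes> m)"
  using K_comm[of k l] m_assoc[of k l m] m_assoc[of l k m] K_carrier by simp

private lemma den_h: "den h g"
  using gh K_carrier cong_mod_refl[OF ideal_P] by (simp add: den_def)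

text \<open>Differentiating \<open>t (g/h) = y\<close> gives \<open>(H x t) (g/h) = H x y\<close>
  since \<open>g/h\<close> is a constant. Without fractions: differentiate, multiply by
  \<open>h\<close>, exchange \<open>h (H x g)\<close> for \<open>g (H x h)\<close>, and cancel
  \<open>h\<close>.\<close>

private lemma den_H:
  assumes x: "x \<in> Ham" and ty: "den t y"
  shows "den (H x t) (H x y)"
proof -
  note [trans] = cong_mod_trans[OF ideal_P]
  note rf = cong_mod_refl[OF ideal_P] and sym = cong_mod_sym[OF ideal_P]
    and add = cong_mod_add[OF ideal_P] and mult = cong_mod_mult[OF ideal_P]
  note Ks = gh(1,2) denD(1,2)[OF ty] H_K[OF x gh(1)] H_K[OF x gh(2)] H_K[OF x denD(1)[OF ty]]
    H_K[OF x denD(2)[OF ty]]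
  note As = Ks[THEN K_carrier]
  have D: "cong_mod P (H x t \<otimes> g \<oplus> t \<otimes> H x g) (H x h \<otimes> y \<oplus> h \<otimes> H x y)"
  proof -
    have "H x (t \<otimes> g \<ominus> h \<otimes> y) \<in> P"
      using ham_stable_P x denD(5)[OF ty] by (simp add: ham_stable_def cong_mod_def)
    moreover have "H x (t \<otimes> g \<ominus> h \<otimes> y) = H x (t \<otimes> g) \<ominus> H x (h \<otimes> y)"
      using As by (intro H_simps(5)[OF x]) simp_all
    ultimately show ?thesis using As x by (simp add: cong_mod_def H_mult)
  qed
  have e1: "h \<otimes> (H x t \<otimes> g \<oplus> t \<otimes> H x g) = h \<otimes> (H x t \<otimes> g) \<oplus> t \<otimes> (h \<otimes> H x g)"
    using As Ks by (simp add: r_distr K_lcomm[of h t])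
  have e2: "h \<otimes> (H x h \<otimes> y \<oplus> h \<otimes> H x y) = h \<otimes> (h \<otimes> H x y) \<oplus> H x h \<otimes> (h \<otimes> y)"
    using As Ks by (simp add: r_distr K_lcomm[of h "H x h"] a_comm)
  have "cong_mod P (h \<otimes> (H x t \<otimes> g) \<oplus> t \<otimes> (h \<otimes> H x g)) (h \<otimes> (h \<otimes> H x y) \<oplus> H x h \<otimes> (h \<otimes> y))"
    using mult[OF rf[OF As(2)] D] unfolding e1 e2 .
  also have "cong_mod P \<dots> (h \<otimes> (h \<otimes> H x y) \<oplus> H x h \<otimes> (t \<otimes> g))"
    using As by (intro add[OF rf mult[OF rf sym[OF denD(5)[OF ty]]]]) simp_all
  also have "H x h \<otimes> (t \<otimes> g) = t \<otimes> (g \<otimes> H x h)"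
    using Ks by (simp add: K_lcomm[of "H x h" t] K_comm[of "H x h" g])
  also have "cong_mod P (h \<otimes> (h \<otimes> H x y) \<oplus> t \<otimes> (g \<otimes> H x h)) (h \<otimes> (h \<otimes> H x y) \<oplus> t \<otimes> (h \<otimes> H x g))"
    using As by (intro add[OF rf mult[OF rf sym[OF const[OF x]]]]) simp_all
  finally have "cong_mod P (h \<otimes> (H x t \<otimes> g)) (h \<otimes> (h \<otimes> H x y))"
    by (rule cong_mod_add_cancel[OF ideal_P, rotated 3]) (use As in simp_all)
  then have "cong_mod P (H x t \<otimes> g) (h \<otimes> H x y)"
    by (rule nc_prime_cancel_cong[OF prime_P gh(2,3), rotated 2]) (use As in simp_all)
  then show ?thesis using Ks by (simp add: den_def)
qed

private lemma den_den:
  assumes "den t y" "den t' y'"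
  shows "cong_mod P (t \<otimes> y') (t' \<otimes> y)"
proof -
  note [trans] = cong_mod_trans[OF ideal_P]
  note Ks = gh(1,2) denD(1,2)[OF assms(1)] denD(1,2)[OF assms(2)]
  note As = Ks[THEN K_carrier]
  have "cong_mod P (t \<otimes> (h \<otimes> y')) (t \<otimes> (t' \<otimes> g))"
    using cong_mod_mult[OF ideal_P cong_mod_refl[OF ideal_P As(3)]
        cong_mod_sym[OF ideal_P denD(5)[OF assms(2)]]] .
  also have "t \<otimes> (t' \<otimes> g) = t' \<otimes> (t \<otimes> g)" using Ks by (simp add: K_lcomm)
  also have "cong_mod P (t' \<otimes> (t \<otimes> g)) (t' \<otimes> (h \<otimes> y))"
    using cong_mod_mult[OF ideal_P cong_mod_refl[OF ideal_P As(5)] denD(5)[OF assms(1)]] .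
  finally have "cong_mod P (h \<otimes> (t \<otimes> y')) (h \<otimes> (t' \<otimes> y))"
    using Ks by (simp add: K_lcomm[of t h] K_lcomm[of t' h])
  then show ?thesis
    by (rule nc_prime_cancel_cong[OF prime_P gh(2,3), rotated 2]) (use As in simp_all)
qed

text \<open>\<open>m'\<close> is \<open>g/h\<close> times \<open>m\<close>, tested against all
  denominators at once. Applying \<open>nabla x\<close> to the test for \<open>t\<close> brings in
  the test for \<open>H x t\<close>, so a single denominator would not give a visibly stable
  relation.\<close>

private definition quot :: "'m \<Rightarrow> 'm \<Rightarrow> bool"
  where "quot m m' \<longleftrightarrow> m \<in> carrier M \<and> m' \<in> carrier M \<and>
    (\<forall>t y. den t y \<longrightarrow> t \<odot>\<^bsub>M\<^esub> m' = y \<odot>\<^bsub>M\<^esub> m)"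

private lemma K_act: "\<lbrakk>k \<in> K; a \<in> carrier A; v \<in> carrier M\<rbrakk> \<Longrightarrow> k \<odot>\<^bsub>M\<^esub> (a \<odot>\<^bsub>M\<^esub> v) = a \<odot>\<^bsub>M\<^esub> (k \<odot>\<^bsub>M\<^esub> v)"
  using K_central[of k a] K_carrier[of k] by (simp add: act_mult[symmetric])

private lemma quot_zero: "quot \<zero>\<^bsub>M\<^esub> \<zero>\<^bsub>M\<^esub>"
  using denD by (simp add: quot_def act_zero_right)

private lemma quot_add: "\<lbrakk>quot m m'; quot n n'\<rbrakk> \<Longrightarrow> quot (m \<oplus>\<^bsub>M\<^esub> n) (m' \<oplus>\<^bsub>M\<^esub> n')"
  using denD by (simp add: quot_def act_add_right)

private lemma quot_act: "\<lbrakk>quot m m'; a \<in> carrier A\<rbrakk> \<Longrightarrow> quot (a \<odot>\<^bsub>M\<^esub> m) (a \<odot>\<^bsub>M\<^esub> m')"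
  unfolding quot_def using denD(1,2) by (metis K_act act_closed)

private lemma quot_nabla:
  assumes x: "x \<in> Ham" and m: "quot m m'"
  shows "quot (nabla x m) (nabla x m')"
proof -
  have car: "m \<in> carrier M" "m' \<in> carrier M" using m by (simp_all add: quot_def)
  have "t \<odot>\<^bsub>M\<^esub> nabla x m' = y \<odot>\<^bsub>M\<^esub> nabla x m" if ty: "den t y" for t y
  proof -
    have "t \<odot>\<^bsub>M\<^esub> m' = y \<odot>\<^bsub>M\<^esub> m" "H x t \<odot>\<^bsub>M\<^esub> m' = H x y \<odot>\<^bsub>M\<^esub> m"
      using m ty den_H[OF x ty] by (simp_all add: quot_def)
    then show ?thesis
      using nabla_act[OF x denD(3)[OF ty] car(2)] nabla_act[OF x denD(4)[OF ty] car(1)] by simp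
  qed
  then show ?thesis using car x by (simp add: quot_def nabla_closed)
qed

text \<open>The vectors related to zero form a stable submodule that every denominator kills; were
  it all of \<open>M\<close>, then \<open>h\<close> would lie in \<open>P\<close>.\<close>

private lemma quot_zero_unique:
  assumes "quot \<zero>\<^bsub>M\<^esub> v"
  shows "v = \<zero>\<^bsub>M\<^esub>"
proof (rule ccontr)
  assume nz: "v \<noteq> \<zero>\<^bsub>M\<^esub>"
  have "{v. quot \<zero>\<^bsub>M\<^esub> v} = carrier M"
  proof (rule simple_stable_submodule[OF _ _ nz])
    show "{v. quot \<zero>\<^bsub>M\<^esub> v} \<subseteq> carrier M" by (auto simp: quot_def)
    show "v \<oplus>\<^bsub>M\<^esub> w \<in> {v. quot \<zero>\<^bsub>M\<^esub> v}" if "v \<in> {v. quot \<zero>\<^bsub>M\<^esub> v}" "w \<in> {v. quot \<zero>\<^bsub>M\<^esub> v}" for v w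
      using that quot_add[of "\<zero>\<^bsub>M\<^esub>" v "\<zero>\<^bsub>M\<^esub>" w] by simp
    show "a \<odot>\<^bsub>M\<^esub> v \<in> {v. quot \<zero>\<^bsub>M\<^esub> v}" if "a \<in> carrier A" "v \<in> {v. quot \<zero>\<^bsub>M\<^esub> v}" for a v
      using that quot_act[of "\<zero>\<^bsub>M\<^esub>" v a] by (simp add: act_zero_right)
    show "nabla x v \<in> {v. quot \<zero>\<^bsub>M\<^esub> v}" if "x \<in> Ham" "v \<in> {v. quot \<zero>\<^bsub>M\<^esub> v}" for x v
      using that quot_nabla[of x "\<zero>\<^bsub>M\<^esub>" v] by (simp add: nabla_zero)
  qed (use assms quot_zero in simp_all)
  then have "quot \<zero>\<^bsub>M\<^esub> w" if "w \<in> carrier M" for w using that by blast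
  then have "h \<odot>\<^bsub>M\<^esub> w = \<zero>\<^bsub>M\<^esub>" if "w \<in> carrier M" for w
    using that den_h denD(4)[OF den_h] by (auto simp: quot_def act_zero_right)
  then show False using gh(2,3) K_carrier by (simp add: annihilator_def)
qed

private lemma quot_unique:
  assumes "quot m v" "quot m w"
  shows "v = w"
proof -
  have car: "m \<in> carrier M" "v \<in> carrier M" "w \<in> carrier M" using assms by (simp_all add: quot_def)
  have neg: "(\<ominus> \<one>) \<odot>\<^bsub>M\<^esub> m = \<ominus>\<^bsub>M\<^esub> m" "(\<ominus> \<one>) \<odot>\<^bsub>M\<^esub> w = \<ominus>\<^bsub>M\<^esub> w"
    using car by (simp_all add: act_neg_one)
  have "quot (m \<oplus>\<^bsub>M\<^esub> \<ominus>\<^bsub>M\<^esub> m) (v \<oplus>\<^bsub>M\<^esub> \<ominus>\<^bsub>M\<^esub> w)"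
    using quot_add[OF assms(1) quot_act[OF assms(2), of "\<ominus> \<one>"]] unfolding neg by simp
  then have "v \<ominus>\<^bsub>M\<^esub> w = \<zero>\<^bsub>M\<^esub>"
    using quot_zero_unique car by (simp add: LM.r_neg LM.minus_eq)
  then show ?thesis using LM.eq_of_minus_zero car by simp
qed

text \<open>The domain is a stable submodule. It contains \<open>h v\<close> with image
  \<open>g v\<close>, and some \<open>h v\<close> is nonzero as \<open>h\<close> is outside
  \<open>P\<close>.\<close>

private lemma quot_exists: "{m. \<exists>m'. quot m m'} = carrier M"
proof -
  have "\<exists>v\<in>carrier M. h \<odot>\<^bsub>M\<^esub> v \<noteq> \<zero>\<^bsub>M\<^esub>" using gh(2,3) K_carrier by (auto simp: annihilator_def)
  then obtain v where v: "v \<in> carrier M" "h \<odot>\<^bsub>M\<^esub> v \<noteq> \<zero>\<^bsub>M\<^esub>" by blast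
  have "t \<odot>\<^bsub>M\<^esub> (g \<odot>\<^bsub>M\<^esub> v) = y \<odot>\<^bsub>M\<^esub> (h \<odot>\<^bsub>M\<^esub> v)" if ty: "den t y" for t y
    using cong_act[OF den_den[OF ty den_h] v(1)] K_comm[OF gh(2) denD(2)[OF ty]]
      denD(3,4)[OF ty] K_carrier[OF gh(1)] K_carrier[OF gh(2)] v by (simp add: act_mult)
  then have q: "quot (h \<odot>\<^bsub>M\<^esub> v) (g \<odot>\<^bsub>M\<^esub> v)"
    using v K_carrier gh by (simp add: quot_def act_closed)
  show ?thesis
  proof (rule simple_stable_submodule[OF _ _ v(2)])
    show "{m. \<exists>m'. quot m m'} \<subseteq> carrier M" by (auto simp: quot_def)
    show "v \<oplus>\<^bsub>M\<^esub> w \<in> {m. \<exists>m'. quot m m'}" if "v \<in> {m. \<exists>m'. quot m m'}" "w \<in> {m. \<exists>m'. quot m m'}" for v w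
      using that quot_add by blast
    show "a \<odot>\<^bsub>M\<^esub> v \<in> {m. \<exists>m'. quot m m'}" if "a \<in> carrier A" "v \<in> {m. \<exists>m'. quot m m'}" for a v
      using that quot_act by blast
    show "nabla x v \<in> {m. \<exists>m'. quot m m'}" if "x \<in> Ham" "v \<in> {m. \<exists>m'. quot m m'}" for x v
      using that quot_nabla by blast
  qed (use q quot_zero in auto)
qed

text \<open>\<open>g/h\<close> acts by an endomorphism \<open>f\<close> of \<open>M\<close> that
  commutes with \<open>A\<close> and with \<open>nabla\<close>. If no \<open>f - c\<close> were
  zero, each would be bijective by simplicity, and a fixed nonzero vector would have a resolvent at
  every complex number.\<close>

lemma constant_fraction_scalar: "\<exists>c. cong_mod P g (sc c \<otimes> h)"
proof (rule ccontr)
  assume "\<not> ?thesis"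
  then have nscal: "\<not> cong_mod P g (sc c \<otimes> h)" for c by simp
  have "\<forall>m\<in>carrier M. \<exists>m'. quot m m'" using quot_exists by blast
  then obtain f where f: "\<And>m. m \<in> carrier M \<Longrightarrow> quot m (f m)" by metis
  have f_eq: "f m = m'" if "quot m m'" for m m'
    using quot_unique[OF f that] that by (simp add: quot_def)
  have f_closed: "f m \<in> carrier M" if "m \<in> carrier M" for m using f[OF that] by (simp add: quot_def)
  have f_add: "f (m \<oplus>\<^bsub>M\<^esub> n) = f m \<oplus>\<^bsub>M\<^esub> f n" if "m \<in> carrier M" "n \<in> carrier M" for m n
    using f_eq[OF quot_add[OF f[OF that(1)] f[OF that(2)]]] .
  have f_act: "f (a \<odot>\<^bsub>M\<^esub> m) = a \<odot>\<^bsub>M\<^esub> f m" if "a \<in> carrier A" "m \<in> carrier M" for a m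
    using f_eq[OF quot_act[OF f[OF that(2)] that(1)]] .
  have f_nabla: "f (nabla x m) = nabla x (f m)" if "x \<in> Ham" "m \<in> carrier M" for x m
    using f_eq[OF quot_nabla[OF that(1) f[OF that(2)]]] .
  have f_zero: "f \<zero>\<^bsub>M\<^esub> = \<zero>\<^bsub>M\<^esub>" using f_eq[OF quot_zero] .
  define d where "d c m = f m \<oplus>\<^bsub>M\<^esub> csc (- c) m" for c m
  have d_closed: "d c m \<in> carrier M" if "m \<in> carrier M" for c m
    using that f_closed by (simp add: d_def)
  have d_zero: "d c \<zero>\<^bsub>M\<^esub> = \<zero>\<^bsub>M\<^esub>" for c by (simp add: d_def f_zero csc_zero)
  have d_add: "d c (m \<oplus>\<^bsub>M\<^esub> n) = d c m \<oplus>\<^bsub>M\<^esub> d c n" if "m \<in> carrier M" "n \<in> carrier M" for c m n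
    using that f_closed by (simp add: d_def f_add csc_add LM.a_ac)
  have d_act: "d c (a \<odot>\<^bsub>M\<^esub> m) = a \<odot>\<^bsub>M\<^esub> d c m" if "a \<in> carrier A" "m \<in> carrier M" for c a m
    using that f_closed K_act[OF K_sc that] by (simp add: d_def f_act act_add_right)
  \<comment> \<open>Scalars commute with \<open>nabla x\<close> because \<open>H x\<close> kills the
    unit and hence every scalar.\<close>
  have d_nabla: "d c (nabla x m) = nabla x (d c m)" if x: "x \<in> Ham" and m: "m \<in> carrier M" for c x m
  proof -
    have "H x (sc (- c)) = sc (- c) \<otimes> H x \<one>" using H_sc[OF x, of \<one> "- c"] by simp
    moreover have "H x \<one> = \<zero>" using H_mult[OF x, of \<one> \<one>] H_closed[OF x, of \<one>]
      by (metis add.l_cancel_one' l_one one_closed r_one)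
    ultimately have "csc (- c) (nabla x m) = nabla x (csc (- c) m)"
      using nabla_act[OF x sc_closed m, of "- c"] nabla_closed[OF x] m
      by (simp add: act_zero_left LM.minus_eq)
    then show ?thesis using m x f_closed by (simp add: d_def f_nabla nabla_add)
  qed
  have inj: "m = \<zero>\<^bsub>M\<^esub>" if m: "m \<in> carrier M" "d c m = \<zero>\<^bsub>M\<^esub>" for c m
  proof (rule ccontr)
    assume nz: "m \<noteq> \<zero>\<^bsub>M\<^esub>"
    have all: "{m \<in> carrier M. d c m = \<zero>\<^bsub>M\<^esub>} = carrier M"
      by (rule simple_stable_submodule[OF _ _ nz])
        (use m in \<open>simp_all add: Collect_restrict d_zero d_add d_act d_nabla act_closed act_zero_right
            nabla_closed nabla_zero\<close>)
    have "(g \<ominus> sc c \<otimes> h) \<odot>\<^bsub>M\<^esub> v = \<zero>\<^bsub>M\<^esub>" if v: "v \<in> carrier M" for v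
    proof -
      note hA = K_carrier[OF gh(2)] and gA = K_carrier[OF gh(1)]
      have "f v \<oplus>\<^bsub>M\<^esub> csc (- c) v = \<zero>\<^bsub>M\<^esub>" using all v unfolding d_def by blast
      then have "f v = csc c v"
        using v f_closed[OF v] LM.minus_equality[of "f v" "csc (- c) v"] by (simp add: csc_simps)
      moreover have "h \<odot>\<^bsub>M\<^esub> f v = g \<odot>\<^bsub>M\<^esub> v" using f[OF v] den_h by (simp add: quot_def)
      ultimately have "g \<odot>\<^bsub>M\<^esub> v = (sc c \<otimes> h) \<odot>\<^bsub>M\<^esub> v"
        using K_act[OF gh(2) sc_closed v, of c] v hA by (simp add: act_mult)
      then show ?thesis using v hA gA by (simp add: act_minus act_closed LM.minus_eq LM.r_neg)
    qed
    then have "g \<ominus> sc c \<otimes> h \<in> P"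
      using K_carrier[OF gh(1)] K_carrier[OF gh(2)] by (simp add: annihilator_def)
    then show False
      using nscal[of c] K_carrier[OF gh(1)] K_carrier[OF gh(2)] by (simp add: cong_mod_def)
  qed
  obtain w where w: "w \<in> carrier M" "w \<noteq> \<zero>\<^bsub>M\<^esub>" by (rule obtain_nonzero)
  have surj: "d c ` carrier M = carrier M" for c
  proof (rule simple_stable_submodule)
    show "d c ` carrier M \<subseteq> carrier M" using d_closed by auto
    show "d c w \<in> d c ` carrier M" using w by simp
    show "d c w \<noteq> \<zero>\<^bsub>M\<^esub>" using inj w by blast
    show "\<zero>\<^bsub>M\<^esub> \<in> d c ` carrier M" using d_zero[of c] by (metis LM.zero_closed imageI)
    show "u \<oplus>\<^bsub>M\<^esub> v \<in> d c ` carrier M" if "u \<in> d c ` carrier M" "v \<in> d c ` carrier M" for u v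
      using that by (auto simp: d_add[symmetric])
    show "a \<odot>\<^bsub>M\<^esub> v \<in> d c ` carrier M" if "a \<in> carrier A" "v \<in> d c ` carrier M" for a v
      using that by (auto simp: d_act[symmetric] act_closed)
    show "nabla x v \<in> d c ` carrier M" if "x \<in> Ham" "v \<in> d c ` carrier M" for x v
      using that by (auto simp: d_nabla[symmetric] nabla_closed)
  qed
  have "countable {l. \<exists>y\<in>carrier M. (f y \<oplus>\<^bsub>M\<^esub> csc (- l) y) \<ominus>\<^bsub>M\<^esub> w \<in> {\<zero>\<^bsub>M\<^esub>}}"
  proof (rule countable_resolvents[OF _ _ _ _ _ _ _ _ _ _ _ countable_dim])
    show "v \<in> {\<zero>\<^bsub>M\<^esub>}" if "v \<in> carrier M" "f v \<oplus>\<^bsub>M\<^esub> csc (- c) v \<in> {\<zero>\<^bsub>M\<^esub>}" for c v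
      using inj[of v c] that by (simp add: d_def)
  qed (use f_closed f_add f_act f_zero w in \<open>simp_all add: csc_zero\<close>)
  moreover have "\<exists>y\<in>carrier M. (f y \<oplus>\<^bsub>M\<^esub> csc (- l) y) \<ominus>\<^bsub>M\<^esub> w \<in> {\<zero>\<^bsub>M\<^esub>}" for l
  proof -
    obtain y where "y \<in> carrier M" "d l y = w" using surj[of l] w(1) by (metis imageE)
    then show ?thesis using w(1) by (intro bexI[of _ y]) (simp_all add: d_def LM.minus_eq LM.r_neg)
  qed
  ultimately show False using uncountable_UNIV_complex by simp
qed

end

end

section \<open>Independence along derivations\<close>

context abelian_group
begin

lemma finsum_additive_op:
  assumes \<phi>: "additive_op G \<phi>" and "finite B" "f \<in> B \<rightarrow> carrier G"
  shows "\<phi> (\<Oplus>b\<in>B. f b) = (\<Oplus>b\<in>B. \<phi> (f b))"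
  using assms(2,3)
proof (induction B rule: finite_induct)
  case (insert b B)
  then have "f b \<in> carrier G" "f \<in> B \<rightarrow> carrier G" "(\<Oplus>b\<in>B. f b) \<in> carrier G"
    "(\<lambda>b. \<phi> (f b)) \<in> B \<rightarrow> carrier G" "\<phi> (f b) \<in> carrier G"
    using additive_opD(1)[OF \<phi>] by (auto intro: finsum_closed)
  then show ?case using insert by (simp add: finsum_insert additive_opD(2)[OF \<phi>])
qed (simp add: additive_opD(3)[OF \<phi>])

lemma finsum_minus:
  assumes "finite B" "f \<in> B \<rightarrow> carrier G" "g \<in> B \<rightarrow> carrier G"
  shows "(\<Oplus>b\<in>B. f b \<ominus> g b) = (\<Oplus>b\<in>B. f b) \<ominus> (\<Oplus>b\<in>B. g b)"
proof -
  have neg: "additive_op G (\<lambda>u. \<ominus> u)" by (simp add: additive_op_def minus_add)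
  have "(\<Oplus>b\<in>B. f b \<ominus> g b) = (\<Oplus>b\<in>B. f b) \<oplus> (\<Oplus>b\<in>B. \<ominus> g b)"
    unfolding minus_eq by (rule finsum_addf) (use assms in auto)
  then show ?thesis using finsum_additive_op[OF neg assms(1,3)] by (simp add: minus_eq)
qed

end

context ring
begin

lemma finsum_cong_mod:
  assumes I: "ideal I R" and "finite B" "\<And>b. b \<in> B \<Longrightarrow> cong_mod I (f b) (g b)"
  shows "cong_mod I (\<Oplus>b\<in>B. f b) (\<Oplus>b\<in>B. g b)"
  using assms(2,3)
proof (induction B rule: finite_induct)
  case empty
  then show ?case by (simp add: cong_mod_refl[OF I])
next
  case (insert b B)
  then have "f \<in> B \<rightarrow> carrier R" "g \<in> B \<rightarrow> carrier R" "f b \<in> carrier R" "g b \<in> carrier R"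
    by (auto simp: cong_mod_def)
  then show ?case using insert by (simp add: finsum_insert cong_mod_add[OF I])
qed

lemma finsum_mult_left:
  assumes "a \<in> carrier R" "finite B" "f \<in> B \<rightarrow> carrier R"
  shows "a \<otimes> (\<Oplus>b\<in>B. f b) = (\<Oplus>b\<in>B. a \<otimes> f b)"
  using assms by (intro finsum_additive_op) (simp_all add: additive_op_def r_distr)

end

section \<open>Words in the derivations and the rank of a linear system\<close>

context noetherian_diff_ring
begin

lemma K_commute: "\<lbrakk>k \<in> K; l \<in> K\<rbrakk> \<Longrightarrow> k \<otimes> l = l \<otimes> k"
  using K_central K_carrier by blast

lemma K_left_commute: "\<lbrakk>k \<in> K; l \<in> K; m \<in> K\<rbrakk> \<Longrightarrow> k \<otimes> (l \<otimes> m) = l \<otimes> (k \<otimes> m)"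
  using K_commute[of k l] m_assoc[of k l m] m_assoc[of l k m] K_carrier by simp

lemma K_finsum: "\<lbrakk>finite B; f \<in> B \<rightarrow> K\<rbrakk> \<Longrightarrow> (\<Oplus>b\<in>B. f b) \<in> K"
proof (induction B rule: finite_induct)
  case (insert b B)
  then have "f \<in> B \<rightarrow> carrier A" "f b \<in> carrier A" using K_carrier by (auto simp: Pi_iff)
  then show ?case using insert by (simp add: finsum_insert K_add)
qed (simp add: K_zero)

lemma word_K: "\<lbrakk>ws \<in> lists Ham; k \<in> K\<rbrakk> \<Longrightarrow> foldr H ws k \<in> K"
  by (induction ws) (simp_all add: H_K)

lemma word_additive: "ws \<in> lists Ham \<Longrightarrow> additive_op A (foldr H ws)"
  by (induction ws) (simp_all add: additive_op_def H_closed H_add)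

lemma word_sc: "\<lbrakk>ws \<in> lists Ham; a \<in> carrier A\<rbrakk> \<Longrightarrow> foldr H ws (sc c \<otimes> a) = sc c \<otimes> foldr H ws a"
proof (induction ws)
  case (Cons x ws)
  then show ?case using additive_opD(1)[OF word_additive, of ws a] by (simp add: H_sc)
qed simp

lemma word_stable: "\<lbrakk>ws \<in> lists Ham; ham_stable J; a \<in> J\<rbrakk> \<Longrightarrow> foldr H ws a \<in> J"
  by (induction ws) (simp_all add: ham_stable_def)

text \<open>Gaussian elimination: the rank of a family of vectors over the domain \<open>K/(K \<inter> P)\<close> does not
  drop modulo the primes that avoid the product of the pivots.\<close>

lemma rank_spreads:
  assumes P: "nc_prime P" and "finite B" "\<And>t. t \<in> T \<Longrightarrow> t \<in> B \<rightarrow> K"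
    and "\<And>f. \<lbrakk>f \<in> B \<rightarrow> K; \<And>t. t \<in> T \<Longrightarrow> (\<Oplus>b\<in>B. f b \<otimes> t b) \<in> P\<rbrakk> \<Longrightarrow> \<forall>b\<in>B. f b \<in> P"
  shows "\<exists>d\<in>K. d \<notin> P \<and> (\<forall>I f. nc_prime I \<longrightarrow> d \<notin> I \<longrightarrow> f \<in> B \<rightarrow> K \<longrightarrow>
    (\<forall>t\<in>T. (\<Oplus>b\<in>B. f b \<otimes> t b) \<in> I) \<longrightarrow> (\<forall>b\<in>B. f b \<in> I))"
  using assms(2-)
proof (induction B arbitrary: T rule: finite_induct)
  case empty
  show ?case using K_one nc_primeD(2)[OF P] by (intro bexI[of _ \<one>]) simp_all
next
  case (insert b0 B)
  have TK: "t b \<in> K" if "t \<in> T" "b \<in> insert b0 B" for t b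
    using insert.prems(1)[OF that(1)] that(2) by (rule funcset_mem)
  have ins: "(\<Oplus>b\<in>insert b0 B. f b \<otimes> t b) = f b0 \<otimes> t b0 \<oplus> (\<Oplus>b\<in>B. f b \<otimes> t b)"
    if "f \<in> insert b0 B \<rightarrow> K" "t \<in> T" for f t
    using that(1) TK[OF that(2)] K_carrier insert.hyps by (intro finsum_insert) (auto simp: Pi_iff)
  \<comment> \<open>If the column of \<open>b0\<close> vanished modulo \<open>P\<close>, the unit
    vector at \<open>b0\<close> would be a solution with an entry outside \<open>P\<close>.\<close>
  have "\<exists>t0\<in>T. t0 b0 \<notin> P"
  proof (rule ccontr)
    assume "\<not> ?thesis"
    then have none: "t b0 \<in> P" if "t \<in> T" for t using that by blast
    define f where "f b = (if b = b0 then \<one> else \<zero>)" for b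
    have fK: "f \<in> insert b0 B \<rightarrow> K" by (simp add: f_def K_one K_zero)
    have "(\<Oplus>b\<in>insert b0 B. f b \<otimes> t b) \<in> P" if t: "t \<in> T" for t
    proof -
      have "(\<Oplus>b\<in>B. f b \<otimes> t b) = (\<Oplus>b\<in>B. \<zero>)"
        using insert.hyps TK[OF t] K_carrier by (intro finsum_cong') (auto simp: f_def)
      then show ?thesis
        using none[OF t] TK[OF t, of b0] K_carrier by (simp add: ins[OF fK t]) (simp add: f_def)
    qed
    then have "f b0 \<in> P" using insert.prems(2)[OF fK] by simp
    then show False using nc_primeD(2)[OF P] by (simp add: f_def)
  qed
  then obtain t0 where t0: "t0 \<in> T" "t0 b0 \<notin> P" by blast
  define a where "a = t0 b0"
  have a: "a \<in> K" "a \<in> carrier A" "a \<notin> P" using TK[OF t0(1)] K_carrier t0 by (simp_all add: a_def)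
  \<comment> \<open>The row \<open>t\<close> after clearing the column of \<open>b0\<close> with the
    pivot row, cross-multiplied to stay inside \<open>K\<close>.\<close>
  define r where "r t b = a \<otimes> t b \<ominus> t b0 \<otimes> t0 b" for t b
  have rK: "r t b \<in> K" if "t \<in> T" "b \<in> B" for t b
    using TK[OF that(1)] TK[OF t0(1)] a that(2) by (simp add: r_def K_minus K_mult)
  have key: "(\<Oplus>b\<in>B. g b \<otimes> r t b) =
      a \<otimes> (\<Oplus>b\<in>B. g b \<otimes> t b) \<ominus> t b0 \<otimes> (\<Oplus>b\<in>B. g b \<otimes> t0 b)" if g: "g \<in> B \<rightarrow> K" and t: "t \<in> T" for g t
  proof -
    have car: "g b \<in> carrier A" "t b \<in> carrier A" "t0 b \<in> carrier A"
      and Ks: "g b \<in> K" "t b \<in> K" "t0 b \<in> K" if "b \<in> B" for b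
      using g that TK[OF t] TK[OF t0(1)] K_carrier by auto
    have tb0: "t b0 \<in> K" "t b0 \<in> carrier A" using TK[OF t] K_carrier by simp_all
    have "g b \<otimes> r t b = a \<otimes> (g b \<otimes> t b) \<ominus> t b0 \<otimes> (g b \<otimes> t0 b)" if b: "b \<in> B" for b
      using car[OF b] Ks[OF b] a tb0
      by (simp add: r_def minus_eq r_distr r_minus K_left_commute[of "g b"])
    then have "(\<Oplus>b\<in>B. g b \<otimes> r t b) = (\<Oplus>b\<in>B. a \<otimes> (g b \<otimes> t b) \<ominus> t b0 \<otimes> (g b \<otimes> t0 b))"
      using car a tb0 by (intro finsum_cong') auto
    also have "\<dots> = (\<Oplus>b\<in>B. a \<otimes> (g b \<otimes> t b)) \<ominus> (\<Oplus>b\<in>B. t b0 \<otimes> (g b \<otimes> t0 b))"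
      using car a tb0 insert.hyps by (intro finsum_minus) auto
    also have "(\<Oplus>b\<in>B. a \<otimes> (g b \<otimes> t b)) = a \<otimes> (\<Oplus>b\<in>B. g b \<otimes> t b)"
      using car a insert.hyps by (intro finsum_mult_left[symmetric]) auto
    also have "(\<Oplus>b\<in>B. t b0 \<otimes> (g b \<otimes> t0 b)) = t b0 \<otimes> (\<Oplus>b\<in>B. g b \<otimes> t0 b)"
      using car tb0 insert.hyps by (intro finsum_mult_left[symmetric]) auto
    finally show ?thesis .
  qed
  have sumK: "(\<Oplus>b\<in>B. g b \<otimes> t b) \<in> K" if "g \<in> B \<rightarrow> K" "t \<in> T" for g t
    using that TK[OF that(2)] K_mult insert.hyps by (intro K_finsum) auto
  have "\<exists>d\<in>K. d \<notin> P \<and> (\<forall>I f. nc_prime I \<longrightarrow> d \<notin> I \<longrightarrow> f \<in> B \<rightarrow> K \<longrightarrow>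
    (\<forall>t\<in>r ` T. (\<Oplus>b\<in>B. f b \<otimes> t b) \<in> I) \<longrightarrow> (\<forall>b\<in>B. f b \<in> I))"
  proof (rule insert.IH)
    show "t \<in> B \<rightarrow> K" if "t \<in> r ` T" for t using that rK by auto
    fix g assume g: "g \<in> B \<rightarrow> K" and gr: "\<And>t. t \<in> r ` T \<Longrightarrow> (\<Oplus>b\<in>B. g b \<otimes> t b) \<in> P"
    have gA: "g b \<in> carrier A" if "b \<in> B" for b using g that K_carrier by auto
    define s where "s = (\<Oplus>b\<in>B. g b \<otimes> t0 b)"
    have s: "s \<in> K" "s \<in> carrier A" using sumK[OF g t0(1)] K_carrier by (simp_all add: s_def)
    \<comment> \<open>A solution \<open>g\<close> of the reduced system extends to the full one:
      scaling by the pivot \<open>a\<close> allows the entry at \<open>b0\<close> to be solved from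
      the pivot row.\<close>
    define f where "f b = (if b = b0 then \<ominus> s else a \<otimes> g b)" for b
    have fK: "f \<in> insert b0 B \<rightarrow> K"
      using K_uminus[OF s(1)] K_mult[OF a(1) funcset_mem[OF g]] by (auto simp: f_def)
    have "(\<Oplus>b\<in>insert b0 B. f b \<otimes> t b) \<in> P" if t: "t \<in> T" for t
    proof -
      have tA: "t b \<in> carrier A" if "b \<in> insert b0 B" for b using TK[OF t that] K_carrier by simp
      have "(\<Oplus>b\<in>B. f b \<otimes> t b) = (\<Oplus>b\<in>B. a \<otimes> (g b \<otimes> t b))"
        using insert.hyps tA gA a by (intro finsum_cong') (auto simp: f_def m_assoc)
      also have "\<dots> = a \<otimes> (\<Oplus>b\<in>B. g b \<otimes> t b)"
        using insert.hyps tA gA a by (intro finsum_mult_left[symmetric]) auto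
      finally have "(\<Oplus>b\<in>insert b0 B. f b \<otimes> t b) = (\<ominus> s) \<otimes> t b0 \<oplus> a \<otimes> (\<Oplus>b\<in>B. g b \<otimes> t b)"
        by (simp add: ins[OF fK t]) (simp add: f_def)
      also have "\<dots> = (\<Oplus>b\<in>B. g b \<otimes> r t b)"
        unfolding key[OF g t] s_def[symmetric]
        using s a tA[of b0] K_carrier[OF sumK[OF g t]] K_commute[OF s(1) TK[OF t, of b0]]
        by (simp add: l_minus minus_eq a_comm)
      finally show ?thesis using gr t by simp
    qed
    then have fP: "\<forall>b\<in>insert b0 B. f b \<in> P" by (rule insert.prems(2)[OF fK])
    show "\<forall>b\<in>B. g b \<in> P"
    proof
      fix b assume b: "b \<in> B"
      then have "f b = a \<otimes> g b" using insert.hyps by (auto simp: f_def)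
      then have "a \<otimes> g b \<in> P" using fP b by (metis insertI2)
      then show "g b \<in> P" using K_cancel[OF P a(1,3) gA[OF b]] by simp
    qed
  qed
  then obtain d where d: "d \<in> K" "d \<notin> P"
    and dI: "\<And>I f. \<lbrakk>nc_prime I; d \<notin> I; f \<in> B \<rightarrow> K; \<forall>t\<in>r ` T. (\<Oplus>b\<in>B. f b \<otimes> t b) \<in> I\<rbrakk> \<Longrightarrow>
      \<forall>b\<in>B. f b \<in> I" by blast
  \<comment> \<open>A prime that avoids the product avoids both the pivot of this step and the
    product of the later pivots.\<close>
  show ?case
  proof (intro bexI[of _ "a \<otimes> d"] conjI allI impI)
    show "a \<otimes> d \<in> K" using K_mult[OF a(1) d(1)] .
    show "a \<otimes> d \<notin> P" using K_prime[OF P a(1,3) d] .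
    fix I f assume I: "nc_prime I" and adI: "a \<otimes> d \<notin> I" and f: "f \<in> insert b0 B \<rightarrow> K"
      and fI: "\<forall>t\<in>T. (\<Oplus>b\<in>insert b0 B. f b \<otimes> t b) \<in> I"
    note ID = idealD[OF nc_primeD(1)[OF I]]
    have aI: "a \<notin> I" using adI ID(7)[of a d] K_carrier[OF d(1)] by blast
    have dnI: "d \<notin> I" using adI ID(6)[of d a] a by blast
    have fB: "f \<in> B \<rightarrow> K" and f0: "f b0 \<in> K" "f b0 \<in> carrier A" using f K_carrier by auto
    have FB: "\<forall>b\<in>B. f b \<in> I"
    proof (rule dI[OF I dnI fB], intro ballI)
      fix t' assume "t' \<in> r ` T"
      then obtain t where t: "t \<in> T" "t' = r t" by blast
      define u u0 where "u = (\<Oplus>b\<in>B. f b \<otimes> t b)" and "u0 = (\<Oplus>b\<in>B. f b \<otimes> t0 b)"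
      have u: "u \<in> K" "u \<in> carrier A" "u0 \<in> K" "u0 \<in> carrier A"
        using sumK[OF fB t(1)] sumK[OF fB t0(1)] K_carrier by (simp_all add: u_def u0_def)
      have tb0: "t b0 \<in> K" "t b0 \<in> carrier A" using TK[OF t(1)] K_carrier by simp_all
      have "f b0 \<otimes> t b0 \<oplus> u \<in> I" "f b0 \<otimes> a \<oplus> u0 \<in> I"
        using fI t(1) t0(1) by (simp_all add: ins[OF f] u_def u0_def a_def)
      then have "a \<otimes> (f b0 \<otimes> t b0 \<oplus> u) \<ominus> t b0 \<otimes> (f b0 \<otimes> a \<oplus> u0) \<in> I"
        using ID(4) ID(6) a(2) tb0(2) by simp
      moreover have "a \<otimes> (f b0 \<otimes> t b0 \<oplus> u) \<ominus> t b0 \<otimes> (f b0 \<otimes> a \<oplus> u0) = a \<otimes> u \<ominus> t b0 \<otimes> u0"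
      proof -
        have "t b0 \<otimes> (f b0 \<otimes> a) = a \<otimes> (f b0 \<otimes> t b0)"
          using K_left_commute[OF tb0(1) f0(1) a(1)] K_left_commute[OF f0(1) a(1) tb0(1)]
            K_commute[OF tb0(1) a(1)] by simp
        then show ?thesis
          using u a tb0 f0 by (simp add: r_distr minus_eq minus_add a_ac r_neg r_neg1 r_neg2)
      qed
      ultimately show "(\<Oplus>b\<in>B. f b \<otimes> t' b) \<in> I"
        by (simp add: t(2) key[OF fB t(1)] u_def u0_def)
    qed
    have "(\<Oplus>b\<in>B. f b \<otimes> t0 b) \<in> I"
    proof -
      have "cong_mod I (\<Oplus>b\<in>B. f b \<otimes> t0 b) (\<Oplus>b\<in>B. \<zero>)"
        using FB TK[OF t0(1)] K_carrier ID(7) insert.hyps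
        by (intro finsum_cong_mod[OF nc_primeD(1)[OF I]])
          (simp_all add: cong_mod_zero[OF nc_primeD(1)[OF I]])
      then show ?thesis by (simp add: cong_mod_zero[OF nc_primeD(1)[OF I]])
    qed
    moreover have "f b0 \<otimes> a \<oplus> (\<Oplus>b\<in>B. f b \<otimes> t0 b) \<in> I"
      using fI t0(1) by (simp add: ins[OF f] a_def)
    ultimately have "f b0 \<otimes> a \<oplus> (\<Oplus>b\<in>B. f b \<otimes> t0 b) \<ominus> (\<Oplus>b\<in>B. f b \<otimes> t0 b) \<in> I" using ID(4) by blast
    moreover have "f b0 \<otimes> a \<oplus> (\<Oplus>b\<in>B. f b \<otimes> t0 b) \<ominus> (\<Oplus>b\<in>B. f b \<otimes> t0 b) = a \<otimes> f b0"
      using f0 a K_carrier[OF sumK[OF fB t0(1)]] K_commute[OF f0(1) a(1)]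
      by (simp add: minus_eq a_assoc r_neg)
    ultimately have "f b0 \<in> I" using K_cancel[OF I a(1) aI f0(2)] by simp
    then show "\<forall>b\<in>insert b0 B. f b \<in> I" using FB by simp
  qed
qed

end

section \<open>Linear independence over the constants and Wronskians\<close>

context simple_diff_module
begin

definition independent_mod :: "'a set \<Rightarrow> bool"
  where "independent_mod B \<longleftrightarrow> finite B \<and> B \<subseteq> K \<and>
    (\<forall>c. (\<Oplus>b\<in>B. sc (c b) \<otimes> b) \<in> P \<longrightarrow> (\<forall>b\<in>B. c b = 0))"

lemma independent_modD:
  "\<lbrakk>independent_mod B; (\<Oplus>b\<in>B. sc (c b) \<otimes> b) \<in> P\<rbrakk> \<Longrightarrow> \<forall>b\<in>B. c b = 0"
  unfolding independent_mod_def by blast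

lemma independent_mod_insert:
  assumes B: "finite B" "insert b0 B \<subseteq> K" "b0 \<notin> B"
  shows "(\<Oplus>b\<in>insert b0 B. sc (c b) \<otimes> b) = sc (c b0) \<otimes> b0 \<oplus> (\<Oplus>b\<in>B. sc (c b) \<otimes> b)"
    "(\<Oplus>b\<in>B. sc (c b) \<otimes> b) \<in> carrier A"
    "(\<And>b. b \<in> B \<Longrightarrow> c b = c' b) \<Longrightarrow> (\<Oplus>b\<in>B. sc (c b) \<otimes> b) = (\<Oplus>b\<in>B. sc (c' b) \<otimes> b)"
proof -
  have BA: "b \<in> carrier A" if "b \<in> insert b0 B" for b using B(2) that K_carrier by blast
  show "(\<Oplus>b\<in>insert b0 B. sc (c b) \<otimes> b) = sc (c b0) \<otimes> b0 \<oplus> (\<Oplus>b\<in>B. sc (c b) \<otimes> b)"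
    using B BA by (intro finsum_insert) auto
  show "(\<Oplus>b\<in>B. sc (c b) \<otimes> b) \<in> carrier A" using BA by (intro finsum_closed) auto
  show "(\<Oplus>b\<in>B. sc (c b) \<otimes> b) = (\<Oplus>b\<in>B. sc (c' b) \<otimes> b)" if "\<And>b. b \<in> B \<Longrightarrow> c b = c' b"
    using BA that by (intro finsum_cong') auto
qed

lemma independent_mod_subset:
  assumes ind: "independent_mod (insert b0 B)" and b0: "b0 \<notin> B"
  shows "independent_mod B"
  unfolding independent_mod_def
proof (intro conjI allI impI)
  have B: "finite B" "insert b0 B \<subseteq> K" using ind by (simp_all add: independent_mod_def)
  then show "finite B" "B \<subseteq> K" by auto
  fix c assume cP: "(\<Oplus>b\<in>B. sc (c b) \<otimes> b) \<in> P"
  define c' where "c' = c(b0 := 0)"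
  note ins = independent_mod_insert[OF B b0]
  have "(\<Oplus>b\<in>B. sc (c' b) \<otimes> b) = (\<Oplus>b\<in>B. sc (c b) \<otimes> b)"
    by (rule ins(3)) (use b0 in \<open>auto simp: c'_def\<close>)
  then have "(\<Oplus>b\<in>insert b0 B. sc (c' b) \<otimes> b) \<in> P"
    using cP ins(2)[of c] B(2) K_carrier[of b0] by (simp add: ins(1) c'_def sc_zero)
  then have "\<forall>b\<in>insert b0 B. c' b = 0" by (rule independent_modD[OF ind])
  then show "\<forall>b\<in>B. c b = 0" using b0 by (auto simp: c'_def split: if_splits)
qed

text \<open>A Wronskian argument: by minimality, the ratios of the coefficients of a relation between
  all the words in the derivations applied to \<open>B\<close> are constants, hence scalars.\<close>

lemma wronskian:
  assumes "independent_mod B" "f \<in> B \<rightarrow> K"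
    and "\<And>ws. ws \<in> lists Ham \<Longrightarrow> (\<Oplus>b\<in>B. f b \<otimes> foldr H ws b) \<in> P"
  shows "\<forall>b\<in>B. f b \<in> P"
proof -
  have "finite B" using assms(1) by (simp add: independent_mod_def)
  then show ?thesis using assms
  proof (induction B arbitrary: f rule: finite_induct)
    case (insert b0 B)
    note PD = idealD[OF ideal_P]
    have BK: "insert b0 B \<subseteq> K" using insert.prems(1) by (simp add: independent_mod_def)
    note ins = independent_mod_insert[OF insert.hyps(1) BK insert.hyps(2)]
    have BKs: "b \<in> K" if "b \<in> insert b0 B" for b using BK that by (rule subsetD)
    have wK: "foldr H ws b \<in> K" if "ws \<in> lists Ham" "b \<in> insert b0 B" for ws b
      using word_K[OF that(1) BKs[OF that(2)]] .
    have wA: "foldr H ws b \<in> carrier A" if "ws \<in> lists Ham" "b \<in> insert b0 B" for ws b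
      using wK[OF that] K_carrier by simp
    have fK: "f b \<in> K" if "b \<in> insert b0 B" for b using insert.prems(2) that by (rule funcset_mem)
    have fA: "f b \<in> carrier A" if "b \<in> insert b0 B" for b using fK[OF that] K_carrier by simp
    have indB: "independent_mod B" using independent_mod_subset[OF insert.prems(1) insert.hyps(2)] .
    define T where "T k ws = (\<Oplus>b\<in>B. k b \<otimes> foldr H ws b)" for k ws
    have TA: "T k ws \<in> carrier A" if "ws \<in> lists Ham" "\<And>b. b \<in> B \<Longrightarrow> k b \<in> carrier A" for k ws
      unfolding T_def using that wA by (intro finsum_closed) auto
    have S: "f b0 \<otimes> foldr H ws b0 \<oplus> T f ws \<in> P" if ws: "ws \<in> lists Ham" for ws
    proof -
      have "(\<Oplus>b\<in>insert b0 B. f b \<otimes> foldr H ws b) = f b0 \<otimes> foldr H ws b0 \<oplus> T f ws"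
        unfolding T_def using insert.hyps fA wA[OF ws] by (intro finsum_insert) auto
      then show ?thesis using insert.prems(3)[OF ws] by simp
    qed
    show ?case
    proof (cases "f b0 \<in> P")
      case True
      have "T f ws \<in> P" if ws: "ws \<in> lists Ham" for ws
      proof -
        have "f b0 \<otimes> foldr H ws b0 \<in> P" using PD(7)[OF True] wA[OF ws] by simp
        then have "(f b0 \<otimes> foldr H ws b0 \<oplus> T f ws) \<ominus> f b0 \<otimes> foldr H ws b0 \<in> P"
          using PD(4)[OF S[OF ws]] by simp
        moreover have "(f b0 \<otimes> foldr H ws b0 \<oplus> T f ws) \<ominus> f b0 \<otimes> foldr H ws b0 = T f ws"
          using fA wA[OF ws] TA[OF ws] by (simp add: minus_eq a_ac r_neg r_neg1 r_neg2)
        ultimately show ?thesis by simp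
      qed
      then have "\<forall>b\<in>B. f b \<in> P"
        using insert.IH[OF indB] fK unfolding T_def by (simp add: Pi_iff)
      then show ?thesis using True by simp
    next
      case False
      let ?f0 = "f b0"
      have f0: "?f0 \<in> K" "?f0 \<in> carrier A" using fK fA by simp_all
      have "\<exists>c. cong_mod P (f b) (sc c \<otimes> ?f0)" if b: "b \<in> B" for b
      proof (rule constant_fraction_scalar)
        show "f b \<in> K" "?f0 \<in> K" "?f0 \<notin> P" using fK b False by simp_all
        fix x assume x: "x \<in> Ham"
        have Hf: "H x (f b) \<in> K" "H x (f b) \<in> carrier A" if "b \<in> insert b0 B" for b
          using H_K[OF x fK[OF that]] K_carrier by simp_all
        \<comment> \<open>The derivative of the relation for \<open>ws\<close> minus the relation
          for \<open>x # ws\<close> is a relation with differentiated coefficients.\<close>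
        have R: "H x ?f0 \<otimes> foldr H ws b0 \<oplus> T (\<lambda>b. H x (f b)) ws \<in> P" if ws: "ws \<in> lists Ham" for ws
        proof -
          have xws: "x # ws \<in> lists Ham" using x ws by simp
          note car = f0(2) wA[OF ws] wA[OF xws] Hf(2) TA[OF ws, of f] TA[OF xws, of f]
            TA[OF ws, of "\<lambda>b. H x (f b)"] fA
          have "H x (T f ws) = (\<Oplus>b\<in>B. H x (f b \<otimes> foldr H ws b))"
            unfolding T_def using insert.hyps fA wA[OF ws]
            by (intro finsum_additive_op[OF H_additive[OF x]]) auto
          also have "\<dots> = (\<Oplus>b\<in>B. H x (f b) \<otimes> foldr H ws b \<oplus> f b \<otimes> foldr H (x # ws) b)"
            using fA wA[OF ws] wA[OF xws] Hf x by (intro finsum_cong') (auto simp: H_mult H_closed)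
          also have "\<dots> = T (\<lambda>b. H x (f b)) ws \<oplus> T f (x # ws)"
            unfolding T_def using fA wA[OF ws] wA[OF xws] Hf by (intro finsum_addf) auto
          finally have HT: "H x (T f ws) = T (\<lambda>b. H x (f b)) ws \<oplus> T f (x # ws)" .
          have "H x (?f0 \<otimes> foldr H ws b0 \<oplus> T f ws) =
              (H x ?f0 \<otimes> foldr H ws b0 \<oplus> T (\<lambda>b. H x (f b)) ws) \<oplus>
              (?f0 \<otimes> foldr H (x # ws) b0 \<oplus> T f (x # ws))"
            using x car by (simp add: H_add H_mult HT a_ac H_closed)
          moreover have "H x (?f0 \<otimes> foldr H ws b0 \<oplus> T f ws) \<in> P"
            using ham_stable_P S[OF ws] x by (simp add: ham_stable_def)
          ultimately have "(H x ?f0 \<otimes> foldr H ws b0 \<oplus> T (\<lambda>b. H x (f b)) ws) \<oplus>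
              (?f0 \<otimes> foldr H (x # ws) b0 \<oplus> T f (x # ws)) \<ominus>
              (?f0 \<otimes> foldr H (x # ws) b0 \<oplus> T f (x # ws)) \<in> P"
            using PD(4) S[OF xws] by simp
          then show ?thesis using car by (simp add: minus_eq a_assoc r_neg H_closed x)
        qed
        \<comment> \<open>The numerator of the derivative of \<open>f b / f b0\<close>.
          Cross-multiplying the original and the differentiated relation eliminates
          \<open>b0\<close>, so the induction hypothesis for \<open>B\<close> puts every
          \<open>k b\<close> into \<open>P\<close>.\<close>
        define k where "k b = ?f0 \<otimes> H x (f b) \<ominus> H x ?f0 \<otimes> f b" for b
        have "\<forall>b\<in>B. k b \<in> P"
        proof (rule insert.IH[OF indB])
          show "k \<in> B \<rightarrow> K" using Hf fK f0 by (auto simp: k_def K_minus K_mult)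
          fix ws assume ws: "ws \<in> lists Ham"
          define w0 U p q where "w0 = foldr H ws b0" and "U = ?f0 \<otimes> (H x ?f0 \<otimes> w0)"
            and "p = T (\<lambda>b. H x (f b)) ws" and "q = T f ws"
          have w0: "w0 \<in> K" "w0 \<in> carrier A" using wK[OF ws] wA[OF ws] by (simp_all add: w0_def)
          have pq: "p \<in> carrier A" "q \<in> carrier A" using TA[OF ws] Hf fA by (simp_all add: p_def q_def)
          have "(\<Oplus>b\<in>B. k b \<otimes> foldr H ws b) =
              (\<Oplus>b\<in>B. ?f0 \<otimes> (H x (f b) \<otimes> foldr H ws b) \<ominus> H x ?f0 \<otimes> (f b \<otimes> foldr H ws b))"
            using fA wA[OF ws] Hf f0 by (intro finsum_cong')
              (auto simp: k_def minus_eq l_distr l_minus m_assoc)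
          also have "\<dots> = (\<Oplus>b\<in>B. ?f0 \<otimes> (H x (f b) \<otimes> foldr H ws b)) \<ominus>
              (\<Oplus>b\<in>B. H x ?f0 \<otimes> (f b \<otimes> foldr H ws b))"
            using fA wA[OF ws] Hf f0 insert.hyps by (intro finsum_minus) auto
          also have "(\<Oplus>b\<in>B. ?f0 \<otimes> (H x (f b) \<otimes> foldr H ws b)) = ?f0 \<otimes> p"
            unfolding p_def T_def using wA[OF ws] Hf f0 insert.hyps
            by (intro finsum_mult_left[symmetric]) auto
          also have "(\<Oplus>b\<in>B. H x ?f0 \<otimes> (f b \<otimes> foldr H ws b)) = H x ?f0 \<otimes> q"
            unfolding q_def T_def using wA[OF ws] Hf fA insert.hyps
            by (intro finsum_mult_left[symmetric]) auto
          finally have sum: "(\<Oplus>b\<in>B. k b \<otimes> foldr H ws b) = ?f0 \<otimes> p \<ominus> H x ?f0 \<otimes> q" .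
          have "?f0 \<otimes> (H x ?f0 \<otimes> w0 \<oplus> p) \<ominus> H x ?f0 \<otimes> (?f0 \<otimes> w0 \<oplus> q) \<in> P"
            using PD(4)[OF PD(6)[OF R[OF ws] f0(2)] PD(6)[OF S[OF ws] Hf(2)[of b0]]]
            by (simp add: w0_def p_def q_def)
          moreover have "?f0 \<otimes> (H x ?f0 \<otimes> w0 \<oplus> p) = U \<oplus> ?f0 \<otimes> p"
            "H x ?f0 \<otimes> (?f0 \<otimes> w0 \<oplus> q) = U \<oplus> H x ?f0 \<otimes> q"
            using f0 w0 pq Hf[of b0] K_left_commute[of ?f0 "H x ?f0" w0] by (simp_all add: U_def r_distr)
          moreover have "(U \<oplus> ?f0 \<otimes> p) \<ominus> (U \<oplus> H x ?f0 \<otimes> q) = ?f0 \<otimes> p \<ominus> H x ?f0 \<otimes> q"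
            using f0 w0 pq Hf[of b0] by (simp add: U_def minus_eq minus_add a_ac r_neg r_neg1 r_neg2)
          ultimately show "(\<Oplus>b\<in>B. k b \<otimes> foldr H ws b) \<in> P" unfolding sum by simp
        qed
        then have "k b \<in> P" using b by blast
        then show "cong_mod P (?f0 \<otimes> H x (f b)) (f b \<otimes> H x ?f0)"
          using Hf[of b] Hf[of b0] f0 fK[of b] fA[of b] b K_commute[of "H x ?f0" "f b"]
          by (simp add: k_def cong_mod_def)
      qed
      then obtain c where c: "\<And>b. b \<in> B \<Longrightarrow> cong_mod P (f b) (sc (c b) \<otimes> ?f0)" by metis
      have BA: "b \<in> carrier A" if "b \<in> insert b0 B" for b using BKs[OF that] K_carrier by simp
      \<comment> \<open>With scalar ratios, the relation for the empty word is \<open>f b0\<close>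
        times a complex combination of \<open>insert b0 B\<close> in which \<open>b0\<close> has
        coefficient one; cancelling \<open>f b0\<close> contradicts independence.\<close>
      have "cong_mod P (T f []) (\<Oplus>b\<in>B. (sc (c b) \<otimes> ?f0) \<otimes> b)"
        unfolding T_def foldr.simps id_apply using c BA insert.hyps
        by (intro finsum_cong_mod[OF ideal_P] cong_mod_mult[OF ideal_P] cong_mod_refl[OF ideal_P]) simp_all
      also have "(\<Oplus>b\<in>B. (sc (c b) \<otimes> ?f0) \<otimes> b) = (\<Oplus>b\<in>B. ?f0 \<otimes> (sc (c b) \<otimes> b))"
        using BA f0 sc_central[OF f0(2)] by (intro finsum_cong') (auto simp: m_assoc[symmetric])
      also have "\<dots> = ?f0 \<otimes> (\<Oplus>b\<in>B. sc (c b) \<otimes> b)"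
        using BA f0 insert.hyps by (intro finsum_mult_left[symmetric]) auto
      finally have "cong_mod P (?f0 \<otimes> b0 \<oplus> T f []) (?f0 \<otimes> b0 \<oplus> ?f0 \<otimes> (\<Oplus>b\<in>B. sc (c b) \<otimes> b))"
        using BA f0 by (intro cong_mod_add[OF ideal_P] cong_mod_refl[OF ideal_P]) simp_all
      then have "?f0 \<otimes> b0 \<oplus> ?f0 \<otimes> (\<Oplus>b\<in>B. sc (c b) \<otimes> b) \<in> P"
        using cong_mod_mem[OF ideal_P] S[of "[]"] by simp
      then have "?f0 \<otimes> (b0 \<oplus> (\<Oplus>b\<in>B. sc (c b) \<otimes> b)) \<in> P"
        using BA[of b0] f0 ins(2)[of c] by (simp add: r_distr)
      then have "b0 \<oplus> (\<Oplus>b\<in>B. sc (c b) \<otimes> b) \<in> P"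
        using K_cancel[OF prime_P f0(1) False] BA[of b0] ins(2)[of c] by simp
      moreover have "(\<Oplus>b\<in>B. sc ((c(b0 := 1)) b) \<otimes> b) = (\<Oplus>b\<in>B. sc (c b) \<otimes> b)"
        by (rule ins(3)) (use insert.hyps in auto)
      ultimately have "(\<Oplus>b\<in>insert b0 B. sc ((c(b0 := 1)) b) \<otimes> b) \<in> P"
        using BA[of b0] unfolding ins(1) by (simp add: sc_one)
      then have "\<forall>b\<in>insert b0 B. (c(b0 := 1)) b = 0"
        by (rule independent_modD[OF insert.prems(1)])
      then show ?thesis by simp
    qed
  qed simp
qed

end

section \<open>Subquotients and coinduced modules\<close>

lemma (in left_module) submoduleD:
  assumes "submodule N A M"
  shows "v \<in> N \<Longrightarrow> v \<in> carrier M" "\<zero>\<^bsub>M\<^esub> \<in> N" "\<lbrakk>v \<in> N; w \<in> N\<rbrakk> \<Longrightarrow> v \<oplus>\<^bsub>M\<^esub> w \<in> N"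
    "\<lbrakk>a \<in> carrier A; v \<in> N\<rbrakk> \<Longrightarrow> a \<odot>\<^bsub>M\<^esub> v \<in> N" "v \<in> N \<Longrightarrow> \<ominus>\<^bsub>M\<^esub> v \<in> N"
    "\<lbrakk>v \<in> N; w \<in> N\<rbrakk> \<Longrightarrow> v \<ominus>\<^bsub>M\<^esub> w \<in> N"
proof -
  interpret N: submodule N A M by fact
  show 1: "v \<in> N \<Longrightarrow> v \<in> carrier M" for v using N.subset by auto
  show "\<zero>\<^bsub>M\<^esub> \<in> N" using N.one_closed by simp
  show 2: "\<lbrakk>v \<in> N; w \<in> N\<rbrakk> \<Longrightarrow> v \<oplus>\<^bsub>M\<^esub> w \<in> N" for v w using N.m_closed by simp
  show 3: "\<lbrakk>a \<in> carrier A; v \<in> N\<rbrakk> \<Longrightarrow> a \<odot>\<^bsub>M\<^esub> v \<in> N" for a v by (rule N.smult_closed)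
  show 4: "\<ominus>\<^bsub>M\<^esub> v \<in> N" if "v \<in> N" for v
    using 3[of "\<ominus>\<^bsub>A\<^esub> \<one>\<^bsub>A\<^esub>" v] 1[OF that] that by (simp add: act_neg_one)
  show "\<lbrakk>v \<in> N; w \<in> N\<rbrakk> \<Longrightarrow> v \<ominus>\<^bsub>M\<^esub> w \<in> N" by (simp add: LM.minus_eq 2 4)
qed

definition residue_class :: "('a, 'm) module \<Rightarrow> 'm set \<Rightarrow> 'm \<Rightarrow> 'm set"
  where "residue_class M U v = {w \<in> carrier M. w \<ominus>\<^bsub>M\<^esub> v \<in> U}"

definition representative :: "('a, 'm) module \<Rightarrow> 'm set \<Rightarrow> 'm set \<Rightarrow> 'm set \<Rightarrow> 'm"
  where "representative M W U q = (SOME v. v \<in> W \<and> residue_class M U v = q)"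

text \<open>Classes modulo \<open>U\<close> are sets of vectors of \<open>M\<close>, and the
  operations go through representatives chosen in \<open>W\<close>; the lemmas on
  \<open>representative\<close> make them independent of this choice.\<close>

definition subquotient :: "('a, 'm) module \<Rightarrow> 'm set \<Rightarrow> 'm set \<Rightarrow> ('a, 'm set) module"
  where "subquotient M W U = \<lparr>carrier = residue_class M U ` W, mult = \<lambda>p q. p, one = U,
    ring.zero = residue_class M U \<zero>\<^bsub>M\<^esub>,
    ring.add = \<lambda>p q. residue_class M U (representative M W U p \<oplus>\<^bsub>M\<^esub> representative M W U q),
    smult = \<lambda>a q. residue_class M U (a \<odot>\<^bsub>M\<^esub> representative M W U q)\<rparr>"

context left_module
begin

context
  fixes W U assumes W: "submodule W A M" and U: "submodule U A M" and UW: "U \<subseteq> W"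
begin

private abbreviation (input) "\<rho> \<equiv> residue_class M U"
private abbreviation (input) "rep \<equiv> representative M W U"
private abbreviation (input) "Q \<equiv> subquotient M W U"

lemma residue_class_eq:
  assumes v: "v \<in> carrier M" and w: "w \<in> carrier M"
  shows "\<rho> v = \<rho> w \<longleftrightarrow> v \<ominus>\<^bsub>M\<^esub> w \<in> U"
proof
  assume "\<rho> v = \<rho> w"
  moreover have "v \<in> \<rho> v" using v submoduleD(2)[OF U] by (simp add: residue_class_def LM.minus_eq LM.r_neg)
  ultimately show "v \<ominus>\<^bsub>M\<^esub> w \<in> U" by (simp add: residue_class_def)
next
  assume vw: "v \<ominus>\<^bsub>M\<^esub> w \<in> U"
  have "u \<ominus>\<^bsub>M\<^esub> v \<in> U \<longleftrightarrow> u \<ominus>\<^bsub>M\<^esub> w \<in> U" if u: "u \<in> carrier M" for u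
  proof -
    define p q where "p = u \<ominus>\<^bsub>M\<^esub> v" and "q = v \<ominus>\<^bsub>M\<^esub> w"
    have "u \<ominus>\<^bsub>M\<^esub> w = p \<oplus>\<^bsub>M\<^esub> q" "p \<in> carrier M" "q \<in> carrier M"
      using u v w by (simp_all add: p_def q_def LM.minus_eq LM.a_assoc LM.r_neg1)
    moreover from this have "p = (p \<oplus>\<^bsub>M\<^esub> q) \<ominus>\<^bsub>M\<^esub> q" by (simp add: LM.minus_eq LM.a_assoc LM.r_neg)
    ultimately show ?thesis using submoduleD(3,6)[OF U] vw unfolding p_def[symmetric] q_def[symmetric]
      by metis
  qed
  then show "\<rho> v = \<rho> w" by (auto simp: residue_class_def)
qed

lemma representative:
  assumes "v \<in> W"
  shows "rep (\<rho> v) \<in> W" "\<rho> (rep (\<rho> v)) = \<rho> v" "rep (\<rho> v) \<ominus>\<^bsub>M\<^esub> v \<in> U"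
proof -
  have "rep (\<rho> v) \<in> W \<and> \<rho> (rep (\<rho> v)) = \<rho> v"
    unfolding representative_def by (rule someI[of _ v]) (use assms in simp)
  then show "rep (\<rho> v) \<in> W" "\<rho> (rep (\<rho> v)) = \<rho> v" by auto
  then show "rep (\<rho> v) \<ominus>\<^bsub>M\<^esub> v \<in> U" using residue_class_eq assms submoduleD(1)[OF W] by metis
qed

text \<open>An additive map that preserves \<open>U\<close> sends two representatives of a class to
  the same class. This serves the action of \<open>A\<close> and the connection alike.\<close>

lemma residue_class_op:
  assumes f: "additive_op M f" and stable: "\<And>u. u \<in> U \<Longrightarrow> f u \<in> U" and v: "v \<in> W"
  shows "\<rho> (f (rep (\<rho> v))) = \<rho> (f v)"
proof -
  have car: "rep (\<rho> v) \<in> carrier M" "v \<in> carrier M" using representative(1)[OF v] v submoduleD(1)[OF W] by auto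
  have "f (rep (\<rho> v)) \<ominus>\<^bsub>M\<^esub> f v \<in> U"
    using stable[OF representative(3)[OF v]] LM.additive_opD(5)[OF f car] by simp
  then show ?thesis using residue_class_eq LM.additive_opD(1)[OF f] car by simp
qed

lemma subquotient_simps:
  "carrier Q = \<rho> ` W" "\<zero>\<^bsub>Q\<^esub> = \<rho> \<zero>\<^bsub>M\<^esub>"
  "\<lbrakk>v \<in> W; w \<in> W\<rbrakk> \<Longrightarrow> \<rho> v \<oplus>\<^bsub>Q\<^esub> \<rho> w = \<rho> (v \<oplus>\<^bsub>M\<^esub> w)"
  "\<lbrakk>a \<in> carrier A; v \<in> W\<rbrakk> \<Longrightarrow> a \<odot>\<^bsub>Q\<^esub> \<rho> v = \<rho> (a \<odot>\<^bsub>M\<^esub> v)"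
proof -
  show "carrier Q = \<rho> ` W" "\<zero>\<^bsub>Q\<^esub> = \<rho> \<zero>\<^bsub>M\<^esub>" by (simp_all add: subquotient_def)
  show "\<rho> v \<oplus>\<^bsub>Q\<^esub> \<rho> w = \<rho> (v \<oplus>\<^bsub>M\<^esub> w)" if v: "v \<in> W" and w: "w \<in> W"
  proof -
    have car: "rep (\<rho> v) \<in> carrier M" "v \<in> carrier M" "rep (\<rho> w) \<in> carrier M" "w \<in> carrier M"
      using representative(1)[OF v] representative(1)[OF w] v w submoduleD(1)[OF W] by auto
    have "(rep (\<rho> v) \<oplus>\<^bsub>M\<^esub> rep (\<rho> w)) \<ominus>\<^bsub>M\<^esub> (v \<oplus>\<^bsub>M\<^esub> w) =
        (rep (\<rho> v) \<ominus>\<^bsub>M\<^esub> v) \<oplus>\<^bsub>M\<^esub> (rep (\<rho> w) \<ominus>\<^bsub>M\<^esub> w)"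
      using car by (simp add: LM.minus_eq LM.minus_add LM.a_ac)
    then have "(rep (\<rho> v) \<oplus>\<^bsub>M\<^esub> rep (\<rho> w)) \<ominus>\<^bsub>M\<^esub> (v \<oplus>\<^bsub>M\<^esub> w) \<in> U"
      using submoduleD(3)[OF U representative(3)[OF v] representative(3)[OF w]] by simp
    then show ?thesis using residue_class_eq car by (simp add: subquotient_def)
  qed
  show "a \<odot>\<^bsub>Q\<^esub> \<rho> v = \<rho> (a \<odot>\<^bsub>M\<^esub> v)" if "a \<in> carrier A" "v \<in> W"
    using residue_class_op[of "\<lambda>v. a \<odot>\<^bsub>M\<^esub> v" v] that submoduleD(4)[OF U]
    by (simp add: subquotient_def additive_op_def act_closed act_add_right)
qed

lemma subquotient_left_module: "left_module A Q"
proof (intro left_module.intro left_module_axioms.intro LR.ring_axioms)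
  note WD = submoduleD[OF W]
  show "abelian_group Q"
  proof (rule abelian_groupI)
    fix q assume "q \<in> carrier Q"
    then obtain v where v: "q = \<rho> v" "v \<in> W" by (auto simp: subquotient_simps)
    then have "\<rho> (\<ominus>\<^bsub>M\<^esub> v) \<oplus>\<^bsub>Q\<^esub> q = \<zero>\<^bsub>Q\<^esub>"
      using WD by (simp add: subquotient_simps LM.l_neg)
    then show "\<exists>p\<in>carrier Q. p \<oplus>\<^bsub>Q\<^esub> q = \<zero>\<^bsub>Q\<^esub>" using v WD(5) by (auto simp: subquotient_simps)
  qed (auto simp: subquotient_simps WD LM.a_ac)
qed (use submoduleD[OF W] in \<open>auto simp: subquotient_simps act_add_left act_add_right act_mult act_one\<close>)

lemma subquotient_minus:
  assumes v: "v \<in> W" and w: "w \<in> W"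
  shows "\<rho> v \<ominus>\<^bsub>Q\<^esub> \<rho> w = \<rho> (v \<ominus>\<^bsub>M\<^esub> w)"
proof -
  interpret Q: left_module A Q by (rule subquotient_left_module)
  note WD = submoduleD[OF W]
  have "\<ominus>\<^bsub>Q\<^esub> \<rho> w = \<rho> (\<ominus>\<^bsub>M\<^esub> w)"
  proof (rule Q.LM.minus_equality)
    show "\<rho> (\<ominus>\<^bsub>M\<^esub> w) \<oplus>\<^bsub>Q\<^esub> \<rho> w = \<zero>\<^bsub>Q\<^esub>" using w WD by (simp add: subquotient_simps LM.l_neg)
  qed (use w WD(5) in \<open>auto simp: subquotient_simps\<close>)
  then show ?thesis using v w WD(5) by (simp add: Q.LM.minus_eq LM.minus_eq subquotient_simps)
qed

lemma residue_class_zero: "v \<in> W \<Longrightarrow> \<rho> v = \<zero>\<^bsub>Q\<^esub> \<longleftrightarrow> v \<in> U"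
proof -
  assume "v \<in> W"
  then have v: "v \<in> carrier M" by (rule submoduleD(1)[OF W])
  have "\<ominus>\<^bsub>M\<^esub> \<zero>\<^bsub>M\<^esub> = \<zero>\<^bsub>M\<^esub>" by simp
  then have "v \<ominus>\<^bsub>M\<^esub> \<zero>\<^bsub>M\<^esub> = v" using v unfolding LM.minus_eq by (metis LM.r_zero)
  then show ?thesis using residue_class_eq[OF v LM.zero_closed] by (simp add: subquotient_simps)
qed

lemma subquotient_submodule:
  assumes N: "submodule N A Q"
  shows "submodule {v \<in> W. \<rho> v \<in> N} A M" "U \<subseteq> {v \<in> W. \<rho> v \<in> N}" "N = \<rho> ` {v \<in> W. \<rho> v \<in> N}"
proof -
  interpret Q: left_module A Q by (rule subquotient_left_module)
  note ND = Q.submoduleD[OF N] and WD = submoduleD[OF W]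
  show sub: "U \<subseteq> {v \<in> W. \<rho> v \<in> N}"
  proof
    fix u assume u: "u \<in> U"
    then have "u \<in> W" using UW by blast
    then show "u \<in> {v \<in> W. \<rho> v \<in> N}" using residue_class_zero[of u] u ND(2) by simp
  qed
  show "submodule {v \<in> W. \<rho> v \<in> N} A M"
  proof (rule left_submoduleI)
    show "{v \<in> W. \<rho> v \<in> N} \<subseteq> carrier M" using WD(1) by blast
    show "\<zero>\<^bsub>M\<^esub> \<in> {v \<in> W. \<rho> v \<in> N}" using sub submoduleD(2)[OF U] by blast
    show "v \<oplus>\<^bsub>M\<^esub> w \<in> {v \<in> W. \<rho> v \<in> N}" if "v \<in> {v \<in> W. \<rho> v \<in> N}" "w \<in> {v \<in> W. \<rho> v \<in> N}" for v w
      using that ND(3)[of "\<rho> v" "\<rho> w"] WD(3) by (simp add: subquotient_simps)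
    show "a \<odot>\<^bsub>M\<^esub> v \<in> {v \<in> W. \<rho> v \<in> N}" if "a \<in> carrier A" "v \<in> {v \<in> W. \<rho> v \<in> N}" for a v
      using that ND(4)[of a "\<rho> v"] WD(4) by (simp add: subquotient_simps)
  qed
  show "N = \<rho> ` {v \<in> W. \<rho> v \<in> N}"
    using ND(1) by (auto simp: subquotient_simps)
qed

end

end

section \<open>Maximal left ideals and primitive ideals\<close>

definition regular_module :: "('a, 'b) ring_scheme \<Rightarrow> ('a, 'a) module"
  where "regular_module R = \<lparr>carrier = carrier R, mult = (\<otimes>\<^bsub>R\<^esub>), one = \<one>\<^bsub>R\<^esub>, ring.zero = \<zero>\<^bsub>R\<^esub>,
    ring.add = (\<oplus>\<^bsub>R\<^esub>), smult = (\<otimes>\<^bsub>R\<^esub>)\<rparr>"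

lemma regular_module_simps [simp]:
  "carrier (regular_module R) = carrier R" "\<zero>\<^bsub>regular_module R\<^esub> = \<zero>\<^bsub>R\<^esub>"
  "a \<oplus>\<^bsub>regular_module R\<^esub> b = a \<oplus>\<^bsub>R\<^esub> b" "a \<odot>\<^bsub>regular_module R\<^esub> b = a \<otimes>\<^bsub>R\<^esub> b"
  by (simp_all add: regular_module_def)

context ring
begin

lemma regular_left_module: "left_module R (regular_module R)"
proof (intro left_module.intro left_module_axioms.intro ring_axioms)
  show "abelian_group (regular_module R)"
  proof (rule abelian_groupI)
    show "\<exists>b\<in>carrier (regular_module R). b \<oplus>\<^bsub>regular_module R\<^esub> a = \<zero>\<^bsub>regular_module R\<^esub>"
      if "a \<in> carrier (regular_module R)" for a
      using that by (intro bexI[of _ "\<ominus> a"]) (simp_all add: l_neg)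
  qed (simp_all add: a_ac)
qed (simp_all add: l_distr r_distr m_assoc)

lemma regular_module_minus [simp]:
  assumes "a \<in> carrier R" "b \<in> carrier R"
  shows "a \<ominus>\<^bsub>regular_module R\<^esub> b = a \<ominus> b"
proof -
  interpret left_module R "regular_module R" by (rule regular_left_module)
  have "\<ominus>\<^bsub>regular_module R\<^esub> b = \<ominus> b"
    using LM.minus_equality[of "\<ominus> b" b] assms by (simp add: l_neg)
  then show ?thesis by (simp add: LM.minus_eq minus_eq)
qed

lemma left_ideal_submodule:
  "left_ideal R L \<Longrightarrow> submodule L R (regular_module R)"
  using left_module.left_submoduleI[OF regular_left_module, of L] by (auto simp: left_ideal_def)

lemma maximal_left_ideal_exists:
  assumes "left_ideal R I" "\<one> \<notin> I"
  shows "\<exists>L. left_ideal R L \<and> I \<subseteq> L \<and> \<one> \<notin> L \<and>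
    (\<forall>L'. left_ideal R L' \<and> L \<subseteq> L' \<and> \<one> \<notin> L' \<longrightarrow> L' = L)"
proof -
  define \<F> where "\<F> = {L. left_ideal R L \<and> I \<subseteq> L \<and> \<one> \<notin> L}"
  have "\<exists>L\<in>\<F>. \<forall>L'\<in>\<F>. L \<subseteq> L' \<longrightarrow> L' = L"
  proof (rule subset_Zorn_nonempty)
    show "\<F> \<noteq> {}" using assms by (auto simp: \<F>_def)
    fix C assume C: "C \<noteq> {}" "subset.chain \<F> C"
    then have F: "left_ideal R L" "I \<subseteq> L" "\<one> \<notin> L" if "L \<in> C" for L
      using that by (auto simp: subset.chain_def \<F>_def)
    have lin: "\<exists>L\<in>C. a \<in> L \<and> b \<in> L" if ab: "a \<in> \<Union>C" "b \<in> \<Union>C" for a b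
    proof -
      obtain L1 L2 where L: "L1 \<in> C" "a \<in> L1" "L2 \<in> C" "b \<in> L2" using ab by (elim UnionE)
      have "L1 \<subseteq> L2 \<or> L2 \<subseteq> L1" using C(2) L(1,3) by (simp add: subset_chain_def)
      then show ?thesis
      proof
        assume "L1 \<subseteq> L2"
        then show ?thesis using L by (intro bexI[of _ L2]) (simp_all add: subsetD)
      next
        assume "L2 \<subseteq> L1"
        then show ?thesis using L by (intro bexI[of _ L1]) (simp_all add: subsetD)
      qed
    qed
    have "left_ideal R (\<Union>C)"
      unfolding left_ideal_def
    proof (intro conjI ballI)
      show "\<Union>C \<subseteq> carrier R" by (intro Union_least subsetI) (rule left_idealD(1)[OF F(1)])
      obtain L0 where "L0 \<in> C" using C(1) by (meson all_not_in_conv)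
      then show "\<zero> \<in> \<Union>C" using left_idealD(2)[OF F(1)] by (meson UnionI)
      show "a \<oplus> b \<in> \<Union>C" if ab: "a \<in> \<Union>C" "b \<in> \<Union>C" for a b
      proof -
        obtain L where "L \<in> C" "a \<in> L" "b \<in> L" using lin[OF ab] by (elim bexE conjE)
        then show ?thesis using left_idealD(3)[OF F(1)] by (meson UnionI)
      qed
      show "c \<otimes> a \<in> \<Union>C" if a: "a \<in> \<Union>C" and c: "c \<in> carrier R" for a c
      proof -
        obtain L where "L \<in> C" "a \<in> L" using a by (elim UnionE)
        then show ?thesis using left_idealD(4)[OF F(1) _ c] by (meson UnionI)
      qed
    qed
    moreover obtain L0 where "L0 \<in> C" using C(1) by (meson all_not_in_conv)
    then have "I \<subseteq> \<Union>C" using F(2) by (meson Union_upper order_trans)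
    ultimately show "\<Union>C \<in> \<F>" using F(3) by (simp add: \<F>_def)
  qed
  then obtain L where L: "L \<in> \<F>" "\<forall>L'\<in>\<F>. L \<subseteq> L' \<longrightarrow> L' = L" by (elim bexE)
  have "L' = L" if L': "left_ideal R L' \<and> L \<subseteq> L' \<and> \<one> \<notin> L'" for L'
  proof -
    have "L' \<in> \<F>" using L' L(1) by (simp add: \<F>_def order_trans[of I L L'])
    then show ?thesis using L(2) L' by simp
  qed
  then show ?thesis using L(1) by (intro exI[of _ L]) (simp add: \<F>_def)
qed

text \<open>For a maximal left ideal \<open>L\<close> containing \<open>I\<close>, the module of
  cosets of \<open>L\<close> is simple. Its annihilator is a two-sided ideal that contains
  \<open>I\<close> and misses the unit, so it is \<open>I\<close>.\<close>

lemma maximal_ideal_primitive: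
  assumes I: "ideal I R" "\<one> \<notin> I"
    and max: "\<And>J. \<lbrakk>ideal J R; I \<subseteq> J\<rbrakk> \<Longrightarrow> J = I \<or> J = carrier R"
  shows "I \<in> Prim R"
proof -
  have "left_ideal R I"
    unfolding left_ideal_def
  proof (intro conjI ballI)
    show "I \<subseteq> carrier R" using idealD(1)[OF I(1)] by (rule subsetI)
  qed (use idealD(2,3,6)[OF I(1)] in simp_all)
  from maximal_left_ideal_exists[OF this I(2)]
  obtain L where L: "left_ideal R L" "I \<subseteq> L" "\<one> \<notin> L"
    and L_max: "\<forall>L'. left_ideal R L' \<and> L \<subseteq> L' \<and> \<one> \<notin> L' \<longrightarrow> L' = L"
    by (elim exE conjE)
  interpret RM: left_module R "regular_module R" by (rule regular_left_module)
  have "left_ideal R (carrier R)" by (simp add: left_ideal_def)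
  note W = left_ideal_submodule[OF this] and U = left_ideal_submodule[OF L(1)]
  have UW: "L \<subseteq> carrier R" using L(1) by (simp add: left_ideal_def)
  let ?Q = "subquotient (regular_module R) (carrier R) L"
  note Q = RM.subquotient_simps[OF W U UW] and zero = RM.residue_class_zero[OF W U UW]
  have "simple_module R ?Q"
    unfolding simple_module_def
  proof (intro conjI allI impI)
    show QM: "left_module R ?Q" by (rule RM.subquotient_left_module[OF W U UW])
    have "residue_class (regular_module R) L \<one> \<noteq> \<zero>\<^bsub>?Q\<^esub>" using zero L(3) by simp
    moreover have "residue_class (regular_module R) L \<one> \<in> carrier ?Q" unfolding Q(1) by simp
    ultimately show "carrier ?Q \<noteq> {\<zero>\<^bsub>?Q\<^esub>}" by (metis singletonD)
    fix N assume N: "submodule N R ?Q"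
    note sub = RM.subquotient_submodule[OF W U UW N]
    let ?L = "{v \<in> carrier R. residue_class (regular_module R) L v \<in> N}"
    have L': "left_ideal R ?L"
      unfolding left_ideal_def
    proof (intro conjI ballI)
      show "?L \<subseteq> carrier R" by (rule Collect_restrict)
      show "\<zero> \<in> ?L" using RM.submoduleD(2)[OF sub(1)] by simp
      show "a \<oplus> b \<in> ?L" if "a \<in> ?L" "b \<in> ?L" for a b
        using RM.submoduleD(3)[OF sub(1) that] by simp
      show "c \<otimes> a \<in> ?L" if "a \<in> ?L" "c \<in> carrier R" for a c
        using RM.submoduleD(4)[OF sub(1) that(2,1)] by simp
    qed
    show "N = {\<zero>\<^bsub>?Q\<^esub>} \<or> N = carrier ?Q"
    proof (cases "\<one> \<in> ?L")
      case True
      have "v \<in> ?L" if "v \<in> carrier R" for v using left_idealD(4)[OF L' True that] that by simp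
      then have "?L = carrier R" by (intro subset_antisym Collect_restrict subsetI)
      then have "N = carrier ?Q" using sub(3) unfolding Q(1) by simp
      then show ?thesis by simp
    next
      case False
      then have "?L = L" using L_max L' sub(2) by (elim allE[of _ ?L]) (rule mp, simp_all)
      then have "N = residue_class (regular_module R) L ` L" using sub(3) by simp
      also have "\<dots> = (\<lambda>_. \<zero>\<^bsub>?Q\<^esub>) ` L" by (rule image_cong) (use zero UW in auto)
      also have "\<dots> = {\<zero>\<^bsub>?Q\<^esub>}" using left_idealD(2)[OF L(1)] by (intro image_constant)
      finally show ?thesis by simp
    qed
  qed
  then have "annihilator R ?Q \<in> Prim R" by (rule annihilator_mem_Prim)
  moreover have "annihilator R ?Q = I"
  proof -
    have ann: "ideal (annihilator R ?Q) R"
      by (rule left_module.annihilator_ideal[OF RM.subquotient_left_module[OF W U UW]])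
    have "I \<subseteq> annihilator R ?Q"
    proof
      fix a assume a: "a \<in> I"
      note aR = idealD(1)[OF I(1) a]
      have "a \<odot>\<^bsub>?Q\<^esub> q = \<zero>\<^bsub>?Q\<^esub>" if q: "q \<in> carrier ?Q" for q
      proof -
        obtain v where v: "v \<in> carrier R" "q = residue_class (regular_module R) L v" using q unfolding Q(1) by auto
        have "a \<otimes> v \<in> L" using idealD(7)[OF I(1) a v(1)] L(2) by blast
        then show ?thesis using zero[of "a \<otimes> v"] Q(4)[OF aR v(1)] v aR by simp
      qed
      then show "a \<in> annihilator R ?Q" using aR by (simp add: annihilator_def)
    qed
    moreover have "\<one> \<notin> annihilator R ?Q"
    proof
      assume "\<one> \<in> annihilator R ?Q"
      then have "\<one> \<odot>\<^bsub>?Q\<^esub> residue_class (regular_module R) L \<one> = \<zero>\<^bsub>?Q\<^esub>"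
        by (simp add: annihilator_def Q(1))
      then show False using Q(4)[of \<one> \<one>] zero[of \<one>] L(3) by simp
    qed
    ultimately show ?thesis using max[OF ann] by blast
  qed
  ultimately show ?thesis by simp
qed

end

section \<open>Simple Poisson subquotients and additive maps\<close>

definition poisson_submodule ::
    "('z, 'c) ring_scheme \<Rightarrow> ('a, 'b) ring_scheme \<Rightarrow> ('a, 'm) module \<Rightarrow> ('z \<Rightarrow> 'm \<Rightarrow> 'm) \<Rightarrow> 'm set \<Rightarrow> bool"
  where "poisson_submodule Z A M nabla N \<longleftrightarrow>
    submodule N A M \<and> (\<forall>x\<in>carrier Z. \<forall>v\<in>N. nabla x v \<in> N)"

lemma subquotient_poisson_module:
  assumes PM: "poisson_module Z pb A H M nabla"
    and W: "poisson_submodule Z A M nabla W" and U: "poisson_submodule Z A M nabla U" and UW: "U \<subseteq> W"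
  defines "nab \<equiv> \<lambda>x q. residue_class M U (nabla x (representative M W U q))"
  shows "poisson_module Z pb A H (subquotient M W U) nab"
    and "\<And>x v. \<lbrakk>x \<in> carrier Z; v \<in> W\<rbrakk> \<Longrightarrow> nab x (residue_class M U v) = residue_class M U (nabla x v)"
proof -
  note ax = poisson_moduleD[OF PM]
  interpret L: left_module A M by (fact ax)
  interpret HO: hamiltonian_order Z pb A H by (fact ax)
  interpret RA: ring A by (fact ax)
  interpret RZ: cring Z by (fact ax)
  have sub: "submodule W A M" "submodule U A M"
    and st: "\<And>x v. \<lbrakk>x \<in> carrier Z; v \<in> W\<rbrakk> \<Longrightarrow> nabla x v \<in> W"
      "\<And>x v. \<lbrakk>x \<in> carrier Z; v \<in> U\<rbrakk> \<Longrightarrow> nabla x v \<in> U"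
    using W U by (simp_all add: poisson_submodule_def)
  have Zmod: "Module.module complex_field Z"
    using ax(6) by (auto simp: poisson_algebra_def Module.algebra_def)
  have sc: "(c \<odot>\<^bsub>Z\<^esub> \<one>\<^bsub>Z\<^esub>) \<in> carrier Z" for c
    by (intro Module.module.smult_closed[OF Zmod]) (auto simp: ring_of_type_algebra_def)
  have scx: "(c \<odot>\<^bsub>Z\<^esub> x) \<in> carrier Z" if "x \<in> carrier Z" for c x
    by (intro Module.module.smult_closed[OF Zmod]) (auto simp: ring_of_type_algebra_def that)
  have zA: "x \<odot>\<^bsub>A\<^esub> \<one>\<^bsub>A\<^esub> \<in> carrier A" if "x \<in> carrier Z" for x
    using that HO.ZA.smult_closed by blast
  note WD = L.submoduleD[OF sub(1)]
  note Q = L.subquotient_simps[OF sub UW] L.subquotient_minus[OF sub UW]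
  show nab: "nab x (residue_class M U v) = residue_class M U (nabla x v)"
    if "x \<in> carrier Z" "v \<in> W" for x v
    unfolding nab_def
    by (rule L.residue_class_op[OF sub UW])
      (use that st(2) poisson_module.nabla_closed[OF PM] poisson_module.nabla_add_right[OF PM] in
        \<open>simp_all add: additive_op_def\<close>)
  note rules = Q nab st(1) WD(1,3,4,6) sc scx zA HO.H_closed
    poisson_algebra.pb_closed[OF ax(6)]
  show "poisson_module Z pb A H (subquotient M W U) nab"
  proof (intro poisson_module.intro poisson_module_axioms.intro ax L.subquotient_left_module[OF sub UW])
  qed (auto simp: rules poisson_module.nabla_add_right[OF PM] poisson_module.nabla_add_left[OF PM]
      poisson_module.nabla_scale_right[OF PM] poisson_module.nabla_scale_left[OF PM]
      poisson_module.nabla_mult[OF PM] poisson_module.nabla_H[OF PM]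
      poisson_module.nabla_pb[OF PM])
qed

text \<open>\<open>U\<close> is maximal among the Poisson submodules that miss \<open>v\<close>, and
  \<open>W\<close> is generated by \<open>U\<close> and \<open>v\<close>; a submodule in between
  either contains \<open>v\<close>, hence is \<open>W\<close>, or misses it, hence is
  \<open>U\<close>. The last clause lets a property of all of \<open>W\<close> be checked on
  \<open>U\<close> and \<open>v\<close>, provided that it defines a Poisson submodule.\<close>

lemma simple_subquotient_exists:
  assumes PM: "poisson_module Z pb A H M nabla" and v: "v \<in> carrier M" "v \<noteq> \<zero>\<^bsub>M\<^esub>"
  shows "\<exists>W U nab. poisson_submodule Z A M nabla W \<and> poisson_submodule Z A M nabla U \<and> U \<subseteq> W \<and>
    v \<in> W \<and> v \<notin> U \<and> simple_poisson_module Z pb A H (subquotient M W U) nab \<and>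
    (\<forall>N. poisson_submodule Z A M nabla N \<and> U \<subseteq> N \<and> v \<in> N \<longrightarrow> W \<subseteq> N)"
proof -
  interpret L: left_module A M by (fact poisson_moduleD[OF PM])
  let ?S = "poisson_submodule Z A M nabla"
  have SD: "submodule N A M" "\<And>x w. \<lbrakk>x \<in> carrier Z; w \<in> N\<rbrakk> \<Longrightarrow> nabla x w \<in> N" if "?S N" for N
    using that by (simp_all add: poisson_submodule_def)
  note SM = L.submoduleD[OF SD(1)]
  have SI: "?S N" if "N \<subseteq> carrier M" "\<zero>\<^bsub>M\<^esub> \<in> N" "\<And>v w. \<lbrakk>v \<in> N; w \<in> N\<rbrakk> \<Longrightarrow> v \<oplus>\<^bsub>M\<^esub> w \<in> N"
    "\<And>a v. \<lbrakk>a \<in> carrier A; v \<in> N\<rbrakk> \<Longrightarrow> a \<odot>\<^bsub>M\<^esub> v \<in> N"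
    "\<And>x v. \<lbrakk>x \<in> carrier Z; v \<in> N\<rbrakk> \<Longrightarrow> nabla x v \<in> N" for N
    unfolding poisson_submodule_def using L.left_submoduleI[OF that(1-4)] that(5) by simp
  define \<F> where "\<F> = {N. ?S N \<and> v \<notin> N}"
  have "\<exists>U\<in>\<F>. \<forall>N\<in>\<F>. U \<subseteq> N \<longrightarrow> N = U"
  proof (rule subset_Zorn_nonempty)
    have "?S {\<zero>\<^bsub>M\<^esub>}"
      by (rule SI) (use nabla_zero[OF PM] in \<open>simp_all add: L.act_zero_right\<close>)
    then have "{\<zero>\<^bsub>M\<^esub>} \<in> \<F>" using v by (simp add: \<F>_def)
    then show "\<F> \<noteq> {}" by (metis empty_iff)
    fix C assume C: "C \<noteq> {}" "subset.chain \<F> C"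
    then have CF: "?S N" "v \<notin> N" if "N \<in> C" for N
      using that by (auto simp: subset.chain_def \<F>_def)
    obtain N0 where N0: "N0 \<in> C" using C(1) by (meson all_not_in_conv)
    have "?S (\<Union>C)"
    proof (rule SI)
      show "\<Union>C \<subseteq> carrier M" by (intro Union_least subsetI) (rule SM(1)[OF CF(1)])
      show "\<zero>\<^bsub>M\<^esub> \<in> \<Union>C" using SM(2)[OF CF(1)[OF N0]] N0 by (rule UnionI[rotated])
      show "u \<oplus>\<^bsub>M\<^esub> w \<in> \<Union>C" if uw: "u \<in> \<Union>C" "w \<in> \<Union>C" for u w
      proof -
        obtain N1 N2 where N: "N1 \<in> C" "u \<in> N1" "N2 \<in> C" "w \<in> N2" using uw by (elim UnionE)
        have "N1 \<subseteq> N2 \<or> N2 \<subseteq> N1" using C(2) N(1,3) by (simp add: subset_chain_def)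
        then show ?thesis
        proof
          assume "N1 \<subseteq> N2"
          then show ?thesis using SM(3)[OF CF(1)[OF N(3)] subsetD[OF _ N(2)] N(4)] N(3) by (intro UnionI)
        next
          assume "N2 \<subseteq> N1"
          then show ?thesis using SM(3)[OF CF(1)[OF N(1)] N(2) subsetD[OF _ N(4)]] N(1) by (intro UnionI)
        qed
      qed
      show "a \<odot>\<^bsub>M\<^esub> u \<in> \<Union>C" if a: "a \<in> carrier A" and u: "u \<in> \<Union>C" for a u
      proof -
        obtain N where N: "N \<in> C" "u \<in> N" using u by (elim UnionE)
        show ?thesis using SM(4)[OF CF(1)[OF N(1)] a N(2)] N(1) by (rule UnionI[rotated])
      qed
      show "nabla x u \<in> \<Union>C" if x: "x \<in> carrier Z" and u: "u \<in> \<Union>C" for x u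
      proof -
        obtain N where N: "N \<in> C" "u \<in> N" using u by (elim UnionE)
        show ?thesis using SD(2)[OF CF(1)[OF N(1)] x N(2)] N(1) by (rule UnionI[rotated])
      qed
    qed
    then show "\<Union>C \<in> \<F>" using CF(2) by (simp add: \<F>_def)
  qed
  then obtain U where UF: "U \<in> \<F>" and Umax: "\<forall>N\<in>\<F>. U \<subseteq> N \<longrightarrow> N = U" by (elim bexE)
  have U: "?S U" "v \<notin> U" using UF by (simp_all add: \<F>_def)
  define W where "W = {w \<in> carrier M. \<forall>N. ?S N \<and> U \<subseteq> N \<and> v \<in> N \<longrightarrow> w \<in> N}"
  have WE: "w \<in> N" if "w \<in> W" "?S N" "U \<subseteq> N" "v \<in> N" for w N using that unfolding W_def by simp
  have WI: "w \<in> W" if "w \<in> carrier M" "\<And>N. \<lbrakk>?S N; U \<subseteq> N; v \<in> N\<rbrakk> \<Longrightarrow> w \<in> N" for w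
    using that unfolding W_def by simp
  have WM: "w \<in> carrier M" if "w \<in> W" for w using that unfolding W_def by simp
  have W: "?S W"
  proof (rule SI)
    show "W \<subseteq> carrier M" using WM by (rule subsetI)
    show "\<zero>\<^bsub>M\<^esub> \<in> W" by (rule WI) (simp_all add: SM(2))
    show "u \<oplus>\<^bsub>M\<^esub> w \<in> W" if "u \<in> W" "w \<in> W" for u w
      by (rule WI) (use that WM in \<open>simp_all add: SM(3) WE\<close>)
    show "a \<odot>\<^bsub>M\<^esub> u \<in> W" if "a \<in> carrier A" "u \<in> W" for a u
      by (rule WI) (use that WM in \<open>simp_all add: SM(4) WE L.act_closed\<close>)
    show "nabla x u \<in> W" if "x \<in> carrier Z" "u \<in> W" for x u
      by (rule WI) (use that WM in \<open>simp_all add: SD(2) WE poisson_module.nabla_closed[OF PM]\<close>)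
  qed
  have UW: "U \<subseteq> W" by (intro subsetI WI) (auto intro: SM(1)[OF U(1)])
  have vW: "v \<in> W" using v by (intro WI)
  note sub = SD(1)[OF W] SD(1)[OF U(1)]
  note Q = L.subquotient_simps[OF sub UW] and zero = L.residue_class_zero[OF sub UW]
  let ?Q = "subquotient M W U"
  let ?nab = "\<lambda>x q. residue_class M U (nabla x (representative M W U q))"
  have "simple_poisson_module Z pb A H ?Q ?nab"
    unfolding simple_poisson_module_def
  proof (intro conjI allI impI)
    show "poisson_module Z pb A H ?Q ?nab" by (rule subquotient_poisson_module(1)[OF PM W U(1) UW])
    have "residue_class M U v \<noteq> \<zero>\<^bsub>?Q\<^esub>" using zero[OF vW] U(2) by simp
    moreover have "residue_class M U v \<in> carrier ?Q" unfolding Q(1) using vW by (rule imageI)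
    ultimately show "carrier ?Q \<noteq> {\<zero>\<^bsub>?Q\<^esub>}" by (metis singletonD)
    fix N assume N: "submodule N A ?Q \<and> (\<forall>x\<in>carrier Z. \<forall>q\<in>N. ?nab x q \<in> N)"
    note pre = L.subquotient_submodule[OF sub UW conjunct1[OF N]]
    let ?N = "{w \<in> W. residue_class M U w \<in> N}"
    have "?S ?N"
      unfolding poisson_submodule_def
    proof (intro conjI ballI pre(1))
      fix x w assume x: "x \<in> carrier Z" and w: "w \<in> ?N"
      have "?nab x (residue_class M U w) \<in> N" using N x w by simp
      then show "nabla x w \<in> ?N"
        using subquotient_poisson_module(2)[OF PM W U(1) UW x, of w] w SD(2)[OF W x] by simp
    qed
    note S = this
    show "N = {\<zero>\<^bsub>?Q\<^esub>} \<or> N = carrier ?Q"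
    proof (cases "v \<in> ?N")
      case True
      have "W \<subseteq> ?N" by (rule subsetI) (rule WE[OF _ S pre(2) True])
      then have "?N = W" by (intro subset_antisym Collect_restrict)
      then have "N = residue_class M U ` W" using pre(3) by simp
      then show ?thesis by (simp add: Q(1))
    next
      case False
      then have "?N \<in> \<F>" using S by (simp add: \<F>_def)
      then have "?N = U" using Umax pre(2) by simp
      then have "N = residue_class M U ` U" using pre(3) by simp
      also have "\<dots> = (\<lambda>_. \<zero>\<^bsub>?Q\<^esub>) ` U"
      proof (rule image_cong)
        fix u assume u: "u \<in> U"
        then have "u \<in> W" using UW by (rule subsetD[rotated])
        then show "residue_class M U u = \<zero>\<^bsub>?Q\<^esub>" using zero u by simp
      qed simp
      also have "\<dots> = {\<zero>\<^bsub>?Q\<^esub>}" using SM(2)[OF U(1)] by (intro image_constant)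
      finally show ?thesis by simp
    qed
  qed
  moreover have "\<forall>N. ?S N \<and> U \<subseteq> N \<and> v \<in> N \<longrightarrow> W \<subseteq> N" using WE by (intro allI impI subsetI) simp
  ultimately show ?thesis using W U UW vW by (intro exI conjI)
qed

text \<open>The additive maps from \<open>A\<close> to an abelian group \<open>V\<close>, extended by zero off the carrier. They
  form a Poisson module without any assumption on \<open>V\<close>: the Leibniz rule \<open>\<nabla>(xy) = x \<nabla>(y) + y \<nabla>(x)\<close>
  holds because the bracket of \<open>Z\<close> is skew.\<close>

definition coinduced :: "('z, 'a) module \<Rightarrow> ('a, 'v) module \<Rightarrow> ('a, 'a \<Rightarrow> 'v) module"
  where "coinduced A V = \<lparr>carrier = {\<phi>. (\<forall>a\<in>carrier A. \<phi> a \<in> carrier V) \<and>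
      (\<forall>a. a \<notin> carrier A \<longrightarrow> \<phi> a = \<zero>\<^bsub>V\<^esub>) \<and>
      (\<forall>a\<in>carrier A. \<forall>b\<in>carrier A. \<phi> (a \<oplus>\<^bsub>A\<^esub> b) = \<phi> a \<oplus>\<^bsub>V\<^esub> \<phi> b)},
    mult = \<lambda>\<phi> \<psi>. \<phi>, one = \<lambda>a. \<zero>\<^bsub>V\<^esub>, ring.zero = \<lambda>a. \<zero>\<^bsub>V\<^esub>,
    ring.add = \<lambda>\<phi> \<psi> a. \<phi> a \<oplus>\<^bsub>V\<^esub> \<psi> a,
    smult = \<lambda>c \<phi> a. if a \<in> carrier A then \<phi> (a \<otimes>\<^bsub>A\<^esub> c) else \<zero>\<^bsub>V\<^esub>\<rparr>"

text \<open>The sign is that of a dual action: it turns the derivation rule for \<open>H x\<close>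
  on \<open>a c\<close> into compatibility with the action of \<open>c\<close>, and it compensates
  the reversed order in which two such operators compose.\<close>

definition coinduced_nabla ::
    "('z, 'a) module \<Rightarrow> ('z \<Rightarrow> 'a \<Rightarrow> 'a) \<Rightarrow> ('a, 'v) module \<Rightarrow> 'z \<Rightarrow> ('a \<Rightarrow> 'v) \<Rightarrow> 'a \<Rightarrow> 'v"
  where "coinduced_nabla A H V x \<phi> a = (if a \<in> carrier A then \<ominus>\<^bsub>V\<^esub> \<phi> (H x a) else \<zero>\<^bsub>V\<^esub>)"

lemma coinduced_simps:
  "\<zero>\<^bsub>coinduced A V\<^esub> = (\<lambda>a. \<zero>\<^bsub>V\<^esub>)" "\<phi> \<oplus>\<^bsub>coinduced A V\<^esub> \<psi> = (\<lambda>a. \<phi> a \<oplus>\<^bsub>V\<^esub> \<psi> a)"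
  "c \<odot>\<^bsub>coinduced A V\<^esub> \<phi> = (\<lambda>a. if a \<in> carrier A then \<phi> (a \<otimes>\<^bsub>A\<^esub> c) else \<zero>\<^bsub>V\<^esub>)"
  by (simp_all add: coinduced_def)

context poisson_order
begin

lemma central_act: "\<lbrakk>z \<in> carrier Z; a \<in> carrier A\<rbrakk> \<Longrightarrow> a \<otimes>\<^bsub>A\<^esub> (z \<odot>\<^bsub>A\<^esub> \<one>\<^bsub>A\<^esub>) = z \<odot>\<^bsub>A\<^esub> a"
  "\<lbrakk>z \<in> carrier Z; a \<in> carrier A\<rbrakk> \<Longrightarrow> (z \<odot>\<^bsub>A\<^esub> \<one>\<^bsub>A\<^esub>) \<otimes>\<^bsub>A\<^esub> a = z \<odot>\<^bsub>A\<^esub> a"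
  using smult_mult_right[of z a "\<one>\<^bsub>A\<^esub>"] smult_mult_left[of z "\<one>\<^bsub>A\<^esub>" a] by simp_all

lemma scalar_closed: "c \<odot>\<^bsub>Z\<^esub> x \<in> carrier Z" if "x \<in> carrier Z"
  by (intro PZ.smult_closed) (simp_all add: that ring_of_type_algebra_def)

lemma H_smult:
  assumes "x \<in> carrier Z" "y \<in> carrier Z" "a \<in> carrier A"
  shows "H x (y \<odot>\<^bsub>A\<^esub> a) = pb x y \<odot>\<^bsub>A\<^esub> a \<oplus>\<^bsub>A\<^esub> y \<odot>\<^bsub>A\<^esub> H x a"
proof -
  have "H x ((y \<odot>\<^bsub>A\<^esub> \<one>\<^bsub>A\<^esub>) \<otimes>\<^bsub>A\<^esub> a) =
      (pb x y \<odot>\<^bsub>A\<^esub> \<one>\<^bsub>A\<^esub>) \<otimes>\<^bsub>A\<^esub> a \<oplus>\<^bsub>A\<^esub> (y \<odot>\<^bsub>A\<^esub> \<one>\<^bsub>A\<^esub>) \<otimes>\<^bsub>A\<^esub> H x a"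
    using assms by (simp add: H_derivation H_extends ZA.smult_closed)
  then show ?thesis using assms by (simp add: central_act H_closed PZ.pb_closed)
qed

lemma coinduced_poisson_module:
  assumes "abelian_group V"
  shows "poisson_module Z pb A H (coinduced A V) (coinduced_nabla A H V)"
proof -
  interpret V: abelian_group V by fact
  have V0: "\<ominus>\<^bsub>V\<^esub> \<zero>\<^bsub>V\<^esub> = \<zero>\<^bsub>V\<^esub>" by simp
  let ?N = "coinduced A V"
  have carI: "\<phi> \<in> carrier ?N" if "\<And>a. a \<in> carrier A \<Longrightarrow> \<phi> a \<in> carrier V"
    "\<And>a. a \<notin> carrier A \<Longrightarrow> \<phi> a = \<zero>\<^bsub>V\<^esub>"
    "\<And>a b. \<lbrakk>a \<in> carrier A; b \<in> carrier A\<rbrakk> \<Longrightarrow> \<phi> (a \<oplus>\<^bsub>A\<^esub> b) = \<phi> a \<oplus>\<^bsub>V\<^esub> \<phi> b" for \<phi>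
    using that by (simp add: coinduced_def)
  have cl: "\<phi> a \<in> carrier V" if "\<phi> \<in> carrier ?N" for \<phi> a
    using that by (cases "a \<in> carrier A") (simp_all add: coinduced_def)
  have out: "\<phi> a = \<zero>\<^bsub>V\<^esub>" if "\<phi> \<in> carrier ?N" "a \<notin> carrier A" for \<phi> a
    using that by (simp add: coinduced_def)
  have add: "\<phi> (a \<oplus>\<^bsub>A\<^esub> b) = \<phi> a \<oplus>\<^bsub>V\<^esub> \<phi> b"
    if "\<phi> \<in> carrier ?N" "a \<in> carrier A" "b \<in> carrier A" for \<phi> a b
    using that by (simp add: coinduced_def)
  have neg: "\<phi> (\<ominus>\<^bsub>A\<^esub> a) = \<ominus>\<^bsub>V\<^esub> \<phi> a" if \<phi>: "\<phi> \<in> carrier ?N" and a: "a \<in> carrier A" for \<phi> a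
  proof -
    have "\<phi> \<zero>\<^bsub>A\<^esub> = \<zero>\<^bsub>V\<^esub>" using add[OF \<phi>, of "\<zero>\<^bsub>A\<^esub>" "\<zero>\<^bsub>A\<^esub>"] cl[OF \<phi>, of "\<zero>\<^bsub>A\<^esub>"]
      by (metis ZA.M.l_zero ZA.M.zero_closed V.add.l_cancel_one')
    then have "\<phi> (\<ominus>\<^bsub>A\<^esub> a) \<oplus>\<^bsub>V\<^esub> \<phi> a = \<zero>\<^bsub>V\<^esub>"
      using add[OF \<phi>, of "\<ominus>\<^bsub>A\<^esub> a" a] a by (simp add: ZA.M.l_neg)
    then show ?thesis using V.minus_equality cl[OF \<phi>] by metis
  qed
  have gN: "abelian_group ?N"
  proof (rule abelian_groupI)
    show "\<phi> \<oplus>\<^bsub>?N\<^esub> \<psi> \<in> carrier ?N" if "\<phi> \<in> carrier ?N" "\<psi> \<in> carrier ?N" for \<phi> \<psi>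
      by (rule carI) (use that in \<open>simp_all add: coinduced_simps cl out add V.a_ac\<close>)
    show "\<zero>\<^bsub>?N\<^esub> \<in> carrier ?N" by (rule carI) (simp_all add: coinduced_simps)
    show "\<exists>\<psi>\<in>carrier ?N. \<psi> \<oplus>\<^bsub>?N\<^esub> \<phi> = \<zero>\<^bsub>?N\<^esub>" if "\<phi> \<in> carrier ?N" for \<phi>
    proof (rule bexI)
      show "(\<lambda>a. \<ominus>\<^bsub>V\<^esub> \<phi> a) \<oplus>\<^bsub>?N\<^esub> \<phi> = \<zero>\<^bsub>?N\<^esub>" using that by (simp add: coinduced_simps cl V.l_neg)
      show "(\<lambda>a. \<ominus>\<^bsub>V\<^esub> \<phi> a) \<in> carrier ?N"
        by (rule carI) (use that in \<open>simp_all add: cl out add V.minus_add\<close>)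
    qed
  qed (simp_all add: coinduced_simps cl V.a_ac)
  have minus: "\<phi> \<ominus>\<^bsub>?N\<^esub> \<psi> = (\<lambda>a. \<phi> a \<ominus>\<^bsub>V\<^esub> \<psi> a)" if "\<phi> \<in> carrier ?N" "\<psi> \<in> carrier ?N" for \<phi> \<psi>
  proof -
    interpret N: abelian_group ?N by (rule gN)
    have \<psi>: "(\<lambda>a. \<ominus>\<^bsub>V\<^esub> \<psi> a) \<in> carrier ?N"
      by (rule carI) (use that in \<open>simp_all add: cl out add V.minus_add\<close>)
    have "\<ominus>\<^bsub>?N\<^esub> \<psi> = (\<lambda>a. \<ominus>\<^bsub>V\<^esub> \<psi> a)"
      by (rule N.minus_equality[OF _ that(2) \<psi>]) (use that in \<open>simp add: coinduced_simps cl V.l_neg\<close>)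
    then show ?thesis by (simp add: N.minus_eq coinduced_simps V.minus_eq)
  qed
  have smult: "c \<odot>\<^bsub>?N\<^esub> \<phi> \<in> carrier ?N" if "c \<in> carrier A" "\<phi> \<in> carrier ?N" for c \<phi>
    by (rule carI) (use that in \<open>simp_all add: coinduced_simps cl add AR.l_distr\<close>)
  have nab: "coinduced_nabla A H V x \<phi> \<in> carrier ?N" if "x \<in> carrier Z" "\<phi> \<in> carrier ?N" for x \<phi>
    by (rule carI) (use that in \<open>simp_all add: coinduced_nabla_def cl add H_add_right H_closed V.minus_add\<close>)
  have lm: "left_module A ?N"
  proof (intro left_module.intro left_module_axioms.intro gN AR.ring_axioms)
    show "c \<odot>\<^bsub>?N\<^esub> \<phi> \<in> carrier ?N" if "c \<in> carrier A" "\<phi> \<in> carrier ?N" for c \<phi>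
      using that by (rule smult)
  qed (auto simp: coinduced_simps cl add out AR.r_distr AR.m_assoc intro!: ext)
  note S = coinduced_simps coinduced_nabla_def cl add neg
  show ?thesis
  proof (intro poisson_module.intro poisson_module_axioms.intro lm hamiltonian_order_axioms)
    show "coinduced_nabla A H V x \<phi> \<in> carrier ?N" if "x \<in> carrier Z" "\<phi> \<in> carrier ?N" for x \<phi>
      using that by (rule nab)
    show "coinduced_nabla A H V x (\<phi> \<oplus>\<^bsub>?N\<^esub> \<psi>) =
        coinduced_nabla A H V x \<phi> \<oplus>\<^bsub>?N\<^esub> coinduced_nabla A H V x \<psi>"
      if "x \<in> carrier Z" "\<phi> \<in> carrier ?N" "\<psi> \<in> carrier ?N" for x \<phi> \<psi>
      using that by (intro ext) (simp add: S V.minus_add)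
    show "coinduced_nabla A H V x (((c \<odot>\<^bsub>Z\<^esub> \<one>\<^bsub>Z\<^esub>) \<odot>\<^bsub>A\<^esub> \<one>\<^bsub>A\<^esub>) \<odot>\<^bsub>?N\<^esub> \<phi>) =
        ((c \<odot>\<^bsub>Z\<^esub> \<one>\<^bsub>Z\<^esub>) \<odot>\<^bsub>A\<^esub> \<one>\<^bsub>A\<^esub>) \<odot>\<^bsub>?N\<^esub> coinduced_nabla A H V x \<phi>"
      if "x \<in> carrier Z" "\<phi> \<in> carrier ?N" for x c \<phi>
      using that by (intro ext)
        (simp add: S H_closed central_act scalar_closed ZA.smult_closed H_scale_right)
    show "coinduced_nabla A H V (x \<oplus>\<^bsub>Z\<^esub> y) \<phi> =
        coinduced_nabla A H V x \<phi> \<oplus>\<^bsub>?N\<^esub> coinduced_nabla A H V y \<phi>"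
      if "x \<in> carrier Z" "y \<in> carrier Z" "\<phi> \<in> carrier ?N" for x y \<phi>
      using that by (intro ext) (simp add: S H_add_left H_closed V.minus_add)
    show "coinduced_nabla A H V (c \<odot>\<^bsub>Z\<^esub> x) \<phi> =
        ((c \<odot>\<^bsub>Z\<^esub> \<one>\<^bsub>Z\<^esub>) \<odot>\<^bsub>A\<^esub> \<one>\<^bsub>A\<^esub>) \<odot>\<^bsub>?N\<^esub> coinduced_nabla A H V x \<phi>"
      if "x \<in> carrier Z" "\<phi> \<in> carrier ?N" for c x \<phi>
      using that by (intro ext)
        (simp add: S H_closed central_act scalar_closed ZA.smult_closed H_scale_right H_scale_left)
    show "coinduced_nabla A H V (x \<otimes>\<^bsub>Z\<^esub> y) \<phi> =
        (x \<odot>\<^bsub>A\<^esub> \<one>\<^bsub>A\<^esub>) \<odot>\<^bsub>?N\<^esub> coinduced_nabla A H V y \<phi> \<oplus>\<^bsub>?N\<^esub>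
        (y \<odot>\<^bsub>A\<^esub> \<one>\<^bsub>A\<^esub>) \<odot>\<^bsub>?N\<^esub> coinduced_nabla A H V x \<phi>"
      if xy: "x \<in> carrier Z" "y \<in> carrier Z" and \<phi>: "\<phi> \<in> carrier ?N" for x y \<phi>
    proof (rule ext)
      fix a
      show "coinduced_nabla A H V (x \<otimes>\<^bsub>Z\<^esub> y) \<phi> a =
        ((x \<odot>\<^bsub>A\<^esub> \<one>\<^bsub>A\<^esub>) \<odot>\<^bsub>?N\<^esub> coinduced_nabla A H V y \<phi> \<oplus>\<^bsub>?N\<^esub>
          (y \<odot>\<^bsub>A\<^esub> \<one>\<^bsub>A\<^esub>) \<odot>\<^bsub>?N\<^esub> coinduced_nabla A H V x \<phi>) a"
      proof (cases "a \<in> carrier A")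
        case a: True
        define u s t where "u = \<phi> (pb x y \<odot>\<^bsub>A\<^esub> a)" and "s = \<phi> (x \<odot>\<^bsub>A\<^esub> H y a)" and "t = \<phi> (y \<odot>\<^bsub>A\<^esub> H x a)"
        have ust: "u \<in> carrier V" "s \<in> carrier V" "t \<in> carrier V"
          using cl[OF \<phi>] by (simp_all add: u_def s_def t_def)
        \<comment> \<open>Letting \<open>x\<close> or \<open>y\<close> act multiplies the argument,
          so differentiation produces the extra terms \<open>{y, x} a\<close> and
          \<open>{x, y} a\<close>, which cancel.\<close>
        have "pb y x = \<ominus>\<^bsub>Z\<^esub> pb x y" using PZ.pb_skew[OF xy(2,1)] .
        then have "\<phi> (pb y x \<odot>\<^bsub>A\<^esub> a) = \<ominus>\<^bsub>V\<^esub> u"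
          using neg[OF \<phi>, of "pb x y \<odot>\<^bsub>A\<^esub> a"] xy a
          by (simp add: u_def ZA.smult_l_minus PZ.pb_closed ZA.smult_closed)
        moreover have "H y (x \<odot>\<^bsub>A\<^esub> a) = pb y x \<odot>\<^bsub>A\<^esub> a \<oplus>\<^bsub>A\<^esub> x \<odot>\<^bsub>A\<^esub> H y a"
          "H x (y \<odot>\<^bsub>A\<^esub> a) = pb x y \<odot>\<^bsub>A\<^esub> a \<oplus>\<^bsub>A\<^esub> y \<odot>\<^bsub>A\<^esub> H x a" using H_smult xy a by simp_all
        ultimately have "\<phi> (H y (x \<odot>\<^bsub>A\<^esub> a)) = \<ominus>\<^bsub>V\<^esub> u \<oplus>\<^bsub>V\<^esub> s" "\<phi> (H x (y \<odot>\<^bsub>A\<^esub> a)) = u \<oplus>\<^bsub>V\<^esub> t"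
          using add[OF \<phi>] xy a by (simp_all add: u_def s_def t_def H_closed PZ.pb_closed ZA.smult_closed)
        moreover have "\<phi> (H (x \<otimes>\<^bsub>Z\<^esub> y) a) = s \<oplus>\<^bsub>V\<^esub> t"
          using add[OF \<phi>] xy a by (simp add: s_def t_def H_leibniz H_closed ZA.smult_closed)
        moreover have "u \<oplus>\<^bsub>V\<^esub> (\<ominus>\<^bsub>V\<^esub> s \<oplus>\<^bsub>V\<^esub> (\<ominus>\<^bsub>V\<^esub> t \<oplus>\<^bsub>V\<^esub> \<ominus>\<^bsub>V\<^esub> u)) = \<ominus>\<^bsub>V\<^esub> s \<oplus>\<^bsub>V\<^esub> \<ominus>\<^bsub>V\<^esub> t"
        proof -
          have "u \<oplus>\<^bsub>V\<^esub> (\<ominus>\<^bsub>V\<^esub> s \<oplus>\<^bsub>V\<^esub> (\<ominus>\<^bsub>V\<^esub> t \<oplus>\<^bsub>V\<^esub> \<ominus>\<^bsub>V\<^esub> u)) = (u \<oplus>\<^bsub>V\<^esub> \<ominus>\<^bsub>V\<^esub> u) \<oplus>\<^bsub>V\<^esub> (\<ominus>\<^bsub>V\<^esub> s \<oplus>\<^bsub>V\<^esub> \<ominus>\<^bsub>V\<^esub> t)"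
            using ust by (simp add: V.a_ac)
          then show ?thesis using ust by (simp add: V.r_neg)
        qed
        ultimately show ?thesis
          using a xy ust by (simp add: coinduced_simps coinduced_nabla_def central_act ZA.smult_closed
              V.minus_add V.minus_minus V.a_ac V.r_neg V.r_neg1 V.r_neg2)
      qed (simp add: coinduced_simps coinduced_nabla_def)
    qed
    show "H x c \<odot>\<^bsub>?N\<^esub> \<phi> = coinduced_nabla A H V x (c \<odot>\<^bsub>?N\<^esub> \<phi>) \<ominus>\<^bsub>?N\<^esub> c \<odot>\<^bsub>?N\<^esub> coinduced_nabla A H V x \<phi>"
      if x: "x \<in> carrier Z" and c: "c \<in> carrier A" and \<phi>: "\<phi> \<in> carrier ?N" for x c \<phi>
      unfolding minus[OF nab[OF x smult[OF c \<phi>]] smult[OF c nab[OF x \<phi>]]]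
    proof (rule ext)
      fix a
      show "(H x c \<odot>\<^bsub>?N\<^esub> \<phi>) a =
        coinduced_nabla A H V x (c \<odot>\<^bsub>?N\<^esub> \<phi>) a \<ominus>\<^bsub>V\<^esub> (c \<odot>\<^bsub>?N\<^esub> coinduced_nabla A H V x \<phi>) a"
        using x c \<phi> by (cases "a \<in> carrier A")
          (simp_all add: S H_closed H_derivation V.minus_eq V.minus_add V.minus_minus
            V.a_assoc[symmetric] V.l_neg V.r_neg)
    qed
    \<comment> \<open>Flatness of the connection is the Jacobi identity of the extended bracket,
      composed with \<open>\<phi>\<close>.\<close>
    show "coinduced_nabla A H V (pb x y) \<phi> =
        coinduced_nabla A H V x (coinduced_nabla A H V y \<phi>) \<ominus>\<^bsub>?N\<^esub>
        coinduced_nabla A H V y (coinduced_nabla A H V x \<phi>)"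
      if x: "x \<in> carrier Z" and y: "y \<in> carrier Z" and \<phi>: "\<phi> \<in> carrier ?N" for x y \<phi>
      unfolding minus[OF nab[OF x nab[OF y \<phi>]] nab[OF y nab[OF x \<phi>]]]
      using x y \<phi> by (intro ext)
        (simp add: V0 S H_closed H_jacobi ZA.M.minus_eq V.minus_eq V.minus_add V.minus_minus V.a_comm)
  qed
qed

text \<open>Let \<open>\<phi>\<close> be the map \<open>a \<mapsto> a v\<close>, on which
  \<open>A\<close> acts as on \<open>v\<close>, and take a simple subquotient of \<open>W\<close> by
  \<open>U\<close> that detects \<open>\<phi>\<close>. If its annihilator had an element outside
  \<open>I\<close>, simplicity of \<open>V\<close> would turn it into some \<open>k\<close> in the
  annihilator with \<open>k v = v\<close>, so \<open>\<phi> = k \<phi>\<close> would lie in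
  \<open>U\<close>. Conversely, the maps that the Poisson core sends into \<open>U\<close> form a
  Poisson submodule containing \<open>U\<close> and \<open>\<phi>\<close>, hence
  \<open>W\<close>.\<close>

lemma poisson_core_poisson_annihilator:
  assumes I: "I \<in> Prim A"
  shows "poisson_core Z A H I \<in> poisson_annihilators Z pb A H"
proof -
  obtain V :: "('b, 'b) module" where V: "simple_module A V" "I = annihilator A V"
    using I by (auto simp: Prim_def)
  interpret V: left_module A V using V by (simp add: simple_module_def)
  have idI: "ideal I A" unfolding V(2) by (rule V.annihilator_ideal)
  note core = poisson_core_greatest[OF hamiltonian_order_axioms idI]
  have ID: "\<And>a b. \<lbrakk>a \<in> carrier A; b \<in> I\<rbrakk> \<Longrightarrow> a \<otimes>\<^bsub>A\<^esub> b \<in> I" using AR.idealD(6)[OF idI] by simp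
  obtain v where v: "v \<in> carrier V" "v \<noteq> \<zero>\<^bsub>V\<^esub>"
    using V(1) V.LM.zero_closed by (auto simp: simple_module_def)
  have cyclic: "\<exists>b\<in>carrier A. b \<odot>\<^bsub>V\<^esub> w = u"
    if w: "w \<in> carrier V" "w \<noteq> \<zero>\<^bsub>V\<^esub>" and u: "u \<in> carrier V" for w u
  proof -
    have "submodule ((\<lambda>b. b \<odot>\<^bsub>V\<^esub> w) ` carrier A) A V"
    proof (rule V.left_submoduleI)
      show "(\<lambda>b. b \<odot>\<^bsub>V\<^esub> w) ` carrier A \<subseteq> carrier V" using V.act_closed w by auto
      show "\<zero>\<^bsub>V\<^esub> \<in> (\<lambda>b. b \<odot>\<^bsub>V\<^esub> w) ` carrier A"
        using V.act_zero_left[OF w(1)] by (intro image_eqI[of _ _ "\<zero>\<^bsub>A\<^esub>"]) simp_all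
      show "p \<oplus>\<^bsub>V\<^esub> q \<in> (\<lambda>b. b \<odot>\<^bsub>V\<^esub> w) ` carrier A"
        if "p \<in> (\<lambda>b. b \<odot>\<^bsub>V\<^esub> w) ` carrier A" "q \<in> (\<lambda>b. b \<odot>\<^bsub>V\<^esub> w) ` carrier A" for p q
        using that w by (auto simp: V.act_add_left[symmetric])
      show "a \<odot>\<^bsub>V\<^esub> p \<in> (\<lambda>b. b \<odot>\<^bsub>V\<^esub> w) ` carrier A"
        if "a \<in> carrier A" "p \<in> (\<lambda>b. b \<odot>\<^bsub>V\<^esub> w) ` carrier A" for a p
        using that w by (auto simp: V.act_mult[symmetric])
    qed
    moreover have "w \<in> (\<lambda>b. b \<odot>\<^bsub>V\<^esub> w) ` carrier A"
      using w by (intro image_eqI[of _ _ "\<one>\<^bsub>A\<^esub>"]) (simp_all add: V.act_one)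
    ultimately have "(\<lambda>b. b \<odot>\<^bsub>V\<^esub> w) ` carrier A = carrier V"
      using V(1) w(2) unfolding simple_module_def by (metis singletonD)
    then have "u \<in> (\<lambda>b. b \<odot>\<^bsub>V\<^esub> w) ` carrier A" using u by simp
    then show ?thesis by (elim imageE) (rule bexI, simp_all)
  qed
  let ?N = "coinduced A V" and ?nab = "coinduced_nabla A H V"
  have PN: "poisson_module Z pb A H ?N ?nab"
    by (rule coinduced_poisson_module[OF V.LM.abelian_group_axioms])
  interpret N: left_module A ?N by (fact poisson_moduleD[OF PN])
  define \<phi> where "\<phi> a = (if a \<in> carrier A then a \<odot>\<^bsub>V\<^esub> v else \<zero>\<^bsub>V\<^esub>)" for a
  have \<phi>N: "\<phi> \<in> carrier ?N"
    using v by (simp add: coinduced_def \<phi>_def V.act_closed V.act_add_left)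
  have "\<phi> \<one>\<^bsub>A\<^esub> \<noteq> \<zero>\<^bsub>V\<^esub>" using v by (simp add: \<phi>_def V.act_one)
  then have \<phi>0: "\<phi> \<noteq> \<zero>\<^bsub>?N\<^esub>" by (auto simp: coinduced_simps)
  have act\<phi>: "a \<odot>\<^bsub>?N\<^esub> \<phi> = (\<lambda>b. if b \<in> carrier A then b \<odot>\<^bsub>V\<^esub> (a \<odot>\<^bsub>V\<^esub> v) else \<zero>\<^bsub>V\<^esub>)"
    if "a \<in> carrier A" for a
    using that v by (intro ext) (simp add: coinduced_simps \<phi>_def V.act_mult)
  obtain W U nab where WU: "poisson_submodule Z A ?N ?nab W" "poisson_submodule Z A ?N ?nab U" "U \<subseteq> W"
    "\<phi> \<in> W" "\<phi> \<notin> U" and simple: "simple_poisson_module Z pb A H (subquotient ?N W U) nab"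
    and least: "\<forall>Y. poisson_submodule Z A ?N ?nab Y \<and> U \<subseteq> Y \<and> \<phi> \<in> Y \<longrightarrow> W \<subseteq> Y"
    using simple_subquotient_exists[OF PN \<phi>N \<phi>0] by (elim exE conjE)
  have sub: "submodule W A ?N" "submodule U A ?N" using WU(1,2) by (simp_all add: poisson_submodule_def)
  note UD = N.submoduleD[OF sub(2)] and WD = N.submoduleD[OF sub(1)]
  let ?Q = "subquotient ?N W U"
  note Q = N.subquotient_simps[OF sub WU(3)] and zero = N.residue_class_zero[OF sub WU(3)]
  have PQ: "poisson_module Z pb A H ?Q nab" using simple by (simp add: simple_poisson_module_def)
  have annQ: "poisson_ideal Z A H (annihilator A ?Q)"
    unfolding poisson_ideal_def
    using left_module.annihilator_ideal[OF poisson_moduleD(2)[OF PQ]] poisson_annihilator_stable[OF PQ]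
    by simp
  have annE: "a \<odot>\<^bsub>?N\<^esub> w \<in> U" if "a \<in> annihilator A ?Q" "w \<in> W" for a w
  proof -
    have a: "a \<in> carrier A" using that(1) by (simp add: annihilator_def)
    have "residue_class ?N U w \<in> carrier ?Q" using that(2) by (simp add: Q(1))
    then have "a \<odot>\<^bsub>?Q\<^esub> residue_class ?N U w = \<zero>\<^bsub>?Q\<^esub>" using that(1) by (simp add: annihilator_def)
    then show ?thesis using Q(4)[OF a that(2)] zero[OF WD(4)[OF a that(2)]] by simp
  qed
  have "annihilator A ?Q \<subseteq> I"
  proof
    fix a assume a: "a \<in> annihilator A ?Q"
    have aA: "a \<in> carrier A" using a by (simp add: annihilator_def)
    show "a \<in> I"
    proof (rule ccontr)
      assume "a \<notin> I"
      then obtain u where u: "u \<in> carrier V" "a \<odot>\<^bsub>V\<^esub> u \<noteq> \<zero>\<^bsub>V\<^esub>"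
        using aA V(2) by (auto simp: annihilator_def)
      obtain c where c: "c \<in> carrier A" "c \<odot>\<^bsub>V\<^esub> v = u" using cyclic[OF v u(1)] by (elim bexE)
      obtain b where b: "b \<in> carrier A" "b \<odot>\<^bsub>V\<^esub> (a \<odot>\<^bsub>V\<^esub> u) = v"
        using cyclic[OF V.act_closed[OF aA u(1)] u(2) v(1)] by (elim bexE)
      define k where "k = b \<otimes>\<^bsub>A\<^esub> (a \<otimes>\<^bsub>A\<^esub> c)"
      have k: "k \<in> annihilator A ?Q" "k \<in> carrier A"
        using annQ AR.idealD(6,7)[of "annihilator A ?Q"] a b(1) c(1) aA
        by (simp_all add: k_def poisson_ideal_def)
      have "k \<odot>\<^bsub>V\<^esub> v = v" using aA b c v by (simp add: k_def V.act_mult V.act_closed)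
      then have "k \<odot>\<^bsub>?N\<^esub> \<phi> = \<phi>" using act\<phi>[OF k(2)] by (simp add: \<phi>_def fun_eq_iff)
      then show False using annE[OF k(1) WU(4)] WU(5) by simp
    qed
  qed
  then have "annihilator A ?Q \<subseteq> poisson_core Z A H I" by (rule core(3)[OF annQ])
  moreover have "poisson_core Z A H I \<subseteq> annihilator A ?Q"
  proof -
    let ?C = "poisson_core Z A H I"
    have C: "ideal ?C A" "\<And>x a. \<lbrakk>x \<in> carrier Z; a \<in> ?C\<rbrakk> \<Longrightarrow> H x a \<in> ?C"
      using core(1) by (simp_all add: poisson_ideal_def)
    note CD = AR.idealD[OF C(1)]
    define Y where "Y = {w \<in> carrier ?N. \<forall>a\<in>?C. a \<odot>\<^bsub>?N\<^esub> w \<in> U}"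
    have YE: "w \<in> carrier ?N" "\<And>a. a \<in> ?C \<Longrightarrow> a \<odot>\<^bsub>?N\<^esub> w \<in> U" if "w \<in> Y" for w
      using that by (simp_all add: Y_def)
    have YI: "w \<in> Y" if "w \<in> carrier ?N" "\<And>a. a \<in> ?C \<Longrightarrow> a \<odot>\<^bsub>?N\<^esub> w \<in> U" for w
      using that by (simp add: Y_def)
    have "poisson_submodule Z A ?N ?nab Y"
      unfolding poisson_submodule_def
    proof (intro conjI ballI N.left_submoduleI)
      show "Y \<subseteq> carrier ?N" using YE(1) by (rule subsetI)
      show "\<zero>\<^bsub>?N\<^esub> \<in> Y" by (rule YI) (simp_all add: N.act_zero_right CD(1) UD(2))
      show "p \<oplus>\<^bsub>?N\<^esub> q \<in> Y" if "p \<in> Y" "q \<in> Y" for p q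
        by (rule YI) (use that in \<open>simp_all add: YE N.act_add_right CD(1) UD(3)\<close>)
      show "c \<odot>\<^bsub>?N\<^esub> p \<in> Y" if c: "c \<in> carrier A" and p: "p \<in> Y" for c p
      proof (rule YI)
        show "c \<odot>\<^bsub>?N\<^esub> p \<in> carrier ?N" by (rule N.act_closed[OF c YE(1)[OF p]])
        fix a assume a: "a \<in> ?C"
        show "a \<odot>\<^bsub>?N\<^esub> (c \<odot>\<^bsub>?N\<^esub> p) \<in> U"
          using N.act_mult[OF CD(1)[OF a] c YE(1)[OF p]] YE(2)[OF p CD(7)[OF a c]] by simp
      qed
      fix x p assume x: "x \<in> carrier Z" and p: "p \<in> Y"
      show "?nab x p \<in> Y"
      proof (rule YI)
        show np: "?nab x p \<in> carrier ?N" by (rule poisson_module.nabla_closed[OF PN x YE(1)[OF p]])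
        fix a assume a: "a \<in> ?C"
        note aA = CD(1)[OF a]
        have car: "?nab x (a \<odot>\<^bsub>?N\<^esub> p) \<in> carrier ?N" "a \<odot>\<^bsub>?N\<^esub> ?nab x p \<in> carrier ?N"
          using N.act_closed[OF aA] np YE(1)[OF p] poisson_module.nabla_closed[OF PN x] by simp_all
        have "?nab x (a \<odot>\<^bsub>?N\<^esub> p) \<in> U"
          using WU(2) x YE(2)[OF p a] by (simp add: poisson_submodule_def)
        moreover have "H x a \<odot>\<^bsub>?N\<^esub> p \<in> U" using YE(2)[OF p C(2)[OF x a]] .
        ultimately have "?nab x (a \<odot>\<^bsub>?N\<^esub> p) \<ominus>\<^bsub>?N\<^esub> H x a \<odot>\<^bsub>?N\<^esub> p \<in> U" by (rule UD(6))
        moreover have "?nab x (a \<odot>\<^bsub>?N\<^esub> p) \<ominus>\<^bsub>?N\<^esub> H x a \<odot>\<^bsub>?N\<^esub> p = a \<odot>\<^bsub>?N\<^esub> ?nab x p"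
          unfolding poisson_module.nabla_H[OF PN x aA YE(1)[OF p]]
          using car by (simp add: N.LM.minus_eq N.LM.minus_add N.LM.minus_minus N.LM.r_neg2)
        ultimately show "a \<odot>\<^bsub>?N\<^esub> ?nab x p \<in> U" by simp
      qed
    qed
    moreover have "U \<subseteq> Y" by (intro subsetI YI) (simp_all add: UD(1,4) CD(1))
    moreover have "\<phi> \<in> Y"
    proof (rule YI[OF \<phi>N])
      fix a assume a: "a \<in> ?C"
      have "a \<in> I" using core(2) a by (rule subsetD)
      then have "a \<odot>\<^bsub>V\<^esub> v = \<zero>\<^bsub>V\<^esub>" using V(2) v by (simp add: annihilator_def)
      then have "a \<odot>\<^bsub>?N\<^esub> \<phi> = \<zero>\<^bsub>?N\<^esub>"
        using act\<phi>[OF CD(1)[OF a]] by (simp add: coinduced_simps V.act_zero_right cong: if_cong)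
      then show "a \<odot>\<^bsub>?N\<^esub> \<phi> \<in> U" using UD(2) by simp
    qed
    ultimately have WY: "W \<subseteq> Y" using least by simp
    show ?thesis
    proof
      fix a assume a: "a \<in> ?C"
      note aA = CD(1)[OF a]
      have "a \<odot>\<^bsub>?Q\<^esub> q = \<zero>\<^bsub>?Q\<^esub>" if q: "q \<in> carrier ?Q" for q
      proof -
        obtain w where w: "w \<in> W" "q = residue_class ?N U w" using q unfolding Q(1) by (elim imageE)
        have "a \<odot>\<^bsub>?N\<^esub> w \<in> U" using YE(2)[OF subsetD[OF WY w(1)] a] .
        then show ?thesis using Q(4)[OF aA w(1)] zero[OF WD(4)[OF aA w(1)]] w(2) by simp
      qed
      then show "a \<in> annihilator A ?Q" using aA by (simp add: annihilator_def)
    qed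
  qed
  ultimately have "poisson_core Z A H I = annihilator A ?Q" by simp
  then show ?thesis using annihilator_mem_poisson_annihilators[OF simple] by simp
qed

end

section \<open>Primitive ideals with a prescribed core\<close>

context complex_scalars
begin

primrec span_upto :: "(nat \<Rightarrow> 'a) \<Rightarrow> nat \<Rightarrow> 'a set"
  where "span_upto e 0 = {\<zero>}"
  | "span_upto e (Suc n) = {v \<oplus> sc c \<otimes> e n | v c. v \<in> span_upto e n}"

text \<open>The sequence is taken from \<open>S\<close> itself: for the central subring its members
  stay inside the subring, where Wronskians are formed.\<close>

definition countable_span :: "'a set \<Rightarrow> bool"
  where "countable_span S \<longleftrightarrow> (\<exists>e. range e \<subseteq> S \<and> S \<subseteq> (\<Union>n. span_upto e n))"

lemma regular_complex_module: "complex_module A (regular_module A) sc"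
  by (intro complex_module.intro complex_scalars_axioms regular_left_module)

lemma span_upto_regular: "complex_module.initial_span (regular_module A) sc e n = span_upto e n"
proof (induction n)
  case (Suc n)
  then show ?case by (simp add: complex_module.initial_span.simps[OF regular_complex_module])
qed (simp add: complex_module.initial_span.simps[OF regular_complex_module])

lemma countable_span_carrier:
  "countable_span (carrier A) \<Longrightarrow> complex_module.countable_dim (regular_module A) sc"
  unfolding countable_span_def complex_module.countable_dim_def[OF regular_complex_module]
  by (simp add: span_upto_regular)

end

context noetherian_diff_ring
begin

text \<open>\<open>I\<close> is maximal among the ideals that contain \<open>P\<close> and avoid
  \<open>S\<close>. Primitivity comes from showing that \<open>I\<close> is a maximal ideal, because
  every element of \<open>K\<close>, in particular of \<open>S\<close>, is a scalar modulo
  \<open>I\<close>.\<close>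

lemma prime_avoiding_exists:
  assumes A: "countable_span (carrier A)" and P: "ideal P A"
    and S: "countable S" "S \<subseteq> K" "\<one> \<in> S" "\<And>s t. \<lbrakk>s \<in> S; t \<in> S\<rbrakk> \<Longrightarrow> s \<otimes> t \<in> S" "S \<inter> P = {}"
  shows "\<exists>I. nc_prime I \<and> P \<subseteq> I \<and> S \<inter> I = {} \<and> I \<in> Prim A"
proof -
  have SK: "s \<in> K" "s \<in> carrier A" if "s \<in> S" for s
    using subsetD[OF S(2) that] K_carrier by simp_all
  define \<F> where "\<F> = {I. ideal I A \<and> P \<subseteq> I \<and> S \<inter> I = {}}"
  have "\<exists>I\<in>\<F>. \<forall>J\<in>\<F>. I \<subseteq> J \<longrightarrow> J = I"
  proof (rule subset_Zorn_nonempty)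
    have "P \<in> \<F>" using P S(5) by (simp add: \<F>_def)
    then show "\<F> \<noteq> {}" by (metis empty_iff)
    fix C assume C: "C \<noteq> {}" "subset.chain \<F> C"
    then have F: "ideal I A" "P \<subseteq> I" "S \<inter> I = {}" if "I \<in> C" for I
      using that by (auto simp: subset.chain_def \<F>_def)
    obtain I0 where I0: "I0 \<in> C" using C(1) by (meson all_not_in_conv)
    have "ideal (\<Union>C) A"
    proof (rule two_sided_idealI)
      show "\<Union>C \<subseteq> carrier A" by (intro Union_least subsetI) (rule idealD(1)[OF F(1)])
      show "\<zero> \<in> \<Union>C" using idealD(2)[OF F(1)[OF I0]] I0 by (rule UnionI[rotated])
      show "u \<oplus> w \<in> \<Union>C" if uw: "u \<in> \<Union>C" "w \<in> \<Union>C" for u w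
      proof -
        obtain N1 N2 where N: "N1 \<in> C" "u \<in> N1" "N2 \<in> C" "w \<in> N2" using uw by (elim UnionE)
        have "N1 \<subseteq> N2 \<or> N2 \<subseteq> N1" using C(2) N(1,3) by (simp add: subset_chain_def)
        then show ?thesis
        proof
          assume "N1 \<subseteq> N2"
          then show ?thesis using idealD(3)[OF F(1)[OF N(3)] subsetD[OF _ N(2)] N(4)] N(3) by (intro UnionI)
        next
          assume "N2 \<subseteq> N1"
          then show ?thesis using idealD(3)[OF F(1)[OF N(1)] N(2) subsetD[OF _ N(4)]] N(1) by (intro UnionI)
        qed
      qed
      show "c \<otimes> u \<in> \<Union>C" "u \<otimes> c \<in> \<Union>C" if u: "u \<in> \<Union>C" and c: "c \<in> carrier A" for u c
      proof -
        obtain N where N: "N \<in> C" "u \<in> N" using u by (elim UnionE)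
        show "c \<otimes> u \<in> \<Union>C" using idealD(6)[OF F(1)[OF N(1)] N(2) c] N(1) by (rule UnionI[rotated])
        show "u \<otimes> c \<in> \<Union>C" using idealD(7)[OF F(1)[OF N(1)] N(2) c] N(1) by (rule UnionI[rotated])
      qed
    qed
    moreover have "P \<subseteq> \<Union>C" using F(2)[OF I0] I0 by (meson Union_upper order_trans)
    moreover have "S \<inter> \<Union>C = {}" using F(3) by (simp add: Int_Union)
    ultimately show "\<Union>C \<in> \<F>" by (simp add: \<F>_def)
  qed
  then obtain I where "I \<in> \<F>" and max: "\<forall>J\<in>\<F>. I \<subseteq> J \<longrightarrow> J = I" by (elim bexE)
  then have I: "ideal I A" "P \<subseteq> I" "S \<inter> I = {}" by (simp_all add: \<F>_def)
  note ID = idealD[OF I(1)]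
  have S_I: "s \<notin> I" if "s \<in> S" for s using I(3) that by (meson disjoint_iff)
  have meets: "\<exists>s\<in>S. s \<in> J" if J: "ideal J A" "I \<subseteq> J" "J \<noteq> I" for J
  proof (rule ccontr)
    assume "\<not> ?thesis"
    then have "J \<in> \<F>" using J I(2) by (auto simp: \<F>_def)
    then show False using max J by simp
  qed
  have prime: "nc_prime I"
    unfolding nc_prime_def
  proof (intro conjI ballI impI I(1))
    show "\<one> \<notin> I" using S_I S(3) by simp
    fix a b assume a: "a \<in> carrier A" and b: "b \<in> carrier A" and ab: "\<forall>c\<in>carrier A. a \<otimes> c \<otimes> b \<in> I"
    show "a \<in> I \<or> b \<in> I"
    proof (rule ccontr)
      assume nab: "\<not> (a \<in> I \<or> b \<in> I)"
      \<comment> \<open>The elements that multiply \<open>b\<close> into \<open>I\<close> form an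
        ideal larger than \<open>I\<close>, so it meets \<open>S\<close> in some \<open>s\<close>.
        The elements that \<open>s\<close> multiplies into \<open>I\<close> form another one, which
        gives \<open>t\<close> in \<open>S\<close> with \<open>s t\<close> in \<open>I\<close>, a
        contradiction.\<close>
      define J where "J = {u \<in> carrier A. \<forall>c\<in>carrier A. u \<otimes> c \<otimes> b \<in> I}"
      have "ideal J A"
      proof (rule two_sided_idealI)
        show "u \<oplus> w \<in> J" if "u \<in> J" "w \<in> J" for u w
          using that b ID(3) by (simp add: J_def l_distr)
        show "c \<otimes> u \<in> J" if "u \<in> J" "c \<in> carrier A" for u c
        proof -
          have "c \<otimes> u \<otimes> d \<otimes> b = c \<otimes> (u \<otimes> d \<otimes> b)" if "d \<in> carrier A" for d
            using \<open>u \<in> J\<close> \<open>c \<in> carrier A\<close> that b by (simp add: J_def m_assoc)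
          then show ?thesis using that ID(6)[of _ c] by (simp add: J_def)
        qed
        show "u \<otimes> c \<in> J" if "u \<in> J" "c \<in> carrier A" for u c
        proof -
          have "u \<otimes> c \<otimes> d \<otimes> b \<in> I" if d: "d \<in> carrier A" for d
          proof -
            have "u \<otimes> (c \<otimes> d) \<otimes> b \<in> I" using \<open>u \<in> J\<close> \<open>c \<in> carrier A\<close> d by (simp add: J_def)
            then show ?thesis using \<open>u \<in> J\<close> \<open>c \<in> carrier A\<close> d by (simp add: J_def m_assoc)
          qed
          then show ?thesis using that by (simp add: J_def)
        qed
      qed (use b ID(2) in \<open>simp_all add: J_def Collect_restrict\<close>)
      moreover have "I \<subseteq> J"
        by (rule subsetI) (use b ID(1,7) in \<open>simp add: J_def\<close>)
      moreover have "J \<noteq> I" using a ab nab by (auto simp: J_def)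
      ultimately obtain s where s: "s \<in> S" "s \<in> J" using meets by (elim meets[elim_format] bexE)
      have "s \<otimes> \<one> \<otimes> b \<in> I" using s(2) unfolding J_def by blast
      then have sb: "s \<otimes> b \<in> I" using SK[OF s(1)] by simp
      define J' where "J' = {u \<in> carrier A. s \<otimes> u \<in> I}"
      have "ideal J' A"
      proof (rule two_sided_idealI)
        show "u \<oplus> w \<in> J'" if "u \<in> J'" "w \<in> J'" for u w
          using that SK[OF s(1)] ID(3) by (simp add: J'_def r_distr)
        show "c \<otimes> u \<in> J'" if "u \<in> J'" "c \<in> carrier A" for u c
        proof -
          have u: "u \<in> carrier A" "s \<otimes> u \<in> I" using that(1) by (simp_all add: J'_def)
          have "s \<otimes> (c \<otimes> u) = c \<otimes> (s \<otimes> u)"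
            using K_central[OF SK(1)[OF s(1)] that(2)] u(1) that(2) SK(2)[OF s(1)]
              m_assoc[of s c u] m_assoc[of c s u] by simp
          then show ?thesis using ID(6)[OF u(2) that(2)] u(1) that(2) by (simp add: J'_def)
        qed
        show "u \<otimes> c \<in> J'" if "u \<in> J'" "c \<in> carrier A" for u c
          using that SK[OF s(1)] ID(7)[of "s \<otimes> u" c] by (simp add: J'_def m_assoc)
      qed (use SK[OF s(1)] ID(2) in \<open>simp_all add: J'_def Collect_restrict\<close>)
      moreover have "I \<subseteq> J'"
        by (rule subsetI) (use SK[OF s(1)] ID(1,6) in \<open>simp add: J'_def\<close>)
      moreover have "J' \<noteq> I" using b sb nab by (auto simp: J'_def)
      ultimately obtain t where t: "t \<in> S" "t \<in> J'" using meets by (elim meets[elim_format] bexE)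
      have "s \<otimes> t \<in> I" using t(2) by (simp add: J'_def)
      then show False using S_I S(4)[OF s(1) t(1)] by simp
    qed
  qed
  interpret reg: complex_module A "regular_module A" sc by (rule regular_complex_module)
  \<comment> \<open>Otherwise every \<open>k - l\<close> generates together with \<open>I\<close> an
    ideal that meets \<open>S\<close>, so some \<open>s\<close> in \<open>S\<close> has a resolvent
    under \<open>k\<close> at \<open>l\<close> modulo \<open>I\<close>. As \<open>S\<close> is
    countable, the complex numbers would be a countable union of countable sets.\<close>
  have scalar: "\<exists>c. k \<ominus> sc c \<in> I" if k: "k \<in> K" for k
  proof (rule ccontr)
    assume none: "\<not> ?thesis"
    have kA: "k \<in> carrier A" using K_carrier[OF k] .
    have shift: "k \<otimes> v \<oplus> sc (- c) \<otimes> v = (k \<ominus> sc c) \<otimes> v" if "v \<in> carrier A" for c v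
      using that kA by (simp add: sc_uminus minus_eq l_distr)
    have kc: "k \<ominus> sc c \<in> K" for c using K_minus[OF k K_sc] .
    have cnt: "countable {l. \<exists>y\<in>carrier A. (k \<otimes> y \<oplus> sc (- l) \<otimes> y) \<ominus> s \<in> I}" if s: "s \<in> S" for s
    proof -
      have "countable {l. \<exists>y\<in>carrier (regular_module A). (k \<otimes> y \<oplus>\<^bsub>regular_module A\<^esub>
          sc (- l) \<odot>\<^bsub>regular_module A\<^esub> y) \<ominus>\<^bsub>regular_module A\<^esub> s \<in> I}"
      proof (rule reg.countable_resolvents[OF _ _ _ _ _ _ _ _ _ _ _ countable_span_carrier[OF A]])
        show "k \<otimes> (sc c \<odot>\<^bsub>regular_module A\<^esub> v) = sc c \<odot>\<^bsub>regular_module A\<^esub> (k \<otimes> v)"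
          if "v \<in> carrier (regular_module A)" for c v
          using that kA K_left_commute sc_central[OF kA, of c] m_assoc[of k "sc c" v] m_assoc[of "sc c" k v]
          by simp
        show "v \<in> I" if "v \<in> carrier (regular_module A)"
          "k \<otimes> v \<oplus>\<^bsub>regular_module A\<^esub> sc (- c) \<odot>\<^bsub>regular_module A\<^esub> v \<in> I" for c v
        proof -
          have "(k \<ominus> sc c) \<otimes> v \<in> I" using that shift[of v c] by simp
          moreover have "k \<ominus> sc c \<notin> I" using none by simp
          ultimately show ?thesis using K_cancel[OF prime kc] that(1) by simp
        qed
      qed (use kA ID SK[OF s] S_I[OF s] in \<open>simp_all add: r_distr subsetI\<close>)
      moreover have "(\<exists>y\<in>carrier (regular_module A). (k \<otimes> y \<oplus>\<^bsub>regular_module A\<^esub>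
          sc (- l) \<odot>\<^bsub>regular_module A\<^esub> y) \<ominus>\<^bsub>regular_module A\<^esub> s \<in> I) \<longleftrightarrow>
        (\<exists>y\<in>carrier A. (k \<otimes> y \<oplus> sc (- l) \<otimes> y) \<ominus> s \<in> I)" for l
        using kA SK[OF s] by (simp cong: bex_cong)
      ultimately show ?thesis by simp
    qed
    have "\<exists>s\<in>S. \<exists>y\<in>carrier A. (k \<otimes> y \<oplus> sc (- l) \<otimes> y) \<ominus> s \<in> I" for l
    proof -
      define r where "r = k \<ominus> sc l"
      have r: "r \<in> K" "r \<in> carrier A" "r \<notin> I" using kc K_carrier none by (simp_all add: r_def)
      \<comment> \<open>The sum of \<open>I\<close> and the multiples of \<open>r\<close>, an ideal
        because \<open>r\<close> is central.\<close>
      define J where "J = {u \<in> carrier A. \<exists>y\<in>carrier A. cong_mod I u (r \<otimes> y)}"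
      have JI: "u \<in> J" if "u \<in> carrier A" "y \<in> carrier A" "cong_mod I u (r \<otimes> y)" for u y
        using that unfolding J_def by blast
      have JE: "\<exists>y\<in>carrier A. cong_mod I u (r \<otimes> y)" "u \<in> carrier A" if "u \<in> J" for u
        using that unfolding J_def by simp_all
      have "ideal J A"
      proof (rule two_sided_idealI)
        show "J \<subseteq> carrier A" unfolding J_def by (rule Collect_restrict)
        show "\<zero> \<in> J" by (rule JI[of _ \<zero>]) (use r cong_mod_refl[OF I(1)] in simp_all)
        show "u \<oplus> w \<in> J" if uw: "u \<in> J" "w \<in> J" for u w
        proof -
          obtain y y' where y: "y \<in> carrier A" "cong_mod I u (r \<otimes> y)" "y' \<in> carrier A" "cong_mod I w (r \<otimes> y')"
            using JE(1)[OF uw(1)] JE(1)[OF uw(2)] by (elim bexE)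
          show ?thesis
            by (rule JI[of _ "y \<oplus> y'"]) (use y JE(2)[OF uw(1)] JE(2)[OF uw(2)] r
                cong_mod_add[OF I(1) y(2,4)] in \<open>simp_all add: r_distr\<close>)
        qed
        show "c \<otimes> u \<in> J" "u \<otimes> c \<in> J" if u: "u \<in> J" and c: "c \<in> carrier A" for u c
        proof -
          obtain y where y: "y \<in> carrier A" "cong_mod I u (r \<otimes> y)" using JE(1)[OF u] by (elim bexE)
          have "c \<otimes> (r \<otimes> y) = r \<otimes> (c \<otimes> y)"
            using K_central[OF r(1) c] m_assoc[of c r y] m_assoc[of r c y] c y(1) r(2) by simp
          then have "cong_mod I (c \<otimes> u) (r \<otimes> (c \<otimes> y))"
            using cong_mod_mult[OF I(1) cong_mod_refl[OF I(1) c] y(2)] by simp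
          then show "c \<otimes> u \<in> J" using JI[of "c \<otimes> u" "c \<otimes> y"] c y(1) JE(2)[OF u] by simp
          have "cong_mod I (u \<otimes> c) (r \<otimes> (y \<otimes> c))"
            using cong_mod_mult[OF I(1) y(2) cong_mod_refl[OF I(1) c]] y(1) c r by (simp add: m_assoc)
          then show "u \<otimes> c \<in> J" using JI[of "u \<otimes> c" "y \<otimes> c"] c y(1) JE(2)[OF u] by simp
        qed
      qed
      moreover have "I \<subseteq> J"
        by (intro subsetI JI[of _ \<zero>]) (use r ID(1) cong_mod_zero[OF I(1)] in simp_all)
      moreover have "r \<in> J" by (rule JI[of _ \<one>]) (use r cong_mod_refl[OF I(1)] in simp_all)
      then have "J \<noteq> I" using r(3) by metis
      ultimately obtain s where s: "s \<in> S" "s \<in> J" by (elim meets[elim_format] bexE)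
      obtain y where y: "y \<in> carrier A" "cong_mod I s (r \<otimes> y)" using JE(1)[OF s(2)] by (elim bexE)
      then have "(k \<otimes> y \<oplus> sc (- l) \<otimes> y) \<ominus> s \<in> I"
        using cong_mod_sym[OF I(1) y(2)] shift[OF y(1), of l] by (simp add: cong_mod_def r_def)
      then show ?thesis using s(1) y(1) by (intro bexI)
    qed
    then have "UNIV \<subseteq> (\<Union>s\<in>S. {l. \<exists>y\<in>carrier A. (k \<otimes> y \<oplus> sc (- l) \<otimes> y) \<ominus> s \<in> I})" by blast
    moreover have "countable (\<Union>s\<in>S. {l. \<exists>y\<in>carrier A. (k \<otimes> y \<oplus> sc (- l) \<otimes> y) \<ominus> s \<in> I})"
      using S(1) cnt by (rule countable_UN)
    ultimately have "countable (UNIV :: complex set)" by (rule countable_subset)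
    then show False using uncountable_UNIV_complex by simp
  qed
  have "I \<in> Prim A"
  proof (rule maximal_ideal_primitive[OF I(1)])
    show "\<one> \<notin> I" using S_I S(3) by simp
    fix J assume J: "ideal J A" "I \<subseteq> J"
    show "J = I \<or> J = carrier A"
    proof (cases "J = I")
      case False
      then obtain s where s: "s \<in> S" "s \<in> J" using J by (elim meets[elim_format] bexE)
      \<comment> \<open>Modulo \<open>I\<close>, \<open>s\<close> is a scalar, nonzero because
        \<open>s\<close> is outside \<open>I\<close>; an ideal containing \<open>I\<close> and
        \<open>s\<close> therefore contains the unit.\<close>
      obtain c where c: "s \<ominus> sc c \<in> I" using scalar[OF SK(1)[OF s(1)]] by (elim exE)
      have "c \<noteq> 0"
      proof
        assume "c = 0"
        then have "s \<ominus> sc c = s" using SK[OF s(1)] by (simp add: sc_zero minus_eq)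
        then show False using c S_I[OF s(1)] by simp
      qed
      moreover have "sc c \<otimes> \<one> \<in> J"
      proof -
        have "s \<ominus> (s \<ominus> sc c) \<in> J" using idealD(4)[OF J(1) s(2)] c J(2) by (simp add: subsetD)
        moreover have "s \<ominus> (s \<ominus> sc c) = sc c" using SK[OF s(1)] by (simp add: minus_eq minus_add r_neg1 r_neg2)
        ultimately show ?thesis by simp
      qed
      ultimately have "\<one> \<in> J" using sc_cancel[OF J(1)] by simp
      then have "J = carrier A" using ideal.one_imp_carrier[OF J(1)] by simp
      then show ?thesis by simp
    qed simp
  qed
  then show ?thesis using prime I by blast
qed

end

section \<open>A primitive ideal that contains no stable ideal larger than the annihilator\<close>

context simple_diff_module
begin

text \<open>The Wronskian argument gives the system of all derivatives of \<open>B\<close> full rank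
  modulo \<open>P\<close>, and this rank persists modulo every prime that avoids one
  \<open>d\<close>. A constant solution modulo such a prime has its entries in that prime, so they
  vanish, since nonzero scalars are invertible.\<close>

lemma independent_spreads:
  assumes B: "independent_mod B"
  shows "\<exists>d\<in>K. d \<notin> P \<and> (\<forall>I c. nc_prime I \<longrightarrow> d \<notin> I \<longrightarrow>
    (\<forall>ws\<in>lists Ham. (\<Oplus>b\<in>B. sc (c b) \<otimes> foldr H ws b) \<in> I) \<longrightarrow> (\<forall>b\<in>B. c b = 0))"
proof -
  have fin: "finite B" and BK: "b \<in> K" if "b \<in> B" for b
    using B that by (auto simp: independent_mod_def)
  have "\<exists>d\<in>K. d \<notin> P \<and> (\<forall>I f. nc_prime I \<longrightarrow> d \<notin> I \<longrightarrow> f \<in> B \<rightarrow> K \<longrightarrow>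
    (\<forall>t\<in>foldr H ` lists Ham. (\<Oplus>b\<in>B. f b \<otimes> t b) \<in> I) \<longrightarrow> (\<forall>b\<in>B. f b \<in> I))"
  proof (rule rank_spreads[OF prime_P])
    show "finite B" using B by (simp add: independent_mod_def)
    show "t \<in> B \<rightarrow> K" if "t \<in> foldr H ` lists Ham" for t
      using that word_K BK by auto
    show "\<forall>b\<in>B. f b \<in> P" if "f \<in> B \<rightarrow> K"
      "\<And>t. t \<in> foldr H ` lists Ham \<Longrightarrow> (\<Oplus>b\<in>B. f b \<otimes> t b) \<in> P" for f
      by (rule wronskian[OF B that(1)]) (rule that(2), simp)
  qed
  then obtain d where d: "d \<in> K" "d \<notin> P"
    and spread: "\<And>I f. \<lbrakk>nc_prime I; d \<notin> I; f \<in> B \<rightarrow> K;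
      \<forall>t\<in>foldr H ` lists Ham. (\<Oplus>b\<in>B. f b \<otimes> t b) \<in> I\<rbrakk> \<Longrightarrow> \<forall>b\<in>B. f b \<in> I" by blast
  have "c b = 0" if I: "nc_prime I" "d \<notin> I"
    and c: "\<forall>ws\<in>lists Ham. (\<Oplus>b\<in>B. sc (c b) \<otimes> foldr H ws b) \<in> I" and b: "b \<in> B" for I c b
  proof (rule ccontr)
    assume nz: "c b \<noteq> 0"
    have "\<forall>b\<in>B. sc (c b) \<in> I" by (rule spread[OF I]) (use c K_sc in auto)
    then have "sc (c b) \<otimes> \<one> \<in> I" using b by simp
    then have "\<one> \<in> I" using sc_cancel[OF nc_primeD(1)[OF I(1)] _ nz] by simp
    then show False using nc_primeD(2)[OF I(1)] by simp
  qed
  then show ?thesis using d by blast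
qed

text \<open>Greedy choice of a basis: \<open>e n\<close> is added exactly when it is not yet a
  combination of the earlier choices modulo \<open>P\<close>.\<close>

lemma independent_mod_exists:
  assumes e: "range e \<subseteq> K"
  shows "\<exists>B. independent_mod B \<and>
    (\<forall>k\<in>span_upto e n. \<exists>c. cong_mod P k (\<Oplus>b\<in>B. sc (c b) \<otimes> b))"
proof (induction n)
  case 0
  have "independent_mod {}" by (simp add: independent_mod_def)
  then show ?case using cong_mod_refl[OF ideal_P, of \<zero>] by (intro exI[of _ "{}"]) simp
next
  case (Suc n)
  note [trans] = cong_mod_trans[OF ideal_P]
  obtain B where B: "independent_mod B"
    and span: "\<And>k. k \<in> span_upto e n \<Longrightarrow> \<exists>c. cong_mod P k (\<Oplus>b\<in>B. sc (c b) \<otimes> b)" using Suc.IH by blast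
  have fin: "finite B" and BKs: "B \<subseteq> K" using B by (simp_all add: independent_mod_def)
  have BA: "b \<in> carrier A" if "b \<in> B" for b using subsetD[OF BKs that] K_carrier by simp
  have en: "e n \<in> K" "e n \<in> carrier A" using e K_carrier by (auto simp: image_subset_iff)
  have sum_lin: "(\<Oplus>b\<in>B. sc (c b + t * d b) \<otimes> b) =
      (\<Oplus>b\<in>B. sc (c b) \<otimes> b) \<oplus> sc t \<otimes> (\<Oplus>b\<in>B. sc (d b) \<otimes> b)" for c d t
  proof -
    have "(\<Oplus>b\<in>B. sc (c b + t * d b) \<otimes> b) = (\<Oplus>b\<in>B. sc (c b) \<otimes> b \<oplus> sc t \<otimes> (sc (d b) \<otimes> b))"
      using BA by (intro finsum_cong') (auto simp: sc_add sc_mult l_distr m_assoc)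
    also have "\<dots> = (\<Oplus>b\<in>B. sc (c b) \<otimes> b) \<oplus> (\<Oplus>b\<in>B. sc t \<otimes> (sc (d b) \<otimes> b))"
      using BA by (intro finsum_addf) auto
    also have "(\<Oplus>b\<in>B. sc t \<otimes> (sc (d b) \<otimes> b)) = sc t \<otimes> (\<Oplus>b\<in>B. sc (d b) \<otimes> b)"
      using BA fin by (intro finsum_mult_left[symmetric]) auto
    finally show ?thesis .
  qed
  have sumA: "(\<Oplus>b\<in>B. sc (c b) \<otimes> b) \<in> carrier A" for c using BA by (intro finsum_closed) auto
  note rf = cong_mod_refl[OF ideal_P]
  show ?case
  proof (cases "\<exists>d. cong_mod P (e n) (\<Oplus>b\<in>B. sc (d b) \<otimes> b)")
    case True
    then obtain d where d: "cong_mod P (e n) (\<Oplus>b\<in>B. sc (d b) \<otimes> b)" by blast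
    have "\<exists>c. cong_mod P k (\<Oplus>b\<in>B. sc (c b) \<otimes> b)" if k: "k \<in> span_upto e (Suc n)" for k
    proof -
      obtain v t where v: "k = v \<oplus> sc t \<otimes> e n" "v \<in> span_upto e n" using k by auto
      obtain c where c: "cong_mod P v (\<Oplus>b\<in>B. sc (c b) \<otimes> b)" using span[OF v(2)] by blast
      have "cong_mod P k (\<Oplus>b\<in>B. sc (c b + t * d b) \<otimes> b)"
        unfolding v(1) sum_lin
        by (rule cong_mod_add[OF ideal_P c cong_mod_mult[OF ideal_P rf[OF sc_closed] d]])
      then show ?thesis by (rule exI[of _ "\<lambda>b. c b + t * d b"])
    qed
    then show ?thesis using B by blast
  next
    case False
    have enB: "e n \<notin> B"
    proof
      assume b: "e n \<in> B"
      have "(\<Oplus>b\<in>B. sc (if b = e n then 1 else 0) \<otimes> b) = (\<Oplus>b\<in>B. if e n = b then b else \<zero>)"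
        using BA by (intro finsum_cong') (auto simp: sc_one sc_zero)
      also have "\<dots> = e n" using finsum_singleton[OF b fin, of "\<lambda>b. b"] BA by simp
      finally have "cong_mod P (e n) (\<Oplus>b\<in>B. sc (if b = e n then 1 else 0) \<otimes> b)"
        using rf[OF en(2)] by simp
      then show False by (rule notE[OF False exI])
    qed
    note ins = independent_mod_insert[OF fin _ enB]
    have insK: "insert (e n) B \<subseteq> K" using en BKs by simp
    have ind: "independent_mod (insert (e n) B)"
      unfolding independent_mod_def
    proof (intro conjI allI impI)
      show "finite (insert (e n) B)" using fin by simp
      show "insert (e n) B \<subseteq> K" by (rule insK)
      fix c assume cP: "(\<Oplus>b\<in>insert (e n) B. sc (c b) \<otimes> b) \<in> P"
      then have sP: "sc (c (e n)) \<otimes> e n \<oplus> (\<Oplus>b\<in>B. sc (c b) \<otimes> b) \<in> P" using ins(1)[OF insK] by simp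
      have c0: "c (e n) = 0"
      proof (rule ccontr)
        assume nz: "c (e n) \<noteq> 0"
        \<comment> \<open>Normalises the relation so that it expresses \<open>e n\<close> through
          \<open>B\<close> modulo \<open>P\<close>.\<close>
        define t where "t = - 1 / c (e n)"
        have zero: "(\<Oplus>b\<in>B. sc (0::complex) \<otimes> b) = \<zero>"
        proof -
          have "(\<Oplus>b\<in>B. sc (0::complex) \<otimes> b) = (\<Oplus>b\<in>B. \<zero>)"
            using BA by (intro finsum_cong') (auto simp: sc_zero)
          then show ?thesis by simp
        qed
        have eq: "(\<Oplus>b\<in>B. sc (t * c b) \<otimes> b) = sc t \<otimes> (\<Oplus>b\<in>B. sc (c b) \<otimes> b)"
          using sum_lin[of "\<lambda>_. 0" t c] sumA zero by simp
        have "sc t \<otimes> (sc (c (e n)) \<otimes> e n) = sc (t * c (e n)) \<otimes> e n"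
          using en by (simp add: sc_mult m_assoc)
        also have "\<dots> = \<ominus> e n" using nz en by (simp add: t_def sc_uminus sc_one l_minus)
        finally have "sc t \<otimes> (sc (c (e n)) \<otimes> e n \<oplus> (\<Oplus>b\<in>B. sc (c b) \<otimes> b)) =
            (\<Oplus>b\<in>B. sc (t * c b) \<otimes> b) \<ominus> e n"
          using en sumA by (simp add: r_distr eq minus_eq a_comm)
        then have "(\<Oplus>b\<in>B. sc (t * c b) \<otimes> b) \<ominus> e n \<in> P"
          using idealD(6)[OF ideal_P sP sc_closed[of t]] by simp
        then have "cong_mod P (\<Oplus>b\<in>B. sc (t * c b) \<otimes> b) (e n)"
          using en sumA by (simp add: cong_mod_def)
        then have "cong_mod P (e n) (\<Oplus>b\<in>B. sc (t * c b) \<otimes> b)" by (rule cong_mod_sym[OF ideal_P])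
        then show False by (rule notE[OF False exI])
      qed
      then have "(\<Oplus>b\<in>B. sc (c b) \<otimes> b) \<in> P" using sP en sumA by (simp add: sc_zero)
      then show "\<forall>b\<in>insert (e n) B. c b = 0" using independent_modD[OF B] c0 by simp
    qed
    have "\<exists>c. cong_mod P k (\<Oplus>b\<in>insert (e n) B. sc (c b) \<otimes> b)" if k: "k \<in> span_upto e (Suc n)" for k
    proof -
      obtain v t where v: "k = v \<oplus> sc t \<otimes> e n" "v \<in> span_upto e n" using k by auto
      obtain c where c: "cong_mod P v (\<Oplus>b\<in>B. sc (c b) \<otimes> b)" using span[OF v(2)] by blast
      have "(\<Oplus>b\<in>B. sc ((c(e n := t)) b) \<otimes> b) = (\<Oplus>b\<in>B. sc (c b) \<otimes> b)"
        by (rule ins(3)[OF insK]) (use enB in auto)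
      then have eq: "(\<Oplus>b\<in>insert (e n) B. sc ((c(e n := t)) b) \<otimes> b) =
          (\<Oplus>b\<in>B. sc (c b) \<otimes> b) \<oplus> sc t \<otimes> e n"
        using sumA en unfolding ins(1)[OF insK] by (simp add: a_comm)
      have "cong_mod P k ((\<Oplus>b\<in>B. sc (c b) \<otimes> b) \<oplus> sc t \<otimes> e n)"
        unfolding v(1) using en by (intro cong_mod_add[OF ideal_P c rf]) simp
      then show ?thesis unfolding eq[symmetric] by (rule exI[of _ "c(e n := t)"])
    qed
    then show ?thesis using ind by blast
  qed
qed

text \<open>The multiplicative set to be avoided is generated by one \<open>d n\<close> for each
  finite stage of the basis, since an element of \<open>K\<close> involves only finitely many
  members of \<open>e\<close>, and by a central \<open>s\<close> outside \<open>P\<close> in the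
  ideal generated by \<open>a\<close> and \<open>P\<close>. Avoiding \<open>s\<close> keeps
  \<open>a\<close> out of \<open>I\<close>.\<close>

lemma primitive_ideal_exists:
  assumes A: "countable_span (carrier A)" and Kc: "countable_span K"
    and a: "a \<in> carrier A" "a \<notin> P"
  shows "\<exists>I\<in>Prim A. P \<subseteq> I \<and> a \<notin> I \<and>
    (\<forall>J. ideal J A \<longrightarrow> ham_stable J \<longrightarrow> P \<subseteq> J \<longrightarrow> J \<subseteq> I \<longrightarrow> J = P)"
proof -
  note PD = idealD[OF ideal_P]
  obtain e where e: "range e \<subseteq> K" "K \<subseteq> (\<Union>n. span_upto e n)" using Kc by (auto simp: countable_span_def)
  have "\<forall>n. \<exists>B. independent_mod B \<and> (\<forall>k\<in>span_upto e n. \<exists>c. cong_mod P k (\<Oplus>b\<in>B. sc (c b) \<otimes> b))"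
    using independent_mod_exists[OF e(1)] by blast
  then obtain B where B: "\<And>n. independent_mod (B n)"
    and span: "\<And>n k. k \<in> span_upto e n \<Longrightarrow> \<exists>c. cong_mod P k (\<Oplus>b\<in>B n. sc (c b) \<otimes> b)" by metis
  have "\<forall>n. \<exists>d. d \<in> K \<and> d \<notin> P \<and> (\<forall>I c. nc_prime I \<longrightarrow> d \<notin> I \<longrightarrow>
    (\<forall>ws\<in>lists Ham. (\<Oplus>b\<in>B n. sc (c b) \<otimes> foldr H ws b) \<in> I) \<longrightarrow> (\<forall>b\<in>B n. c b = 0))"
    using independent_spreads[OF B] by blast
  then obtain d where d: "\<And>n. d n \<in> K" "\<And>n. d n \<notin> P"
    and spread: "\<And>n I c. \<lbrakk>nc_prime I; d n \<notin> I;
      \<forall>ws\<in>lists Ham. (\<Oplus>b\<in>B n. sc (c b) \<otimes> foldr H ws b) \<in> I\<rbrakk> \<Longrightarrow> \<forall>b\<in>B n. c b = 0" by metis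
  define G where "G = Idl (insert a P)"
  have "insert a P \<subseteq> carrier A" using a PD(1) by blast
  then have G: "ideal G A" "P \<subseteq> G" "a \<in> G"
    unfolding G_def using genideal_ideal[of "insert a P"] genideal_self[of "insert a P"] by simp_all
  obtain s where s: "s \<in> K" "s \<in> G" "s \<notin> P"
    using central_element_in_ideal[OF prime_P G(1,2)] G(3) a(2) by blast
  define S where "S = (\<lambda>l. foldr (\<otimes>) l \<one>) ` lists (insert s (range d))"
  have DK: "k \<in> K" "k \<notin> P" if "k \<in> insert s (range d)" for k using that d s by auto
  have S_props: "foldr (\<otimes>) l \<one> \<in> K \<and> foldr (\<otimes>) l \<one> \<notin> P" if "l \<in> lists (insert s (range d))" for l
    using that
  proof (induction l)
    case Nil
    then show ?case using K_one nc_primeD(2)[OF prime_P] by simp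
  next
    case (Cons k l)
    then show ?case using DK[of k] K_mult K_prime[OF prime_P] by simp
  qed
  have mem: "k \<in> S" if "k \<in> insert s (range d)" for k
    unfolding S_def using that K_carrier[OF DK(1)[OF that]] by (intro image_eqI[of _ _ "[k]"]) simp_all
  have "\<exists>I. nc_prime I \<and> P \<subseteq> I \<and> S \<inter> I = {} \<and> I \<in> Prim A"
  proof (rule prime_avoiding_exists[OF A ideal_P])
    show "countable S" unfolding S_def by (intro countable_image countable_lists) simp
    show "S \<subseteq> K" using S_props by (auto simp: S_def)
    show "\<one> \<in> S" unfolding S_def by (rule image_eqI[of _ _ "[]"]) simp_all
    show "S \<inter> P = {}" using S_props by (auto simp: S_def)
    show "p \<otimes> q \<in> S" if pq: "p \<in> S" "q \<in> S" for p q
    proof -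
      obtain l m where lm: "l \<in> lists (insert s (range d))" "m \<in> lists (insert s (range d))"
        "p = foldr (\<otimes>) l \<one>" "q = foldr (\<otimes>) m \<one>" using pq unfolding S_def by (elim imageE)
      have qA: "q \<in> carrier A" using S_props[OF lm(2)] K_carrier lm(4) by simp
      have "foldr (\<otimes>) l \<one> \<otimes> q = foldr (\<otimes>) (l @ m) \<one>"
        using lm(1)
      proof (induction l)
        case Nil
        then show ?case using qA lm(4) by simp
      next
        case (Cons k l)
        then have "k \<in> carrier A" "foldr (\<otimes>) l \<one> \<in> carrier A"
          using DK(1)[of k] S_props[of l] K_carrier by simp_all
        then show ?case using Cons qA by (simp add: m_assoc)
      qed
      then show ?thesis unfolding S_def lm(3) using lm(1,2) by (intro image_eqI[of _ _ "l @ m"]) simp_all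
    qed
  qed
  then obtain I where I: "nc_prime I" "P \<subseteq> I" "S \<inter> I = {}" "I \<in> Prim A" by blast
  note II = nc_primeD(1)[OF I(1)]
  have avoid: "k \<notin> I" if "k \<in> insert s (range d)" for k using mem[OF that] I(3) by blast
  have "a \<notin> I"
  proof
    assume "a \<in> I"
    then have "G \<subseteq> I" unfolding G_def using I(2) by (intro genideal_minimal[OF II]) simp
    then show False using s(2) avoid[of s] by blast
  qed
  moreover have "J = P" if J: "ideal J A" "ham_stable J" "P \<subseteq> J" "J \<subseteq> I" for J
  proof (rule ccontr)
    assume "J \<noteq> P"
    then obtain z where z: "z \<in> K" "z \<in> J" "z \<notin> P"
      using central_element_in_ideal[OF prime_P J(1,3)] by blast
    obtain n where n: "z \<in> span_upto e n" using e(2) z(1) by blast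
    obtain c where c: "cong_mod P z (\<Oplus>b\<in>B n. sc (c b) \<otimes> b)" using span[OF n] by blast
    have fin: "finite (B n)" and BK: "B n \<subseteq> K" using B[of n] by (simp_all add: independent_mod_def)
    have BA: "b \<in> carrier A" "b \<in> K" if "b \<in> B n" for b using subsetD[OF BK that] K_carrier by simp_all
    \<comment> \<open>The word sends \<open>z\<close> into \<open>J\<close>, hence into
      \<open>I\<close>, and sends the error term from \<open>P\<close> to \<open>P\<close>; so it
      sends the combination into \<open>I\<close>, and scalars commute with words.\<close>
    have "(\<Oplus>b\<in>B n. sc (c b) \<otimes> foldr H ws b) \<in> I" if ws: "ws \<in> lists Ham" for ws
    proof -
      let ?s = "\<Oplus>b\<in>B n. sc (c b) \<otimes> b"
      have sA: "?s \<in> carrier A" using BA by (intro finsum_closed) auto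
      note wA = additive_opD[OF word_additive[OF ws]]
      have "foldr H ws (z \<ominus> ?s) \<in> P"
        using word_stable[OF ws ham_stable_P] c by (simp add: cong_mod_def)
      then have "foldr H ws z \<ominus> foldr H ws ?s \<in> I"
        using wA(5)[OF K_carrier[OF z(1)] sA] I(2) by (simp add: subsetD)
      moreover have "foldr H ws z \<in> I" using word_stable[OF ws J(2) z(2)] J(4) by (rule subsetD[rotated])
      ultimately have "foldr H ws z \<ominus> (foldr H ws z \<ominus> foldr H ws ?s) \<in> I" using idealD(4)[OF II] by simp
      moreover have "foldr H ws z \<ominus> (foldr H ws z \<ominus> foldr H ws ?s) = foldr H ws ?s"
        using wA(1)[OF K_carrier[OF z(1)]] wA(1)[OF sA] by (simp add: minus_eq minus_add r_neg1 r_neg2)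
      moreover have "foldr H ws ?s = (\<Oplus>b\<in>B n. foldr H ws (sc (c b) \<otimes> b))"
        using BA fin by (intro finsum_additive_op[OF word_additive[OF ws]]) auto
      moreover have "\<dots> = (\<Oplus>b\<in>B n. sc (c b) \<otimes> foldr H ws b)"
        using BA wA(1) by (intro finsum_cong') (auto simp: word_sc[OF ws])
      ultimately show ?thesis by simp
    qed
    then have "\<forall>b\<in>B n. c b = 0" using spread[OF I(1), of n c] avoid[of "d n"] by blast
    then have "(\<Oplus>b\<in>B n. sc (c b) \<otimes> b) = (\<Oplus>b\<in>B n. \<zero>)"
      using BA by (intro finsum_cong') (auto simp: sc_zero)
    then have "z \<in> P" using c cong_mod_zero[OF ideal_P] by simp
    then show False using z(3) by simp
  qed
  ultimately show ?thesis using I(2,4) by blast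
qed

end

section \<open>Generators of Poisson orders and of simple Poisson modules\<close>

context complex_module
begin

abbreviation complex_span :: "(nat \<Rightarrow> 'm) \<Rightarrow> 'm set"
  where "complex_span e \<equiv> \<Union>n. initial_span e n"

lemma initial_span_mono:
  assumes e: "range e \<subseteq> carrier M" and mn: "m \<le> n"
  shows "initial_span e m \<subseteq> initial_span e n"
  using mn
proof (induction n rule: dec_induct)
  case (step n)
  have "v \<in> initial_span e (Suc n)" if v: "v \<in> initial_span e n" for v
  proof -
    have "v \<in> carrier M" "e n \<in> carrier M" using initial_span_closed[OF e] v e by auto
    then have "v = v \<oplus>\<^bsub>M\<^esub> csc 0 (e n)" by (simp add: csc_simps)
    then show ?thesis using v by (simp only: initial_span.simps mem_Collect_eq) blast
  qed
  then show ?case using step.IH by (meson order_trans subsetI)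
qed simp

lemma complex_span_closed:
  assumes e: "range e \<subseteq> carrier M"
  shows "complex_span e \<subseteq> carrier M" "\<zero>\<^bsub>M\<^esub> \<in> complex_span e" "e n \<in> complex_span e"
    "\<lbrakk>v \<in> complex_span e; w \<in> complex_span e\<rbrakk> \<Longrightarrow> v \<oplus>\<^bsub>M\<^esub> csc c w \<in> complex_span e"
    "\<lbrakk>v \<in> complex_span e; w \<in> complex_span e\<rbrakk> \<Longrightarrow> v \<oplus>\<^bsub>M\<^esub> w \<in> complex_span e"
    "v \<in> complex_span e \<Longrightarrow> csc c v \<in> complex_span e"
proof -
  show 1: "complex_span e \<subseteq> carrier M" using initial_span_closed[OF e] by (rule UN_least)
  have zero: "\<zero>\<^bsub>M\<^esub> \<in> initial_span e 0" by simp
  then show 2: "\<zero>\<^bsub>M\<^esub> \<in> complex_span e" by blast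
  show 3: "v \<oplus>\<^bsub>M\<^esub> csc c w \<in> complex_span e" if vw: "v \<in> complex_span e" "w \<in> complex_span e" for v w c
  proof -
    obtain m n where mn: "v \<in> initial_span e m" "w \<in> initial_span e n" using vw by blast
    have "v \<in> initial_span e (max m n)" "w \<in> initial_span e (max m n)"
      using mn initial_span_mono[OF e, of m "max m n"] initial_span_mono[OF e, of n "max m n"] by auto
    then show ?thesis using initial_span_lin[OF e] by blast
  qed
  have "\<zero>\<^bsub>M\<^esub> \<oplus>\<^bsub>M\<^esub> csc 1 (e n) \<in> initial_span e (Suc n)"
    using initial_span_mono[OF e, of 0 n] zero by (simp only: initial_span.simps(2) mem_Collect_eq) blast
  moreover have "e n \<in> carrier M" using e by auto
  ultimately show "e n \<in> complex_span e" by (simp only: csc_simps LM.l_zero) blast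
  show "v \<oplus>\<^bsub>M\<^esub> w \<in> complex_span e" if vw: "v \<in> complex_span e" "w \<in> complex_span e"
  proof -
    have "w \<in> carrier M" using vw(2) 1 by (rule subsetD[rotated])
    then show ?thesis using 3[OF vw, of 1] by (simp add: csc_simps)
  qed
  show "csc c v \<in> complex_span e" if v: "v \<in> complex_span e"
  proof -
    have "v \<in> carrier M" using v 1 by (rule subsetD[rotated])
    then show ?thesis using 3[OF 2 v, of c] by simp
  qed
qed

lemma complex_span_induct:
  assumes e: "range e \<subseteq> carrier M" and v: "v \<in> complex_span e" and zero: "Q \<zero>\<^bsub>M\<^esub>"
    and step: "\<And>v c n. \<lbrakk>v \<in> complex_span e; Q v\<rbrakk> \<Longrightarrow> Q (v \<oplus>\<^bsub>M\<^esub> csc c (e n))"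
  shows "Q v"
proof -
  obtain n where "v \<in> initial_span e n" using v by blast
  then show ?thesis
  proof (induction n arbitrary: v)
    case (Suc n)
    obtain w c where w: "w \<in> initial_span e n" "v = w \<oplus>\<^bsub>M\<^esub> csc c (e n)" using Suc.prems by auto
    have "w \<in> complex_span e" using w(1) by blast
    then show ?case unfolding w(2) using Suc.IH[OF w(1)] by (rule step)
  qed (use zero in simp)
qed

text \<open>The sequence enumerates the words in \<open>\<Phi>\<close> applied to \<open>G\<close>.
  By the last conclusion it stays in every set that contains \<open>G\<close> and is closed under
  \<open>\<Phi>\<close>, which later keeps the sequence for the central subring inside that
  subring.\<close>

lemma countable_span_exists:
  assumes "countable \<Phi>" "\<And>\<phi>. \<phi> \<in> \<Phi> \<Longrightarrow> additive_op M \<phi>"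
    and lin: "\<And>\<phi> c v. \<lbrakk>\<phi> \<in> \<Phi>; v \<in> carrier M\<rbrakk> \<Longrightarrow> \<phi> (csc c v) = csc c (\<phi> v)"
    and G: "countable G" "G \<noteq> {}" "G \<subseteq> carrier M"
  obtains e where "range e \<subseteq> carrier M" "G \<subseteq> complex_span e"
    "\<And>\<phi> v. \<lbrakk>\<phi> \<in> \<Phi>; v \<in> complex_span e\<rbrakk> \<Longrightarrow> \<phi> v \<in> complex_span e"
    "\<And>Y. \<lbrakk>G \<subseteq> Y; \<And>\<phi> v. \<lbrakk>\<phi> \<in> \<Phi>; v \<in> Y\<rbrakk> \<Longrightarrow> \<phi> v \<in> Y\<rbrakk> \<Longrightarrow> range e \<subseteq> Y"
proof -
  define D where "D = (\<lambda>(ws, x). foldr (\<lambda>\<phi>. \<phi>) ws x) ` (lists \<Phi> \<times> G)"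
  have DI: "foldr (\<lambda>\<phi>. \<phi>) ws x \<in> D" if "ws \<in> lists \<Phi>" "x \<in> G" for ws x
    using that by (auto simp: D_def intro!: image_eqI[of _ _ "(ws, x)"])
  have DE: "\<exists>ws\<in>lists \<Phi>. \<exists>x\<in>G. d = foldr (\<lambda>\<phi>. \<phi>) ws x" if "d \<in> D" for d
    using that by (auto simp: D_def)
  have GD: "G \<subseteq> D" using DI[of "[]"] by (auto intro: lists.Nil)
  have "countable D" unfolding D_def using assms(1) G(1) by simp
  moreover have "D \<noteq> {}" using GD G(2) by blast
  ultimately have re: "range (from_nat_into D) = D" by (simp add: range_from_nat_into)
  let ?e = "from_nat_into D"
  have D_min: "D \<subseteq> Y" if Y: "G \<subseteq> Y" "\<And>\<phi> v. \<lbrakk>\<phi> \<in> \<Phi>; v \<in> Y\<rbrakk> \<Longrightarrow> \<phi> v \<in> Y" for Y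
  proof
    fix d assume "d \<in> D"
    then obtain ws x where d: "ws \<in> lists \<Phi>" "x \<in> G" "d = foldr (\<lambda>\<phi>. \<phi>) ws x" using DE by blast
    have "foldr (\<lambda>\<phi>. \<phi>) ws x \<in> Y" using d(1)
      by (induction ws) (use d(2) Y in auto)
    then show "d \<in> Y" by (simp add: d(3))
  qed
  note opD = LM.additive_opD[OF assms(2)]
  have e: "range ?e \<subseteq> carrier M" unfolding re by (rule D_min) (use G opD(1) in auto)
  note cl = complex_span_closed[OF e]
  have "G \<subseteq> complex_span ?e"
  proof
    fix x assume "x \<in> G"
    then have "x \<in> range ?e" using GD re by blast
    then obtain n where "x = ?e n" by blast
    then show "x \<in> complex_span ?e" using cl(3) by simp
  qed
  moreover have "\<phi> v \<in> complex_span ?e" if \<phi>: "\<phi> \<in> \<Phi>" and v: "v \<in> complex_span ?e" for \<phi> v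
    using e v
  proof (rule complex_span_induct)
    show "\<phi> \<zero>\<^bsub>M\<^esub> \<in> complex_span ?e" using opD(3)[OF \<phi>] cl(2) by simp
    fix v c n assume v: "v \<in> complex_span ?e" "\<phi> v \<in> complex_span ?e"
    have car: "v \<in> carrier M" "?e n \<in> carrier M" using subsetD[OF cl(1) v(1)] e by auto
    have "?e n \<in> D" using re by blast
    then obtain ws x where d: "ws \<in> lists \<Phi>" "x \<in> G" "?e n = foldr (\<lambda>\<phi>. \<phi>) ws x" using DE by blast
    have "\<phi> (?e n) \<in> D" using DI[of "\<phi> # ws" x] d \<phi> by simp
    then have "\<phi> (?e n) \<in> range ?e" by (simp only: re)
    then have "\<phi> (?e n) \<in> complex_span ?e" using cl(3) by (elim rangeE) simp
    then show "\<phi> (v \<oplus>\<^bsub>M\<^esub> csc c (?e n)) \<in> complex_span ?e"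
      using car opD(2)[OF \<phi> car(1) csc_closed[OF car(2)]] lin[OF \<phi> car(2)] cl(4)[OF v(2)] by simp
  qed
  ultimately show thesis using that[OF e] D_min re by simp
qed

end

section \<open>A Poisson order as a Noetherian ring with derivations\<close>

context poisson_order
begin

definition cscalar :: "complex \<Rightarrow> 'b"
  where "cscalar c = (c \<odot>\<^bsub>Z\<^esub> \<one>\<^bsub>Z\<^esub>) \<odot>\<^bsub>A\<^esub> \<one>\<^bsub>A\<^esub>"

definition central_image :: "'b set"
  where "central_image = (\<lambda>z. z \<odot>\<^bsub>A\<^esub> \<one>\<^bsub>A\<^esub>) ` carrier Z"

lemma unit_act: "z \<in> carrier Z \<Longrightarrow> z \<odot>\<^bsub>A\<^esub> \<one>\<^bsub>A\<^esub> \<in> carrier A"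
  by (simp add: ZA.smult_closed)

lemma cscalar_closed: "c \<odot>\<^bsub>Z\<^esub> \<one>\<^bsub>Z\<^esub> \<in> carrier Z"
  by (simp add: scalar_closed)

lemma cscalar_mult: "a \<in> carrier A \<Longrightarrow> cscalar c \<otimes>\<^bsub>A\<^esub> a = (c \<odot>\<^bsub>Z\<^esub> \<one>\<^bsub>Z\<^esub>) \<odot>\<^bsub>A\<^esub> a"
  unfolding cscalar_def by (rule central_act(2)[OF cscalar_closed])

lemma complex_field_simps: "carrier complex_field = UNIV" "\<one>\<^bsub>complex_field\<^esub> = 1"
    "c \<oplus>\<^bsub>complex_field\<^esub> d = c + d" "c \<otimes>\<^bsub>complex_field\<^esub> d = c * d"
  by (simp_all add: ring_of_type_algebra_def)

lemma diff_ring_order: "diff_ring A cscalar central_image (carrier Z) H"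
proof (intro diff_ring.intro complex_scalars.intro complex_scalars_axioms.intro diff_ring_axioms.intro)
  show "ring A" by (rule AR.ring_axioms)
  show "cscalar c \<in> carrier A" for c by (simp add: cscalar_def unit_act cscalar_closed)
  show "cscalar (c + d) = cscalar c \<oplus>\<^bsub>A\<^esub> cscalar d" for c d
    using PZ.smult_l_distr[of c d "\<one>\<^bsub>Z\<^esub>"] cscalar_closed
    by (simp add: cscalar_def complex_field_simps ZA.smult_l_distr)
  show "cscalar (c * d) = cscalar c \<otimes>\<^bsub>A\<^esub> cscalar d" for c d
  proof -
    have "(c * d) \<odot>\<^bsub>Z\<^esub> \<one>\<^bsub>Z\<^esub> = c \<odot>\<^bsub>Z\<^esub> (d \<odot>\<^bsub>Z\<^esub> \<one>\<^bsub>Z\<^esub>)"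
      using PZ.smult_assoc1[of c d "\<one>\<^bsub>Z\<^esub>"] by (simp add: complex_field_simps)
    also have "\<dots> = (c \<odot>\<^bsub>Z\<^esub> \<one>\<^bsub>Z\<^esub>) \<otimes>\<^bsub>Z\<^esub> (d \<odot>\<^bsub>Z\<^esub> \<one>\<^bsub>Z\<^esub>)"
      using PZ.smult_assoc2[of c "\<one>\<^bsub>Z\<^esub>" "d \<odot>\<^bsub>Z\<^esub> \<one>\<^bsub>Z\<^esub>"] cscalar_closed by (simp add: complex_field_simps)
    finally have "cscalar (c * d) = (c \<odot>\<^bsub>Z\<^esub> \<one>\<^bsub>Z\<^esub>) \<odot>\<^bsub>A\<^esub> cscalar d"
      using ZA.smult_assoc1[OF cscalar_closed cscalar_closed] by (simp add: cscalar_def)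
    moreover have "cscalar d \<in> carrier A" by (simp add: cscalar_def unit_act cscalar_closed)
    ultimately show ?thesis by (simp add: cscalar_mult)
  qed
  show "cscalar 1 = \<one>\<^bsub>A\<^esub>"
    using PZ.smult_one[of "\<one>\<^bsub>Z\<^esub>"] by (simp add: cscalar_def complex_field_simps ZA.smult_one)
  show cc: "a \<otimes>\<^bsub>A\<^esub> cscalar c = cscalar c \<otimes>\<^bsub>A\<^esub> a" if "a \<in> carrier A" for a c
    using central_act[OF cscalar_closed that] by (simp add: cscalar_def)
  show "a \<in> carrier A" if "a \<in> central_image" for a
    using that by (auto simp: central_image_def unit_act)
  show "cscalar c \<in> central_image" for c
    using cscalar_closed by (auto simp: central_image_def cscalar_def)
  show "a \<oplus>\<^bsub>A\<^esub> b \<in> central_image" if ab: "a \<in> central_image" "b \<in> central_image" for a b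
  proof -
    obtain y z where yz: "y \<in> carrier Z" "z \<in> carrier Z" "a = y \<odot>\<^bsub>A\<^esub> \<one>\<^bsub>A\<^esub>" "b = z \<odot>\<^bsub>A\<^esub> \<one>\<^bsub>A\<^esub>"
      using ab unfolding central_image_def by (elim imageE)
    then have "a \<oplus>\<^bsub>A\<^esub> b = (y \<oplus>\<^bsub>Z\<^esub> z) \<odot>\<^bsub>A\<^esub> \<one>\<^bsub>A\<^esub>" by (simp add: ZA.smult_l_distr)
    then show ?thesis using yz unfolding central_image_def by (intro image_eqI[of _ _ "y \<oplus>\<^bsub>Z\<^esub> z"]) simp_all
  qed
  show "a \<otimes>\<^bsub>A\<^esub> b \<in> central_image" if ab: "a \<in> central_image" "b \<in> central_image" for a b
  proof -
    obtain y z where yz: "y \<in> carrier Z" "z \<in> carrier Z" "a = y \<odot>\<^bsub>A\<^esub> \<one>\<^bsub>A\<^esub>" "b = z \<odot>\<^bsub>A\<^esub> \<one>\<^bsub>A\<^esub>"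
      using ab unfolding central_image_def by (elim imageE)
    then have "a \<otimes>\<^bsub>A\<^esub> b = (y \<otimes>\<^bsub>Z\<^esub> z) \<odot>\<^bsub>A\<^esub> \<one>\<^bsub>A\<^esub>"
      using central_act(2)[OF yz(1) unit_act[OF yz(2)]] ZA.smult_assoc1 by simp
    then show ?thesis using yz unfolding central_image_def by (intro image_eqI[of _ _ "y \<otimes>\<^bsub>Z\<^esub> z"]) simp_all
  qed
  show "a \<otimes>\<^bsub>A\<^esub> k = k \<otimes>\<^bsub>A\<^esub> a" if k: "k \<in> central_image" and a: "a \<in> carrier A" for k a
    using k unfolding central_image_def by (elim imageE) (simp add: central_act a)
  show "H x (cscalar c \<otimes>\<^bsub>A\<^esub> a) = cscalar c \<otimes>\<^bsub>A\<^esub> H x a" if "x \<in> carrier Z" "a \<in> carrier A" for x a c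
    using that by (simp add: cscalar_mult H_scale_right H_closed)
  show "H x a \<in> central_image" if x: "x \<in> carrier Z" and a: "a \<in> central_image" for x a
    using a unfolding central_image_def
    by (elim imageE) (simp add: H_extends x, intro imageI PZ.pb_closed x)
qed (simp_all add: H_closed H_add_right H_derivation)

text \<open>Negatives are obtained as products with the scalar \<open>-1\<close>, so closure under
  sums and products is all that has to be checked.\<close>

lemma generated_induct:
  assumes gen: "generate_ring Z (S \<union> range (\<lambda>c. c \<odot>\<^bsub>Z\<^esub> \<one>\<^bsub>Z\<^esub>)) = carrier Z" and S: "S \<subseteq> carrier Z"
    and z: "z \<in> carrier Z"
    and base: "\<And>s. s \<in> S \<Longrightarrow> Q s" "\<And>c. Q (c \<odot>\<^bsub>Z\<^esub> \<one>\<^bsub>Z\<^esub>)"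
    and add: "\<And>y z. \<lbrakk>y \<in> carrier Z; z \<in> carrier Z; Q y; Q z\<rbrakk> \<Longrightarrow> Q (y \<oplus>\<^bsub>Z\<^esub> z)"
    and mult: "\<And>y z. \<lbrakk>y \<in> carrier Z; z \<in> carrier Z; Q y; Q z\<rbrakk> \<Longrightarrow> Q (y \<otimes>\<^bsub>Z\<^esub> z)"
  shows "Q z"
proof -
  have "z \<in> generate_ring Z (S \<union> range (\<lambda>c. c \<odot>\<^bsub>Z\<^esub> \<one>\<^bsub>Z\<^esub>))" using z gen by simp
  then show ?thesis
  proof (induction rule: generate_ring.induct)
    case one
    then show ?case using base(2)[of 1] PZ.smult_one[of "\<one>\<^bsub>Z\<^esub>"] by (simp add: complex_field_simps)
  next
    case (incl h)
    then show ?case using base by (elim UnE rangeE) simp_all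
  next
    case (a_inv h)
    then have h: "h \<in> carrier Z" using gen by simp
    have "Q (((-1) \<odot>\<^bsub>Z\<^esub> \<one>\<^bsub>Z\<^esub>) \<otimes>\<^bsub>Z\<^esub> h)" using h a_inv.IH base(2) cscalar_closed by (intro mult)
    moreover have "((-1) \<odot>\<^bsub>Z\<^esub> \<one>\<^bsub>Z\<^esub>) \<otimes>\<^bsub>Z\<^esub> h = \<ominus>\<^bsub>Z\<^esub> h"
    proof -
      have "((-1) \<odot>\<^bsub>Z\<^esub> \<one>\<^bsub>Z\<^esub>) \<otimes>\<^bsub>Z\<^esub> h = (-1) \<odot>\<^bsub>Z\<^esub> h"
        using PZ.smult_assoc2[of "-1" "\<one>\<^bsub>Z\<^esub>" h] h by (simp add: complex_field_simps)
      moreover have "(-1) \<odot>\<^bsub>Z\<^esub> h \<oplus>\<^bsub>Z\<^esub> h = \<zero>\<^bsub>Z\<^esub>"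
        using PZ.smult_l_distr[of "-1" 1 h] PZ.smult_one[of h] PZ.smult_l_null[of h] h
        by (simp add: complex_field_simps ring_of_type_algebra_def)
      ultimately show ?thesis using h PZ.minus_equality[of _ h] scalar_closed[OF h] by simp
    qed
    ultimately show ?case by simp
  next
    case (eng_add y z)
    then show ?case using gen add by simp
  next
    case (eng_mult y z)
    then show ?case using gen mult by simp
  qed
qed

end

lemma (in abelian_monoid) finsum_mem:
  assumes "N \<subseteq> carrier G" "\<zero> \<in> N" "\<And>u v. \<lbrakk>u \<in> N; v \<in> N\<rbrakk> \<Longrightarrow> u \<oplus> v \<in> N"
    and "finite F" "\<And>f. f \<in> F \<Longrightarrow> g f \<in> N"
  shows "(\<Oplus>f\<in>F. g f) \<in> N"
  using assms(4,5)
proof (induction F rule: finite_induct)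
  case (insert f F)
  have "g \<in> F \<rightarrow> carrier G" "g f \<in> carrier G" using insert.prems assms(1) by auto
  then show ?case using insert assms(3) by simp
qed (use assms(2) in simp)

context poisson_order
begin

context
  fixes S assumes gen: "generate_ring Z (S \<union> range (\<lambda>c. c \<odot>\<^bsub>Z\<^esub> \<one>\<^bsub>Z\<^esub>)) = carrier Z"
    and S: "S \<subseteq> carrier Z" "finite S"
begin

lemma scalar_stable_act_closed:
  assumes N: "N \<subseteq> carrier A" "\<And>u v. \<lbrakk>u \<in> N; v \<in> N\<rbrakk> \<Longrightarrow> u \<oplus>\<^bsub>A\<^esub> v \<in> N"
    "\<And>c u. u \<in> N \<Longrightarrow> cscalar c \<otimes>\<^bsub>A\<^esub> u \<in> N" "\<And>s u. \<lbrakk>s \<in> S; u \<in> N\<rbrakk> \<Longrightarrow> s \<odot>\<^bsub>A\<^esub> u \<in> N"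
    and z: "z \<in> carrier Z" and u: "u \<in> N"
  shows "z \<odot>\<^bsub>A\<^esub> u \<in> N"
proof -
  have NA: "u \<in> carrier A" if "u \<in> N" for u using N(1) that by (rule subsetD)
  have "\<forall>u\<in>N. z \<odot>\<^bsub>A\<^esub> u \<in> N"
    using gen S(1) z
  proof (rule generated_induct)
    show "\<forall>u\<in>N. (c \<odot>\<^bsub>Z\<^esub> \<one>\<^bsub>Z\<^esub>) \<odot>\<^bsub>A\<^esub> u \<in> N" for c
      using N(3)[of _ c] by (simp add: cscalar_mult[OF NA])
  qed (simp_all add: N NA ZA.smult_l_distr ZA.smult_assoc1)
  then show ?thesis using u by simp
qed

text \<open>The Hilbert argument yields a submodule \<open>N\<close> containing the module
  generators \<open>F\<close> and satisfying the chain condition for the scalars and the finitely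
  many generators of \<open>Z\<close>. Stability under these gives stability under \<open>Z\<close>,
  so \<open>N\<close> is all of \<open>A\<close>. Chains of \<open>K\<close>-submodules are stable
  under the smaller set of operators and hence are covered.\<close>

lemma noetherian_order: "noetherian_diff_ring A cscalar central_image (carrier Z) H"
proof -
  interpret D: diff_ring A cscalar central_image "carrier Z" H by (rule diff_ring_order)
  obtain F where F: "finite F" "F \<subseteq> carrier A"
    "\<And>a. a \<in> carrier A \<Longrightarrow> \<exists>z\<in>F \<rightarrow> carrier Z. a = (\<Oplus>\<^bsub>A\<^esub>f\<in>F. z f \<odot>\<^bsub>A\<^esub> f)"
    using finite_module by blast
  let ?S = "(\<lambda>s. s \<odot>\<^bsub>A\<^esub> \<one>\<^bsub>A\<^esub>) ` S"
  let ?\<Omega> = "range (\<lambda>c u. cscalar c \<otimes>\<^bsub>A\<^esub> u) \<union> (\<lambda>s u. s \<otimes>\<^bsub>A\<^esub> u) ` ?S"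
  have SK: "?S \<subseteq> central_image" unfolding central_image_def using S(1) by (rule image_mono)
  have SA: "?S \<subseteq> carrier A" using SK D.K_carrier by (rule subset_trans[OF _ subsetI])
  obtain N where N: "F \<subseteq> N" "op_subgroup A ?\<Omega> N" "acc_on A ?\<Omega> N"
    using D.noetherian_of_generators[of ?S F] F(1,2) S(2) SA D.K_central[OF subsetD[OF SK]] by blast
  note ND = ZA.op_subgroupD[OF N(2)]
  have NA: "N \<subseteq> carrier A" using ND(1) by (rule subsetI)
  have act: "z \<odot>\<^bsub>A\<^esub> u \<in> N" if "z \<in> carrier Z" "u \<in> N" for z u
  proof (rule scalar_stable_act_closed[OF NA ND(5) _ _ that])
    show "cscalar c \<otimes>\<^bsub>A\<^esub> u \<in> N" if "u \<in> N" for c u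
      using ND(6)[of "\<lambda>u. cscalar c \<otimes>\<^bsub>A\<^esub> u", OF _ that] by simp
    show "s \<odot>\<^bsub>A\<^esub> u \<in> N" if s: "s \<in> S" and u: "u \<in> N" for s u
      using ND(6)[of "\<lambda>u. (s \<odot>\<^bsub>A\<^esub> \<one>\<^bsub>A\<^esub>) \<otimes>\<^bsub>A\<^esub> u", OF _ u] s
        central_act(2)[OF subsetD[OF S(1) s] ND(1)[OF u]] by simp
  qed
  have "carrier A \<subseteq> N"
  proof
    fix a assume "a \<in> carrier A"
    then obtain z where z: "z \<in> F \<rightarrow> carrier Z" "a = (\<Oplus>\<^bsub>A\<^esub>f\<in>F. z f \<odot>\<^bsub>A\<^esub> f)" using F(3) by blast
    have "(\<Oplus>\<^bsub>A\<^esub>f\<in>F. z f \<odot>\<^bsub>A\<^esub> f) \<in> N"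
      using NA ND(2,5) F(1) by (rule ZA.finsum_mem) (use z(1) N(1) act in auto)
    then show "a \<in> N" by (simp add: z(2))
  qed
  then have NA': "N = carrier A" using NA by simp
  have sub: "?\<Omega> \<subseteq> (\<lambda>k a. k \<otimes>\<^bsub>A\<^esub> a) ` central_image"
    using SK D.K_sc by auto
  have "acc_on A ((\<lambda>k a. k \<otimes>\<^bsub>A\<^esub> a) ` central_image) (carrier A)"
    unfolding acc_on_def
  proof (intro allI impI)
    fix K :: "nat \<Rightarrow> 'b set"
    assume K: "\<forall>i. op_subgroup A ((\<lambda>k a. k \<otimes>\<^bsub>A\<^esub> a) ` central_image) (K i) \<and> K i \<subseteq> carrier A \<and> K i \<subseteq> K (Suc i)"
    show "\<exists>n. \<forall>i\<ge>n. K i = K n"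
      by (rule acc_onD[OF N(3)[unfolded NA']]) (use K op_subgroup_mono[OF _ sub] in blast)+
  qed
  then show ?thesis by (intro noetherian_diff_ring.intro diff_ring_order noetherian_diff_ring_axioms.intro)
qed

text \<open>\<open>Y\<close> is carried along for the sake of the central subring, whose spanning
  sequence has to consist of its own elements.\<close>

lemma module_countable_span:
  assumes F: "countable F" "F \<noteq> {}" "F \<subseteq> carrier A"
    and Y: "F \<subseteq> Y" "\<And>s u. \<lbrakk>s \<in> S; u \<in> Y\<rbrakk> \<Longrightarrow> s \<odot>\<^bsub>A\<^esub> u \<in> Y"
  shows "\<exists>e N. range e \<subseteq> Y \<and> N = (\<Union>n. complex_scalars.span_upto A cscalar e n) \<and> N \<subseteq> carrier A \<and>
    \<zero>\<^bsub>A\<^esub> \<in> N \<and> (\<forall>u\<in>N. \<forall>v\<in>N. u \<oplus>\<^bsub>A\<^esub> v \<in> N) \<and> (\<forall>z\<in>carrier Z. \<forall>f\<in>F. z \<odot>\<^bsub>A\<^esub> f \<in> N)"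
proof -
  interpret D: diff_ring A cscalar central_image "carrier Z" H by (rule diff_ring_order)
  interpret R: complex_module A "regular_module A" cscalar by (rule D.regular_complex_module)
  let ?\<Phi> = "(\<lambda>s u. s \<odot>\<^bsub>A\<^esub> u) ` S"
  have SZ: "s \<in> carrier Z" if "s \<in> S" for s using S(1) that by (rule subsetD)
  have op: "additive_op (regular_module A) \<phi>" if "\<phi> \<in> ?\<Phi>" for \<phi>
    using that by (elim imageE) (simp add: additive_op_def ZA.smult_r_distr SZ)
  have lin: "\<phi> (cscalar c \<odot>\<^bsub>regular_module A\<^esub> v) = cscalar c \<odot>\<^bsub>regular_module A\<^esub> \<phi> v"
    if "\<phi> \<in> ?\<Phi>" "v \<in> carrier (regular_module A)" for \<phi> c v
    using that by (elim imageE) (simp add: SZ smult_mult_right)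
  obtain e where e: "range e \<subseteq> carrier (regular_module A)" "F \<subseteq> R.complex_span e"
    "\<And>\<phi> v. \<lbrakk>\<phi> \<in> ?\<Phi>; v \<in> R.complex_span e\<rbrakk> \<Longrightarrow> \<phi> v \<in> R.complex_span e"
    "\<And>Y. \<lbrakk>F \<subseteq> Y; \<And>\<phi> v. \<lbrakk>\<phi> \<in> ?\<Phi>; v \<in> Y\<rbrakk> \<Longrightarrow> \<phi> v \<in> Y\<rbrakk> \<Longrightarrow> range e \<subseteq> Y"
    by (rule R.countable_span_exists[of ?\<Phi> F])
      (use op lin F S(2) in \<open>auto simp: countable_finite\<close>)
  note cl = R.complex_span_closed[OF e(1), unfolded regular_module_simps]
  let ?N = "R.complex_span e"
  have "z \<odot>\<^bsub>A\<^esub> f \<in> ?N" if z: "z \<in> carrier Z" and f: "f \<in> F" for z f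
    using cl(1,5) _ _ z subsetD[OF e(2) f]
    by (rule scalar_stable_act_closed) (use cl(6) e(3) in auto)
  moreover have "range e \<subseteq> Y" using Y by (intro e(4)) auto
  moreover have "?N = (\<Union>n. D.span_upto e n)" by (simp add: D.span_upto_regular)
  ultimately show ?thesis using cl by (intro exI[of _ e] exI[of _ ?N] conjI ballI)
qed

lemma countable_span_order:
  "complex_scalars.countable_span A cscalar (carrier A)"
  "complex_scalars.countable_span A cscalar central_image"
proof -
  interpret D: diff_ring A cscalar central_image "carrier Z" H by (rule diff_ring_order)
  obtain F where F: "finite F" "F \<subseteq> carrier A"
    "\<And>a. a \<in> carrier A \<Longrightarrow> \<exists>z\<in>F \<rightarrow> carrier Z. a = (\<Oplus>\<^bsub>A\<^esub>f\<in>F. z f \<odot>\<^bsub>A\<^esub> f)"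
    using finite_module by blast
  have SZ: "s \<in> carrier Z" if "s \<in> S" for s using S(1) that by (rule subsetD)
  obtain e N where e: "range e \<subseteq> carrier A" "N = (\<Union>n. D.span_upto e n)" "N \<subseteq> carrier A" "\<zero>\<^bsub>A\<^esub> \<in> N"
    "\<forall>u\<in>N. \<forall>v\<in>N. u \<oplus>\<^bsub>A\<^esub> v \<in> N" "\<forall>z\<in>carrier Z. \<forall>f\<in>insert \<one>\<^bsub>A\<^esub> F. z \<odot>\<^bsub>A\<^esub> f \<in> N"
    using module_countable_span[of "insert \<one>\<^bsub>A\<^esub> F" "carrier A"] F(1,2)
    by (auto simp: countable_finite SZ)
  have "carrier A \<subseteq> N"
  proof
    fix a assume "a \<in> carrier A"
    then obtain z where z: "z \<in> F \<rightarrow> carrier Z" "a = (\<Oplus>\<^bsub>A\<^esub>f\<in>F. z f \<odot>\<^bsub>A\<^esub> f)" using F(3) by blast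
    have "(\<Oplus>\<^bsub>A\<^esub>f\<in>F. z f \<odot>\<^bsub>A\<^esub> f) \<in> N"
      using e(3,4) _ F(1) by (rule ZA.finsum_mem) (use z(1) e(5,6) in auto)
    then show "a \<in> N" by (simp add: z(2))
  qed
  then show "D.countable_span (carrier A)" unfolding D.countable_span_def using e(1,2) by blast
  have "s \<odot>\<^bsub>A\<^esub> k \<in> central_image" if s: "s \<in> S" and k: "k \<in> central_image" for s k
    using D.K_mult[of "s \<odot>\<^bsub>A\<^esub> \<one>\<^bsub>A\<^esub>" k] k SZ[OF s] central_act(2)[OF SZ[OF s] D.K_carrier[OF k]]
    by (simp add: central_image_def)
  then obtain e N where e: "range e \<subseteq> central_image" "N = (\<Union>n. D.span_upto e n)"
    "\<forall>z\<in>carrier Z. \<forall>f\<in>{\<one>\<^bsub>A\<^esub>}. z \<odot>\<^bsub>A\<^esub> f \<in> N"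
    using module_countable_span[of "{\<one>\<^bsub>A\<^esub>}" central_image] D.K_one by auto
  have "central_image \<subseteq> N" using e(3) by (auto simp: central_image_def)
  then show "D.countable_span central_image" unfolding D.countable_span_def using e(1,2) by blast
qed

end

end

section \<open>Countable dimension of simple Poisson modules\<close>

context poisson_order
begin

text \<open>The point is countable dimension. A nonzero vector is closed up under countably many
  operators: a spanning sequence of \<open>A\<close>, and \<open>nabla x\<close> for finitely many
  generators \<open>x\<close>. The Leibniz rule \<open>nabla (x y) = x nabla y + y nabla x\<close>
  extends stability to all of \<open>Z\<close>, so simplicity makes this countable span all of
  \<open>M\<close>.\<close>

lemma simple_poisson_diff_module:
  assumes fg: "finitely_generated_algebra Z" and SM: "simple_poisson_module Z pb A H M nabla"
  shows "simple_diff_module A cscalar central_image (carrier Z) H M nabla"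
proof -
  obtain S where S: "finite S" "S \<subseteq> carrier Z"
    and gen: "generate_ring Z (S \<union> range (\<lambda>c. c \<odot>\<^bsub>Z\<^esub> \<one>\<^bsub>Z\<^esub>)) = carrier Z"
    using fg by (auto simp: finitely_generated_algebra_def)
  interpret D: noetherian_diff_ring A cscalar central_image "carrier Z" H
    by (rule noetherian_order[OF gen S(2,1)])
  have PM: "poisson_module Z pb A H M nabla" using SM by (simp add: simple_poisson_module_def)
  note nab = poisson_module.nabla_closed[OF PM] poisson_module.nabla_add_right[OF PM]
  interpret L: left_module A M by (fact poisson_moduleD[OF PM])
  interpret C: complex_module A M cscalar
    by (intro complex_module.intro D.complex_scalars_axioms L.left_module_axioms)
  have simple: "N = {\<zero>\<^bsub>M\<^esub>} \<or> N = carrier M"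
    if "submodule N A M" "\<And>x v. \<lbrakk>x \<in> carrier Z; v \<in> N\<rbrakk> \<Longrightarrow> nabla x v \<in> N" for N
    using SM that by (simp add: simple_poisson_module_def)
  have ne: "carrier M \<noteq> {\<zero>\<^bsub>M\<^esub>}" using SM by (simp add: simple_poisson_module_def)
  then obtain v where v: "v \<in> carrier M" "v \<noteq> \<zero>\<^bsub>M\<^esub>" using L.LM.zero_closed by auto
  obtain a where a: "range a \<subseteq> carrier A" "carrier A \<subseteq> (\<Union>n. D.span_upto a n)"
    using countable_span_order(1)[OF gen S(2,1)] by (auto simp: D.countable_span_def)
  have aA: "a n \<in> carrier A" for n using a(1) by (auto simp: image_subset_iff)
  \<comment> \<open>The unit is included to cover the scalars in \<open>Z\<close>: on
    \<open>c\<close> times the unit, \<open>nabla\<close> is \<open>c\<close> times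
    \<open>nabla\<close> of the unit.\<close>
  let ?T = "insert \<one>\<^bsub>Z\<^esub> S"
  have TZ: "x \<in> carrier Z" if "x \<in> ?T" for x using that S(2) by auto
  let ?\<Phi> = "range (\<lambda>n u. a n \<odot>\<^bsub>M\<^esub> u) \<union> nabla ` ?T"
  have op: "additive_op M \<phi>" if "\<phi> \<in> ?\<Phi>" for \<phi>
    using that by (elim UnE imageE)
      (simp_all only: additive_op_def, simp_all add: nab TZ aA L.act_closed L.act_add_right del: insert_iff)
  have lin: "\<phi> (C.csc c u) = C.csc c (\<phi> u)" if "\<phi> \<in> ?\<Phi>" and u: "u \<in> carrier M" for \<phi> c u
    using that(1)
  proof (elim UnE imageE)
    fix x assume x: "\<phi> = nabla x" "x \<in> ?T"
    show ?thesis
      using poisson_module.nabla_scale_right[OF PM TZ[OF x(2)] u, of c] by (simp add: x(1) cscalar_def)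
  next
    fix n assume "\<phi> = (\<lambda>u. a n \<odot>\<^bsub>M\<^esub> u)"
    then show ?thesis
      using L.act_mult[OF aA[of n] D.sc_closed[of c] u] L.act_mult[OF D.sc_closed[of c] aA[of n] u]
        D.sc_central[OF aA[of n], of c] by simp
  qed
  obtain e where e: "range e \<subseteq> carrier M" "{v} \<subseteq> C.complex_span e"
    "\<And>\<phi> u. \<lbrakk>\<phi> \<in> ?\<Phi>; u \<in> C.complex_span e\<rbrakk> \<Longrightarrow> \<phi> u \<in> C.complex_span e"
    by (rule C.countable_span_exists[of ?\<Phi> "{v}"]) (use op lin v S(1) in \<open>auto simp: countable_finite\<close>)
  note cl = C.complex_span_closed[OF e(1)]
  define U where "U = C.complex_span e"
  note cl = cl[folded U_def] and stable = e(3)[folded U_def]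
  have UM: "u \<in> carrier M" if "u \<in> U" for u using cl(1) that by (rule subsetD)
  have nU: "nabla x u \<in> U" if "x \<in> ?T" "u \<in> U" for x u
    using UnI2[OF imageI[OF that(1)]] that(2) by (rule stable)
  have act: "b \<odot>\<^bsub>M\<^esub> u \<in> U" if b: "b \<in> carrier A" and u: "u \<in> U" for b u
  proof -
    obtain n where "b \<in> D.span_upto a n" using a(2) b by blast
    then have "b \<in> carrier A \<and> b \<odot>\<^bsub>M\<^esub> u \<in> U"
    proof (induction n arbitrary: b)
      case 0
      then show ?case using cl(2) L.act_zero_left[OF UM[OF u]] by simp
    next
      case (Suc n)
      obtain b' c where b': "b' \<in> D.span_upto a n" "b = b' \<oplus>\<^bsub>A\<^esub> cscalar c \<otimes>\<^bsub>A\<^esub> a n"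
        using Suc.prems by auto
      note IH = Suc.IH[OF b'(1)]
      have "b \<odot>\<^bsub>M\<^esub> u = b' \<odot>\<^bsub>M\<^esub> u \<oplus>\<^bsub>M\<^esub> C.csc c (a n \<odot>\<^bsub>M\<^esub> u)"
        using IH aA UM[OF u] by (simp add: b'(2) L.act_add_left L.act_mult)
      moreover have "a n \<odot>\<^bsub>M\<^esub> u \<in> U" using stable[of "\<lambda>u. a n \<odot>\<^bsub>M\<^esub> u" u] u by simp
      ultimately show ?case using cl(4) IH aA by (simp add: b'(2))
    qed
    then show ?thesis by simp
  qed
  have nabla_U: "\<forall>u\<in>U. nabla x u \<in> U" if x: "x \<in> carrier Z" for x
    using gen S(2) x
  proof (rule generated_induct)
    show "\<forall>u\<in>U. nabla s u \<in> U" if "s \<in> S" for s using nU[of s] that by simp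
    show "\<forall>u\<in>U. nabla (c \<odot>\<^bsub>Z\<^esub> \<one>\<^bsub>Z\<^esub>) u \<in> U" for c
    proof
      fix u assume u: "u \<in> U"
      have "nabla (c \<odot>\<^bsub>Z\<^esub> \<one>\<^bsub>Z\<^esub>) u = C.csc c (nabla \<one>\<^bsub>Z\<^esub> u)"
        using poisson_module.nabla_scale_left[OF PM _ UM[OF u], of "\<one>\<^bsub>Z\<^esub>" c] by (simp add: cscalar_def)
      then show "nabla (c \<odot>\<^bsub>Z\<^esub> \<one>\<^bsub>Z\<^esub>) u \<in> U" using nU[OF _ u] cl(6) by simp
    qed
    show "\<forall>u\<in>U. nabla (y \<oplus>\<^bsub>Z\<^esub> z) u \<in> U" if "y \<in> carrier Z" "z \<in> carrier Z"
      "\<forall>u\<in>U. nabla y u \<in> U" "\<forall>u\<in>U. nabla z u \<in> U" for y z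
      using that UM cl(5) by (simp add: poisson_module.nabla_add_left[OF PM])
    show "\<forall>u\<in>U. nabla (y \<otimes>\<^bsub>Z\<^esub> z) u \<in> U" if "y \<in> carrier Z" "z \<in> carrier Z"
      "\<forall>u\<in>U. nabla y u \<in> U" "\<forall>u\<in>U. nabla z u \<in> U" for y z
      using that UM cl(5) act[OF unit_act] by (simp add: poisson_module.nabla_mult[OF PM])
  qed
  have "submodule U A M" by (rule L.left_submoduleI) (use cl(1,2,5) act in simp_all)
  then have "U = {\<zero>\<^bsub>M\<^esub>} \<or> U = carrier M" by (rule simple) (use nabla_U in simp)
  moreover have "v \<in> U" using e(2) by (simp add: U_def)
  ultimately have "carrier M = U" using v(2) by auto
  then have dim: "C.countable_dim" unfolding C.countable_dim_def U_def using e(1) by blast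
  show ?thesis
    by (intro simple_diff_module.intro simple_diff_module_axioms.intro D.noetherian_diff_ring_axioms
        C.complex_module_axioms)
      (use nab poisson_module.nabla_H[OF PM] ne simple dim in simp_all)
qed

lemma primitive_ideal_with_core:
  assumes fg: "finitely_generated_algebra Z" and SM: "simple_poisson_module Z pb A H M nabla"
    and a: "a \<in> carrier A" "a \<notin> annihilator A M"
  shows "\<exists>I\<in>Prim A. poisson_core Z A H I = annihilator A M \<and> a \<notin> I"
proof -
  interpret S: simple_diff_module A cscalar central_image "carrier Z" H M nabla
    by (rule simple_poisson_diff_module[OF fg SM])
  obtain T where T: "finite T" "T \<subseteq> carrier Z"
    "generate_ring Z (T \<union> range (\<lambda>c. c \<odot>\<^bsub>Z\<^esub> \<one>\<^bsub>Z\<^esub>)) = carrier Z"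
    using fg by (auto simp: finitely_generated_algebra_def)
  obtain I where I: "I \<in> Prim A" "S.P \<subseteq> I" "a \<notin> I"
    and max: "\<And>J. \<lbrakk>ideal J A; S.ham_stable J; S.P \<subseteq> J; J \<subseteq> I\<rbrakk> \<Longrightarrow> J = S.P"
    using S.primitive_ideal_exists[OF countable_span_order[OF T(3,2,1)] a] by blast
  have idI: "ideal I A"
    using I(1) left_module.annihilator_ideal by (fastforce simp: Prim_def simple_module_def)
  note core = poisson_core_greatest[OF hamiltonian_order_axioms idI]
  have "poisson_ideal Z A H S.P"
    using S.ideal_P S.ham_stable_P by (simp add: poisson_ideal_def S.ham_stable_def)
  then have "S.P \<subseteq> poisson_core Z A H I" using I(2) by (rule core(3))
  then have "poisson_core Z A H I = S.P"
    using core(1,2) by (intro max) (simp_all add: poisson_ideal_def S.ham_stable_def)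
  then show ?thesis using I by blast
qed

end

section \<open>Symplectic cores and annihilators of simple Poisson modules\<close>

context poisson_order
begin

lemma ideal_Prim: "I \<in> Prim A \<Longrightarrow> ideal I A"
  using left_module.annihilator_ideal by (fastforce simp: Prim_def simple_module_def)

lemmas core_greatest = poisson_core_greatest[OF hamiltonian_order_axioms ideal_Prim]

lemma proper_poisson_annihilator:
  assumes "P \<in> poisson_annihilators Z pb A H"
  shows "poisson_ideal Z A H P" "\<one>\<^bsub>A\<^esub> \<notin> P" "P \<subseteq> carrier A"
proof -
  obtain M :: "('b, ('b + 'a) list list) module" and nabla
    where SM: "simple_poisson_module Z pb A H M nabla" and P: "P = annihilator A M"
    using assms by (auto simp: poisson_annihilators_def)
  have PM: "poisson_module Z pb A H M nabla" using SM by (simp add: simple_poisson_module_def)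
  interpret L: left_module A M by (fact poisson_moduleD[OF PM])
  show "poisson_ideal Z A H P"
    using L.annihilator_ideal poisson_annihilator_stable[OF PM] by (simp add: poisson_ideal_def P)
  have "carrier M \<noteq> {\<zero>\<^bsub>M\<^esub>}" using SM by (simp add: simple_poisson_module_def)
  then obtain v where v: "v \<in> carrier M" "v \<noteq> \<zero>\<^bsub>M\<^esub>" using L.LM.zero_closed by auto
  have "b \<odot>\<^bsub>M\<^esub> v = \<zero>\<^bsub>M\<^esub>" if "b \<in> P" for b using that v(1) by (simp add: P annihilator_def)
  then show "\<one>\<^bsub>A\<^esub> \<notin> P" using L.act_one[OF v(1)] v(2) by metis
  show "P \<subseteq> carrier A" by (auto simp: P annihilator_def)
qed

definition core_fibre :: "'b set \<Rightarrow> 'b set set"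
  where "core_fibre P = {I \<in> Prim A. poisson_core Z A H I = P}"

context
  assumes fg: "finitely_generated_algebra Z"
begin

private abbreviation (input) "\<S> \<equiv> poisson_annihilators Z pb A H"
private abbreviation (input) "\<kappa> \<equiv> poisson_core Z A H"

text \<open>Separating every single \<open>a\<close> makes \<open>P\<close> the intersection of its
  fibre, and \<open>a = 1\<close> shows that the fibre is nonempty.\<close>

lemma fibre_separates:
  assumes P: "P \<in> \<S>" and a: "a \<in> carrier A" "a \<notin> P"
  shows "\<exists>I\<in>core_fibre P. a \<notin> I"
proof -
  obtain M :: "('b, ('b + 'a) list list) module" and nabla
    where M: "simple_poisson_module Z pb A H M nabla" "P = annihilator A M"
    using P by (auto simp: poisson_annihilators_def)
  show ?thesis
    using primitive_ideal_with_core[OF fg M(1), of a] a unfolding M(2) core_fibre_def by blast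
qed

lemma fibre_nonempty: "P \<in> \<S> \<Longrightarrow> core_fibre P \<noteq> {}"
  using fibre_separates[of P "\<one>\<^bsub>A\<^esub>"] proper_poisson_annihilator(2)[of P] by auto

lemma fibreD:
  assumes "I \<in> core_fibre P"
  shows "I \<in> Prim A" "\<kappa> I = P" "P \<subseteq> I"
  using assms core_greatest(2)[of I] by (auto simp: core_fibre_def)

lemma Inter_fibre:
  assumes P: "P \<in> \<S>"
  shows "carrier A \<inter> \<Inter>(core_fibre P) = P"
proof
  show "carrier A \<inter> \<Inter>(core_fibre P) \<subseteq> P" using fibre_separates[OF P] by auto
  show "P \<subseteq> carrier A \<inter> \<Inter>(core_fibre P)"
    using proper_poisson_annihilator(3)[OF P] fibreD(3) by (simp add: Inter_greatest)
qed

text \<open>Every core of a primitive ideal is the annihilator of a simple Poisson module, and every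
  such annihilator has a nonempty fibre; so the equivalence classes are exactly the fibres over the
  annihilators.\<close>

lemma symplectic_cores_eq: "symplectic_cores Z A H = core_fibre ` \<S>"
proof -
  let ?r = "{(I, J). I \<in> Prim A \<and> J \<in> Prim A \<and> \<kappa> I = \<kappa> J}"
  have cls: "?r `` {I} = core_fibre (\<kappa> I)" if "I \<in> Prim A" for I
    using that by (auto simp: core_fibre_def)
  show ?thesis
    unfolding symplectic_cores_def
  proof
    show "Prim A // ?r \<subseteq> core_fibre ` \<S>"
    proof
      fix C assume "C \<in> Prim A // ?r"
      then obtain I where I: "I \<in> Prim A" "C = ?r `` {I}" by (rule quotientE)
      show "C \<in> core_fibre ` \<S>"
        unfolding I(2) cls[OF I(1)] using poisson_core_poisson_annihilator[OF I(1)] by (rule imageI)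
    qed
    show "core_fibre ` \<S> \<subseteq> Prim A // ?r"
    proof (rule image_subsetI)
      fix P assume "P \<in> \<S>"
      then obtain I where I: "I \<in> core_fibre P" using fibre_nonempty by blast
      show "core_fibre P \<in> Prim A // ?r"
        using quotientI[OF fibreD(1)[OF I], of ?r] unfolding cls[OF fibreD(1)[OF I]] fibreD(2)[OF I] .
    qed
  qed
qed

lemma inj_core_fibre: "inj_on core_fibre \<S>"
proof (rule inj_onI)
  fix P Q assume PQ: "P \<in> \<S>" "Q \<in> \<S>" "core_fibre P = core_fibre Q"
  have "carrier A \<inter> \<Inter>(core_fibre P) = Q" unfolding PQ(3) by (rule Inter_fibre[OF PQ(2)])
  then show "P = Q" unfolding Inter_fibre[OF PQ(1)] .
qed

lemma poisson_ideal_subset_iff: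
  assumes "I \<in> Prim A" "poisson_ideal Z A H J"
  shows "J \<subseteq> I \<longleftrightarrow> J \<subseteq> \<kappa> I"
  using core_greatest(2,3)[OF assms(1)] assms(2) by blast

lemma poisson_ideal_Inter:
  assumes "S \<subseteq> \<S>" shows "poisson_ideal Z A H (carrier A \<inter> \<Inter>S)"
proof -
  have id: "ideal J A" "\<And>x a. \<lbrakk>x \<in> carrier Z; a \<in> J\<rbrakk> \<Longrightarrow> H x a \<in> J" if "J \<in> S" for J
    using proper_poisson_annihilator(1)[of J] assms that by (auto simp: poisson_ideal_def)
  show ?thesis
    unfolding poisson_ideal_def using id by (auto intro!: ideal_Inter AR.ring_axioms H_closed)
qed

section \<open>The Jacobson topology and the quotient topology\<close>

abbreviation prim_space :: "'b set topology"
  where "prim_space \<equiv> jacobson_topology A (Prim A)"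

text \<open>The empty \<open>S\<close> defines the closed set of primitive ideals containing the
  whole ring, so the point is that primitive ideals are proper. This is read off from the Poisson
  core, which is the annihilator of a nonzero module.\<close>

lemma topspace_prim: "topspace prim_space = Prim A"
proof -
  have "\<not> carrier A \<subseteq> I" if "I \<in> Prim A" for I
  proof
    assume I: "carrier A \<subseteq> I"
    have "poisson_ideal Z A H (carrier A)"
      by (simp add: poisson_ideal_def AR.oneideal H_closed)
    then have "carrier A \<subseteq> \<kappa> I" using I by (rule core_greatest(3)[OF that])
    then show False
      using proper_poisson_annihilator(2)[OF poisson_core_poisson_annihilator[OF that]] by auto
  qed
  then have "{I \<in> Prim A. carrier A \<subseteq> I} = {}" by simp
  then have "openin prim_space (Prim A)"
    unfolding openin_jacobson_Prim[OF AR.ring_axioms] by (intro conjI exI[of _ "{}"]) auto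
  then have "Prim A \<subseteq> topspace prim_space" by (rule openin_subset)
  moreover have "topspace prim_space \<subseteq> Prim A"
    by (rule conjunct1[OF openin_topspace[of prim_space, unfolded openin_jacobson_Prim[OF AR.ring_axioms]]])
  ultimately show ?thesis by (rule subset_antisym[rotated])
qed

lemma closedin_prim:
  "closedin prim_space K \<longleftrightarrow> (\<exists>S\<subseteq>Prim A. K = {I \<in> Prim A. carrier A \<inter> \<Inter>S \<subseteq> I})"
proof
  assume "closedin prim_space K"
  then have K: "K \<subseteq> Prim A" "openin prim_space (Prim A - K)"
    unfolding closedin_def topspace_prim by (rule conjunct1, rule conjunct2)
  show "\<exists>S\<subseteq>Prim A. K = {I \<in> Prim A. carrier A \<inter> \<Inter>S \<subseteq> I}"
    using conjunct2[OF K(2)[unfolded openin_jacobson_Prim[OF AR.ring_axioms]]]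
    unfolding double_diff[OF K(1) subset_refl] .
next
  assume "\<exists>S\<subseteq>Prim A. K = {I \<in> Prim A. carrier A \<inter> \<Inter>S \<subseteq> I}"
  moreover from this have K: "K \<subseteq> Prim A" by (elim exE conjE) simp
  ultimately show "closedin prim_space K"
    unfolding closedin_def topspace_prim openin_jacobson_Prim[OF AR.ring_axioms]
      double_diff[OF K subset_refl] by (intro conjI Diff_subset)
qed

lemma closure_prim:
  assumes C: "C \<subseteq> Prim A"
  shows "prim_space closure_of C = {I \<in> Prim A. carrier A \<inter> \<Inter>C \<subseteq> I}"
proof (rule closure_of_unique)
  show "closedin prim_space {I \<in> Prim A. carrier A \<inter> \<Inter>C \<subseteq> I}"
    unfolding closedin_prim using C by (intro exI[of _ C]) simp
  show "C \<subseteq> {I \<in> Prim A. carrier A \<inter> \<Inter>C \<subseteq> I}" using C by auto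
  fix T assume T: "C \<subseteq> T" "closedin prim_space T"
  then obtain S where S: "T = {I \<in> Prim A. carrier A \<inter> \<Inter>S \<subseteq> I}" unfolding closedin_prim by (elim exE conjE)
  then have "carrier A \<inter> \<Inter>S \<subseteq> J" if "J \<in> C" for J using T(1) that by auto
  then have "carrier A \<inter> \<Inter>S \<subseteq> carrier A \<inter> \<Inter>C" by auto
  then show "{I \<in> Prim A. carrier A \<inter> \<Inter>C \<subseteq> I} \<subseteq> T" by (auto simp: S)
qed

text \<open>Inside the variety of \<open>P\<close>, the closure of the fibre of \<open>Q\<close>
  consists of the ideals that contain \<open>Q\<close>. Containment in the variety forces
  \<open>P\<close> into every member of the fibre of \<open>Q\<close>, and density forces
  \<open>Q\<close> into every member of the fibre of \<open>P\<close>; intersecting the two fibres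
  gives \<open>P = Q\<close>.\<close>

lemma dense_core_iff:
  assumes P: "P \<in> \<S>"
  shows "dense_core Z A H P C \<longleftrightarrow> C = core_fibre P"
proof -
  let ?V = "prim_variety A P"
  have cl: "subtopology prim_space ?V closure_of core_fibre Q = {I \<in> ?V. Q \<subseteq> I}"
    if Q: "Q \<in> \<S>" "core_fibre Q \<subseteq> ?V" for Q
  proof -
    have "core_fibre Q \<subseteq> Prim A" by (auto simp: core_fibre_def)
    then have "prim_space closure_of core_fibre Q = {I \<in> Prim A. Q \<subseteq> I}"
      using Inter_fibre[OF Q(1)] by (simp add: closure_prim)
    then show ?thesis
      using Q(2) by (auto simp: closure_of_subtopology Int_absorb1 prim_variety_def)
  qed
  have sub: "core_fibre P \<subseteq> ?V" unfolding prim_variety_def core_fibre_def using core_greatest(2) by auto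
  show ?thesis
  proof
    assume D: "dense_core Z A H P C"
    then obtain Q where Q: "Q \<in> \<S>" "C = core_fibre Q"
      by (auto simp: dense_core_def symplectic_cores_eq)
    have CV: "core_fibre Q \<subseteq> ?V" and eq: "{I \<in> ?V. Q \<subseteq> I} = ?V"
      using D cl[of Q] Q by (simp_all add: dense_core_def)
    have "P \<subseteq> carrier A \<inter> \<Inter>(core_fibre Q)"
      using CV proper_poisson_annihilator(3)[OF P] by (auto simp: prim_variety_def)
    then have PQ: "P \<subseteq> Q" using Inter_fibre[OF Q(1)] by simp
    have "Q \<subseteq> carrier A \<inter> \<Inter>(core_fibre P)"
      using eq sub proper_poisson_annihilator(3)[OF Q(1)] by auto
    then have "Q \<subseteq> P" using Inter_fibre[OF P] by simp
    then show "C = core_fibre P" using PQ Q(2) by simp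
  next
    assume "C = core_fibre P"
    then show "dense_core Z A H P C"
      using cl[OF P sub] sub P by (auto simp: dense_core_def symplectic_cores_eq prim_variety_def)
  qed
qed

text \<open>A closed union of fibres is cut out by a Poisson ideal: with \<open>J\<close> it
  contains the whole fibre of \<open>\<kappa> J\<close>, so its defining ideal lies in the
  intersection \<open>\<kappa> J\<close> of that fibre, and \<open>S\<close> may be replaced by the
  cores of its members. Conversely, a Poisson ideal lies in \<open>I\<close> exactly when it lies in
  the core of \<open>I\<close>.\<close>

lemma openin_fibres_iff:
  assumes U: "U \<subseteq> \<S>"
  shows "openin prim_space (\<Union>(core_fibre ` U)) \<longleftrightarrow> openin (jacobson_topology A \<S>) U"
proof -
  have fib: "I \<in> \<Union>(core_fibre ` U) \<longleftrightarrow> I \<in> Prim A \<and> \<kappa> I \<in> U" for I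
    by (auto simp: core_fibre_def)
  have core: "\<kappa> I \<in> \<S>" if "I \<in> Prim A" for I
    using that by (rule poisson_core_poisson_annihilator)
  note open_S = openin_jacobson_poisson_annihilators[OF AR.ring_axioms, of Z pb H]
  show ?thesis
  proof
    assume "openin prim_space (\<Union>(core_fibre ` U))"
    then obtain S where S: "S \<subseteq> Prim A"
      and SE: "Prim A - \<Union>(core_fibre ` U) = {I \<in> Prim A. carrier A \<inter> \<Inter>S \<subseteq> I}"
      by (auto simp: openin_jacobson_Prim[OF AR.ring_axioms])
    let ?Y = "carrier A \<inter> \<Inter>S" and ?X = "carrier A \<inter> \<Inter>(\<kappa> ` S)"
    have closed: "?Y \<subseteq> I \<longleftrightarrow> \<kappa> I \<notin> U" if "I \<in> Prim A" for I
      using SE fib[of I] that by blast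
    have XY: "?X \<subseteq> ?Y" using S core_greatest(2) by blast
    \<comment> \<open>The whole fibre of \<open>Q\<close> lies in the closed set, and its
      intersection is \<open>Q\<close>.\<close>
    have YQ: "?Y \<subseteq> Q" if Q: "Q \<in> \<S>" "Q \<notin> U" for Q
    proof -
      have "?Y \<subseteq> I" if "I \<in> core_fibre Q" for I
        using closed[OF fibreD(1)[OF that]] fibreD(2)[OF that] Q(2) by simp
      then have "?Y \<subseteq> carrier A \<inter> \<Inter>(core_fibre Q)" by auto
      then show ?thesis using Inter_fibre[OF Q(1)] by simp
    qed
    have "?Y \<subseteq> \<kappa> J" if J: "J \<in> S" for J
    proof (rule YQ)
      have JP: "J \<in> Prim A" using S J by (rule subsetD)
      show "\<kappa> J \<in> \<S>" by (rule core[OF JP])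
      show "\<kappa> J \<notin> U" using closed[OF JP] J by auto
    qed
    then have YX: "?Y \<subseteq> ?X" by auto
    have notU: "Q \<notin> U" if Q: "Q \<in> \<S>" "?X \<subseteq> Q" for Q
    proof -
      obtain I where I: "I \<in> core_fibre Q" using fibre_nonempty[OF Q(1)] by blast
      have "?Y \<subseteq> I" using YX Q(2) fibreD(3)[OF I] by (meson order_trans)
      then show ?thesis using closed[OF fibreD(1)[OF I]] fibreD(2)[OF I] by simp
    qed
    have "\<S> - U = {Q \<in> \<S>. ?X \<subseteq> Q}"
      using notU YQ order_trans[OF XY YQ] by (intro subset_antisym subsetI) simp_all
    moreover have "\<kappa> ` S \<subseteq> \<S>" using S core by auto
    ultimately show "openin (jacobson_topology A \<S>) U"
      unfolding open_S using U by (intro conjI exI[of _ "\<kappa> ` S"])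
  next
    assume "openin (jacobson_topology A \<S>) U"
    then obtain S where S: "S \<subseteq> \<S>" and SE: "\<S> - U = {Q \<in> \<S>. carrier A \<inter> \<Inter>S \<subseteq> Q}"
      unfolding open_S by blast
    let ?X = "carrier A \<inter> \<Inter>S" and ?S = "\<Union>(core_fibre ` S)"
    have X_eq: "?X = carrier A \<inter> \<Inter>?S"
    proof -
      have "carrier A \<inter> \<Inter>?S = carrier A \<inter> (\<Inter>Q\<in>S. carrier A \<inter> \<Inter>(core_fibre Q))" by auto
      also have "\<dots> = carrier A \<inter> (\<Inter>Q\<in>S. Q)" using S Inter_fibre by (metis (no_types, lifting) INF_cong subsetD)
      finally show ?thesis by simp
    qed
    have X_iff: "?X \<subseteq> I \<longleftrightarrow> \<kappa> I \<notin> U" if I: "I \<in> Prim A" for I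
    proof -
      have "?X \<subseteq> I \<longleftrightarrow> ?X \<subseteq> \<kappa> I" by (rule poisson_ideal_subset_iff[OF I poisson_ideal_Inter[OF S]])
      also have "\<dots> \<longleftrightarrow> \<kappa> I \<notin> U" using SE core[OF I] by blast
      finally show ?thesis .
    qed
    have "Prim A - \<Union>(core_fibre ` U) = {I \<in> Prim A. carrier A \<inter> \<Inter>?S \<subseteq> I}"
      unfolding X_eq[symmetric]
    proof (rule Set.set_eqI)
      fix I
      show "I \<in> Prim A - \<Union>(core_fibre ` U) \<longleftrightarrow> I \<in> {I \<in> Prim A. ?X \<subseteq> I}"
        unfolding Diff_iff fib mem_Collect_eq using X_iff[of I] by argo
    qed
    moreover have "?S \<subseteq> Prim A" by (auto simp: core_fibre_def)
    moreover have "\<Union>(core_fibre ` U) \<subseteq> Prim A" by (auto simp: core_fibre_def)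
    ultimately show "openin prim_space (\<Union>(core_fibre ` U))"
      unfolding openin_jacobson_Prim[OF AR.ring_axioms] by (intro conjI exI[of _ ?S])
  qed
qed

text \<open>An injective quotient map is a homeomorphism. A set of cores is the image of its
  preimage, so the quotient condition reduces to the correspondence of open sets.\<close>

lemma homeomorphic_map_core_fibre:
  "homeomorphic_map (jacobson_topology A \<S>) (core_space Z A H) core_fibre"
proof -
  have "\<not> carrier A \<subseteq> Q" if "Q \<in> \<S>" for Q
    using proper_poisson_annihilator(2)[OF that] by auto
  then have "{Q \<in> \<S>. carrier A \<inter> \<Inter>{} \<subseteq> Q} = {}" by simp
  then have open_S: "openin (jacobson_topology A \<S>) \<S>"
    unfolding openin_jacobson_poisson_annihilators[OF AR.ring_axioms]
    by (intro conjI exI[of _ "{}"]) simp_all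
  from open_S have "\<S> \<subseteq> topspace (jacobson_topology A \<S>)" by (rule openin_subset)
  moreover have "topspace (jacobson_topology A \<S>) \<subseteq> \<S>"
    by (rule conjunct1[OF openin_topspace[of "jacobson_topology A \<S>",
      unfolded openin_jacobson_poisson_annihilators[OF AR.ring_axioms]]])
  ultimately have topS: "topspace (jacobson_topology A \<S>) = \<S>" by (rule subset_antisym[rotated])
  have open_core: "openin (core_space Z A H) (core_fibre ` U) \<longleftrightarrow> openin (jacobson_topology A \<S>) U"
    if "U \<subseteq> \<S>" for U
    unfolding openin_core_space symplectic_cores_eq using that openin_fibres_iff[OF that] by auto
  have "openin (core_space Z A H) (core_fibre ` \<S>)"
    using open_core[of \<S>] open_S by simp
  then have "core_fibre ` \<S> \<subseteq> topspace (core_space Z A H)" by (rule openin_subset)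
  moreover have "topspace (core_space Z A H) \<subseteq> core_fibre ` \<S>"
    by (rule conjunct1[OF openin_topspace[of "core_space Z A H", unfolded openin_core_space symplectic_cores_eq]])
  ultimately have topC: "topspace (core_space Z A H) = core_fibre ` \<S>" by (rule subset_antisym[rotated])
  show ?thesis
    unfolding homeomorphic_map_def quotient_map_def topS topC
  proof (intro conjI allI impI inj_core_fibre refl)
    fix \<U> assume "\<U> \<subseteq> core_fibre ` \<S>"
    then have "\<U> = core_fibre ` {P \<in> \<S>. core_fibre P \<in> \<U>}" by auto
    then show "openin (jacobson_topology A \<S>) {P \<in> \<S>. core_fibre P \<in> \<U>} \<longleftrightarrow> openin (core_space Z A H) \<U>"
      using open_core[of "{P \<in> \<S>. core_fibre P \<in> \<U>}"] by simp
  qed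
qed

end

end

theorem mainTheorem1:
  fixes Z :: "(complex, 'z) module" and pb :: "'z \<Rightarrow> 'z \<Rightarrow> 'z"
    and A :: "('z, 'a) module" and H :: "'z \<Rightarrow> 'a \<Rightarrow> 'a"
  assumes "affine_poisson_algebra Z pb"
    and "smooth_spectrum Z"
    and "\<forall>L \<in> symplectic_leaves Z pb. zariski_locally_closed Z L"
    and "poisson_order Z pb A H"
  shows "(\<forall>(M :: ('a, 'm) module) nabla. simple_poisson_module Z pb A H M nabla \<longrightarrow>
            (\<exists>!C. dense_core Z A H (annihilator A M) C)) \<and>
         homeomorphic_map
           (jacobson_topology A (poisson_annihilators Z pb A H))
           (core_space Z A H)
           (\<lambda>P. THE C. dense_core Z A H P C)"
proof -
  interpret poisson_order Z pb A H by fact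
  have fg: "finitely_generated_algebra Z"
    using assms(1) by (rule affine_poisson_algebra.finitely_generated)
  \<comment> \<open>The agreement is stated for annihilators of simple Poisson modules, which are
    all the points of the source space.\<close>
  have the_core: "(THE C. dense_core Z A H P C) = core_fibre P"
    if "P \<in> poisson_annihilators Z pb A H" for P
    using dense_core_iff[OF fg that] by simp
  have "homeomorphic_map (jacobson_topology A (poisson_annihilators Z pb A H)) (core_space Z A H)
    (\<lambda>P. THE C. dense_core Z A H P C)"
  proof (rule homeomorphic_map_eq[OF homeomorphic_map_core_fibre[OF fg]])
    fix P assume "P \<in> topspace (jacobson_topology A (poisson_annihilators Z pb A H))"
    then have "P \<in> poisson_annihilators Z pb A H"
      by (rule subsetD[OF conjunct1[OF openin_topspace[of "jacobson_topology A (poisson_annihilators Z pb A H)",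
        unfolded openin_jacobson_poisson_annihilators[OF AR.ring_axioms]]]])
    then show "core_fibre P = (THE C. dense_core Z A H P C)" by (simp add: the_core)
  qed
  \<comment> \<open>\<open>M\<close> may live on any carrier type; its annihilator is also attained
    on the fixed type of lists of words, where \<open>dense_core_iff\<close> applies.\<close>
  moreover have "\<exists>!C. dense_core Z A H (annihilator A M) C"
    if "simple_poisson_module Z pb A H M nabla" for M :: "('a, 'm) module" and nabla
    using dense_core_iff[OF fg annihilator_mem_poisson_annihilators[OF that]] by simp
  ultimately show ?thesis by (intro conjI allI impI)
qed

end
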